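(* Let $k$ be a perfect field and let $F(X,Y)\in S=k[X,Y]$ be an irreducible polynomial with $\deg(F)=\deg_Y F=N$ which is monic and separable in $Y$. Let $A=S/\langle F\rangle$ and let $\mathfrak{C}_A=\{z\in A\mid z\overline A\subset A\}$ be its conductor in its integral closure $\overline A$ in its fraction field. Then the residue classes modulo $F$ of the polynomials output by the procedure described in the context (Steps A and B, applied to the input $F$) form a basis of the $k$-vector space \[ \mathfrak{C}_A^{(N-3)}=\{\phi\in\mathfrak{C}_A : \deg(\phi)\le N-3\}. \]
   Context: "Separable in $Y$" means: writing $x,y$ for the classes of $X,Y$ in $A$, $y$ is a simple root of $F(x,Y)\in k[x][Y]$. For $\phi\in A$, "$\deg(\phi)\le N-3$" means that $\phi$ is represented by a polynomial of total degree $\le N-3$. $\mathrm{Mon}(S)$ is the set of monomials of $S$. $F_y=(\partial F/\partial Y)(x,y)$. $Q(\cdot)$ denotes the field of fractions. Procedure. Step (A-1) (normalization). Put $S_0=S$, $I_0=\langle F\rangle$, $A_0=A$. Given $A_{i-1}=S_{i-1}/I_{i-1}$ (a domain), choose a test pair $(\tilde J_i,a_i)$: a radical ideal $\tilde J_i\subset A_{i-1}$ whose vanishing locus contains the non-normal locus of $A_{i-1}$, and a nonzero element $a_i\in\tilde J_i$. If $a_i\tilde J_i:\tilde J_i=\langle a_i\rangle$, where $a_i\tilde J_i:\tilde J_i=\{b\in A_{i-1}: b\tilde J_i\subset a_i\tilde J_i\}$, stop with $n=i-1$. Otherwise choose generators $u_{i,0}=a_i,u_{i,1},\dots,u_{i,s_i}$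 of the ideal $a_i\tilde J_i:\tilde J_i$, elements $\xi^{jl}_{\nu}\in A_{i-1}$ with $u_{i,j}u_{i,l}=\sum_{\nu=0}^{s_i}a_i\xi^{jl}_{\nu}u_{i,\nu}$, and generators $(\eta^{(q)}_0,\dots,\eta^{(q)}_{s_i})$ of the syzygy module of $(u_{i,0},\dots,u_{i,s_i})$ over $A_{i-1}$. Put $S_i=S_{i-1}[T_{i,1},\dots,T_{i,s_i}]$, let $I_i\subset S_i$ be the ideal containing $I_{i-1}$ that corresponds to the ideal of $A_{i-1}[T_{i,1},\dots,T_{i,s_i}]$ generated by all $T_{i,j}T_{i,l}-\sum_{\nu=0}^{s_i}\xi^{jl}_{\nu}T_{i,\nu}$ ($1\le j\le l\le s_i$) and all $\sum_{\nu=0}^{s_i}\eta^{(q)}_{\nu}T_{i,\nu}$, where $T_{i,0}:=1$, put $A_i=S_i/I_i$, and continue. The map $T_{i,j}\mapsto u_{i,j}/a_i$ identifies $A_i$ with the subring $(1/a_i)(a_i\tilde J_i:\tilde J_i)$ of $Q(A_{i-1})$ and induces $\phi_i:Q(A_i)\to Q(A_{i-1})$. This gives $A=A_0\subset A_1\subset\cdots\subset A_n=\overline A$; put $\phi=\phi_1\circ\cdots\circ\phi_n$. Let $t_{i,j}$ be the class of $T_{i,j}$, let $\mathcal B_i=\{1,t_{i,1},\dots,t_{i,s_i}\}$, and let $\mathcal B=\{t_1\cdots t_n y^j: t_i\in\mathcal B_i,\ 0\le j\le N-1\}=\{B_1,\dots,B_r\}\subset S_n/I_n$. Step (A-2) (a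 $k[x]$-basis of $\overline A$). Compute generators $U_1,\dots,U_m$ of the $k[X]$-module $\{(a_1,\dots,a_r)\in k[X]^r:\sum_i a_iB_i=0\text{ in }S_n/I_n\}$ ($X$ acting as $x$). Let $U$ be the $m\times r$ matrix with rows $U_i$. Compute its Smith normal form $\tilde U=PUQ$, with $P\in \mathrm{GL}_m(k[X])$, $Q\in\mathrm{GL}_r(k[X])$; it has the form $\begin{pmatrix}E_{r-N}&0\\0&0\end{pmatrix}$ with $E_{r-N}$ the identity matrix of size $r-N$. Let $W_i$ be the $(r-N+i)$-th row of $Q^{-1}$ and $w_i=W_i\cdot{}^t(B_1,\dots,B_r)\in S_n/I_n$ for $1\le i\le N$. Step (A-3) (a $k[x]$-basis of the conductor). Compute the traces $\mathrm{Tr}_{k(x,y)/k(x)}(w_iw_j)\in k[x]$; put ${}^t(w_1^*,\dots,w_N^* )=(\mathrm{Tr}_{k(x,y)/k(x)}(w_iw_j))^{-1}\,{}^t(w_1,\dots,w_N)$, and $\mathcal F=\{F_y\cdot\phi(w_i^* ):1\le i\le N\}\subset k[x,y]=A$. Step B (truncation). Compute a Gröbner basis $\mathcal G$, with respect to a graded monomial order (one that first compares total degrees), of the ideal of $S$ that is the preimage of the ideal $\langle\mathcal F\rangle_A$ of $A$. Form $\mathcal S=\{mg: m\in\mathrm{Mon}(S),\ g\in\mathcal G,\ \deg(mg)\le N-3\}$, its Macaulay matrix $M$ (the matrix whose rows are the coefficient vectors of elements of $\mathcal S$ with respect to the monomials of degree $\le N-3$), and the (reduced) row echelon form of $M$.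 Output the polynomials corresponding to the nonzero rows of that row echelon form. *)

theory Defs
  imports
    "HOL-Library.Poly_Mapping"
    "HOL-Algebra.QuotRing"
    "HOL-Algebra.Embedded_Algebras"
    "HOL-Algebra.Algebraic_Closure_Type"
    "HOL-Computational_Algebra.Computational_Algebra"
    "Jordan_Normal_Form.Matrix"
    "Jordan_Normal_Form.Gauss_Jordan_Elimination"
begin

text \<open>
  \<open>S = k[X,Y]\<close> is the type \<open>'a poly poly\<close>, the outer variable being \<open>Y\<close>: an element \<open>p\<close>
  of \<open>k[X]\<close> is \<open>[:p:]\<close>, a constant \<open>c\<close> is \<open>[:[:c:]:]\<close>, and \<open>Y\<close> is \<open>[:0, 1:]\<close>.
\<close>

definition perfect_field :: "'a::field itself \<Rightarrow> bool" where
  "perfect_field _ \<longleftrightarrow> CHAR('a) = 0 \<or> (\<forall>x::'a. \<exists>z. z ^ CHAR('a) = x)"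

text \<open>The exponent pair \<open>(a, b)\<close> stands for the monomial \<open>X^a Y^b\<close>.\<close>

definition coeff2 :: "'a::zero poly poly \<Rightarrow> nat \<times> nat \<Rightarrow> 'a" where
  "coeff2 p e = poly.coeff (poly.coeff p (snd e)) (fst e)"

definition monom2 :: "nat \<times> nat \<Rightarrow> 'a::comm_semiring_1 poly poly" where
  "monom2 e = Polynomial.monom (Polynomial.monom 1 (fst e)) (snd e)"

definition supp2 :: "'a::zero poly poly \<Rightarrow> (nat \<times> nat) set" where
  "supp2 p = {e. coeff2 p e \<noteq> 0}"

definition total_degree :: "'a::zero poly poly \<Rightarrow> nat" where
  "total_degree p = Max (insert 0 ((\<lambda>e. fst e + snd e) ` supp2 p))"

text \<open>The bound is an integer (\<open>N - 3\<close> may be negative) and \<open>deg 0\<close> is minus infinity.\<close>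

definition deg_le :: "'a::zero poly poly \<Rightarrow> int \<Rightarrow> bool" where
  "deg_le p d \<longleftrightarrow> p = 0 \<or> int (total_degree p) \<le> d"

abbreviation S_ring :: "'a::field poly poly ring" where
  "S_ring \<equiv> ring_of_type_algebra"

definition res_class :: "'a::field poly poly \<Rightarrow> 'a poly poly \<Rightarrow> 'a poly poly set" where
  "res_class F p = (PIdl\<^bsub>S_ring\<^esub> F) +>\<^bsub>S_ring\<^esub> p"

definition coord_ring :: "'a::field poly poly \<Rightarrow> 'a poly poly set ring" where
  "coord_ring F = S_ring Quot (PIdl\<^bsub>S_ring\<^esub> F)"

definition coord_consts :: "'a::field poly poly \<Rightarrow> 'a poly poly set set" where
  "coord_consts F = {res_class F [:[:c:]:] | c. True}"


section \<open>Domains embedded in a field\<close>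

text \<open>
  A domain \<open>R\<close> comes with an injective ring homomorphism \<open>e\<close> into a field (a type of class
  \<open>field\<close>); \<open>Q(R)\<close> and the localizations of \<open>R\<close> are then subrings of that field.
\<close>

definition field_embedding :: "'r ring \<Rightarrow> ('r \<Rightarrow> 'l::field) \<Rightarrow> bool" where
  "field_embedding R e \<longleftrightarrow> e \<in> Ring.ring_hom R ring_of_type_algebra \<and> inj_on e (carrier R)"

definition frac_field :: "'r ring \<Rightarrow> ('r \<Rightarrow> 'l::field) \<Rightarrow> 'l set" where
  "frac_field R e = {e a / e b | a b. a \<in> carrier R \<and> b \<in> carrier R \<and> b \<noteq> \<zero>\<^bsub>R\<^esub>}"

definition localization :: "'r ring \<Rightarrow> ('r \<Rightarrow> 'l::field) \<Rightarrow> 'r set \<Rightarrow> 'l set" where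
  "localization R e P = {e a / e b | a b. a \<in> carrier R \<and> b \<in> carrier R \<and> b \<notin> P}"

definition integral_over :: "'l::field set \<Rightarrow> 'l \<Rightarrow> bool" where
  "integral_over B z \<longleftrightarrow> (\<exists>n c. (\<forall>i<n. c i \<in> B) \<and> z ^ n + (\<Sum>i<n. c i * z ^ i) = 0)"

definition integral_closure :: "'r ring \<Rightarrow> ('r \<Rightarrow> 'l::field) \<Rightarrow> 'l set" where
  "integral_closure R e = {z \<in> frac_field R e. integral_over (e ` carrier R) z}"

definition conductor :: "'r ring \<Rightarrow> ('r \<Rightarrow> 'l::field) \<Rightarrow> 'r set" where
  "conductor R e = {z \<in> carrier R. \<forall>w \<in> integral_closure R e. e z * w \<in> e ` carrier R}"

definition non_normal_locus :: "'r ring \<Rightarrow> ('r \<Rightarrow> 'l::field) \<Rightarrow> 'r set set" where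
  "non_normal_locus R e = {P. primeideal P R \<and>
     \<not> (\<forall>z \<in> frac_field R e. integral_over (localization R e P) z \<longrightarrow> z \<in> localization R e P)}"

definition vanishing_locus :: "'r ring \<Rightarrow> 'r set \<Rightarrow> 'r set set" where
  "vanishing_locus R J = {P. primeideal P R \<and> J \<subseteq> P}"

definition radical_ideal :: "'r ring \<Rightarrow> 'r set \<Rightarrow> bool" where
  "radical_ideal R J \<longleftrightarrow> ideal J R \<and> (\<forall>x \<in> carrier R. \<forall>n::nat. x [^]\<^bsub>R\<^esub> n \<in> J \<longrightarrow> x \<in> J)"

definition test_pair :: "'r ring \<Rightarrow> ('r \<Rightarrow> 'l::field) \<Rightarrow> 'r set \<Rightarrow> 'r \<Rightarrow> bool" where
  "test_pair R e J a \<longleftrightarrow> radical_ideal R J \<and> non_normal_locus R e \<subseteq> vanishing_locus R J \<and>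
     a \<in> J \<and> a \<noteq> \<zero>\<^bsub>R\<^esub>"

text \<open>The ideal \<open>aJ : J\<close>.\<close>

definition test_colon :: "'r ring \<Rightarrow> 'r set \<Rightarrow> 'r \<Rightarrow> 'r set" where
  "test_colon R J a =
     {b \<in> carrier R. (\<lambda>c. b \<otimes>\<^bsub>R\<^esub> c) ` J \<subseteq> (\<lambda>c. a \<otimes>\<^bsub>R\<^esub> c) ` J}"

definition is_syzygy :: "'r ring \<Rightarrow> nat \<Rightarrow> (nat \<Rightarrow> 'r) \<Rightarrow> (nat \<Rightarrow> 'r) \<Rightarrow> bool" where
  "is_syzygy R s u v \<longleftrightarrow> (\<forall>\<nu>\<le>s. v \<nu> \<in> carrier R) \<and>
     (\<Oplus>\<^bsub>R\<^esub>\<nu>\<in>{..s}. v \<nu> \<otimes>\<^bsub>R\<^esub> u \<nu>) = \<zero>\<^bsub>R\<^esub>"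

definition syzygy_generators ::
  "'r ring \<Rightarrow> nat \<Rightarrow> (nat \<Rightarrow> 'r) \<Rightarrow> nat \<Rightarrow> (nat \<Rightarrow> nat \<Rightarrow> 'r) \<Rightarrow> bool" where
  "syzygy_generators R s u h \<eta> \<longleftrightarrow> (\<forall>q<h. is_syzygy R s u (\<eta> q)) \<and>
     (\<forall>v. is_syzygy R s u v \<longrightarrow> (\<exists>c. (\<forall>q<h. c q \<in> carrier R) \<and>
        (\<forall>\<nu>\<le>s. v \<nu> = (\<Oplus>\<^bsub>R\<^esub>q\<in>{..<h}. c q \<otimes>\<^bsub>R\<^esub> \<eta> q \<nu>))))"


section \<open>Normalization\<close>

text \<open>
  All the rings \<open>S_i = S[T_{1,1}, \<dots>, T_{i,s_i}]\<close> are subrings of the polynomial ring over \<open>S\<close>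
  in variables \<open>T_{i,j}\<close> indexed by pairs of natural numbers.  The list \<open>ss = [s_1, \<dots>, s_i]\<close>
  records the numbers of variables; \<open>S_0\<close> consists of the constants \<open>t_const p\<close>.
\<close>

type_synonym 'a tpoly = "((nat \<times> nat) \<Rightarrow>\<^sub>0 nat) \<Rightarrow>\<^sub>0 'a poly poly"

definition t_const :: "'a::field poly poly \<Rightarrow> 'a tpoly" where
  "t_const p = Poly_Mapping.single 0 p"

definition t_var :: "nat \<Rightarrow> nat \<Rightarrow> 'a::field tpoly" where
  "t_var i j = (if j = 0 then 1 else Poly_Mapping.single (Poly_Mapping.single (i, j) 1) 1)"

definition tower_vars :: "nat list \<Rightarrow> (nat \<times> nat) set" where
  "tower_vars ss = {(i, j). 1 \<le> i \<and> i \<le> length ss \<and> 1 \<le> j \<and> j \<le> ss ! (i - 1)}"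

definition tower_ring :: "nat list \<Rightarrow> 'a::field tpoly ring" where
  "tower_ring ss = ring_of_type_algebra
     \<lparr> carrier := {p. \<forall>m \<in> Poly_Mapping.keys p. Poly_Mapping.keys m \<subseteq> tower_vars ss} \<rparr>"

text \<open>
  A state is \<open>(ss, I, \<tau>)\<close>, where \<open>I\<close> is the ideal \<open>I_i\<close> of \<open>S_i\<close>, so that \<open>A_i = S_i/I_i\<close>, and \<open>\<tau>\<close> gives the images of the
  \<open>T_{i,j}\<close> in the field \<open>'l\<close> containing \<open>Q(A)\<close> under the composite of \<open>T_{i,j} \<mapsto> u_{i,j}/a_i\<close>
  with the identifications of the previous stages.
\<close>

type_synonym ('a, 'l) state = "nat list \<times> 'a tpoly set \<times> (nat \<times> nat \<Rightarrow> 'l)"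

fun stage_ring :: "('a::field, 'l::field) state \<Rightarrow> 'a tpoly set ring" where
  "stage_ring (ss, I, \<tau>) = tower_ring ss Quot I"

fun stage_class :: "('a::field, 'l::field) state \<Rightarrow> 'a tpoly \<Rightarrow> 'a tpoly set" where
  "stage_class (ss, I, \<tau>) p = I +>\<^bsub>tower_ring ss\<^esub> p"

definition t_eval :: "'a::field poly poly \<Rightarrow> ('a poly poly set \<Rightarrow> 'l::field) \<Rightarrow>
    (nat \<times> nat \<Rightarrow> 'l) \<Rightarrow> 'a tpoly \<Rightarrow> 'l" where
  "t_eval F \<iota> \<tau> p = (\<Sum>m \<in> Poly_Mapping.keys p. \<iota> (res_class F (Poly_Mapping.lookup p m)) *
     (\<Prod>v \<in> Poly_Mapping.keys m. \<tau> v ^ Poly_Mapping.lookup m v))"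

text \<open>
  The map \<open>A_i \<rightarrow> 'l\<close> induced by evaluation: the restriction to \<open>A_i\<close> of
  \<open>\<phi>_1 \<circ> \<dots> \<circ> \<phi>_i : Q(A_i) \<rightarrow> Q(A)\<close>, followed by \<open>\<iota>\<close>.
\<close>

fun stage_emb :: "'a::field poly poly \<Rightarrow> ('a poly poly set \<Rightarrow> 'l::field) \<Rightarrow>
    ('a, 'l) state \<Rightarrow> 'a tpoly set \<Rightarrow> 'l" where
  "stage_emb F \<iota> (ss, I, \<tau>) C = the_elem (t_eval F \<iota> \<tau> ` C)"

definition initial_state :: "'a::field poly poly \<Rightarrow> ('a, 'l::field) state" where
  "initial_state F = ([], t_const ` (PIdl\<^bsub>S_ring\<^esub> F), \<lambda>_. 0)"

text \<open>
  \<open>\<xi>\<close> and \<open>\<eta>\<close> have entries in \<open>A_{i-1}\<close>, i.e. cosets of \<open>I_{i-1}\<close>; letting their representatives \<open>x\<close>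
  range over the whole cosets yields the ideal of \<open>S_i\<close> containing \<open>I_{i-1}\<close> that corresponds to the
  ideal of \<open>A_{i-1}[T_{i,1}, \<dots>, T_{i,s}]\<close> generated by the relations with coefficients \<open>\<xi>\<close> and \<open>\<eta>\<close>.
\<close>

definition next_ideal :: "nat list \<Rightarrow> 'a::field tpoly set \<Rightarrow> nat \<Rightarrow>
    (nat \<Rightarrow> nat \<Rightarrow> nat \<Rightarrow> 'a tpoly set) \<Rightarrow> nat \<Rightarrow> (nat \<Rightarrow> nat \<Rightarrow> 'a tpoly set) \<Rightarrow> 'a tpoly set" where
  "next_ideal ss I s \<xi> h \<eta> = (let i = Suc (length ss) in
     Idl\<^bsub>tower_ring (ss @ [s])\<^esub> (I
       \<union> {t_var i j * t_var i l - (\<Sum>\<nu>\<le>s. x \<nu> * t_var i \<nu>) | j l x.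
            1 \<le> j \<and> j \<le> l \<and> l \<le> s \<and> (\<forall>\<nu>\<le>s. x \<nu> \<in> \<xi> j l \<nu>)}
       \<union> {(\<Sum>\<nu>\<le>s. x \<nu> * t_var i \<nu>) | q x. q < h \<and> (\<forall>\<nu>\<le>s. x \<nu> \<in> \<eta> q \<nu>)}))"

text \<open>\<open>u 0\<close> is the element \<open>a_i\<close> of the test pair.\<close>

fun normalization_step :: "'a::field poly poly \<Rightarrow> ('a poly poly set \<Rightarrow> 'l::field) \<Rightarrow>
    ('a, 'l) state \<Rightarrow> ('a, 'l) state \<Rightarrow> bool" where
  "normalization_step F \<iota> (ss, I, \<tau>) (ss', I', \<tau>') \<longleftrightarrow>
     (let R = stage_ring (ss, I, \<tau>); e = stage_emb F \<iota> (ss, I, \<tau>); i = Suc (length ss) in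
      \<exists>J s u \<xi> h \<eta>.
        test_pair R e J (u 0) \<and>
        test_colon R J (u 0) \<noteq> PIdl\<^bsub>R\<^esub> (u 0) \<and>
        (\<forall>j\<le>s. u j \<in> carrier R) \<and> test_colon R J (u 0) = Idl\<^bsub>R\<^esub> (u ` {..s}) \<and>
        (\<forall>j l. 1 \<le> j \<and> j \<le> l \<and> l \<le> s \<longrightarrow>
           (\<forall>\<nu>\<le>s. \<xi> j l \<nu> \<in> carrier R) \<and>
           u j \<otimes>\<^bsub>R\<^esub> u l = (\<Oplus>\<^bsub>R\<^esub>\<nu>\<in>{..s}. u 0 \<otimes>\<^bsub>R\<^esub> \<xi> j l \<nu> \<otimes>\<^bsub>R\<^esub> u \<nu>)) \<and>
        syzygy_generators R s u h \<eta> \<and>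
        ss' = ss @ [s] \<and>
        I' = next_ideal ss I s \<xi> h \<eta> \<and>
        \<tau>' = (\<lambda>(i', j). if i' = i \<and> 1 \<le> j \<and> j \<le> s then e (u j) / e (u 0) else \<tau> (i', j)))"

definition normalization_stop :: "'a::field poly poly \<Rightarrow> ('a poly poly set \<Rightarrow> 'l::field) \<Rightarrow>
    ('a, 'l) state \<Rightarrow> bool" where
  "normalization_stop F \<iota> st \<longleftrightarrow> (\<exists>J a. test_pair (stage_ring st) (stage_emb F \<iota> st) J a \<and>
     test_colon (stage_ring st) J a = PIdl\<^bsub>stage_ring st\<^esub> a)"

definition normalization_result :: "'a::field poly poly \<Rightarrow> ('a poly poly set \<Rightarrow> 'l::field) \<Rightarrow>
    ('a, 'l) state \<Rightarrow> bool" where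
  "normalization_result F \<iota> st \<longleftrightarrow>
     (normalization_step F \<iota>)\<^sup>*\<^sup>* (initial_state F) st \<and> normalization_stop F \<iota> st"


section \<open>A \<open>k[x]\<close>-basis of the integral closure\<close>

fun candidate_set :: "'a::field poly poly \<Rightarrow> ('a, 'l::field) state \<Rightarrow> 'a tpoly set set" where
  "candidate_set F (ss, I, \<tau>) =
     {stage_class (ss, I, \<tau>) ((\<Prod>i\<in>{1..length ss}. t_var i (c i)) * t_const ([:0, 1:] ^ j)) | c j.
        (\<forall>i\<in>{1..length ss}. c i \<le> ss ! (i - 1)) \<and> j < total_degree F}"

definition kx_combination :: "('a::field, 'l::field) state \<Rightarrow> 'a tpoly set list \<Rightarrow> 'a poly vec \<Rightarrow>
    'a tpoly set" where
  "kx_combination st Bs v = (\<Oplus>\<^bsub>stage_ring st\<^esub>i\<in>{..<length Bs}.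
     stage_class st (t_const [:v $ i:]) \<otimes>\<^bsub>stage_ring st\<^esub> Bs ! i)"

definition kx_relations :: "('a::field, 'l::field) state \<Rightarrow> 'a tpoly set list \<Rightarrow> 'a poly vec set" where
  "kx_relations st Bs =
     {v \<in> carrier_vec (length Bs). kx_combination st Bs v = \<zero>\<^bsub>stage_ring st\<^esub>}"

text \<open>Diagonal entries are normalized to be monic or zero.\<close>

definition smith_normal_form :: "'a::field poly mat \<Rightarrow> bool" where
  "smith_normal_form D \<longleftrightarrow> diagonal_mat D \<and>
     (\<forall>i < min (dim_row D) (dim_col D). D $$ (i, i) = 0 \<or> lead_coeff (D $$ (i, i)) = 1) \<and>
     (\<forall>i. Suc i < min (dim_row D) (dim_col D) \<longrightarrow> D $$ (i, i) dvd D $$ (Suc i, Suc i))"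

definition mutually_inverse :: "nat \<Rightarrow> 'b::semiring_1 mat \<Rightarrow> 'b mat \<Rightarrow> bool" where
  "mutually_inverse n P P' \<longleftrightarrow> P \<in> carrier_mat n n \<and> P' \<in> carrier_mat n n \<and>
     inverts_mat P P' \<and> inverts_mat P' P"

text \<open>
  Rows and the \<open>w i\<close> (\<open>i < N\<close>) are numbered from 0.  The rows of \<open>U\<close> generate the relation module;
  \<open>P'\<close> and \<open>Q'\<close> are the inverses of \<open>P\<close> and \<open>Q\<close>.
\<close>

definition kx_basis_result :: "'a::field poly poly \<Rightarrow> ('a, 'l::field) state \<Rightarrow>
    (nat \<Rightarrow> 'a tpoly set) \<Rightarrow> bool" where
  "kx_basis_result F st w \<longleftrightarrow> (\<exists>Bs m U P P' Q Q'.
     set Bs = candidate_set F st \<and>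
     U \<in> carrier_mat m (length Bs) \<and>
     kx_relations st Bs = (\<lambda>c. transpose_mat U *\<^sub>v c) ` carrier_vec m \<and>
     mutually_inverse m P P' \<and> mutually_inverse (length Bs) Q Q' \<and>
     smith_normal_form (P * U * Q) \<and>
     (\<forall>i < total_degree F. w i = kx_combination st Bs (row Q' (length Bs - total_degree F + i))))"


section \<open>A \<open>k[x]\<close>-basis of the conductor\<close>

definition kx_field :: "'a::field poly poly \<Rightarrow> ('a poly poly set \<Rightarrow> 'l::field) \<Rightarrow> 'l set" where
  "kx_field F \<iota> = {\<iota> (res_class F [:p:]) / \<iota> (res_class F [:q:]) | p q. q \<noteq> 0}"

text \<open>
  The trace of \<open>k(x,y)\<close> over \<open>k(x)\<close>: the trace of multiplication by \<open>z\<close>, with matrix taken in the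
  basis \<open>1, y, \<dots>, y^{N-1}\<close>.
\<close>

definition field_trace :: "'a::field poly poly \<Rightarrow> ('a poly poly set \<Rightarrow> 'l::field) \<Rightarrow> 'l \<Rightarrow> 'l" where
  "field_trace F \<iota> z = (let N = total_degree F; y = \<iota> (res_class F [:0, 1:]) in
     THE t. \<exists>M \<in> carrier_mat N N. elements_mat M \<subseteq> kx_field F \<iota> \<and>
       (\<forall>j<N. z * y ^ j = (\<Sum>i<N. M $$ (i, j) * y ^ i)) \<and> t = (\<Sum>i<N. M $$ (i, i)))"

definition trace_dual :: "'a::field poly poly \<Rightarrow> ('a poly poly set \<Rightarrow> 'l::field) \<Rightarrow>
    (nat \<Rightarrow> 'l) \<Rightarrow> (nat \<Rightarrow> 'l) \<Rightarrow> bool" where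
  "trace_dual F \<iota> w w' \<longleftrightarrow> (let N = total_degree F in
     \<exists>G. mutually_inverse N (mat N N (\<lambda>(i, j). field_trace F \<iota> (w i * w j))) G \<and>
       (\<forall>i<N. w' i = (G *\<^sub>v vec N w) $ i))"

definition conductor_gens :: "'a::field poly poly \<Rightarrow> ('a poly poly set \<Rightarrow> 'l::field) \<Rightarrow>
    (nat \<Rightarrow> 'l) \<Rightarrow> 'a poly poly set set" where
  "conductor_gens F \<iota> w' = {f \<in> carrier (coord_ring F).
     \<exists>i < total_degree F. \<iota> f = \<iota> (res_class F (pderiv F)) * w' i}"


section \<open>Truncation\<close>

definition graded_monomial_order :: "(nat \<times> nat) rel \<Rightarrow> bool" where
  "graded_monomial_order r \<longleftrightarrow> linear_order r \<and>
     (\<forall>a b c d a' b'. ((a, b), (c, d)) \<in> r \<longrightarrow> ((a + a', b + b'), (c + a', d + b')) \<in> r) \<and>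
     (\<forall>a b c d. a + b < c + d \<longrightarrow> ((a, b), (c, d)) \<in> r)"

definition lead_exp :: "(nat \<times> nat) rel \<Rightarrow> 'a::zero poly poly \<Rightarrow> nat \<times> nat" where
  "lead_exp r p = (THE e. e \<in> supp2 p \<and> (\<forall>e' \<in> supp2 p. (e', e) \<in> r))"

definition groebner_basis :: "(nat \<times> nat) rel \<Rightarrow> 'a::field poly poly set \<Rightarrow>
    'a poly poly set \<Rightarrow> bool" where
  "groebner_basis r I G \<longleftrightarrow> finite G \<and> G \<subseteq> I \<and>
     (\<forall>f \<in> I - {0}. \<exists>g \<in> G - {0}. fst (lead_exp r g) \<le> fst (lead_exp r f) \<and>
        snd (lead_exp r g) \<le> snd (lead_exp r f))"

definition conductor_preimage :: "'a::field poly poly \<Rightarrow> 'a poly poly set set \<Rightarrow>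
    'a poly poly set" where
  "conductor_preimage F \<F> = {p. res_class F p \<in> Idl\<^bsub>coord_ring F\<^esub> \<F>}"

definition macaulay_set :: "nat \<Rightarrow> 'a::field poly poly set \<Rightarrow> 'a poly poly set" where
  "macaulay_set N G = {p. \<exists>e. \<exists>g \<in> G. p = monom2 e * g \<and> deg_le p (int N - 3)}"

definition macaulay_mat :: "'a::field poly poly list \<Rightarrow> (nat \<times> nat) list \<Rightarrow> 'a mat" where
  "macaulay_mat fs ms = mat (length fs) (length ms) (\<lambda>(i, j). coeff2 (fs ! i) (ms ! j))"

text \<open>\<^const>\<open>row_echelon_form\<close> is the reduced row echelon form.\<close>

definition rref_of :: "'a::field mat \<Rightarrow> 'a mat \<Rightarrow> bool" where
  "rref_of M E \<longleftrightarrow> row_echelon_form E \<and> (\<exists>P P'. mutually_inverse (dim_row M) P P' \<and> E = P * M)"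

definition row_polys :: "(nat \<times> nat) list \<Rightarrow> 'a::field mat \<Rightarrow> 'a poly poly list" where
  "row_polys ms E =
     map (\<lambda>v. \<Sum>j < length ms. Polynomial.smult [:v $ j:] (monom2 (ms ! j)))
       (filter (\<lambda>v. v \<noteq> 0\<^sub>v (length ms)) (rows E))"

definition truncation_output :: "nat \<Rightarrow> 'a::field poly poly set \<Rightarrow> 'a poly poly list \<Rightarrow> bool" where
  "truncation_output N I out \<longleftrightarrow> (\<exists>r G fs ms E.
     graded_monomial_order r \<and> groebner_basis r I G \<and>
     distinct fs \<and> set fs = macaulay_set N G \<and>
     distinct ms \<and> set ms = {e. int (fst e + snd e) \<le> int N - 3} \<and>
     rref_of (macaulay_mat fs ms) E \<and> out = row_polys ms E)"


section \<open>The procedure\<close>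

text \<open>
  \<open>out\<close> is the list of polynomials output by some run on the input \<open>F\<close>; every choice left open by
  the procedure is existentially quantified.
\<close>

definition procedure_output :: "'a::field poly poly \<Rightarrow> ('a poly poly set \<Rightarrow> 'l::field) \<Rightarrow>
    'a poly poly list \<Rightarrow> bool" where
  "procedure_output F \<iota> out \<longleftrightarrow> (\<exists>st w w'.
     normalization_result F \<iota> st \<and>
     kx_basis_result F st w \<and>
     trace_dual F \<iota> (\<lambda>i. stage_emb F \<iota> st (w i)) w' \<and>
     truncation_output (total_degree F) (conductor_preimage F (conductor_gens F \<iota> w')) out)"

definition conductor_trunc :: "'a::field poly poly \<Rightarrow> ('a poly poly set \<Rightarrow> 'l::field) \<Rightarrow> int \<Rightarrow>
    'a poly poly set set" where
  "conductor_trunc F \<iota> d =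
     {\<phi> \<in> conductor (coord_ring F) \<iota>. \<exists>p. \<phi> = res_class F p \<and> deg_le p d}"

text \<open>\<open>y\<close> is a simple root of \<open>F(x,Y)\<close>.\<close>

definition separable_in_Y :: "'a::field poly poly \<Rightarrow> ('a poly poly set \<Rightarrow> 'l::field) \<Rightarrow> bool" where
  "separable_in_Y F \<iota> \<longleftrightarrow>
     Polynomial.order (\<iota> (res_class F [:0, 1:])) (map_poly (\<lambda>c. \<iota> (res_class F [:c:])) F) = 1"

end

(*
  Idea.  Let A = k[x,y], and call order a k[x]-subalgebra of k(x,y) that contains A and is a finitely
  generated k[x]-module.  All orders lie in the order Abar, so strictly increasing chains of orders
  are finite and the normalization terminates; by the Grauert-Remmert criterion it can only stop
  at Abar.  The elements B_i span Abar over k[x], and as Abar is torsion free, a Smith normal form of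
  their relations exhibits a basis w_1, ..., w_N.

  For the k(x)-linear form lam(z) = coefficient of y^(N-1) in z, Euler's formula says that
  Tr(z) = lam(F_y z) and that A is its own dual under (z,v) |-> lam(zv).  Hence z Abar is contained in
  A iff lam(z Abar) is contained in k[x], and the dual basis of w_1, ..., w_N under this pairing,
  which consists of the elements F_y w_i^*, is a k[x]-basis of the conductor.

  Division by a Groebner basis for a graded order does not raise total degrees, so the multiples of
  degree at most N-3 span the truncation of the ideal; no nonzero polynomial of degree below N
  vanishes modulo F, so linear independence survives in A.
*)
theory Submission
  imports Defs "HOL-Library.Function_Algebras" "Jordan_Normal_Form.Determinant"
begin

section \<open>Modules over principal ideal domains\<close>

text \<open>The procedure speaks of quotients of polynomial rings, the mathematics of subsets of one
  field. The bridge is that each ideal I_i is the full kernel of the evaluation T_{i,j} ->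
  u_{i,j}/a_i: modulo the quadratic relations every polynomial is linear in the new variables, and a
  linear polynomial in the kernel is, after multiplication by a_i, a syzygy. So A_i is an order
  inside the type \<open>'l\<close>. Separability enters as Fy \<noteq> 0, and Fy controls the rest:
  traces of elements of an order lie in k[x], hence Fy * R lies in A for every order R. This bounds
  Abar, puts Fy into every non-normal prime, and makes the radical of Fy a test ideal at every
  stage. All finiteness is that of submodules of k[x]^n. The statement also claims termination and
  the existence of a run, so each choice left open needs a witness: generators of colon ideals and
  of syzygies, a Smith normal form, a Groebner basis.\<close>

locale pid_module = Modules.module scale
  for scale :: "'r::euclidean_ring \<Rightarrow> 'v::ab_group_add \<Rightarrow> 'v" (infixr \<open>\<cdot>\<close> 75)
begin

text \<open>Generators come as indexed families, not as sets: repetitions are allowed, coefficients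
  are plain functions of which only the values below n enter, and independence is a statement about
  these coefficients.\<close>

definition lincomb :: "nat \<Rightarrow> (nat \<Rightarrow> 'r) \<Rightarrow> (nat \<Rightarrow> 'v) \<Rightarrow> 'v" where
  "lincomb n c g = (\<Sum>i<n. c i \<cdot> g i)"

definition fam_span :: "nat \<Rightarrow> (nat \<Rightarrow> 'v) \<Rightarrow> 'v set" where
  "fam_span n g = range (\<lambda>c. lincomb n c g)"

definition fam_indep :: "nat \<Rightarrow> (nat \<Rightarrow> 'v) \<Rightarrow> bool" where
  "fam_indep n g \<longleftrightarrow> (\<forall>c. lincomb n c g = 0 \<longrightarrow> (\<forall>i<n. c i = 0))"

lemma lincomb_Suc_upd:
  "lincomb (Suc n) (c(n := a)) (g(n := x)) = lincomb n c g + a \<cdot> x"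
proof -
  have "(\<Sum>i<n. (c(n := a)) i \<cdot> (g(n := x)) i) = (\<Sum>i<n. c i \<cdot> g i)"
    by (rule sum.cong) auto
  then show ?thesis by (simp add: lincomb_def)
qed

lemma lincomb_Suc: "lincomb (Suc n) c g = lincomb n c g + c n \<cdot> g n"
  by (simp add: lincomb_def)

lemma lincomb_cong: "(\<And>i. i < n \<Longrightarrow> c i = c' i) \<Longrightarrow> (\<And>i. i < n \<Longrightarrow> g i = g' i) \<Longrightarrow>
   lincomb n c g = lincomb n c' g'"
  by (simp add: lincomb_def)

lemma lincomb_add: "lincomb n c g + lincomb n c' g = lincomb n (\<lambda>i. c i + c' i) g"
  by (simp add: lincomb_def scale_left_distrib sum.distrib)

lemma lincomb_diff: "lincomb n c g - lincomb n c' g = lincomb n (\<lambda>i. c i - c' i) g"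
  by (simp add: lincomb_def scale_left_diff_distrib sum_subtractf)

lemma lincomb_scale: "a \<cdot> lincomb n c g = lincomb n (\<lambda>i. a * c i) g"
  by (simp add: lincomb_def scale_sum_right)

lemma lincomb_in_subspace: "subspace M \<Longrightarrow> (\<And>i. i < n \<Longrightarrow> g i \<in> M) \<Longrightarrow> lincomb n c g \<in> M"
  unfolding lincomb_def by (intro subspace_sum subspace_scale) auto

lemma fam_span_subset: "subspace M \<Longrightarrow> (\<And>i. i < n \<Longrightarrow> g i \<in> M) \<Longrightarrow> fam_span n g \<subseteq> M"
  unfolding fam_span_def using lincomb_in_subspace by blast

lemma subspace_fam_span: "subspace (fam_span n g)"
proof (rule subspaceI)
  have "lincomb n (\<lambda>_. 0) g = 0" by (simp add: lincomb_def)
  then show "0 \<in> fam_span n g" by (metis fam_span_def rangeI)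
qed (auto simp: fam_span_def lincomb_add lincomb_scale)

lemma lincomb_single:
  assumes "i < n" shows "lincomb n (\<lambda>j. if j = i then a else 0) g = a \<cdot> g i"
proof -
  have "lincomb n (\<lambda>j. if j = i then a else 0) g = (\<Sum>j<n. if j = i then a \<cdot> g i else 0)"
    unfolding lincomb_def by (rule sum.cong) auto
  then show ?thesis using assms by simp
qed

lemma fam_span_base: "i < n \<Longrightarrow> g i \<in> fam_span n g"
  using lincomb_single[of i n 1 g] unfolding fam_span_def by (metis rangeI scale_one)

lemma fam_indepD: "fam_indep n g \<Longrightarrow> lincomb n c g = 0 \<Longrightarrow> i < n \<Longrightarrow> c i = 0"
  by (simp add: fam_indep_def)

lemma fam_indep_eq:
  assumes "fam_indep n g" "lincomb n c g = lincomb n c' g" "i < n"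
  shows "c i = c' i"
  using fam_indepD[OF assms(1), of "\<lambda>i. c i - c' i"] assms(2,3)
  by (simp flip: lincomb_diff)

text \<open>A nonzero element of least Euclidean size serves as d: the remainder of a member of D
  modulo d lies in D again and is smaller than d, hence 0.\<close>

lemma ideal_principal:
  fixes D :: "'r set"
  assumes "0 \<in> D" "\<And>a b. a \<in> D \<Longrightarrow> b \<in> D \<Longrightarrow> a + b \<in> D" "\<And>a r. a \<in> D \<Longrightarrow> r * a \<in> D"
  obtains d where "d \<in> D" "\<And>a. a \<in> D \<Longrightarrow> d dvd a"
proof (cases "D = {0}")
  case True
  then show ?thesis using that[of 0] by auto
next
  case False
  then have "\<exists>d. d \<in> D \<and> d \<noteq> 0" using assms(1) by auto
  from ex_has_least_nat[of "\<lambda>d. d \<in> D \<and> d \<noteq> 0" _ euclidean_size] this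
  obtain d where d: "d \<in> D" "d \<noteq> 0"
    and least: "\<And>b. b \<in> D \<Longrightarrow> b \<noteq> 0 \<Longrightarrow> euclidean_size d \<le> euclidean_size b" by blast
  have "d dvd a" if a: "a \<in> D" for a
  proof -
    have "a + (- (a div d)) * d \<in> D" by (intro assms a d)
    moreover have "a + (- (a div d)) * d = a mod d" by (simp add: minus_div_mult_eq_mod)
    ultimately have "a mod d \<in> D" by simp
    with least[of "a mod d"] mod_size_less[OF d(2), of a] have "a mod d = 0" by force
    then show ?thesis by (simp add: dvd_eq_mod_eq_0)
  qed
  with d(1) that show ?thesis by blast
qed

lemma subspace_inter_fam_span: "subspace M \<Longrightarrow> subspace (M \<inter> fam_span n g)"
  using subspace_fam_span by (simp add: subspace_inter)

text \<open>Induction on n, splitting off the last coordinate. The last coefficients of elements of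
  M form an ideal \<open>D\<close>; an element x of M that realizes a generator d of
  \<open>D\<close>, together with generators of the part of M inside the span of the first n,
  generates M. If d = 0, no x is added. The bound m \<le> n and the independence of \<open>h\<close>
  come out of the same construction.\<close>

lemma submodule_fin_gen:
  assumes "subspace M" "M \<subseteq> fam_span n g"
  obtains m h where "m \<le> n" "M = fam_span m h" "fam_indep n g \<Longrightarrow> fam_indep m h"
proof -
  have "\<exists>m h. m \<le> n \<and> M = fam_span m h \<and> (fam_indep n g \<longrightarrow> fam_indep m h)"
    using assms
  proof (induction n arbitrary: M)
    case 0
    then have "M = fam_span 0 g" using subspace_0[OF 0(1)] by (auto simp: fam_span_def lincomb_def)
    then show ?case by (intro exI[of _ 0] exI[of _ g]) (auto simp: fam_indep_def)
  next
    case (Suc n)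
    have ind: "fam_indep n g" if h: "fam_indep (Suc n) g"
    proof (unfold fam_indep_def, intro allI impI)
      fix c i assume *: "lincomb n c g = 0" "i < n"
      have "lincomb (Suc n) (c(n := 0)) g = 0"
        using lincomb_Suc_upd[of n c 0 g "g n"] * by simp
      then show "c i = 0" using fam_indepD[OF h, of "c(n := 0)" i] * by simp
    qed
    define D where "D = {a. \<exists>v \<in> fam_span n g. v + a \<cdot> g n \<in> M}"
    obtain d where d: "d \<in> D" "\<And>a. a \<in> D \<Longrightarrow> d dvd a"
    proof (rule ideal_principal[of D])
      show "0 \<in> D" unfolding D_def
        using subspace_0[OF Suc.prems(1)] subspace_0[OF subspace_fam_span[of n g]] by force
    next
      fix a b assume "a \<in> D" "b \<in> D"
      then obtain v w where vw: "v \<in> fam_span n g" "v + a \<cdot> g n \<in> M" "w \<in> fam_span n g" "w + b \<cdot> g n \<in> M"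
        unfolding D_def by blast
      have "v + w \<in> fam_span n g" using subspace_add[OF subspace_fam_span] vw by blast
      moreover have "(v + w) + (a + b) \<cdot> g n \<in> M"
        using subspace_add[OF Suc.prems(1) vw(2) vw(4)] by (simp add: algebra_simps)
      ultimately show "a + b \<in> D" unfolding D_def by blast
    next
      fix a r assume "a \<in> D"
      then obtain v where v: "v \<in> fam_span n g" "v + a \<cdot> g n \<in> M" unfolding D_def by blast
      have "r \<cdot> v \<in> fam_span n g" using subspace_scale[OF subspace_fam_span] v by blast
      moreover have "r \<cdot> v + (r * a) \<cdot> g n \<in> M"
        using subspace_scale[OF Suc.prems(1) v(2), of r] by (simp add: algebra_simps)
      ultimately show "r * a \<in> D" unfolding D_def by blast
    qed auto
    obtain v0 where v0: "v0 \<in> fam_span n g" "v0 + d \<cdot> g n \<in> M" using d(1) unfolding D_def by blast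
    define x where "x = v0 + d \<cdot> g n"
    have M': "subspace (M \<inter> fam_span n g)" by (rule subspace_inter_fam_span[OF Suc.prems(1)])
    obtain m h where mh: "m \<le> n" "M \<inter> fam_span n g = fam_span m h"
      "fam_indep n g \<Longrightarrow> fam_indep m h"
      using Suc.IH[OF M'] by auto
    have dec: "\<exists>a u. z = u + a \<cdot> x \<and> u \<in> fam_span m h" if z: "z \<in> M" for z
    proof -
      from z Suc.prems(2) obtain c where c: "z = lincomb (Suc n) c g" unfolding fam_span_def by auto
      have "c n \<in> D" unfolding D_def using z c by (auto simp: lincomb_Suc fam_span_def)
      with d(2) obtain a where a: "c n = d * a" by blast
      have "z - a \<cdot> x = lincomb n c g - a \<cdot> v0"
        by (simp add: c lincomb_Suc a x_def algebra_simps)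
      moreover have "lincomb n c g - a \<cdot> v0 \<in> fam_span n g"
        by (intro subspace_diff subspace_scale subspace_fam_span v0(1)) (auto simp: fam_span_def)
      moreover have "z - a \<cdot> x \<in> M"
        using z v0(2) unfolding x_def by (intro subspace_diff subspace_scale Suc.prems(1))
      ultimately have "z - a \<cdot> x \<in> fam_span m h" using mh(2) by auto
      then show ?thesis by (intro exI[of _ a] exI[of _ "z - a \<cdot> x"]) simp
    qed
    show ?case
    proof (cases "d = 0")
      case True
      have "M \<subseteq> fam_span n g"
      proof
        fix z assume z: "z \<in> M"
        with Suc.prems(2) obtain c where c: "z = lincomb (Suc n) c g" unfolding fam_span_def by auto
        have "c n \<in> D" unfolding D_def using z c by (auto simp: lincomb_Suc fam_span_def)
        with d(2) True have "c n = 0" by auto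
        then show "z \<in> fam_span n g" by (auto simp: c lincomb_Suc fam_span_def)
      qed
      then have "M = fam_span m h" using mh(2) by auto
      then show ?thesis using mh(1,3) ind by (intro exI[of _ m] exI[of _ h]) auto
    next
      case False
      have x: "x \<in> M" using v0(2) x_def by simp
      have "M = fam_span (Suc m) (h(m := x))"
      proof
        show "M \<subseteq> fam_span (Suc m) (h(m := x))"
        proof
          fix z assume "z \<in> M"
          from dec[OF this] obtain a c where "z = lincomb m c h + a \<cdot> x" unfolding fam_span_def by blast
          then have "z = lincomb (Suc m) (c(m := a)) (h(m := x))" by (simp add: lincomb_Suc_upd)
          then show "z \<in> fam_span (Suc m) (h(m := x))" by (simp add: fam_span_def)
        qed
        show "fam_span (Suc m) (h(m := x)) \<subseteq> M"
        proof (rule fam_span_subset[OF Suc.prems(1)])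
          fix i assume "i < Suc m"
          then show "(h(m := x)) i \<in> M"
            using x fam_span_base[of i m h] mh(2) by (cases "i = m") auto
        qed
      qed
      moreover have "fam_indep (Suc m) (h(m := x))" if i: "fam_indep (Suc n) g"
      proof (unfold fam_indep_def, intro allI impI)
        fix c i assume c0: "lincomb (Suc m) c (h(m := x)) = 0" and "i < Suc m"
        from c0 have eq: "lincomb m c h + c m \<cdot> x = 0"
          using lincomb_Suc_upd[of m c "c m" h x] by simp
        have "lincomb m c h \<in> fam_span n g" using mh(2) by (auto simp: fam_span_def)
        then have "lincomb m c h + c m \<cdot> v0 \<in> fam_span n g"
          by (intro subspace_add subspace_scale subspace_fam_span v0(1))
        then obtain e where e: "lincomb m c h + c m \<cdot> v0 = lincomb n e g" unfolding fam_span_def by auto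
        \<comment> \<open>Rewritten in terms of \<open>g\<close>, the relation has last coefficient
          c m * d; independence of \<open>g\<close> and d \<noteq> 0 force c m = 0.\<close>
        have "lincomb (Suc n) (e(n := c m * d)) g = lincomb m c h + c m \<cdot> x"
          using lincomb_Suc_upd[of n e "c m * d" g "g n"] by (simp flip: e add: x_def algebra_simps)
        with eq have "lincomb (Suc n) (e(n := c m * d)) g = 0" by simp
        from fam_indepD[OF i this, of n] False have cm: "c m = 0" by simp
        with eq have "lincomb m c h = 0" by simp
        with fam_indepD[OF mh(3)[OF ind[OF i]], of c i] cm \<open>i < Suc m\<close> show "c i = 0"
          by (cases "i = m") auto
      qed
      ultimately show ?thesis using mh(1)
        by (intro exI[of _ "Suc m"] exI[of _ "h(m := x)"] conjI impI) blast+
    qed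
  qed
  then show ?thesis using that by blast
qed

text \<open>The union of the chain is a submodule, hence finitely generated, and its finitely many
  generators all lie in one member.\<close>

lemma submodule_chain_stabilizes:
  assumes sub: "\<And>i::nat. subspace (M i)" and ub: "\<And>i. M i \<subseteq> fam_span n g"
    and inc: "\<And>i. M i \<subseteq> M (Suc i)"
  obtains k where "\<And>i. k \<le> i \<Longrightarrow> M i = M k"
proof -
  have mono: "M i \<subseteq> M j" if "i \<le> j" for i j
    using lift_Suc_mono_le[of M, OF inc that] .
  have "subspace (\<Union>i. M i)"
  proof (rule subspaceI)
    show "0 \<in> (\<Union>i. M i)" using subspace_0[OF sub] by auto
    fix x y assume "x \<in> (\<Union>i. M i)" "y \<in> (\<Union>i. M i)"
    then obtain i j where "x \<in> M i" "y \<in> M j" by auto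
    then have "x \<in> M (max i j)" "y \<in> M (max i j)"
      using mono[of i "max i j"] mono[of j "max i j"] by auto
    then show "x + y \<in> (\<Union>i. M i)" using subspace_add[OF sub] by blast
  next
    fix c x assume "x \<in> (\<Union>i. M i)"
    then show "c \<cdot> x \<in> (\<Union>i. M i)" using subspace_scale[OF sub] by blast
  qed
  moreover have "(\<Union>i. M i) \<subseteq> fam_span n g" using ub by auto
  ultimately obtain m h where mh: "(\<Union>i. M i) = fam_span m h" by (rule submodule_fin_gen)
  have "\<forall>j<m. \<exists>i. h j \<in> M i" using fam_span_base[of _ m h] mh by blast
  then obtain f where f: "\<And>j. j < m \<Longrightarrow> h j \<in> M (f j)" by metis
  define k where "k = Max (insert 0 (f ` {..<m}))"
  have "h j \<in> M k" if "j < m" for j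
    using f[OF that] mono[of "f j" k] that by (auto simp: k_def)
  then have "fam_span m h \<subseteq> M k" by (intro fam_span_subset sub)
  then have "M i = M k" if "k \<le> i" for i using mh mono[OF that] by auto
  then show ?thesis by (rule that)
qed

text \<open>Without a maximal member, dependent choice builds a strictly increasing chain, which
  cannot stabilize. This form is used for the ideals R : z.\<close>

lemma maximal_submodule:
  assumes "M \<in> \<M>" "\<And>M. M \<in> \<M> \<Longrightarrow> subspace M \<and> M \<subseteq> fam_span n g"
  obtains M where "M \<in> \<M>" "\<And>M'. M' \<in> \<M> \<Longrightarrow> M \<subseteq> M' \<Longrightarrow> M' = M"
proof (rule ccontr)
  assume "\<not> thesis"
  then have step: "\<exists>M'. M' \<in> \<M> \<and> M \<subset> M'" if "M \<in> \<M>" for M using that \<open>\<not> thesis\<close> \<open>(\<And>M. M \<in> \<M> \<Longrightarrow> (\<And>M'. M' \<in> \<M> \<Longrightarrow> M \<subseteq> M' \<Longrightarrow> M' = M) \<Longrightarrow> thesis)\<close> by (metis psubsetI)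
  obtain f where f: "\<And>k::nat. f k \<in> \<M> \<and> f k \<subset> f (Suc k)"
    using dependent_nat_choice[of "\<lambda>_ M. M \<in> \<M>" "\<lambda>_ M M'. M \<subset> M'"] assms(1) step by metis
  obtain k where "\<And>i. k \<le> i \<Longrightarrow> f i = f k"
    by (rule submodule_chain_stabilizes[of f n g]) (use f assms(2) in blast)+
  then show False using f[of k] by (metis le_SucI order_refl psubsetE)
qed

end

text \<open>Fraction-free elimination.\<close>

lemma nontrivial_solution:
  fixes a :: "'i \<Rightarrow> nat \<Rightarrow> 'r::idom"
  assumes "finite I" "m < card I"
  obtains c where "\<exists>i\<in>I. c i \<noteq> 0" "\<And>j. j < m \<Longrightarrow> (\<Sum>i\<in>I. c i * a i j) = 0"
proof -
  have "\<exists>c. (\<exists>i\<in>I. c i \<noteq> 0) \<and> (\<forall>j<m. (\<Sum>i\<in>I. c i * a i j) = 0)"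
    using assms
  proof (induction m arbitrary: I a)
    case 0
    then have "I \<noteq> {}" by auto
    then show ?case by (intro exI[of _ "\<lambda>_. 1"]) auto
  next
    case (Suc m)
    show ?case
    proof (cases "\<forall>i\<in>I. a i m = 0")
      case True
      from Suc.IH[OF Suc.prems(1), of a] Suc.prems(2)
      obtain c where c: "\<exists>i\<in>I. c i \<noteq> 0" "\<forall>j<m. (\<Sum>i\<in>I. c i * a i j) = 0" by auto
      then show ?thesis using True by (intro exI[of _ c]) (auto simp: less_Suc_eq)
    next
      case False
      then obtain p where p: "p \<in> I" "a p m \<noteq> 0" by auto
      define b where "b = (\<lambda>i j. a p m * a i j - a i m * a p j)"
      have "m < card (I - {p})" using Suc.prems p by simp
      from Suc.IH[OF _ this, of b] Suc.prems(1)
      obtain c where c: "\<exists>i\<in>I-{p}. c i \<noteq> 0" "\<forall>j<m. (\<Sum>i\<in>I-{p}. c i * b i j) = 0" by auto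
      \<comment> \<open>The coefficient at the pivot p is chosen so that in every column j the sum
        with \<open>e\<close> equals the sum with \<open>c\<close> over the reduced entries
        \<open>b\<close>; column m vanishes because b i m = 0.\<close>
      define e where "e = (\<lambda>i. if i = p then - (\<Sum>i\<in>I-{p}. c i * a i m) else c i * a p m)"
      have "(\<Sum>i\<in>I. e i * a i j) = (\<Sum>i\<in>I-{p}. c i * b i j)" for j
      proof -
        have "(\<Sum>i\<in>I-{p}. e i * a i j) = (\<Sum>i\<in>I-{p}. c i * a p m * a i j)"
          by (rule sum.cong) (auto simp: e_def)
        then have "(\<Sum>i\<in>I. e i * a i j)
            = - (\<Sum>i\<in>I-{p}. c i * a i m) * a p j + (\<Sum>i\<in>I-{p}. c i * a p m * a i j)"
          using sum.remove[OF Suc.prems(1) p(1), of "\<lambda>i. e i * a i j"] by (simp add: e_def)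
        also have "\<dots> = (\<Sum>i\<in>I-{p}. c i * b i j)"
          by (simp add: b_def sum_distrib_left sum_subtractf algebra_simps)
        finally show ?thesis .
      qed
      moreover have "b i m = 0" for i by (simp add: b_def)
      ultimately have "\<forall>j<Suc m. (\<Sum>i\<in>I. e i * a i j) = 0" using c(2) by (auto simp: less_Suc_eq)
      moreover have "\<exists>i\<in>I. e i \<noteq> 0" using c(1) p by (auto simp: e_def)
      ultimately show ?thesis by blast
    qed
  qed
  then show ?thesis using that by blast
qed

context pid_module
begin

text \<open>Writing n > m vectors in m generators gives m linear equations in n unknowns; a
  nontrivial solution over the ring itself is a relation among the vectors. All later
  identifications of ranks with N rest on this bound.\<close>

lemma indep_in_span_le:
  assumes "fam_indep n v" "\<And>i. i < n \<Longrightarrow> v i \<in> fam_span m u"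
  shows "n \<le> m"
proof (rule ccontr)
  assume "\<not> n \<le> m"
  have "\<forall>i<n. \<exists>c. v i = lincomb m c u" using assms(2) unfolding fam_span_def by auto
  then obtain a where a: "\<And>i. i < n \<Longrightarrow> v i = lincomb m (a i) u" by metis
  obtain c where c: "\<exists>i\<in>{..<n}. c i \<noteq> 0" "\<And>j. j < m \<Longrightarrow> (\<Sum>i\<in>{..<n}. c i * a i j) = 0"
    by (rule nontrivial_solution[of "{..<n}" m a]) (use \<open>\<not> n \<le> m\<close> in auto)
  have "lincomb n c v = (\<Sum>i<n. \<Sum>j<m. (c i * a i j) \<cdot> u j)"
    by (simp add: lincomb_def a scale_sum_right)
  also have "\<dots> = (\<Sum>j<m. (\<Sum>i<n. c i * a i j) \<cdot> u j)"
    by (subst sum.swap) (simp add: scale_sum_left)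
  also have "\<dots> = 0" using c(2) by simp
  finally show False using fam_indepD[OF assms(1)] c(1) by auto
qed

end


section \<open>Orders in the function field of a plane curve\<close>

text \<open>Abstract form of k[x,y] inside a field: \<open>\<kappa>\<close> is the inclusion of
  k[x], \<open>f\<close> lists the coefficients of F, and \<open>powers_indep\<close> makes F the
  minimal polynomial of y over k(x). Traces, Euler's duality and orders are developed from this
  data.\<close>

locale plane_curve =
  fixes \<kappa> :: "'a::field poly \<Rightarrow> 'l::field" and f :: "nat \<Rightarrow> 'a poly" and N :: nat and y :: 'l
  assumes \<kappa>_add: "\<kappa> (p + q) = \<kappa> p + \<kappa> q" and \<kappa>_mult: "\<kappa> (p * q) = \<kappa> p * \<kappa> q" and \<kappa>_1: "\<kappa> 1 = 1"
    and \<kappa>_inj: "\<kappa> p = 0 \<Longrightarrow> p = 0"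
    and N_pos: "0 < N" and f_N: "f N = 1"
    and root: "(\<Sum>l\<le>N. \<kappa> (f l) * y ^ l) = 0"
    and powers_indep: "(\<Sum>i<N. \<kappa> (c i) * y ^ i) = 0 \<Longrightarrow> i < N \<Longrightarrow> c i = 0"
begin

sublocale pid_module "\<lambda>p v. \<kappa> p * v"
  by unfold_locales (simp_all add: \<kappa>_add \<kappa>_mult \<kappa>_1 algebra_simps)

lemma \<kappa>_0 [simp]: "\<kappa> 0 = 0"
  using \<kappa>_add[of 0 0] by (metis add.right_neutral add_cancel_left_right)

lemma \<kappa>_minus: "\<kappa> (- p) = - \<kappa> p"
  using \<kappa>_add[of p "- p"] by (simp add: eq_neg_iff_add_eq_0 add.commute)

lemma \<kappa>_eq_0_iff [simp]: "\<kappa> p = 0 \<longleftrightarrow> p = 0"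
  using \<kappa>_inj by auto

definition A :: "'l set" where "A = fam_span N (\<lambda>i. y ^ i)"

text \<open>Denominators are taken from k[x] only. That this is nevertheless the whole fraction
  field of A is \<open>Q_inverse\<close>.\<close>

definition Q :: "'l set" where "Q = {z. \<exists>p. p \<noteq> 0 \<and> \<kappa> p * z \<in> A}"

definition Kx :: "'l set" where "Kx = {\<kappa> p / \<kappa> q | p q. q \<noteq> 0}"

definition Fy :: 'l where "Fy = (\<Sum>l\<le>N. of_nat l * \<kappa> (f l) * y ^ (l - 1))"

lemma subspace_A: "subspace A"
  unfolding A_def by (rule subspace_fam_span)

lemma fam_indep_powers: "fam_indep N (\<lambda>i. y ^ i)"
  unfolding fam_indep_def lincomb_def using powers_indep by blast

text \<open>For k \<ge> N the monic equation of y, multiplied by y^(k - N), expresses y^k by smaller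
  powers.\<close>

lemma y_pow_in_A: "y ^ k \<in> A"
proof (induction k rule: less_induct)
  case (less k)
  show ?case
  proof (cases "k < N")
    case True
    then show ?thesis unfolding A_def by (rule fam_span_base)
  next
    case False
    have "(\<Sum>l\<le>N. \<kappa> (f l) * y ^ l) = (\<Sum>l<N. \<kappa> (f l) * y ^ l) + y ^ N"
      by (simp add: lessThan_Suc_atMost[symmetric] f_N \<kappa>_1)
    with root have "y ^ N = - (\<Sum>l<N. \<kappa> (f l) * y ^ l)" by (simp add: eq_neg_iff_add_eq_0 add.commute)
    then have "y ^ (k - N) * y ^ N = - (\<Sum>l<N. \<kappa> (f l) * (y ^ (k - N) * y ^ l))"
      by (simp add: sum_distrib_left mult.left_commute)
    moreover have "y ^ (k - N) * y ^ N = y ^ k" using False by (simp flip: power_add)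
    moreover have "- (\<Sum>l<N. \<kappa> (f l) * (y ^ (k - N) * y ^ l)) \<in> A"
      by (intro subspace_neg subspace_sum subspace_scale subspace_A)
        (use False in \<open>auto simp flip: power_add intro!: less\<close>)
    ultimately show ?thesis by simp
  qed
qed

lemma A_mult: assumes "a \<in> A" "b \<in> A" shows "a * b \<in> A"
proof -
  from assms obtain c d where "a = (\<Sum>i<N. \<kappa> (c i) * y ^ i)" "b = (\<Sum>j<N. \<kappa> (d j) * y ^ j)"
    unfolding A_def fam_span_def lincomb_def by auto
  then have "a * b = (\<Sum>i<N. \<Sum>j<N. \<kappa> (c i * d j) * y ^ (i + j))"
    by (simp add: sum_product \<kappa>_mult power_add mult_ac)
  then show ?thesis by (auto intro!: subspace_sum subspace_scale subspace_A y_pow_in_A)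
qed

lemma one_in_A: "1 \<in> A"
  using y_pow_in_A[of 0] by simp

lemma \<kappa>_in_A: "\<kappa> p \<in> A"
  using subspace_scale[OF subspace_A one_in_A, of p] by simp

lemma A_subset_Q: "A \<subseteq> Q"
  unfolding Q_def using \<kappa>_1 by (auto intro!: exI[of _ 1])

lemma Q_add: assumes "a \<in> Q" "b \<in> Q" shows "a + b \<in> Q"
proof -
  from assms obtain p q where "p \<noteq> 0" "q \<noteq> 0" "\<kappa> p * a \<in> A" "\<kappa> q * b \<in> A" unfolding Q_def by auto
  moreover from this have "\<kappa> q * (\<kappa> p * a) + \<kappa> p * (\<kappa> q * b) \<in> A"
    using subspace_add subspace_scale subspace_A by blast
  ultimately show ?thesis unfolding Q_def by (auto intro!: exI[of _ "p * q"] simp: \<kappa>_mult algebra_simps)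
qed

lemma Q_mult: assumes "a \<in> Q" "b \<in> Q" shows "a * b \<in> Q"
proof -
  from assms obtain p q where "p \<noteq> 0" "q \<noteq> 0" "\<kappa> p * a \<in> A" "\<kappa> q * b \<in> A" unfolding Q_def by auto
  moreover from this have "(\<kappa> p * a) * (\<kappa> q * b) \<in> A" using A_mult by blast
  ultimately show ?thesis unfolding Q_def by (auto intro!: exI[of _ "p * q"] simp: \<kappa>_mult mult_ac)
qed

lemma \<kappa>_in_Q: "\<kappa> p \<in> Q"
  using \<kappa>_in_A A_subset_Q by auto

lemma zero_in_Q [simp]: "0 \<in> Q" and one_in_Q [simp]: "1 \<in> Q"
  using \<kappa>_in_Q[of 0] \<kappa>_in_Q[of 1] by (auto simp: \<kappa>_1)

lemma subspace_Q: "subspace Q"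
  by (rule subspaceI) (auto intro: Q_add Q_mult \<kappa>_in_Q)

lemma Q_sum: "(\<And>i. i \<in> I \<Longrightarrow> h i \<in> Q) \<Longrightarrow> sum h I \<in> Q"
  by (rule subspace_sum[OF subspace_Q])

lemma Q_denominator: assumes "z \<in> Q" obtains p where "p \<noteq> 0" "\<kappa> p * z \<in> A"
  using assms unfolding Q_def by auto

lemma indep_mult_left: "a \<noteq> 0 \<Longrightarrow> fam_indep n g \<Longrightarrow> fam_indep n (\<lambda>i. a * g i)"
  by (simp add: fam_indep_def lincomb_def mult.left_commute[of _ a] flip: sum_distrib_left)

text \<open>For a \<noteq> 0 in A, the N + 1 elements a, a y, ..., a y^(N-1), 1 lie in the module A
  of rank N, so they are dependent. The first N are independent, hence 1 occurs in the relation, and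
  a divides a nonzero element of k[x] within A.\<close>

lemma Q_inverse: assumes "z \<in> Q" shows "inverse z \<in> Q"
proof (cases "z = 0")
  case False
  from assms obtain p where p: "p \<noteq> 0" "\<kappa> p * z \<in> A" by (rule Q_denominator)
  define a where "a = \<kappa> p * z"
  have a: "a \<in> A" "a \<noteq> 0" using p False by (auto simp: a_def)
  define g where "g = (\<lambda>i. a * y ^ i)(N := 1)"
  have "\<not> fam_indep (Suc N) g"
  proof
    assume "fam_indep (Suc N) g"
    then have "Suc N \<le> N"
    proof (rule indep_in_span_le[of _ _ _ "\<lambda>i. y ^ i"])
      fix i assume "i < Suc N"
      then show "g i \<in> fam_span N (\<lambda>i. y ^ i)"
        using A_mult[OF a(1) y_pow_in_A, of i] one_in_A by (auto simp: g_def A_def)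
    qed
    then show False by simp
  qed
  then obtain c i where c: "lincomb (Suc N) c g = 0" "i < Suc N" "c i \<noteq> 0" unfolding fam_indep_def by auto
  then have eq: "lincomb N c (\<lambda>i. a * y ^ i) + \<kappa> (c N) = 0"
    using lincomb_Suc_upd[of N c "c N" "\<lambda>i. a * y ^ i" 1] by (simp add: g_def)
  have "c N \<noteq> 0"
  proof
    assume 0: "c N = 0"
    with eq have "lincomb N c (\<lambda>i. a * y ^ i) = 0" by simp
    from fam_indepD[OF indep_mult_left[OF a(2) fam_indep_powers] this] c 0 show False
      by (metis less_Suc_eq)
  qed
  have "a * (- lincomb N c (\<lambda>i. y ^ i)) = \<kappa> (c N)"
  proof -
    have "lincomb N c (\<lambda>i. a * y ^ i) = a * lincomb N c (\<lambda>i. y ^ i)"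
      by (simp add: lincomb_def mult.left_commute[of _ a] flip: sum_distrib_left)
    with eq have "\<kappa> (c N) = - (a * lincomb N c (\<lambda>i. y ^ i))" by (simp add: eq_neg_iff_add_eq_0 add.commute)
    then show ?thesis by simp
  qed
  then have "\<kappa> (c N) * inverse a = - lincomb N c (\<lambda>i. y ^ i)"
    using a(2) by (simp add: field_simps)
  moreover have "- lincomb N c (\<lambda>i. y ^ i) \<in> A"
    by (intro subspace_neg subspace_A lincomb_in_subspace y_pow_in_A)
  ultimately have "inverse a \<in> Q" using \<open>c N \<noteq> 0\<close> unfolding Q_def by auto
  moreover have "inverse z = \<kappa> p * inverse a" using p(1) False by (simp add: a_def field_simps)
  ultimately show ?thesis using Q_mult[OF \<kappa>_in_Q] by simp
qed auto

lemma Q_divide: "a \<in> Q \<Longrightarrow> b \<in> Q \<Longrightarrow> a / b \<in> Q"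
  by (simp add: divide_inverse Q_mult Q_inverse)

lemma common_denominator:
  assumes "finite I" "\<And>i. i \<in> I \<Longrightarrow> h i \<in> Q"
  obtains p where "p \<noteq> 0" "\<And>i. i \<in> I \<Longrightarrow> \<kappa> p * h i \<in> A"
proof -
  have "\<forall>i. \<exists>p. i \<in> I \<longrightarrow> p \<noteq> 0 \<and> \<kappa> p * h i \<in> A"
    using assms(2) unfolding Q_def by blast
  from choice[OF this] obtain p where p: "\<And>i. i \<in> I \<Longrightarrow> p i \<noteq> 0 \<and> \<kappa> (p i) * h i \<in> A" by blast
  show ?thesis
  proof (rule that[of "\<Prod>i\<in>I. p i"])
    show "(\<Prod>i\<in>I. p i) \<noteq> 0" using p assms(1) by simp
    fix i assume i: "i \<in> I"
    have "\<kappa> (\<Prod>i\<in>I. p i) * h i = \<kappa> (\<Prod>i\<in>I-{i}. p i) * (\<kappa> (p i) * h i)"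
      by (simp add: prod.remove[OF assms(1) i] \<kappa>_mult mult_ac)
    also have "\<dots> \<in> A" using p[OF i] subspace_scale[OF subspace_A] by blast
    finally show "\<kappa> (\<Prod>i\<in>I. p i) * h i \<in> A" .
  qed
qed


subsection \<open>Coordinates over \<open>k(x)\<close>\<close>

lemma KxI: "q \<noteq> 0 \<Longrightarrow> z = \<kappa> p / \<kappa> q \<Longrightarrow> z \<in> Kx"
  unfolding Kx_def by blast

lemma KxE:
  assumes "z \<in> Kx" obtains p q where "q \<noteq> 0" "z = \<kappa> p / \<kappa> q"
  using assms unfolding Kx_def by blast

lemma \<kappa>_in_Kx: "\<kappa> p \<in> Kx"
  by (rule KxI[of 1 _ p]) (simp_all add: \<kappa>_1)

lemma Kx_add: assumes "a \<in> Kx" "b \<in> Kx" shows "a + b \<in> Kx"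
proof -
  obtain p q where a: "q \<noteq> 0" "a = \<kappa> p / \<kappa> q" using assms(1) by (rule KxE)
  obtain r s where b: "s \<noteq> 0" "b = \<kappa> r / \<kappa> s" using assms(2) by (rule KxE)
  show ?thesis
    by (rule KxI[of "q * s" _ "p * s + r * q"]) (use a b in \<open>simp_all add: \<kappa>_mult \<kappa>_add field_simps\<close>)
qed

lemma Kx_mult: assumes "a \<in> Kx" "b \<in> Kx" shows "a * b \<in> Kx"
proof -
  obtain p q where a: "q \<noteq> 0" "a = \<kappa> p / \<kappa> q" using assms(1) by (rule KxE)
  obtain r s where b: "s \<noteq> 0" "b = \<kappa> r / \<kappa> s" using assms(2) by (rule KxE)
  show ?thesis by (rule KxI[of "q * s" _ "p * r"]) (use a b in \<open>simp_all add: \<kappa>_mult\<close>)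
qed

lemma Kx_subset_Q: "Kx \<subseteq> Q"
  unfolding Kx_def by (auto intro: Q_divide \<kappa>_in_Q)

lemma Kx_common_denominator:
  assumes "finite I" "\<And>i. i \<in> I \<Longrightarrow> h i \<in> Kx"
  obtains p r where "p \<noteq> 0" "\<And>i. i \<in> I \<Longrightarrow> \<kappa> p * h i = \<kappa> (r i)"
proof -
  have "\<forall>i. \<exists>q. i \<in> I \<longrightarrow> (\<exists>r. q \<noteq> 0 \<and> \<kappa> q * h i = \<kappa> r)"
  proof (intro allI)
    fix i show "\<exists>q. i \<in> I \<longrightarrow> (\<exists>r. q \<noteq> 0 \<and> \<kappa> q * h i = \<kappa> r)"
    proof (cases "i \<in> I")
      case True
      then obtain r q where "q \<noteq> 0" "h i = \<kappa> r / \<kappa> q" using assms(2) by (blast elim: KxE)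
      then have "q \<noteq> 0 \<and> \<kappa> q * h i = \<kappa> r" by simp
      then show ?thesis by blast
    qed simp
  qed
  from choice[OF this] obtain q where q: "\<And>i. i \<in> I \<Longrightarrow> q i \<noteq> 0"
    "\<forall>i. \<exists>r. i \<in> I \<longrightarrow> \<kappa> (q i) * h i = \<kappa> r" by blast
  from choice[OF q(2)] obtain r where r: "\<And>i. i \<in> I \<Longrightarrow> \<kappa> (q i) * h i = \<kappa> (r i)" by blast
  show ?thesis
  proof (rule that[of "\<Prod>i\<in>I. q i" "\<lambda>i. (\<Prod>i\<in>I-{i}. q i) * r i"])
    show "(\<Prod>i\<in>I. q i) \<noteq> 0" using q(1) assms(1) by simp
    fix i assume i: "i \<in> I"
    show "\<kappa> (\<Prod>i\<in>I. q i) * h i = \<kappa> ((\<Prod>i\<in>I-{i}. q i) * r i)"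
      by (simp add: prod.remove[OF assms(1) i] \<kappa>_mult r[OF i, symmetric] mult_ac)
  qed
qed

lemma indep_Kx:
  assumes "fam_indep N b" "(\<Sum>i<N. k i * b i) = 0" "\<And>i. i < N \<Longrightarrow> k i \<in> Kx" "i < N"
  shows "k i = 0"
proof -
  obtain p r where pr: "p \<noteq> 0" "\<And>i. i < N \<Longrightarrow> \<kappa> p * k i = \<kappa> (r i)"
    using Kx_common_denominator[of "{..<N}" k] assms(3) by auto
  have "lincomb N r b = \<kappa> p * (\<Sum>i<N. k i * b i)"
    by (simp add: lincomb_def pr(2)[symmetric] sum_distrib_left mult.assoc)
  with assms have "lincomb N r b = 0" by simp
  from fam_indepD[OF assms(1) this] assms(4) pr show ?thesis by force
qed

text \<open>A basis over k(x). Spanning is not part of the definition; it follows from the number N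
  of elements, by \<open>coord_exists\<close>.\<close>

definition is_basis :: "(nat \<Rightarrow> 'l) \<Rightarrow> bool" where
  "is_basis b \<longleftrightarrow> fam_indep N b \<and> (\<forall>i<N. b i \<in> Q)"

lemma is_basis_powers: "is_basis (\<lambda>i. y ^ i)"
  unfolding is_basis_def using fam_indep_powers y_pow_in_A A_subset_Q by auto

text \<open>Adjoining z to the basis gives N + 1 elements that, multiplied by a common denominator,
  lie in the rank N module A. A relation among them must involve z, because the basis is
  independent.\<close>

lemma multiple_in_span:
  assumes "is_basis b" "z \<in> Q"
  obtains q where "q \<noteq> 0" "\<kappa> q * z \<in> fam_span N b"
proof -
  define g where "g = b(N := z)"
  have "g i \<in> Q" if "i \<in> {..N}" for i using assms that by (auto simp: g_def is_basis_def)
  then obtain p where p: "p \<noteq> 0" "\<And>i. i \<le> N \<Longrightarrow> \<kappa> p * g i \<in> A"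
    using common_denominator[of "{..N}" g] by auto
  have "\<not> fam_indep (Suc N) (\<lambda>i. \<kappa> p * g i)"
    using indep_in_span_le[of "Suc N" "\<lambda>i. \<kappa> p * g i" N "\<lambda>i. y ^ i"] p(2) by (auto simp: A_def)
  then obtain c i where c: "lincomb (Suc N) c (\<lambda>i. \<kappa> p * g i) = 0" "i < Suc N" "c i \<noteq> 0"
    unfolding fam_indep_def by auto
  have "\<kappa> p * lincomb (Suc N) c g = lincomb (Suc N) c (\<lambda>i. \<kappa> p * g i)"
    unfolding lincomb_def by (simp add: sum_distrib_left mult_ac distrib_left)
  with c(1) p(1) have "lincomb (Suc N) c g = 0" by simp
  then have eq: "lincomb N c b + \<kappa> (c N) * z = 0"
    using lincomb_Suc_upd[of N c "c N" b z] by (simp add: g_def)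
  have "c N \<noteq> 0"
  proof
    assume "c N = 0"
    with eq fam_indepD[of N b c] assms(1) c show False by (auto simp: is_basis_def less_Suc_eq)
  qed
  moreover have "\<kappa> (c N) * z = - lincomb N c b" using eq by (simp add: eq_neg_iff_add_eq_0 add.commute)
  moreover have "- lincomb N c b \<in> fam_span N b"
    by (intro subspace_neg subspace_fam_span) (auto simp: fam_span_def)
  ultimately show ?thesis using that by metis
qed

lemma coord_exists:
  assumes "is_basis b" "z \<in> Q"
  shows "\<exists>k. (\<forall>i<N. k i \<in> Kx) \<and> z = (\<Sum>i<N. k i * b i)"
proof -
  obtain q where q: "q \<noteq> 0" "\<kappa> q * z \<in> fam_span N b" using multiple_in_span[OF assms] .
  then obtain c where "\<kappa> q * z = (\<Sum>i<N. \<kappa> (c i) * b i)" unfolding fam_span_def lincomb_def by auto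
  then have "z = (\<Sum>i<N. \<kappa> (c i) * b i) / \<kappa> q" using q(1) by (simp add: field_simps)
  then have "z = (\<Sum>i<N. \<kappa> (c i) / \<kappa> q * b i)" by (simp add: sum_divide_distrib)
  moreover have "\<forall>i<N. \<kappa> (c i) / \<kappa> q \<in> Kx" using q(1) unfolding Kx_def by auto
  ultimately show ?thesis by (intro exI[of _ "\<lambda>i. \<kappa> (c i) / \<kappa> q"] conjI)
qed

text \<open>The entries from N on are unspecified; below N the choice is unique by
  \<open>coord_eqI\<close>.\<close>

definition coord :: "(nat \<Rightarrow> 'l) \<Rightarrow> 'l \<Rightarrow> nat \<Rightarrow> 'l" where
  "coord b z = (SOME k. (\<forall>i<N. k i \<in> Kx) \<and> z = (\<Sum>i<N. k i * b i))"

lemma coord_in_Kx: "is_basis b \<Longrightarrow> z \<in> Q \<Longrightarrow> i < N \<Longrightarrow> coord b z i \<in> Kx"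
  and coord_expansion: "is_basis b \<Longrightarrow> z \<in> Q \<Longrightarrow> (\<Sum>i<N. coord b z i * b i) = z"
  using someI_ex[OF coord_exists, folded coord_def] by (blast, metis)

lemma coord_eqI:
  assumes "is_basis b" "z = (\<Sum>i<N. k i * b i)" "\<And>i. i < N \<Longrightarrow> k i \<in> Kx" "i < N"
  shows "coord b z i = k i"
proof -
  have z: "z \<in> Q" unfolding assms(2)
    using assms Kx_subset_Q by (auto intro!: Q_sum Q_mult simp: is_basis_def)
  \<comment> \<open>Subtraction is written with \<open>\<kappa> (-1)\<close> so that closure of
    \<open>Kx\<close> under sums and products is enough.\<close>
  have "(\<Sum>i<N. (coord b z i + \<kappa> (-1) * k i) * b i) = (\<Sum>i<N. coord b z i * b i) - (\<Sum>i<N. k i * b i)"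
    by (simp add: \<kappa>_minus \<kappa>_1 left_diff_distrib sum_subtractf)
  also have "\<dots> = 0" using assms(2) coord_expansion[OF assms(1) z] by simp
  finally have *: "(\<Sum>i<N. (coord b z i + \<kappa> (-1) * k i) * b i) = 0" .
  have "coord b z i + \<kappa> (-1) * k i = 0"
  proof (rule indep_Kx[where b = b and k = "\<lambda>i. coord b z i + \<kappa> (-1) * k i", OF _ * _ assms(4)])
    show "fam_indep N b" using assms(1) by (simp add: is_basis_def)
  qed (intro Kx_add Kx_mult \<kappa>_in_Kx coord_in_Kx assms(1,3) z)
  then show ?thesis by (simp add: \<kappa>_minus \<kappa>_1)
qed

lemma coord_add:
  assumes "is_basis b" "z \<in> Q" "w \<in> Q" "i < N"
  shows "coord b (z + w) i = coord b z i + coord b w i"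
proof (rule coord_eqI[OF assms(1) _ _ assms(4)])
  show "z + w = (\<Sum>i<N. (coord b z i + coord b w i) * b i)"
    by (simp add: distrib_right sum.distrib coord_expansion assms)
qed (intro Kx_add coord_in_Kx assms)

lemma coord_scale:
  assumes "is_basis b" "z \<in> Q" "c \<in> Kx" "i < N"
  shows "coord b (c * z) i = c * coord b z i"
proof (rule coord_eqI[OF assms(1) _ _ assms(4)])
  show "c * z = (\<Sum>i<N. (c * coord b z i) * b i)"
    by (simp add: mult.assoc coord_expansion assms flip: sum_distrib_left)
qed (intro Kx_mult coord_in_Kx assms)

lemma coord_sum:
  assumes "is_basis b" "i < N" "\<And>j. j \<in> J \<Longrightarrow> c j \<in> Kx" "\<And>j. j \<in> J \<Longrightarrow> z j \<in> Q"
  shows "coord b (\<Sum>j\<in>J. c j * z j) i = (\<Sum>j\<in>J. c j * coord b (z j) i)"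
  using assms(3,4)
proof (induction J rule: infinite_finite_induct)
  case (insert j J)
  then show ?case
    using Kx_subset_Q by (auto simp: assms coord_add coord_scale Q_sum Q_mult subset_iff)
qed (use coord_scale[OF assms(1) zero_in_Q \<kappa>_in_Kx assms(2), of 0] in auto)

lemma coord_base:
  assumes "is_basis b" "i < N" "j < N"
  shows "coord b (b j) i = (if i = j then 1 else 0)"
proof (rule coord_eqI[OF assms(1) _ _ assms(2)])
  show "b j = (\<Sum>i<N. (if i = j then 1 else 0) * b i)"
    using assms(3) by (simp add: if_distrib[of "\<lambda>x. x * _"] cong: if_cong)
qed (use \<kappa>_in_Kx[of 0] \<kappa>_in_Kx[of 1] in \<open>auto simp: \<kappa>_1\<close>)

lemma in_fam_span_iff:
  assumes "is_basis b" "z \<in> Q"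
  shows "z \<in> fam_span N b \<longleftrightarrow> (\<forall>i<N. coord b z i \<in> range \<kappa>)"
proof
  assume "z \<in> fam_span N b"
  then obtain c where c: "z = (\<Sum>i<N. \<kappa> (c i) * b i)" unfolding fam_span_def lincomb_def by auto
  have "coord b z i = \<kappa> (c i)" if "i < N" for i
    by (rule coord_eqI[OF assms(1) c \<kappa>_in_Kx that])
  then show "\<forall>i<N. coord b z i \<in> range \<kappa>" by auto
next
  assume "\<forall>i<N. coord b z i \<in> range \<kappa>"
  then have "\<forall>i. \<exists>p. i < N \<longrightarrow> coord b z i = \<kappa> p" by auto
  then obtain c where "\<And>i. i < N \<Longrightarrow> coord b z i = \<kappa> (c i)" by metis
  then have "z = lincomb N c b" using coord_expansion[OF assms] by (simp add: lincomb_def)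
  then show "z \<in> fam_span N b" by (simp add: fam_span_def)
qed

definition mult_trace :: "(nat \<Rightarrow> 'l) \<Rightarrow> 'l \<Rightarrow> 'l" where
  "mult_trace b z = (\<Sum>i<N. coord b (z * b i) i)"

text \<open>Expanding z * b i first in b' and then back in b writes the trace as that of a product
  of two matrices; exchanging the two factors gives the trace with respect to b'.\<close>

lemma mult_trace_basis_indep:
  assumes b: "is_basis b" and b': "is_basis b'" and z: "z \<in> Q"
  shows "mult_trace b z = mult_trace b' z"
proof -
  have bQ: "b i \<in> Q" "b' i \<in> Q" if "i < N" for i using b b' that by (auto simp: is_basis_def)
  have "mult_trace b z = (\<Sum>i<N. \<Sum>j<N. coord b' (z * b i) j * coord b (b' j) i)"
    unfolding mult_trace_def
  proof (rule sum.cong)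
    fix i assume i: "i \<in> {..<N}"
    have "coord b (\<Sum>j<N. coord b' (z * b i) j * b' j) i = (\<Sum>j<N. coord b' (z * b i) j * coord b (b' j) i)"
      using i by (intro coord_sum b coord_in_Kx b' Q_mult z bQ) auto
    then show "coord b (z * b i) i = (\<Sum>j<N. coord b' (z * b i) j * coord b (b' j) i)"
      using coord_expansion[OF b' Q_mult[OF z bQ(1)], of i] i by simp
  qed simp
  also have "\<dots> = (\<Sum>j<N. \<Sum>i<N. coord b (b' j) i * coord b' (z * b i) j)"
    by (subst sum.swap) (simp add: mult.commute)
  also have "\<dots> = (\<Sum>j<N. coord b' (z * b' j) j)"
  proof (rule sum.cong)
    fix j assume j: "j \<in> {..<N}"
    have "(\<Sum>i<N. coord b (b' j) i * coord b' (z * b i) j) = coord b' (\<Sum>i<N. coord b (b' j) i * (z * b i)) j"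
      using j by (intro coord_sum[symmetric] b coord_in_Kx b' Q_mult z bQ) auto
    also have "(\<Sum>i<N. coord b (b' j) i * (z * b i)) = z * (\<Sum>i<N. coord b (b' j) i * b i)"
      by (simp add: sum_distrib_left mult_ac)
    also have "\<dots> = z * b' j" using coord_expansion[OF b bQ(2)] j by simp
    finally show "(\<Sum>i<N. coord b (b' j) i * coord b' (z * b i) j) = coord b' (z * b' j) j" .
  qed simp
  finally show ?thesis by (simp add: mult_trace_def)
qed


subsection \<open>Euler's dual basis\<close>

definition lam :: "'l \<Rightarrow> 'l" where "lam z = coord (\<lambda>i. y ^ i) z (N - 1)"

text \<open>The coefficients of \<open>F(Y)/(Y - y)\<close>.\<close>

definition bd :: "nat \<Rightarrow> 'l" where
  "bd i = (\<Sum>l\<in>{i<..N}. \<kappa> (f l) * y ^ (l - 1 - i))"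

lemma bd_in_A: "bd i \<in> A"
  unfolding bd_def by (intro subspace_sum subspace_scale subspace_A y_pow_in_A)

lemma bd_in_Q: "bd i \<in> Q"
  using bd_in_A A_subset_Q by auto

lemma lam_sum:
  assumes "\<And>j. j \<in> J \<Longrightarrow> c j \<in> Kx" "\<And>j. j \<in> J \<Longrightarrow> z j \<in> Q"
  shows "lam (\<Sum>j\<in>J. c j * z j) = (\<Sum>j\<in>J. c j * lam (z j))"
  unfolding lam_def by (rule coord_sum[OF is_basis_powers]) (use N_pos assms in auto)

lemma lam_y_pow: "i < N \<Longrightarrow> lam (y ^ i) = (if i = N - 1 then 1 else 0)"
  unfolding lam_def using coord_base[OF is_basis_powers, of "N - 1" i] N_pos by auto

text \<open>For j \<le> i all exponents in bd i * y^j are at most N - 1, and N - 1 is reached only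
  by l = N when i = j. For j > i the equation of y replaces the upper part of F by minus its lower
  part, which leaves exponents at most j - 1 < N - 1.\<close>

lemma lam_bd_y_pow:
  assumes "i < N" "j < N"
  shows "lam (bd i * y ^ j) = (if i = j then 1 else 0)"
proof (cases "j \<le> i")
  case True
  have "bd i * y ^ j = (\<Sum>l\<in>{i<..N}. \<kappa> (f l) * y ^ (l - 1 - i + j))"
    unfolding bd_def sum_distrib_right by (rule sum.cong) (auto simp: mult.assoc simp flip: power_add)
  also have "lam \<dots> = (\<Sum>l\<in>{i<..N}. \<kappa> (f l) * lam (y ^ (l - 1 - i + j)))"
    using y_pow_in_A A_subset_Q by (intro lam_sum \<kappa>_in_Kx) auto
  also have "\<dots> = (\<Sum>l\<in>{i<..N}. if l = N then (if i = j then 1 else 0) else 0)"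
    using True assms by (intro sum.cong) (auto simp: lam_y_pow f_N \<kappa>_1 split: if_splits)
  finally show ?thesis using assms by simp
next
  case False
  have split: "{..N} = {..i} \<union> {i<..N}" using assms by auto
  have "(\<Sum>l\<le>N. \<kappa> (f l) * y ^ l) = (\<Sum>l\<le>i. \<kappa> (f l) * y ^ l) + (\<Sum>l\<in>{i<..N}. \<kappa> (f l) * y ^ l)"
    unfolding split by (rule sum.union_disjoint) auto
  with root have eq: "(\<Sum>l\<in>{i<..N}. \<kappa> (f l) * y ^ l) = - (\<Sum>l\<le>i. \<kappa> (f l) * y ^ l)"
    by (simp add: eq_neg_iff_add_eq_0 add.commute)
  have "bd i * y ^ j = (\<Sum>l\<in>{i<..N}. \<kappa> (f l) * (y ^ (l - 1 - i) * y ^ j))"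
    by (simp add: bd_def sum_distrib_right mult.assoc)
  also have "\<dots> = (\<Sum>l\<in>{i<..N}. \<kappa> (f l) * (y ^ l * y ^ (j - 1 - i)))"
    using False by (intro sum.cong) (auto simp flip: power_add intro!: arg_cong[of _ _ "\<lambda>n. y ^ n"])
  also have "\<dots> = y ^ (j - 1 - i) * (\<Sum>l\<in>{i<..N}. \<kappa> (f l) * y ^ l)"
    by (simp add: sum_distrib_left mult_ac)
  also have "\<dots> = (\<Sum>l\<le>i. \<kappa> (- f l) * y ^ (l + (j - 1 - i)))"
    unfolding eq by (simp add: sum_distrib_left power_add \<kappa>_minus sum_negf mult_ac)
  also have "lam \<dots> = (\<Sum>l\<le>i. \<kappa> (- f l) * lam (y ^ (l + (j - 1 - i))))"
    using y_pow_in_A A_subset_Q by (intro lam_sum \<kappa>_in_Kx) auto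
  also have "\<dots> = 0" using False assms by (intro sum.neutral) (auto simp: lam_y_pow)
  finally show ?thesis using False by simp
qed

lemma coord_powers_eq_lam:
  assumes "z \<in> Q" "i < N"
  shows "coord (\<lambda>i. y ^ i) z i = lam (bd i * z)"
proof -
  define k where "k = coord (\<lambda>i. y ^ i) z"
  have k: "j < N \<Longrightarrow> k j \<in> Kx" "(\<Sum>j<N. k j * y ^ j) = z" for j
    unfolding k_def by (auto intro: coord_in_Kx coord_expansion is_basis_powers assms(1))
  have "bd i * z = (\<Sum>j<N. k j * (bd i * y ^ j))"
    unfolding k(2)[symmetric] by (simp add: sum_distrib_left mult_ac)
  then have "lam (bd i * z) = lam (\<Sum>j<N. k j * (bd i * y ^ j))" by (rule arg_cong)
  also have "\<dots> = (\<Sum>j<N. k j * lam (bd i * y ^ j))"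
    using y_pow_in_A A_subset_Q k(1) by (intro lam_sum Q_mult bd_in_Q) auto
  also have "\<dots> = (\<Sum>j<N. if i = j then k j else 0)"
    using assms by (intro sum.cong) (auto simp: lam_bd_y_pow)
  finally show ?thesis using assms(2) by (simp add: k_def)
qed

text \<open>By \<open>coord_powers_eq_lam\<close> the values of \<open>lam\<close> are the
  coordinates in the powers of y. In this form membership in A becomes a test by the elements
  \<open>bd i\<close>, which lie in A themselves.\<close>

lemma in_A_iff: "z \<in> Q \<Longrightarrow> z \<in> A \<longleftrightarrow> (\<forall>i<N. lam (bd i * z) \<in> range \<kappa>)"
  unfolding A_def using in_fam_span_iff[OF is_basis_powers] coord_powers_eq_lam by auto

text \<open>The term with coefficient f l and power y^(l - 1) occurs once for every i < l, which
  produces the factor l of the derivative.\<close>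

lemma sum_bd_y_pow: "(\<Sum>i<N. bd i * y ^ i) = Fy"
proof -
  have "(\<Sum>i<N. bd i * y ^ i) = (\<Sum>i<N. \<Sum>l\<in>{i<..N}. \<kappa> (f l) * y ^ (l - 1))"
    unfolding bd_def sum_distrib_right
  proof (intro sum.cong refl)
    fix i l assume "l \<in> {i<..N}"
    then have "y ^ (l - 1) = y ^ (l - 1 - i) * y ^ i" by (auto simp flip: power_add)
    then show "\<kappa> (f l) * y ^ (l - 1 - i) * y ^ i = \<kappa> (f l) * y ^ (l - 1)" by simp
  qed
  also have "\<dots> = (\<Sum>i<N. \<Sum>l\<le>N. if i < l then \<kappa> (f l) * y ^ (l - 1) else 0)"
    by (intro sum.cong refl sum.mono_neutral_cong_left) auto
  also have "\<dots> = (\<Sum>l\<le>N. \<Sum>i<N. if i < l then \<kappa> (f l) * y ^ (l - 1) else 0)" by (rule sum.swap)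
  also have "\<dots> = (\<Sum>l\<le>N. \<Sum>i<l. \<kappa> (f l) * y ^ (l - 1))"
    by (intro sum.cong refl sum.mono_neutral_cong_right) auto
  finally show ?thesis by (simp add: Fy_def mult.assoc)
qed

lemma Fy_in_A: "Fy \<in> A"
  unfolding sum_bd_y_pow[symmetric] by (intro subspace_sum subspace_A A_mult bd_in_A y_pow_in_A)

lemma Fy_in_Q: "Fy \<in> Q"
  using Fy_in_A A_subset_Q by auto

text \<open>The i-th diagonal entry of multiplication by z in the basis of powers is lam (bd i * z *
  y^i); summing inside \<open>lam\<close> leaves Fy * z.\<close>

lemma lam_Fy:
  assumes "z \<in> Q"
  shows "lam (Fy * z) = mult_trace (\<lambda>i. y ^ i) z"
proof -
  have yQ: "y ^ i \<in> Q" for i using y_pow_in_A A_subset_Q by auto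
  have "mult_trace (\<lambda>i. y ^ i) z = (\<Sum>i<N. 1 * lam (bd i * (z * y ^ i)))"
    unfolding mult_trace_def using assms by (simp add: coord_powers_eq_lam Q_mult yQ)
  also have "\<dots> = lam (\<Sum>i<N. 1 * (bd i * (z * y ^ i)))"
    using \<kappa>_in_Kx[of 1] by (intro lam_sum[symmetric] Q_mult bd_in_Q assms yQ) (simp add: \<kappa>_1)
  finally have *: "mult_trace (\<lambda>i. y ^ i) z = lam (\<Sum>i<N. 1 * (bd i * (z * y ^ i)))" .
  have "(\<Sum>i<N. 1 * (bd i * (z * y ^ i))) = (\<Sum>i<N. bd i * y ^ i) * z"
    unfolding sum_distrib_right by (rule sum.cong) (auto simp: mult_ac)
  with * show ?thesis by (simp only: sum_bd_y_pow)
qed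

end


subsection \<open>Orders and the integral closure\<close>

context plane_curve
begin

definition fin_gen :: "'l set \<Rightarrow> bool" where
  "fin_gen M \<longleftrightarrow> (\<exists>G. finite G \<and> M \<subseteq> span G)"

lemma fin_genE:
  assumes "fin_gen M" obtains n g where "M \<subseteq> fam_span n g"
proof -
  obtain G where G: "finite G" "M \<subseteq> span G" using assms unfolding fin_gen_def by blast
  obtain n :: nat and g where g: "G = g ` {..<n}"
    using G(1) by (metis finite_imp_nat_seg_image_inj_on lessThan_def)
  have "span G \<subseteq> fam_span n g"
    by (rule span_minimal[OF _ subspace_fam_span]) (auto simp: g fam_span_base)
  with G(2) that show ?thesis by blast
qed

lemma fin_gen_fam_span: "fin_gen (fam_span n g)"
proof -
  have "fam_span n g \<subseteq> span (g ` {..<n})"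
    by (intro fam_span_subset subspace_span span_base) auto
  then show ?thesis unfolding fin_gen_def by blast
qed

lemma fin_gen_subset: "fin_gen M \<Longrightarrow> M' \<subseteq> M \<Longrightarrow> fin_gen M'"
  unfolding fin_gen_def by blast

text \<open>Multiplication by a embeds M' into M, so generators of a module containing M, divided by
  a, do for M'. Applied to Abar with a = Fy, and to endomorphism rings of ideals.\<close>

lemma fin_gen_scale_back:
  assumes "fin_gen M" "a \<noteq> 0" "\<And>z. z \<in> M' \<Longrightarrow> a * z \<in> M"
  shows "fin_gen M'"
proof -
  obtain n g where M: "M \<subseteq> fam_span n g" using assms(1) by (rule fin_genE)
  have "M' \<subseteq> fam_span n (\<lambda>i. g i / a)"
  proof
    fix z assume "z \<in> M'"
    with assms(3) M obtain c where c: "a * z = lincomb n c g" unfolding fam_span_def by blast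
    have "lincomb n c (\<lambda>i. g i / a) = lincomb n c g / a"
      by (simp add: lincomb_def sum_divide_distrib)
    also have "\<dots> = z" using assms(2) by (simp flip: c)
    finally show "z \<in> fam_span n (\<lambda>i. g i / a)" unfolding fam_span_def by (metis rangeI)
  qed
  with fin_gen_subset[OF fin_gen_fam_span] show ?thesis by blast
qed

text \<open>Negatives, the unit and the action of k[x] are not listed: they come with the elements
  of A.\<close>

definition is_order :: "'l set \<Rightarrow> bool" where
  "is_order R \<longleftrightarrow> A \<subseteq> R \<and> R \<subseteq> Q \<and> (\<forall>a\<in>R. \<forall>b\<in>R. a + b \<in> R \<and> a * b \<in> R) \<and> fin_gen R"

lemma orderD:
  assumes "is_order R"
  shows "A \<subseteq> R" "R \<subseteq> Q" "a \<in> R \<Longrightarrow> b \<in> R \<Longrightarrow> a + b \<in> R" "a \<in> R \<Longrightarrow> b \<in> R \<Longrightarrow> a * b \<in> R"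
    "fin_gen R" "0 \<in> R" "1 \<in> R" "\<kappa> p \<in> R"
  using assms one_in_A \<kappa>_in_A[of p] \<kappa>_in_A[of 0] unfolding is_order_def by auto

lemma order_subspace: "is_order R \<Longrightarrow> subspace R"
  by (rule subspaceI) (auto intro: orderD)

lemma order_minus: "is_order R \<Longrightarrow> a \<in> R \<Longrightarrow> - a \<in> R"
  by (rule subspace_neg[OF order_subspace])

lemma order_diff: "is_order R \<Longrightarrow> a \<in> R \<Longrightarrow> b \<in> R \<Longrightarrow> a - b \<in> R"
  by (rule subspace_diff[OF order_subspace])

lemma order_sum: "is_order R \<Longrightarrow> (\<And>i. i \<in> I \<Longrightarrow> h i \<in> R) \<Longrightarrow> sum h I \<in> R"
  by (rule subspace_sum[OF order_subspace])

lemma order_power: "is_order R \<Longrightarrow> a \<in> R \<Longrightarrow> a ^ n \<in> R"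
  by (induction n) (auto intro: orderD)

lemma order_A: "is_order A"
  unfolding is_order_def using A_subset_Q A_mult subspace_add[OF subspace_A]
  by (auto simp: A_def fin_gen_fam_span)

text \<open>A common denominator p of the generators moves R into A, where the submodule theorem
  yields at most N independent generators; they are divided by p again. Their number is exactly N
  because R contains the independent powers of y.\<close>

lemma order_basis:
  assumes R: "is_order R"
  obtains h where "is_basis h" "R = fam_span N h"
proof -
  obtain n0 g0 where "R \<subseteq> fam_span n0 g0" using orderD(5)[OF R] by (rule fin_genE)
  then obtain n g where g: "R = fam_span n g" using submodule_fin_gen[OF order_subspace[OF R]] by metis
  have "g i \<in> Q" if "i \<in> {..<n}" for i using fam_span_base[of i n g] orderD(2)[OF R] g that by auto
  then obtain p where p: "p \<noteq> 0" "\<And>i. i \<in> {..<n} \<Longrightarrow> \<kappa> p * g i \<in> A"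
    using common_denominator[of "{..<n}" g] by blast
  have "fam_span n (\<lambda>i. \<kappa> p * g i) \<subseteq> fam_span N (\<lambda>i. y ^ i)"
    using p(2) by (intro fam_span_subset subspace_fam_span) (auto simp: A_def)
  from submodule_fin_gen[OF subspace_fam_span this] fam_indep_powers
  obtain m h' where h': "m \<le> N" "fam_span n (\<lambda>i. \<kappa> p * g i) = fam_span m h'" "fam_indep m h'" by metis
  define h where "h = (\<lambda>i. h' i / \<kappa> p)"
  have sc: "lincomb k c (\<lambda>i. \<kappa> p * x i) = \<kappa> p * lincomb k c x" for k c x
    unfolding lincomb_def sum_distrib_left by (rule sum.cong) (auto simp: mult_ac)
  have hh': "h' = (\<lambda>i. \<kappa> p * h i)" using p(1) by (simp add: h_def)
  have R_eq: "R = fam_span m h"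
  proof -
    have "z \<in> fam_span n g \<longleftrightarrow> z \<in> fam_span m h" for z
    proof -
      have "z \<in> fam_span n g \<longleftrightarrow> \<kappa> p * z \<in> fam_span n (\<lambda>i. \<kappa> p * g i)"
        using p(1) by (auto simp: fam_span_def sc)
      also have "\<dots> \<longleftrightarrow> z \<in> fam_span m h"
        unfolding h'(2) unfolding hh' using p(1) by (auto simp: fam_span_def sc)
      finally show ?thesis .
    qed
    then show ?thesis using g by auto
  qed
  have ind: "fam_indep m h" unfolding fam_indep_def
  proof (intro allI impI)
    fix c i assume "lincomb m c h = 0" "i < m"
    moreover from this have "lincomb m c h' = 0" unfolding hh' by (simp add: sc)
    ultimately show "c i = 0" using fam_indepD[OF h'(3)] by blast
  qed
  have "N \<le> m"
    by (rule indep_in_span_le[OF fam_indep_powers, of m h]) (use R_eq y_pow_in_A orderD(1)[OF R] in auto)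
  with h'(1) have "m = N" by simp
  moreover have "h i \<in> Q" if "i < m" for i using fam_span_base[OF that, of h] R_eq orderD(2)[OF R] by auto
  ultimately show ?thesis using that[of h] ind R_eq by (auto simp: is_basis_def)
qed

lemma range_\<kappa>_sum: "(\<And>i. i \<in> I \<Longrightarrow> h i \<in> range \<kappa>) \<Longrightarrow> sum h I \<in> range \<kappa>"
proof (induction I rule: infinite_finite_induct)
  case (insert j I)
  then obtain p q where "h j = \<kappa> p" "sum h I = \<kappa> q" by blast
  with insert.hyps have "sum h (insert j I) = \<kappa> (p + q)" by (simp add: \<kappa>_add)
  then show ?case by blast
qed (auto intro: range_eqI[of _ _ 0])

text \<open>The trace may be computed in a k[x]-basis of R, and there multiplication by z has all
  its entries in k[x].\<close>

lemma lam_Fy_order: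
  assumes R: "is_order R" and z: "z \<in> R"
  shows "lam (Fy * z) \<in> range \<kappa>"
proof -
  obtain h where h: "is_basis h" "R = fam_span N h" using order_basis[OF R] .
  have zQ: "z \<in> Q" using z orderD(2)[OF R] by auto
  have "lam (Fy * z) = mult_trace h z"
    using lam_Fy[OF zQ] mult_trace_basis_indep[OF is_basis_powers h(1) zQ] by simp
  also have "\<dots> \<in> range \<kappa>"
    unfolding mult_trace_def
  proof (rule range_\<kappa>_sum)
    fix i assume i: "i \<in> {..<N}"
    then have "z * h i \<in> R" using h(2) fam_span_base[of i N h] orderD(4)[OF R z] by auto
    then show "coord h (z * h i) i \<in> range \<kappa>"
      using in_fam_span_iff[OF h(1), of "z * h i"] h(2) orderD(2)[OF R] i by auto
  qed
  finally show ?thesis .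
qed

text \<open>The test elements \<open>bd i\<close> lie in A and hence in R, so each lam (bd i * Fy *
  z) is the trace of an element of R.\<close>

lemma Fy_mult_order:
  assumes R: "is_order R" and z: "z \<in> R"
  shows "Fy * z \<in> A"
proof -
  have zQ: "z \<in> Q" using z orderD(2)[OF R] by auto
  have "lam (bd i * (Fy * z)) \<in> range \<kappa>" for i
  proof -
    have "bd i * z \<in> R" using bd_in_A orderD(1,4)[OF R] z by blast
    from lam_Fy_order[OF R this] show ?thesis by (simp add: mult_ac)
  qed
  then show ?thesis using in_A_iff[OF Q_mult[OF Fy_in_Q zQ]] by blast
qed

text \<open>The new order consists of the polynomials in z of degree below n over R, where n is the
  degree of an integral equation. That equation makes the set stable under multiplication by z, and
  products of a k[x]-basis of R with powers of z generate it.\<close>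

lemma adjoin_integral:
  assumes R: "is_order R" and z: "z \<in> Q" and int: "integral_over R z"
  obtains R' where "is_order R'" "R \<subseteq> R'" "z \<in> R'"
proof -
  obtain n c where c: "\<And>i. i < n \<Longrightarrow> c i \<in> R" "z ^ n + (\<Sum>i<n. c i * z ^ i) = 0"
    using int unfolding integral_over_def by blast
  \<comment> \<open>For n = 0 the integral equation would read 1 = 0.\<close>
  have n: "n > 0" using c(2) by (cases n) auto
  define R' where "R' = {v. \<exists>r. (\<forall>i. r i \<in> R) \<and> v = (\<Sum>i<n. r i * z ^ i)}"
  have add: "v + w \<in> R'" if vw: "v \<in> R'" "w \<in> R'" for v w
  proof -
    obtain r s where "\<And>i. r i \<in> R" "\<And>i. s i \<in> R" "v = (\<Sum>i<n. r i * z ^ i)" "w = (\<Sum>i<n. s i * z ^ i)"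
      using vw unfolding R'_def by blast
    then show ?thesis unfolding R'_def
      by (intro CollectI exI[of _ "\<lambda>i. r i + s i"]) (auto simp: distrib_right sum.distrib intro: orderD[OF R])
  qed
  have smult: "a * v \<in> R'" if av: "a \<in> R" "v \<in> R'" for a v
  proof -
    obtain r where "\<And>i. r i \<in> R" "v = (\<Sum>i<n. r i * z ^ i)" using av unfolding R'_def by blast
    then show ?thesis unfolding R'_def
      by (intro CollectI exI[of _ "\<lambda>i. a * r i"]) (auto simp: sum_distrib_left mult_ac intro: orderD[OF R] av)
  qed
  have zmult: "z * v \<in> R'" if v: "v \<in> R'" for v
  proof -
    obtain r where r: "\<And>i. r i \<in> R" "v = (\<Sum>i<n. r i * z ^ i)" using v unfolding R'_def by blast
    obtain m where m: "n = Suc m" using n by (cases n) auto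
    \<comment> \<open>Multiplication by z shifts the coefficients up by one; the overflow r m * z^n
      is rewritten by the integral equation. The guard i < n is there because c i is known to lie in
      R only for such i.\<close>
    define s where "s = (\<lambda>i. (case i of 0 \<Rightarrow> 0 | Suc j \<Rightarrow> r j) + - (r m * (if i < n then c i else 0)))"
    have "z ^ n = - (\<Sum>i<n. c i * z ^ i)" using c(2) by (simp add: eq_neg_iff_add_eq_0)
    then have "r m * z ^ n = (\<Sum>i<n. - (r m * (if i < n then c i else 0)) * z ^ i)"
      by (simp add: sum_distrib_left sum_negf mult_ac)
    moreover have "z * v = (\<Sum>i<m. r i * z ^ Suc i) + r m * z ^ n"
      by (simp add: r(2) m distrib_left sum_distrib_left mult_ac)
    moreover have "(\<Sum>i<m. r i * z ^ Suc i) = (\<Sum>i<n. (case i of 0 \<Rightarrow> 0 | Suc j \<Rightarrow> r j) * z ^ i)"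
      unfolding m by (subst sum.lessThan_Suc_shift) simp
    ultimately have "z * v = (\<Sum>i<n. s i * z ^ i)"
      by (simp add: s_def distrib_right left_diff_distrib sum.distrib sum_subtractf sum_negf)
    moreover have "s i \<in> R" for i
      unfolding s_def using r(1) c(1)
      by (cases i) (auto intro!: orderD(3,4,6)[OF R] order_minus[OF R] order_diff[OF R])
    ultimately show ?thesis unfolding R'_def by blast
  qed
  have zpow: "z ^ k * v \<in> R'" if "v \<in> R'" for k v
    by (induction k) (use that zmult in \<open>auto simp: mult.assoc\<close>)
  have R_sub: "R \<subseteq> R'"
  proof
    fix a assume "a \<in> R"
    moreover have "(\<Sum>i<n. (if i = 0 then a else 0) * z ^ i) = (\<Sum>i<n. if i = 0 then a else 0)"
      by (rule sum.cong) auto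
    ultimately show "a \<in> R'" unfolding R'_def using n orderD(6)[OF R]
      by (intro CollectI exI[of _ "\<lambda>i. if i = 0 then a else 0"]) auto
  qed
  have zero: "0 \<in> R'" using R_sub orderD(6)[OF R] by auto
  have mult: "v * w \<in> R'" if vw: "v \<in> R'" "w \<in> R'" for v w
  proof -
    obtain r where r: "\<And>i. r i \<in> R" "v = (\<Sum>i<n. r i * z ^ i)" using vw unfolding R'_def by blast
    have sum: "sum h I \<in> R'" if "\<And>i. i \<in> I \<Longrightarrow> h i \<in> R'" for h and I :: "nat set"
      using that by (induction I rule: infinite_finite_induct) (auto intro: add zero)
    have "v * w = (\<Sum>i<n. r i * (z ^ i * w))" by (simp add: r(2) sum_distrib_right mult.assoc)
    also have "\<dots> \<in> R'" by (intro sum smult r zpow vw)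
    finally show ?thesis .
  qed
  obtain h where h: "R = fam_span N h" using order_basis[OF R] by metis
  have "R' \<subseteq> span ((\<lambda>(i, j). h i * z ^ j) ` ({..<N} \<times> {..<n}))" (is "_ \<subseteq> span ?G")
  proof
    fix v assume "v \<in> R'"
    then obtain r where r: "\<And>i. r i \<in> R" "v = (\<Sum>i<n. r i * z ^ i)" unfolding R'_def by blast
    have "r j * z ^ j \<in> span ?G" if j: "j < n" for j
    proof -
      obtain e where "r j = (\<Sum>i<N. \<kappa> (e i) * h i)"
        using r(1)[of j] h unfolding fam_span_def lincomb_def by auto
      then have "r j * z ^ j = (\<Sum>i<N. \<kappa> (e i) * (h i * z ^ j))"
        by (simp add: sum_distrib_right mult.assoc)
      also have "\<dots> \<in> span ?G"
        by (intro span_sum span_scale span_base) (use j in auto)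
      finally show ?thesis .
    qed
    then show "v \<in> span ?G" unfolding r(2) by (intro span_sum) auto
  qed
  then have fg: "fin_gen R'" unfolding fin_gen_def by (intro exI[of _ ?G]) auto
  have "R' \<subseteq> Q"
  proof
    fix v assume "v \<in> R'"
    then obtain r where r: "\<And>i. r i \<in> R" "v = (\<Sum>i<n. r i * z ^ i)" unfolding R'_def by blast
    have "z ^ i \<in> Q" for i by (induction i) (auto intro: Q_mult z)
    then show "v \<in> Q" unfolding r(2) using r(1) orderD(2)[OF R] by (auto intro!: Q_sum Q_mult)
  qed
  then have "is_order R'" unfolding is_order_def using R_sub orderD(1)[OF R] add mult fg by blast
  moreover have "z \<in> R'" using zmult[of 1] R_sub orderD(7)[OF R] by auto
  ultimately show ?thesis using that R_sub by blast
qed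

text \<open>The A-modules M k spanned by 1, z, ..., z^(k-1) form an increasing chain inside a
  finitely generated k[x]-module. Once M (k+1) = M k, the power z^k is an A-combination of lower
  ones, which is a monic equation.\<close>

lemma order_integral:
  assumes R: "is_order R" and z: "z \<in> R"
  shows "integral_over A z"
proof -
  obtain n g where ng: "R \<subseteq> fam_span n g" using orderD(5)[OF R] by (rule fin_genE)
  define M where "M = (\<lambda>k. {v. \<exists>a. (\<forall>i. a i \<in> A) \<and> v = (\<Sum>i<k. a i * z ^ i)})"
  have MI: "(\<Sum>i<k. a i * z ^ i) \<in> M k" if "\<And>i. a i \<in> A" for a k
    unfolding M_def using that by blast
  have ME: "\<exists>a. (\<forall>i. a i \<in> A) \<and> v = (\<Sum>i<k. a i * z ^ i)" if "v \<in> M k" for v k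
    using that unfolding M_def by blast
  have "subspace (M k)" for k
  proof (rule subspaceI)
    show "0 \<in> M k" using MI[of "\<lambda>_. 0" k] subspace_0[OF subspace_A] by simp
    fix v w assume "v \<in> M k" "w \<in> M k"
    with ME obtain a b where "\<forall>i. a i \<in> A" "\<forall>i. b i \<in> A" "v = (\<Sum>i<k. a i * z ^ i)" "w = (\<Sum>i<k. b i * z ^ i)"
      by meson
    then show "v + w \<in> M k" using MI[of "\<lambda>i. a i + b i" k] subspace_add[OF subspace_A]
      by (simp add: distrib_right sum.distrib)
  next
    fix p v assume "v \<in> M k"
    with ME obtain a where "\<forall>i. a i \<in> A" "v = (\<Sum>i<k. a i * z ^ i)" by meson
    then show "\<kappa> p * v \<in> M k" using MI[of "\<lambda>i. \<kappa> p * a i" k] subspace_scale[OF subspace_A]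
      by (simp add: sum_distrib_left mult.assoc)
  qed
  moreover have "M k \<subseteq> fam_span n g" for k
  proof
    fix v assume "v \<in> M k"
    with ME obtain a where a: "\<forall>i. a i \<in> A" "v = (\<Sum>i<k. a i * z ^ i)" by meson
    have "a i \<in> R" for i using a(1) orderD(1)[OF R] by blast
    then have "v \<in> R" unfolding a(2)
      by (intro order_sum[OF R] orderD(4)[OF R] order_power[OF R] z)
    with ng show "v \<in> fam_span n g" by blast
  qed
  moreover have "M k \<subseteq> M (Suc k)" for k
  proof
    fix v assume "v \<in> M k"
    with ME obtain a where a: "\<forall>i. a i \<in> A" "v = (\<Sum>i<k. a i * z ^ i)" by meson
    have "(\<Sum>i<k. a i * z ^ i) = (\<Sum>i<k. (if i < k then a i else 0) * z ^ i)"
      by (rule sum.cong) auto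
    then show "v \<in> M (Suc k)"
      using MI[of "\<lambda>i. if i < k then a i else 0" "Suc k"] a subspace_0[OF subspace_A] by simp
  qed
  ultimately obtain k where k: "\<And>i. k \<le> i \<Longrightarrow> M i = M k" by (rule submodule_chain_stabilizes) blast+
  have "(\<Sum>i<k. (if i = k then 1 else 0) * z ^ i) = 0" by (rule sum.neutral) auto
  then have e1: "z ^ k = (\<Sum>i<Suc k. (if i = k then 1 else 0) * z ^ i)" by simp
  have e2: "(if i = k then 1 else 0) \<in> A" for i using subspace_0[OF subspace_A] one_in_A by auto
  have "z ^ k \<in> M (Suc k)" by (subst e1) (rule MI[OF e2])
  with k[of "Suc k"] have "z ^ k \<in> M k" by simp
  with ME obtain a where a: "\<forall>i. a i \<in> A" "z ^ k = (\<Sum>i<k. a i * z ^ i)" by meson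
  have "\<forall>i<k. - a i \<in> A" using a(1) subspace_neg[OF subspace_A] by blast
  moreover have "z ^ k + (\<Sum>i<k. - a i * z ^ i) = 0" unfolding a(2) by (simp add: sum_negf)
  ultimately show ?thesis unfolding integral_over_def
    by (intro exI[of _ k] exI[of _ "\<lambda>i. - a i"]) blast
qed

lemma integral_over_mono: "integral_over B z \<Longrightarrow> B \<subseteq> C \<Longrightarrow> integral_over C z"
  unfolding integral_over_def by blast

definition Abar :: "'l set" where "Abar = {z \<in> Q. integral_over A z}"

lemma order_subset_Abar: "is_order R \<Longrightarrow> R \<subseteq> Abar"
  unfolding Abar_def using order_integral orderD(2) by blast

lemma Abar_in_order:
  assumes "z \<in> Abar" obtains R where "is_order R" "z \<in> R"
  using assms adjoin_integral[OF order_A, of z] unfolding Abar_def by blast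

lemma integral_over_order:
  assumes "is_order R" "z \<in> Q" "integral_over R z" shows "z \<in> Abar"
  using adjoin_integral[OF assms] order_subset_Abar by blast

lemma Fy_mult_Abar: "z \<in> Abar \<Longrightarrow> Fy * z \<in> A"
  by (metis Abar_in_order Fy_mult_order)

end

locale separable_curve = plane_curve \<kappa> f N y
  for \<kappa> :: "'a::field poly \<Rightarrow> 'l::field" and f N y +
  assumes Fy_nonzero: "Fy \<noteq> 0"
begin

text \<open>Any two elements lie in a common order obtained by two adjunctions, which gives closure
  under sum and product. Finite generation comes from Fy * Abar \<subseteq> A and Fy \<noteq>
  0.\<close>

lemma order_Abar: "is_order Abar"
  unfolding is_order_def
proof (intro conjI ballI)
  show "A \<subseteq> Abar" by (rule order_subset_Abar[OF order_A])
  show "Abar \<subseteq> Q" unfolding Abar_def by blast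
  show "fin_gen Abar"
    by (rule fin_gen_scale_back[OF _ Fy_nonzero Fy_mult_Abar]) (use order_A orderD(5) in auto)
  fix z w assume zw: "z \<in> Abar" "w \<in> Abar"
  obtain R1 where R1: "is_order R1" "z \<in> R1" using zw(1) by (rule Abar_in_order)
  have "w \<in> Q" "integral_over R1 w"
    using zw(2) integral_over_mono[OF _ orderD(1)[OF R1(1)]] unfolding Abar_def by auto
  then obtain R2 where R2: "is_order R2" "R1 \<subseteq> R2" "w \<in> R2" by (rule adjoin_integral[OF R1(1)])
  then have "z + w \<in> R2" "z * w \<in> R2" using R1(2) by (auto intro: orderD(3,4)[OF R2(1)])
  with order_subset_Abar[OF R2(1)] show "z + w \<in> Abar" "z * w \<in> Abar" by auto
qed

lemma no_infinite_order_chain: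
  assumes "\<And>i::nat. is_order (R i)" "\<And>i. R i \<subset> R (Suc i)"
  shows False
proof -
  obtain n g where ng: "Abar \<subseteq> fam_span n g" using orderD(5)[OF order_Abar] by (rule fin_genE)
  obtain k where "\<And>i. k \<le> i \<Longrightarrow> R i = R k"
  proof (rule submodule_chain_stabilizes[of R n g])
    show "subspace (R i)" for i by (rule order_subspace[OF assms(1)])
    show "R i \<subseteq> fam_span n g" for i using order_subset_Abar[OF assms(1)] ng by blast
    show "R i \<subseteq> R (Suc i)" for i using assms(2) by blast
  qed blast
  from this[of "Suc k"] assms(2)[of k] show False by auto
qed


subsection \<open>The Grauert--Remmert criterion\<close>

text \<open>This definition and the following ones restate, for subrings of the field, the notions
  \<open>localization\<close>, \<open>primeideal\<close>, \<open>ideal\<close> and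
  \<open>test_colon\<close> for abstract rings; the locale \<open>embedded_order\<close> matches the
  two sides.\<close>

definition loc :: "'l set \<Rightarrow> 'l set \<Rightarrow> 'l set" where
  "loc R P = {r / s | r s. r \<in> R \<and> s \<in> R \<and> s \<notin> P}"

definition prime_in :: "'l set \<Rightarrow> 'l set \<Rightarrow> bool" where
  "prime_in R P \<longleftrightarrow> P \<subseteq> R \<and> 1 \<notin> P \<and> 0 \<in> P \<and> (\<forall>a\<in>P. \<forall>b\<in>P. a + b \<in> P) \<and> (\<forall>a\<in>P. \<forall>b\<in>R. b * a \<in> P)
     \<and> (\<forall>a\<in>R. \<forall>b\<in>R. a * b \<in> P \<longrightarrow> a \<in> P \<or> b \<in> P)"

definition not_normal_at :: "'l set \<Rightarrow> 'l set \<Rightarrow> bool" where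
  "not_normal_at R P \<longleftrightarrow> (\<exists>z\<in>Q. integral_over (loc R P) z \<and> z \<notin> loc R P)"

definition ideal_in :: "'l set \<Rightarrow> 'l set \<Rightarrow> bool" where
  "ideal_in R J \<longleftrightarrow> J \<subseteq> R \<and> 0 \<in> J \<and> (\<forall>a\<in>J. \<forall>b\<in>J. a + b \<in> J) \<and> (\<forall>a\<in>J. \<forall>b\<in>R. b * a \<in> J)"

lemma ideal_inD:
  assumes "ideal_in R J"
  shows "J \<subseteq> R" "0 \<in> J" "a \<in> J \<Longrightarrow> b \<in> J \<Longrightarrow> a + b \<in> J" "a \<in> J \<Longrightarrow> b \<in> R \<Longrightarrow> b * a \<in> J"
  using assms unfolding ideal_in_def by auto

lemma ideal_in_sum: "ideal_in R J \<Longrightarrow> (\<And>i. i \<in> I \<Longrightarrow> h i \<in> J) \<Longrightarrow> sum h I \<in> J"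
  by (induction I rule: infinite_finite_induct) (auto intro: ideal_inD)

definition colon :: "'l set \<Rightarrow> 'l set \<Rightarrow> 'l \<Rightarrow> 'l set" where
  "colon R J a = {b \<in> R. \<forall>c\<in>J. \<exists>c'\<in>J. b * c = a * c'}"

text \<open>Instead of passing through the radical of the conductor of \<open>R\<close>, choose \<open>z \<in> Abar - R\<close> with
  \<open>R : z\<close> maximal; this ideal is prime and lies in the non-normal locus, hence contains \<open>J\<close>.\<close>

theorem grauert_remmert:
  assumes R: "is_order R" and J: "ideal_in R J"
    and rad: "\<And>x n. x \<in> R \<Longrightarrow> x ^ n \<in> J \<Longrightarrow> x \<in> J"
    and nnl: "\<And>P. prime_in R P \<Longrightarrow> not_normal_at R P \<Longrightarrow> J \<subseteq> P"
    and a: "a \<in> J" "a \<noteq> 0"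
    and stop: "colon R J a \<subseteq> (\<lambda>r. r * a) ` R"
  shows "R = Abar"
proof (rule ccontr)
  assume "R \<noteq> Abar"
  then obtain z0 where z0: "z0 \<in> Abar - R" using order_subset_Abar[OF R] by blast
  \<comment> \<open>\<open>quo z\<close> is the ideal R : z. It is a k[x]-submodule of the finitely
    generated module R, so a maximal ideal of this kind exists.\<close>
  define quo where "quo = (\<lambda>z. {r \<in> R. r * z \<in> R})"
  obtain n g where ng: "R \<subseteq> fam_span n g" using orderD(5)[OF R] by (rule fin_genE)
  have sub: "subspace (quo z)" for z
    unfolding quo_def
    by (rule subspaceI) (auto simp: distrib_right mult.assoc intro: orderD[OF R])
  obtain P where P: "P \<in> quo ` (Abar - R)" "\<And>P'. P' \<in> quo ` (Abar - R) \<Longrightarrow> P \<subseteq> P' \<Longrightarrow> P' = P"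
  proof (rule maximal_submodule[of "quo z0" "quo ` (Abar - R)" n g])
    show "quo z0 \<in> quo ` (Abar - R)" using z0 by blast
    show "subspace M \<and> M \<subseteq> fam_span n g" if "M \<in> quo ` (Abar - R)" for M
      using that sub ng unfolding quo_def by blast
  qed blast
  then obtain z where z: "z \<in> Abar" "z \<notin> R" "P = quo z" by blast
  have prime: "prime_in R P"
    unfolding prime_in_def
  proof (intro conjI ballI impI)
    show "P \<subseteq> R" "1 \<notin> P" "0 \<in> P" using z(2) orderD(6)[OF R] by (auto simp: z(3) quo_def)
    show "v + w \<in> P" if "v \<in> P" "w \<in> P" for v w using subspace_add[OF sub] that by (simp add: z(3))
    show "w * v \<in> P" if "v \<in> P" "w \<in> R" for v w
      using that by (auto simp: z(3) quo_def mult.assoc intro: orderD(4)[OF R])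
    fix b c assume bc: "b \<in> R" "c \<in> R" "b * c \<in> P"
    \<comment> \<open>If c is outside P = R : z, then c * z is still outside R, and R : z is
      contained in R : (c * z); by maximality they agree, and b lies in the latter.\<close>
    show "b \<in> P \<or> c \<in> P"
    proof (rule disjCI)
      assume "c \<notin> P"
      then have "c * z \<notin> R" using bc by (auto simp: z(3) quo_def)
      moreover have "c * z \<in> Abar" using bc(2) z(1) order_subset_Abar[OF R] by (auto intro: orderD(4)[OF order_Abar])
      ultimately have "quo (c * z) \<in> quo ` (Abar - R)" by blast
      moreover have "P \<subseteq> quo (c * z)"
        using bc(2) by (auto simp: z(3) quo_def mult.left_commute[of _ c] intro: orderD(4)[OF R])
      ultimately have "quo (c * z) = P" by (rule P(2))
      moreover have "b \<in> quo (c * z)" using bc by (auto simp: z(3) quo_def mult.assoc)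
      ultimately show "b \<in> P" by blast
    qed
  qed
  have "not_normal_at R P"
    unfolding not_normal_at_def
  proof (intro bexI conjI)
    show "z \<in> Q" using z(1) unfolding Abar_def by blast
    have "A \<subseteq> loc R P"
    proof
      fix v assume "v \<in> A"
      moreover have "1 \<notin> P" using prime unfolding prime_in_def by blast
      moreover have "v = v / 1" by simp
      ultimately show "v \<in> loc R P" unfolding loc_def using orderD(1,7)[OF R] by blast
    qed
    then show "integral_over (loc R P) z" using z(1) integral_over_mono unfolding Abar_def by blast
    show "z \<notin> loc R P"
    proof
      assume "z \<in> loc R P"
      then obtain r s where rs: "r \<in> R" "s \<in> R" "s \<notin> P" "z = r / s" unfolding loc_def by blast
      have "s \<noteq> 0" using rs(3) prime unfolding prime_in_def by blast
      then show False using rs by (auto simp: z(3) quo_def)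
    qed
  qed
  with nnl prime have JP: "J \<subseteq> P" by blast
  \<comment> \<open>Since J \<subseteq> R : z, the element z * c lies in R. Multiplying an integral
    equation of z by c^n shows that (z * c)^n is an element of R times c, so it lies in J, and J is
    radical.\<close>
  have zJ: "z * c \<in> J" if c: "c \<in> J" for c
  proof -
    have zc: "z * c \<in> R" using c JP by (auto simp: z(3) quo_def mult.commute)
    obtain n e where e: "\<And>i. i < n \<Longrightarrow> e i \<in> A" "z ^ n + (\<Sum>i<n. e i * z ^ i) = 0"
      using z(1) unfolding Abar_def integral_over_def by blast
    have "z ^ n = - (\<Sum>i<n. e i * z ^ i)" using e(2) by (simp add: eq_neg_iff_add_eq_0)
    then have "(z * c) ^ n = - (\<Sum>i<n. e i * z ^ i) * c ^ n" by (simp only: power_mult_distrib)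
    also have "\<dots> = (\<Sum>i<n. (- e i * (z * c) ^ i * c ^ (n - i - 1)) * c)"
      unfolding sum_negf[symmetric] sum_distrib_right
    proof (rule sum.cong)
      fix i assume "i \<in> {..<n}"
      then have "c ^ n = c ^ i * c ^ (n - i - 1) * c" by (auto simp flip: power_add power_Suc2)
      then show "- (e i * z ^ i) * c ^ n = (- e i * (z * c) ^ i * c ^ (n - i - 1)) * c"
        by (simp add: power_mult_distrib mult_ac)
    qed simp
    also have "\<dots> \<in> J"
      using e(1) orderD(1)[OF R] ideal_inD(1)[OF J] c
      by (intro ideal_in_sum[OF J] ideal_inD(4)[OF J] c orderD(4)[OF R] order_power[OF R] zc order_minus[OF R]) auto
    finally show ?thesis by (rule rad[OF zc])
  qed
  \<comment> \<open>From z * J \<subseteq> J it follows that a * z lies in aJ : J; the stopping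
    condition then puts z into R, against its choice.\<close>
  have "a * z \<in> colon R J a"
    unfolding colon_def using zJ a(1) ideal_inD(1)[OF J] by (auto simp: mult.assoc mult.commute[of a z])
  with stop obtain r where "r \<in> R" "a * z = r * a" by blast
  with a(2) z(2) show False by (simp add: mult.commute)
qed

text \<open>Let z be integral over the localization at P. A product t of the denominators of the
  equation, still outside P, makes t * z integral over R, so Fy * t * z lies in A. If Fy were
  outside P, then z = (Fy * t * z) / (Fy * t) would lie in the localization.\<close>

lemma Fy_in_non_normal_prime:
  assumes R: "is_order R" and P: "prime_in R P" and nn: "not_normal_at R P"
  shows "Fy \<in> P"
proof (rule ccontr)
  assume Fy: "Fy \<notin> P"
  obtain z where z: "z \<in> Q" "integral_over (loc R P) z" "z \<notin> loc R P"
    using nn unfolding not_normal_at_def by blast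
  then obtain n c where c: "\<And>i. i < n \<Longrightarrow> c i \<in> loc R P" "z ^ n + (\<Sum>i<n. c i * z ^ i) = 0"
    unfolding integral_over_def by blast
  have "\<forall>i. \<exists>r s. i < n \<longrightarrow> r \<in> R \<and> s \<in> R \<and> s \<notin> P \<and> c i = r / s" using c(1) unfolding loc_def by blast
  then obtain r s where rs: "\<And>i. i < n \<Longrightarrow> r i \<in> R \<and> s i \<in> R \<and> s i \<notin> P \<and> c i = r i / s i" by metis
  define t where "t = (\<Prod>i<n. s i)"
  have notP: "prod s I \<notin> P \<and> prod s I \<in> R" if "finite I" "I \<subseteq> {..<n}" for I
    using that
  proof (induction I rule: finite_induct)
    case empty
    then show ?case using P orderD(7)[OF R] unfolding prime_in_def by auto
  next
    case (insert i I)
    then have "s i \<in> R" "s i \<notin> P" "prod s I \<notin> P" "prod s I \<in> R" using rs by auto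
    then show ?case using insert.hyps P orderD(4)[OF R] unfolding prime_in_def by auto
  qed
  then have t: "t \<notin> P" "t \<in> R" unfolding t_def by auto
  have tc: "t * c i \<in> R" if i: "i < n" for i
  proof -
    have "s i \<noteq> 0" using rs[OF i] P unfolding prime_in_def by auto
    moreover have "t = s i * prod s ({..<n} - {i})" unfolding t_def using i by (simp add: prod.remove)
    ultimately have "t * c i = r i * prod s ({..<n} - {i})" using rs[OF i] by simp
    then show ?thesis using rs[OF i] notP[of "{..<n} - {i}"] orderD(4)[OF R] by auto
  qed
  \<comment> \<open>The equation of z multiplied by t^n: the coefficient c i turns into c i * t^(n -
    i), and one factor t already clears its denominator.\<close>
  have "(t * z) ^ n + (\<Sum>i<n. (t * c i * t ^ (n - i - 1)) * (t * z) ^ i) = t ^ n * (z ^ n + (\<Sum>i<n. c i * z ^ i))"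
  proof -
    have "(t * c i * t ^ (n - i - 1)) * (t * z) ^ i = t ^ n * (c i * z ^ i)" if "i \<in> {..<n}" for i
    proof -
      have "t ^ n = t * t ^ (n - i - 1) * t ^ i" using that by (auto simp flip: power_add power_Suc)
      then show ?thesis by (simp add: power_mult_distrib mult_ac)
    qed
    then have "(\<Sum>i<n. (t * c i * t ^ (n - i - 1)) * (t * z) ^ i) = (\<Sum>i<n. t ^ n * (c i * z ^ i))"
      by (intro sum.cong) blast+
    then show ?thesis by (simp only: power_mult_distrib[of t z n] distrib_left sum_distrib_left)
  qed
  moreover have "t * c i * t ^ (n - i - 1) \<in> R" if "i < n" for i
    by (rule orderD(4)[OF R tc[OF that] order_power[OF R t(2)]])
  ultimately have "integral_over R (t * z)"
    unfolding integral_over_def using c(2)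
    by (intro exI[of _ n] exI[of _ "\<lambda>i. t * c i * t ^ (n - i - 1)"] conjI allI impI) simp_all
  moreover have "t * z \<in> Q" using t(2) orderD(2)[OF R] z(1) by (auto intro: Q_mult)
  ultimately have "Fy * (t * z) \<in> R"
    using Fy_mult_Abar[OF integral_over_order[OF R]] orderD(1)[OF R] by blast
  moreover have "Fy \<in> R" using Fy_in_A orderD(1)[OF R] by blast
  then have "Fy * t \<in> R" "Fy * t \<notin> P"
    using t Fy P by (auto simp: prime_in_def intro: orderD(4)[OF R])
  moreover from this have "Fy * t \<noteq> 0" using P unfolding prime_in_def by metis
  then have "z = Fy * (t * z) / (Fy * t)" by simp
  ultimately have "z \<in> loc R P" unfolding loc_def by blast
  with z(3) show False by blast
qed

text \<open>Dividing by a identifies aJ : J with the endomorphisms of J by multiplication in Q; the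
  choice of a drops out.\<close>

lemma colon_quotient:
  assumes R: "is_order R" and J: "ideal_in R J" and a: "a \<in> J" "a \<noteq> 0"
  shows "(\<lambda>b. b / a) ` colon R J a = {z \<in> Q. \<forall>c\<in>J. z * c \<in> J}"
proof (intro equalityI subsetI)
  fix z assume "z \<in> (\<lambda>b. b / a) ` colon R J a"
  then obtain b where b: "b \<in> R" "\<forall>c\<in>J. \<exists>c'\<in>J. b * c = a * c'" "z = b / a" unfolding colon_def by blast
  have "a \<in> Q" "b \<in> Q" using a(1) b(1) ideal_inD(1)[OF J] orderD(2)[OF R] by auto
  then have "z \<in> Q" unfolding b(3) by (intro Q_divide)
  moreover have "z * c \<in> J" if c: "c \<in> J" for c
  proof -
    obtain c' where c': "c' \<in> J" "b * c = a * c'" using b(2) c by blast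
    then have "z * c = c'" using a(2) by (simp add: b(3))
    with c' show ?thesis by simp
  qed
  ultimately show "z \<in> {z \<in> Q. \<forall>c\<in>J. z * c \<in> J}" by blast
next
  fix z assume z: "z \<in> {z \<in> Q. \<forall>c\<in>J. z * c \<in> J}"
  then have "z * a \<in> J" using a(1) by blast
  moreover have "z * a * c = a * (z * c)" for c by (simp add: mult_ac)
  ultimately have "z * a \<in> colon R J a"
    unfolding colon_def using z ideal_inD(1)[OF J] by blast
  then show "z \<in> (\<lambda>b. b / a) ` colon R J a" using a(2) by (intro image_eqI[of _ _ "z * a"]) auto
qed

text \<open>The endomorphisms of J visibly form a ring containing R. They are finitely generated
  because multiplication by a maps them into J \<subseteq> R.\<close>

lemma order_colon_quotient:
  assumes R: "is_order R" and J: "ideal_in R J" and a: "a \<in> J" "a \<noteq> 0"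
  shows "is_order ((\<lambda>b. b / a) ` colon R J a)" "R \<subseteq> (\<lambda>b. b / a) ` colon R J a"
proof -
  let ?E = "{z \<in> Q. \<forall>c\<in>J. z * c \<in> J}"
  have RE: "R \<subseteq> ?E" using orderD(2)[OF R] ideal_inD(4)[OF J] by blast
  then show "R \<subseteq> (\<lambda>b. b / a) ` colon R J a" unfolding colon_quotient[OF assms] .
  have "fin_gen ?E"
  proof (rule fin_gen_scale_back[OF orderD(5)[OF R] a(2)])
    fix z assume "z \<in> ?E"
    then have "z * a \<in> J" using a(1) by blast
    then show "a * z \<in> R" using ideal_inD(1)[OF J] by (auto simp: mult.commute)
  qed
  moreover have "z + w \<in> ?E" "z * w \<in> ?E" if "z \<in> ?E" "w \<in> ?E" for z w
    using that by (auto simp: distrib_right mult.assoc intro: Q_add Q_mult ideal_inD(3)[OF J])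
  ultimately show "is_order ((\<lambda>b. b / a) ` colon R J a)"
    unfolding colon_quotient[OF assms] is_order_def using RE orderD(1)[OF R] by blast
qed


subsection \<open>The conductor\<close>

lemma lam_in_range:
  assumes "z \<in> A" shows "lam z \<in> range \<kappa>"
  unfolding lam_def using in_fam_span_iff[OF is_basis_powers] assms A_subset_Q N_pos by (auto simp: A_def)

lemma lam_diff:
  assumes "z \<in> Q" "w \<in> Q" shows "lam (z - w) = lam z - lam w"
proof -
  have N: "N - 1 < N" using N_pos by simp
  have "lam (z + \<kappa> (-1) * w) = lam z + \<kappa> (-1) * lam w"
    unfolding lam_def coord_add[OF is_basis_powers assms(1) Q_mult[OF \<kappa>_in_Q assms(2)] N]
      coord_scale[OF is_basis_powers assms(2) \<kappa>_in_Kx N] ..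
  then show ?thesis by (simp add: \<kappa>_minus \<kappa>_1)
qed

lemma lam_span:
  assumes "\<And>j. j < N \<Longrightarrow> w j \<in> Q" "z \<in> Q" "v = (\<Sum>j<N. k j * w j)" "\<And>j. j < N \<Longrightarrow> k j \<in> Kx"
  shows "lam (z * v) = (\<Sum>j<N. k j * lam (z * w j))"
proof -
  have "z * v = (\<Sum>j<N. k j * (z * w j))" by (simp add: assms(3) sum_distrib_left mult_ac)
  moreover have "lam (\<Sum>j<N. k j * (z * w j)) = (\<Sum>j<N. k j * lam (z * w j))"
    using assms by (intro lam_sum Q_mult) auto
  ultimately show ?thesis by simp
qed

text \<open>An element orthogonal to a basis is orthogonal to all of Q, in particular to every
  \<open>bd i\<close>, and these pairings are its coordinates in the powers of y.\<close>

lemma lam_nondegenerate: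
  assumes "is_basis w" "z \<in> Q" "\<And>j. j < N \<Longrightarrow> lam (z * w j) = 0"
  shows "z = 0"
proof -
  have lam0: "lam (z * v) = 0" if v: "v \<in> Q" for v
  proof -
    have "lam (z * v) = (\<Sum>j<N. coord w v j * lam (z * w j))"
      using assms(1,2) v
      by (intro lam_span) (auto simp: is_basis_def coord_expansion[OF assms(1)] intro: coord_in_Kx[OF assms(1)])
    then show ?thesis using assms(3) by simp
  qed
  have "coord (\<lambda>i. y ^ i) z i = 0" if "i < N" for i
    using that bd_in_Q by (simp only: coord_powers_eq_lam[OF assms(2)] mult.commute[of "bd i" z] lam0)
  then show ?thesis using coord_expansion[OF is_basis_powers assms(2)] by simp
qed

text \<open>The dual basis of the powers under \<open>lam\<close> is \<open>bd\<close>; a change of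
  basis turns it into the dual \<open>d\<close> of w. Dividing by Fy passes from the pairing by
  \<open>lam\<close> to the trace pairing.\<close>

lemma dual_basis_exists:
  assumes w: "is_basis w"
  obtains w' where "\<And>i. i < N \<Longrightarrow> w' i \<in> Q"
    "\<And>i j. i < N \<Longrightarrow> j < N \<Longrightarrow> lam (Fy * w' i * w j) = (if i = j then 1 else 0)"
proof -
  \<comment> \<open>The coefficients are those of w i in the expansions of the powers y^j: dual
    bases transform by the transposed matrix.\<close>
  define d where "d = (\<lambda>i. \<Sum>j<N. coord w (y ^ j) i * bd j)"
  have yQ: "y ^ j \<in> Q" for j using y_pow_in_A A_subset_Q by auto
  have dQ: "d i \<in> Q" if "i < N" for i
    unfolding d_def using coord_in_Kx[OF w yQ that] Kx_subset_Q by (auto intro!: Q_sum Q_mult bd_in_Q)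
  show ?thesis
  proof (rule that[of "\<lambda>i. d i / Fy"])
    show "d i / Fy \<in> Q" if "i < N" for i using dQ[OF that] Fy_in_Q by (rule Q_divide)
    fix i j assume ij: "i < N" "j < N"
    then have wj: "w j \<in> Q" using w by (simp add: is_basis_def)
    have "Fy * (d i / Fy) * w j = w j * d i" using Fy_nonzero by (simp add: mult.commute)
    also have "lam (w j * d i) = (\<Sum>l<N. coord w (y ^ l) i * lam (w j * bd l))"
      by (rule lam_span[OF _ wj]) (auto simp: d_def intro: bd_in_Q coord_in_Kx[OF w yQ ij(1)])
    also have "\<dots> = (\<Sum>l<N. coord (\<lambda>i. y ^ i) (w j) l * coord w (y ^ l) i)"
      using coord_powers_eq_lam[OF wj] by (intro sum.cong) (auto simp: mult.commute)
    also have "\<dots> = coord w (\<Sum>l<N. coord (\<lambda>i. y ^ i) (w j) l * y ^ l) i"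
      by (rule coord_sum[OF w ij(1), symmetric]) (auto intro: yQ coord_in_Kx[OF is_basis_powers wj])
    also have "\<dots> = coord w (w j) i" by (simp add: coord_expansion[OF is_basis_powers wj])
    finally show "lam (Fy * (d i / Fy) * w j) = (if i = j then 1 else 0)"
      using coord_base[OF w ij] by simp
  qed
qed

context
  fixes w w' :: "nat \<Rightarrow> 'l"
  assumes w: "is_basis w"
    and w'Q: "\<And>i. i < N \<Longrightarrow> w' i \<in> Q"
    and dual: "\<And>i j. i < N \<Longrightarrow> j < N \<Longrightarrow> lam (Fy * w' i * w j) = (if i = j then 1 else 0)"
begin

lemma dual_comb_in_Q: "lincomb N c (\<lambda>i. Fy * w' i) \<in> Q"
  unfolding lincomb_def by (intro Q_sum Q_mult Fy_in_Q \<kappa>_in_Q) (simp add: w'Q)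

lemma lam_dual_comb:
  assumes j: "j < N"
  shows "lam (lincomb N c (\<lambda>i. Fy * w' i) * w j) = \<kappa> (c j)"
proof -
  have wj: "w j \<in> Q" using w j by (simp add: is_basis_def)
  have "lam (w j * lincomb N c (\<lambda>i. Fy * w' i)) = (\<Sum>i<N. \<kappa> (c i) * lam (w j * (Fy * w' i)))"
  proof (rule lam_span[OF _ wj])
    show "Fy * w' i \<in> Q" if "i < N" for i by (rule Q_mult[OF Fy_in_Q w'Q[OF that]])
    show "lincomb N c (\<lambda>i. Fy * w' i) = (\<Sum>i<N. \<kappa> (c i) * (Fy * w' i))" by (simp only: lincomb_def)
  qed (rule \<kappa>_in_Kx)
  also have "\<dots> = (\<Sum>i<N. if i = j then \<kappa> (c i) else 0)"
  proof (rule sum.cong)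
    fix i assume "i \<in> {..<N}"
    then have "lam (w j * (Fy * w' i)) = (if i = j then 1 else 0)"
      using dual[of i j] j by (simp add: mult.commute)
    then show "\<kappa> (c i) * lam (w j * (Fy * w' i)) = (if i = j then \<kappa> (c i) else 0)" by simp
  qed simp
  finally show ?thesis using j by (simp add: mult.commute)
qed

text \<open>Both sides have the same pairings with w, so their difference is 0 by
  nondegeneracy.\<close>

lemma dual_expansion:
  assumes z: "z \<in> Q" "\<And>j. j < N \<Longrightarrow> lam (z * w j) = \<kappa> (c j)"
  shows "z = lincomb N c (\<lambda>i. Fy * w' i)"
proof -
  define v where "v = lincomb N c (\<lambda>i. Fy * w' i)"
  have vQ: "v \<in> Q" unfolding v_def by (rule dual_comb_in_Q)
  have "lam ((z - v) * w j) = 0" if j: "j < N" for j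
  proof -
    have wj: "w j \<in> Q" using w j by (simp add: is_basis_def)
    have "lam ((z - v) * w j) = lam (z * w j) - lam (v * w j)"
      unfolding left_diff_distrib by (rule lam_diff[OF Q_mult[OF z(1) wj] Q_mult[OF vQ wj]])
    then show ?thesis using z(2)[OF j] lam_dual_comb[OF j, of c] unfolding v_def by simp
  qed
  from lam_nondegenerate[OF w subspace_diff[OF subspace_Q z(1) vQ] this] have "z - v = 0" .
  then show ?thesis unfolding v_def by (simp only: right_minus_eq)
qed

text \<open>An element of the conductor has pairings in k[x] with the elements w j of Abar, and
  these pairings are its coefficients in the dual basis. Conversely, pairings in k[x] with all of
  Abar suffice, because the test elements for membership in A can be absorbed into Abar.\<close>

theorem conductor_eq_span:
  assumes Abar: "Abar = fam_span N w"
  shows "{z \<in> A. \<forall>v\<in>Abar. z * v \<in> A} = fam_span N (\<lambda>i. Fy * w' i)"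
proof -
  have wQ: "w j \<in> Q" if "j < N" for j using w that by (simp add: is_basis_def)
  have sub: "z \<in> fam_span N (\<lambda>i. Fy * w' i)" if z: "z \<in> A" "\<And>v. v \<in> Abar \<Longrightarrow> z * v \<in> A" for z
  proof -
    have zQ: "z \<in> Q" using z(1) A_subset_Q by auto
    have "\<exists>p. j < N \<longrightarrow> lam (z * w j) = \<kappa> p" for j
    proof (cases "j < N")
      case True
      then have "w j \<in> Abar" unfolding Abar by (rule fam_span_base)
      from lam_in_range[OF z(2)[OF this]] obtain p where "lam (z * w j) = \<kappa> p" by (rule rangeE)
      then show ?thesis by (intro exI[of _ p] impI)
    qed simp
    then have "\<forall>j. \<exists>p. j < N \<longrightarrow> lam (z * w j) = \<kappa> p" by blast
    from choice[OF this] obtain c where c: "\<And>j. j < N \<Longrightarrow> lam (z * w j) = \<kappa> (c j)" by blast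
    have "z = lincomb N c (\<lambda>i. Fy * w' i)" by (rule dual_expansion[OF zQ c])
    then show ?thesis unfolding fam_span_def by blast
  qed
  have sup: "z \<in> A \<and> (\<forall>v\<in>Abar. z * v \<in> A)" if z: "z \<in> fam_span N (\<lambda>i. Fy * w' i)" for z
  proof -
    obtain c where c: "z = lincomb N c (\<lambda>i. Fy * w' i)" using z unfolding fam_span_def by blast
    have zQ: "z \<in> Q" unfolding c by (rule dual_comb_in_Q)
    have zw: "lam (z * w j) = \<kappa> (c j)" if "j < N" for j unfolding c by (rule lam_dual_comb[OF that])
    have zv: "z * v \<in> A" if v: "v \<in> Abar" for v
    proof -
      have vQ: "v \<in> Q" using v orderD(2)[OF order_Abar] by blast
      have "lam (bd i * (z * v)) \<in> range \<kappa>" for i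
      proof -
        \<comment> \<open>Testing z * v with \<open>bd i\<close> is the same as pairing z with bd i
          * v, which is again an element of Abar.\<close>
        have "bd i * v \<in> Abar"
          using bd_in_A[of i] orderD(1)[OF order_Abar] v orderD(4)[OF order_Abar, of "bd i" v] by blast
        then obtain e where e: "bd i * v = (\<Sum>j<N. \<kappa> (e j) * w j)"
          unfolding Abar fam_span_def lincomb_def by blast
        have "lam (z * (bd i * v)) = (\<Sum>j<N. \<kappa> (e j) * lam (z * w j))"
          by (rule lam_span[OF wQ zQ e \<kappa>_in_Kx])
        then have "lam (z * (bd i * v)) = (\<Sum>j<N. \<kappa> (e j * c j))"
          by (simp add: zw \<kappa>_mult)
        moreover have "(\<Sum>j<N. \<kappa> (e j * c j)) \<in> range \<kappa>" by (rule range_\<kappa>_sum) (rule rangeI)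
        moreover have "bd i * (z * v) = z * (bd i * v)" by (rule mult.left_commute)
        ultimately show ?thesis by (simp only:)
      qed
      then show ?thesis using in_A_iff[OF Q_mult[OF zQ vQ]] by blast
    qed
    have "z \<in> A" using zv[OF orderD(7)[OF order_Abar]] by simp
    with zv show ?thesis by blast
  qed
  show ?thesis using sub sup by blast
qed

end

end


section \<open>Rings embedded in a field type\<close>

lemma type_ring_simps [simp]:
  "carrier (ring_of_type_algebra :: 'b::comm_ring_1 ring) = UNIV"
  "\<one>\<^bsub>(ring_of_type_algebra :: 'b ring)\<^esub> = 1" "\<zero>\<^bsub>(ring_of_type_algebra :: 'b ring)\<^esub> = 0"
  "a \<otimes>\<^bsub>(ring_of_type_algebra :: 'b ring)\<^esub> b = a * b" "a \<oplus>\<^bsub>(ring_of_type_algebra :: 'b ring)\<^esub> b = a + b"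
  by (simp_all add: ring_of_type_algebra_def)

lemma type_ring_a_inv [simp]: "\<ominus>\<^bsub>(ring_of_type_algebra :: 'b::comm_ring_1 ring)\<^esub> a = - a"
proof -
  interpret cring "ring_of_type_algebra :: 'b ring" by (rule cring_from_type_algebra)
  show ?thesis by (rule minus_equality) simp_all
qed

text \<open>Transfer between an abstract ring and its image B in a field. All arguments take place
  in B; the lemmas here move ideals, generated ideals and finite sums across.\<close>

locale embedded_ring =
  fixes R :: "('r, 'm) ring_scheme" (structure) and e :: "'r \<Rightarrow> 'l::field"
  assumes cring: "cring R"
    and hom: "e \<in> Ring.ring_hom R (ring_of_type_algebra :: 'l ring)"
    and inj: "inj_on e (carrier R)"
begin

sublocale R: cring R by (rule cring)

definition B :: "'l set" where "B = e ` carrier R"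

lemma e_mult: "x \<in> carrier R \<Longrightarrow> z \<in> carrier R \<Longrightarrow> e (x \<otimes> z) = e x * e z"
  and e_add: "x \<in> carrier R \<Longrightarrow> z \<in> carrier R \<Longrightarrow> e (x \<oplus> z) = e x + e z"
  and e_one: "e \<one> = 1"
  using ring_hom_mult[OF hom] ring_hom_add[OF hom] ring_hom_one[OF hom] by simp_all

lemma e_zero: "e \<zero> = 0"
  using ring_hom_zero[OF hom R.ring_axioms ring_from_type_algebra] by simp

lemma e_eq_iff: "x \<in> carrier R \<Longrightarrow> z \<in> carrier R \<Longrightarrow> e x = e z \<longleftrightarrow> x = z"
  using inj by (auto simp: inj_on_def)

lemma e_eq_0_iff: "x \<in> carrier R \<Longrightarrow> e x = 0 \<longleftrightarrow> x = \<zero>"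
  using e_eq_iff[of x \<zero>] by (simp add: e_zero)

lemma e_pow: "x \<in> carrier R \<Longrightarrow> e (x [^] (n::nat)) = e x ^ n"
  by (induction n) (simp_all add: e_one e_mult mult.commute)

lemma e_finsum: "finite I \<Longrightarrow> (\<And>i. i \<in> I \<Longrightarrow> g i \<in> carrier R) \<Longrightarrow> e (\<Oplus>i\<in>I. g i) = (\<Sum>i\<in>I. e (g i))"
proof (induction I rule: finite_induct)
  case (insert i I)
  then show ?case by (simp add: e_add Pi_def)
qed (simp add: e_zero)

lemma e_in_B: "x \<in> carrier R \<Longrightarrow> e x \<in> B"
  by (simp add: B_def)

lemma BE: assumes "v \<in> B" obtains x where "x \<in> carrier R" "v = e x"
  using assms unfolding B_def by blast

lemma e_ainv: "x \<in> carrier R \<Longrightarrow> e (\<ominus> x) = - e x"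
  using e_add[of x "\<ominus> x"] by (simp add: R.r_neg e_zero eq_neg_iff_add_eq_0 add.commute)

text \<open>Additive inverses come from closure under multiplication by the element -1 of B.\<close>

lemma ideal_preimage:
  assumes "J \<subseteq> B" "0 \<in> J" "\<And>a b. a \<in> J \<Longrightarrow> b \<in> J \<Longrightarrow> a + b \<in> J" "\<And>a b. a \<in> J \<Longrightarrow> b \<in> B \<Longrightarrow> b * a \<in> J"
  shows "ideal {x \<in> carrier R. e x \<in> J} R"
proof -
  have right: "a * b \<in> J" if "a \<in> J" "b \<in> B" for a b
    using assms(4)[OF that] by (simp only: mult.commute)
  have neg: "- a \<in> J" if "a \<in> J" for a
  proof -
    have "e (\<ominus> \<one>) \<in> B" by (rule e_in_B) simp
    from assms(4)[OF that this] show ?thesis by (simp add: e_ainv e_one)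
  qed
  have "subgroup {x \<in> carrier R. e x \<in> J} (add_monoid R)"
  proof (rule R.add.subgroupI)
    show "{x \<in> carrier R. e x \<in> J} \<noteq> {}" using assms(2) e_zero R.zero_closed by force
  qed (auto simp: e_add e_ainv neg assms(3) simp flip: a_inv_def)
  then show ?thesis
    by (intro idealI R.ring_axioms) (auto simp: e_mult assms(4) e_in_B right)
qed

lemma ideal_image:
  assumes "ideal J R"
  shows "e ` J \<subseteq> B" "0 \<in> e ` J" "a \<in> e ` J \<Longrightarrow> b \<in> e ` J \<Longrightarrow> a + b \<in> e ` J"
    "a \<in> e ` J \<Longrightarrow> b \<in> B \<Longrightarrow> b * a \<in> e ` J"
proof -
  interpret J: ideal J R by (rule assms)
  show "e ` J \<subseteq> B" using J.a_subset unfolding B_def by blast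
  show "0 \<in> e ` J" using J.zero_closed e_zero by (metis imageI)
  show "a \<in> e ` J \<Longrightarrow> b \<in> e ` J \<Longrightarrow> a + b \<in> e ` J"
  proof -
    assume "a \<in> e ` J" "b \<in> e ` J"
    then obtain x z where xz: "x \<in> J" "z \<in> J" "a = e x" "b = e z" by blast
    then have "a + b = e (x \<oplus> z)" by (simp add: e_add J.a_Hcarr)
    then show ?thesis using J.a_closed[OF xz(1,2)] by (rule image_eqI)
  qed
  show "a \<in> e ` J \<Longrightarrow> b \<in> B \<Longrightarrow> b * a \<in> e ` J"
  proof -
    assume "a \<in> e ` J" "b \<in> B"
    then obtain x z where xz: "x \<in> J" "z \<in> carrier R" "a = e x" "b = e z" unfolding B_def by blast
    then have "b * a = e (z \<otimes> x)" by (simp add: e_mult J.a_Hcarr)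
    then show ?thesis using J.I_l_closed[OF xz(1,2)] by (rule image_eqI)
  qed
qed

lemma mem_image_iff: "J \<subseteq> carrier R \<Longrightarrow> x \<in> carrier R \<Longrightarrow> e x \<in> e ` J \<longleftrightarrow> x \<in> J"
  using inj by (meson inj_on_image_mem_iff)

text \<open>The linear combinations pull back to an ideal containing all u j, which gives one
  inclusion by minimality; the other holds because any ideal containing the u j contains their
  combinations.\<close>

lemma genideal_image:
  fixes s :: nat
  assumes u: "\<And>j. j \<le> s \<Longrightarrow> u j \<in> carrier R"
  shows "e ` (Idl (u ` {..s})) = {\<Sum>\<nu>\<le>s. r \<nu> * e (u \<nu>) | r. \<forall>\<nu>. r \<nu> \<in> B}" (is "_ = ?C")
proof
  have C_I: "(\<Sum>\<nu>\<le>s. r \<nu> * e (u \<nu>)) \<in> ?C" if "\<And>\<nu>. r \<nu> \<in> B" for r using that by blast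
  have B0: "0 \<in> B" "1 \<in> B" using e_in_B[of \<zero>] e_in_B[of \<one>] by (simp_all add: e_zero e_one)
  have B_add: "v + w \<in> B" "v * w \<in> B" if "v \<in> B" "w \<in> B" for v w
    using that e_in_B unfolding B_def by (force simp flip: e_add e_mult)+
  have id: "ideal {x \<in> carrier R. e x \<in> ?C} R"
  proof (rule ideal_preimage)
    show "?C \<subseteq> B"
    proof
      fix v assume "v \<in> ?C"
      then obtain r where r: "\<And>\<nu>. r \<nu> \<in> B" "v = (\<Sum>\<nu>\<le>s. r \<nu> * e (u \<nu>))" by blast
      have sumB: "sum h I \<in> B" if "\<And>i. i \<in> I \<Longrightarrow> h i \<in> B" for h and I :: "nat set"
        using that by (induction I rule: infinite_finite_induct) (auto simp: B0 B_add)
      show "v \<in> B" unfolding r(2) by (rule sumB) (use r(1) B_add e_in_B u in auto)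
    qed
    show "0 \<in> ?C" using C_I[of "\<lambda>_. 0"] B0 by simp
    fix a b assume a: "a \<in> ?C"
    then obtain r where r: "\<And>\<nu>. r \<nu> \<in> B" "a = (\<Sum>\<nu>\<le>s. r \<nu> * e (u \<nu>))" by blast
    {
      assume "b \<in> ?C"
      then obtain r' where r': "\<And>\<nu>. r' \<nu> \<in> B" "b = (\<Sum>\<nu>\<le>s. r' \<nu> * e (u \<nu>))" by blast
      have "a + b = (\<Sum>\<nu>\<le>s. (r \<nu> + r' \<nu>) * e (u \<nu>))" by (simp add: r r' distrib_right sum.distrib)
      then show "a + b \<in> ?C" using C_I[of "\<lambda>\<nu>. r \<nu> + r' \<nu>"] r(1) r'(1) B_add by simp
    next
      assume "b \<in> B"
      have "b * a = (\<Sum>\<nu>\<le>s. (b * r \<nu>) * e (u \<nu>))" by (simp add: r sum_distrib_left mult.assoc)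
      then show "b * a \<in> ?C" using C_I[of "\<lambda>\<nu>. b * r \<nu>"] r(1) \<open>b \<in> B\<close> B_add by simp
    }
  qed
  have "u ` {..s} \<subseteq> {x \<in> carrier R. e x \<in> ?C}"
  proof
    fix x assume "x \<in> u ` {..s}"
    then obtain j where j: "j \<le> s" "x = u j" by auto
    have "(\<Sum>\<nu>\<le>s. (if \<nu> = j then 1 else 0) * e (u \<nu>)) = (\<Sum>\<nu>\<le>s. if \<nu> = j then e (u \<nu>) else 0)"
      by (rule sum.cong) auto
    also have "\<dots> = e x" using j by simp
    finally show "x \<in> {x \<in> carrier R. e x \<in> ?C}"
      using C_I[of "\<lambda>\<nu>. if \<nu> = j then 1 else 0"] B0 u[OF j(1)] by (simp add: j(2))
  qed
  from R.genideal_minimal[OF id this] show "e ` (Idl (u ` {..s})) \<subseteq> ?C" by blast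
  have carr: "u ` {..s} \<subseteq> carrier R" using u by auto
  note I = ideal_image[OF R.genideal_ideal[OF carr]]
  show "?C \<subseteq> e ` (Idl (u ` {..s}))"
  proof
    fix v assume "v \<in> ?C"
    then obtain r where r: "\<And>\<nu>. r \<nu> \<in> B" "v = (\<Sum>\<nu>\<le>s. r \<nu> * e (u \<nu>))" by blast
    have sumI: "sum h T \<in> e ` (Idl (u ` {..s}))" if "\<And>i. i \<in> T \<Longrightarrow> h i \<in> e ` (Idl (u ` {..s}))" for h and T :: "nat set"
      using that by (induction T rule: infinite_finite_induct) (auto simp: I(2) intro: I(3))
    have mem: "r \<nu> * e (u \<nu>) \<in> e ` (Idl (u ` {..s}))" if "\<nu> \<in> {..s}" for \<nu>
      using that R.genideal_self[OF carr] by (intro I(4) r imageI) blast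
    show "v \<in> e ` (Idl (u ` {..s}))" unfolding r(2) by (rule sumI[OF mem])
  qed
qed

lemma principal_image:
  assumes "a \<in> carrier R" shows "e ` (PIdl a) = (\<lambda>r. r * e a) ` B"
  unfolding cgenideal_def B_def using assms by (force simp: e_mult)

end

lemma res_class_zero_iff: "res_class F p = res_class F 0 \<longleftrightarrow> F dvd p"
  and res_class_hom: "res_class F \<in> Ring.ring_hom S_ring (coord_ring F)"
  and coord_ring_carrier: "carrier (coord_ring F) = range (res_class F)"
  and coord_ring_cring: "cring (coord_ring F)"
  for F :: "'a::field poly poly"
proof -
  interpret S: cring "S_ring :: 'a poly poly ring" by (rule cring_from_type_algebra)
  interpret I: ideal "PIdl\<^bsub>S_ring\<^esub> F" S_ring by (rule S.cgenideal_ideal) simp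
  show "res_class F \<in> Ring.ring_hom S_ring (coord_ring F)"
    unfolding coord_ring_def res_class_def[abs_def] by (rule I.rcos_ring_hom)
  show "cring (coord_ring F)" unfolding coord_ring_def by (rule I.quotient_is_cring) (rule S.cring_axioms)
  show "carrier (coord_ring F) = range (res_class F)"
    unfolding coord_ring_def FactRing_def A_RCOSETS_def' res_class_def by auto
  have "PIdl\<^bsub>S_ring\<^esub> F = {x * F | x. True}" by (simp add: cgenideal_def)
  then have mem: "x \<in> PIdl\<^bsub>S_ring\<^esub> F \<longleftrightarrow> F dvd x" for x by (auto simp: dvd_def mult.commute)
  have coset: "res_class F q = {h + q | h. F dvd h}" for q
    unfolding res_class_def a_r_coset_def' using mem by auto
  show "res_class F p = res_class F 0 \<longleftrightarrow> F dvd p"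
  proof
    assume "res_class F p = res_class F 0"
    moreover have "p \<in> res_class F p" unfolding coset by (intro CollectI exI[of _ 0]) simp
    ultimately show "F dvd p" unfolding coset by auto
  next
    assume p: "F dvd p"
    show "res_class F p = res_class F 0"
      unfolding coset
    proof (intro equalityI subsetI)
      fix x assume "x \<in> {h + p | h. F dvd h}"
      then obtain h where "x = h + p" "F dvd h" by blast
      then show "x \<in> {h + 0 | h. F dvd h}" using p by (intro CollectI exI[of _ x]) simp
    next
      fix x assume "x \<in> {h + 0 | h. F dvd h}"
      then have "F dvd x" by auto
      then show "x \<in> {h + p | h. F dvd h}" using p by (intro CollectI exI[of _ "x - p"]) simp
    qed
  qed
qed


section \<open>The coordinate ring of the curve\<close>

locale curve_setup =
  fixes F :: "'a::field poly poly" and N :: nat and \<iota> :: "'a poly poly set \<Rightarrow> 'l::field"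
  assumes irred: "Factorial_Ring.irreducible F" and tdeg: "total_degree F = N"
    and deg: "Polynomial.degree F = N" and monic: "lead_coeff F = 1"
    and emb: "field_embedding (coord_ring F) \<iota>" and sep: "separable_in_Y F \<iota>"
begin

sublocale coord: embedded_ring "coord_ring F" \<iota>
  using emb coord_ring_cring unfolding field_embedding_def embedded_ring_def by blast

definition \<rho> :: "'a poly poly \<Rightarrow> 'l" where "\<rho> p = \<iota> (res_class F p)"

lemma res_in_carrier: "res_class F p \<in> carrier (coord_ring F)"
  by (simp add: coord_ring_carrier)

lemma \<rho>_add: "\<rho> (p + q) = \<rho> p + \<rho> q" and \<rho>_mult: "\<rho> (p * q) = \<rho> p * \<rho> q" and \<rho>_1: "\<rho> 1 = 1"
  using ring_hom_add[OF res_class_hom, of p q F] ring_hom_mult[OF res_class_hom, of p q F]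
    ring_hom_one[OF res_class_hom, of F] coord.e_add[OF res_in_carrier res_in_carrier, of p q]
    coord.e_mult[OF res_in_carrier res_in_carrier, of p q] coord.e_one
  by (simp_all add: \<rho>_def)

lemma \<rho>_0 [simp]: "\<rho> 0 = 0"
  using \<rho>_add[of 0 0] by (metis add.right_neutral add_cancel_left_right)

lemma \<rho>_minus: "\<rho> (- p) = - \<rho> p"
  using \<rho>_add[of p "- p"] by (simp add: eq_neg_iff_add_eq_0 add.commute)

lemma \<rho>_diff: "\<rho> (p - q) = \<rho> p - \<rho> q"
  using \<rho>_add[of p "- q"] by (simp add: \<rho>_minus)

lemma \<rho>_sum: "\<rho> (sum h I) = (\<Sum>i\<in>I. \<rho> (h i))"
  by (induction I rule: infinite_finite_induct) (simp_all add: \<rho>_add)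

lemma \<rho>_pow: "\<rho> (p ^ n) = \<rho> p ^ n"
  by (induction n) (simp_all add: \<rho>_1 \<rho>_mult)

lemma \<rho>_eq_iff: "\<rho> p = \<rho> q \<longleftrightarrow> res_class F p = res_class F q"
  unfolding \<rho>_def by (rule coord.e_eq_iff[OF res_in_carrier res_in_carrier])

lemma \<rho>_eq_0_iff: "\<rho> p = 0 \<longleftrightarrow> F dvd p"
  using \<rho>_eq_iff[of p 0] res_class_zero_iff[of F p] by simp

definition \<kappa> :: "'a poly \<Rightarrow> 'l" where "\<kappa> c = \<rho> [:c:]"

definition y :: 'l where "y = \<rho> [:0, 1:]"

lemma N_pos': "0 < N"
proof (rule ccontr)
  assume "\<not> 0 < N"
  then have "Polynomial.degree F = 0" using deg by simp
  with monic have "F = 1" by (metis degree_0_id lead_coeff_1 of_nat_1 one_pCons degree_eq_zeroE coeff_pCons_0)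
  with irred show False by (simp add: Factorial_Ring.irreducible_def)
qed

lemma dvd_degree: "F dvd p \<Longrightarrow> Polynomial.degree p < N \<Longrightarrow> p = 0"
  using dvd_imp_degree_le[of F p] deg by auto

lemma \<kappa>_hom: "\<kappa> (p + q) = \<kappa> p + \<kappa> q" "\<kappa> (p * q) = \<kappa> p * \<kappa> q" "\<kappa> 1 = 1" "\<kappa> 0 = 0"
  using \<rho>_add[of "[:p:]" "[:q:]"] \<rho>_mult[of "[:p:]" "[:q:]"] \<rho>_1
  by (simp_all add: \<kappa>_def mult.commute flip: one_pCons)

lemma \<rho>_eq_poly: "\<rho> p = poly (map_poly \<kappa> p) y"
proof (induction p rule: pCons_induct)
  case (pCons a p)
  have "pCons a p = [:a:] + [:0, 1:] * p" by simp
  then have "\<rho> (pCons a p) = \<kappa> a + y * \<rho> p" by (simp only: \<rho>_add \<rho>_mult \<kappa>_def y_def)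
  then show ?case using pCons by (simp add: map_poly_pCons \<kappa>_hom)
qed simp

lemma \<rho>_monom: "\<rho> (Polynomial.monom c i) = \<kappa> c * y ^ i"
proof -
  have "Polynomial.monom c i = [:c:] * [:0, 1:] ^ i" by (simp add: monom_altdef)
  then show ?thesis by (simp only: \<rho>_mult \<rho>_pow \<kappa>_def y_def)
qed

lemma \<rho>_expand: "Polynomial.degree p \<le> n \<Longrightarrow> \<rho> p = (\<Sum>i\<le>n. \<kappa> (poly.coeff p i) * y ^ i)"
  using arg_cong[OF poly_as_sum_of_monoms'[of p n], of \<rho>] by (simp add: \<rho>_sum \<rho>_monom)

sublocale plane_curve \<kappa> "poly.coeff F" N y
proof
  show "\<kappa> p = 0 \<Longrightarrow> p = 0" for p
    using dvd_degree[of "[:p:]"] N_pos' \<rho>_eq_0_iff[of "[:p:]"] by (simp add: \<kappa>_def)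
  show "(\<Sum>l\<le>N. \<kappa> (poly.coeff F l) * y ^ l) = 0"
    using \<rho>_expand[of F N] deg \<rho>_eq_0_iff[of F] by simp
  show "poly.coeff F N = 1" using monic deg by simp
  fix c :: "nat \<Rightarrow> 'a poly" and i assume s: "(\<Sum>i<N. \<kappa> (c i) * y ^ i) = 0" and i: "i < N"
  \<comment> \<open>A relation among the first N powers of y lifts to a polynomial of Y-degree below
    N that F divides, so the polynomial is 0.\<close>
  define q where "q = (\<Sum>i<N. Polynomial.monom (c i) i)"
  have "\<rho> q = 0" using s by (simp add: q_def \<rho>_sum \<rho>_monom)
  moreover have "Polynomial.degree q < N" unfolding q_def
    using N_pos' by (intro degree_sum_less) (auto intro: le_less_trans[OF degree_monom_le])
  ultimately have "q = 0" using dvd_degree \<rho>_eq_0_iff by blast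
  moreover have "poly.coeff q i = c i" using i by (simp add: q_def coeff_sum)
  ultimately show "c i = 0" by simp
qed (simp_all add: \<kappa>_hom N_pos')

lemma Fy_eq: "Fy = \<rho> (pderiv F)"
proof -
  have "F = (\<Sum>l\<le>N. Polynomial.monom (poly.coeff F l) l)"
    using poly_as_sum_of_monoms'[of F N] deg by simp
  then have "pderiv F = pderiv (\<Sum>l\<le>N. Polynomial.monom (poly.coeff F l) l)" by (rule arg_cong)
  also have "\<dots> = (\<Sum>l\<le>N. Polynomial.monom (of_nat l * poly.coeff F l) (l - 1))"
  proof -
    have "pderiv (\<Sum>l\<le>n. Polynomial.monom (poly.coeff F l) l)
        = (\<Sum>l\<le>n. Polynomial.monom (of_nat l * poly.coeff F l) (l - 1))" for n
      by (induction n) (simp_all add: pderiv_add pderiv_monom)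
    then show ?thesis .
  qed
  finally have "\<rho> (pderiv F) = (\<Sum>l\<le>N. \<kappa> (of_nat l * poly.coeff F l) * y ^ (l - 1))"
    by (simp add: \<rho>_sum \<rho>_monom)
  moreover have "\<kappa> (of_nat l) = of_nat l" for l by (induction l) (simp_all add: \<kappa>_hom)
  ultimately show ?thesis by (simp add: Fy_def \<kappa>_hom)
qed

lemma map_poly_pderiv: "map_poly \<kappa> (pderiv p) = pderiv (map_poly \<kappa> p)"
proof (rule poly_eqI)
  fix n
  have "\<kappa> (of_nat l) = of_nat l" for l by (induction l) (simp_all add: \<kappa>_hom)
  then show "poly.coeff (map_poly \<kappa> (pderiv p)) n = poly.coeff (pderiv (map_poly \<kappa> p)) n"
    by (simp add: coeff_map_poly \<kappa>_hom coeff_pderiv del: of_nat_Suc)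
qed

text \<open>By the product rule the derivative of F(x,Y) = (Y - y) q has the value q(y) at y. If it
  vanished, Y - y would divide q as well and y would be at least a double root, against order
  1.\<close>

sublocale separable_curve \<kappa> "poly.coeff F" N y
proof
  show "Fy \<noteq> 0"
  proof
    assume "Fy = 0"
    define P where "P = map_poly \<kappa> F"
    have dP: "poly (pderiv P) y = 0"
      using \<open>Fy = 0\<close> unfolding Fy_eq \<rho>_eq_poly P_def map_poly_pderiv .
    have ord: "Polynomial.order y P = 1"
      using sep unfolding separable_in_Y_def P_def \<kappa>_def[abs_def] \<rho>_def y_def .
    have P0: "P \<noteq> 0" using ord by (metis \<rho>_eq_poly P_def N_pos' coeff_map_poly \<kappa>_hom(3,4) deg monic coeff_0 zero_neq_one)
    have "[:- y, 1:] dvd P" using order_1[of y P] ord by simp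
    then obtain q where q: "P = [:- y, 1:] * q" by (elim dvdE)
    have "poly (pderiv P) y = poly q y"
      unfolding q pderiv_mult by (simp add: pderiv_pCons)
    with dP have "[:- y, 1:] dvd q" by (simp add: poly_eq_0_iff_dvd)
    then have "[:- y, 1:] ^ 2 dvd P" unfolding q power2_eq_square by (intro mult_dvd_mono) auto
    with P0 ord show False by (simp add: order_divides)
  qed
qed

lemma range_\<rho>: "range \<rho> = A"
proof
  show "range \<rho> \<subseteq> A"
  proof
    fix v assume "v \<in> range \<rho>"
    then obtain p where "v = \<rho> p" by blast
    then have v: "v = (\<Sum>i\<le>Polynomial.degree p. \<kappa> (poly.coeff p i) * y ^ i)" using \<rho>_expand[OF order_refl] by simp
    show "v \<in> A" unfolding v by (intro subspace_sum subspace_scale subspace_A y_pow_in_A)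
  qed
  show "A \<subseteq> range \<rho>"
  proof
    fix v assume "v \<in> A"
    then obtain c where "v = (\<Sum>i<N. \<kappa> (c i) * y ^ i)" unfolding A_def fam_span_def lincomb_def by blast
    then have "v = \<rho> (\<Sum>i<N. Polynomial.monom (c i) i)" by (simp add: \<rho>_sum \<rho>_monom)
    then show "v \<in> range \<rho>" by (rule range_eqI)
  qed
qed

lemma image_coord: "\<iota> ` carrier (coord_ring F) = A"
  unfolding coord_ring_carrier image_image \<rho>_def[symmetric] by (rule range_\<rho>)

end


subsection \<open>Orders as abstract rings\<close>

text \<open>A stage of the normalization seen from both sides: a quotient ring and the order that is
  its image. The lemmas translate fraction field, localizations, primes and colon ideals, so that
  the results on orders apply to the stages.\<close>

locale embedded_order = separable_curve \<kappa> f N y + embedded_ring R e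
  for \<kappa> :: "'a::field poly \<Rightarrow> 'l::field" and f N y and R :: "'r ring" and e :: "'r \<Rightarrow> 'l" +
  assumes order: "is_order B"
begin

lemma frac_field_eq: "frac_field R e = Q"
proof (intro equalityI subsetI)
  fix z assume "z \<in> frac_field R e"
  then obtain a b where "a \<in> carrier R" "b \<in> carrier R" "z = e a / e b" unfolding frac_field_def by blast
  then show "z \<in> Q" using e_in_B orderD(2)[OF order] by (auto intro!: Q_divide)
next
  fix z assume "z \<in> Q"
  then obtain p where p: "p \<noteq> 0" "\<kappa> p * z \<in> A" by (rule Q_denominator)
  obtain a where a: "a \<in> carrier R" "\<kappa> p * z = e a" using p(2) orderD(1)[OF order] BE by blast
  obtain b where b: "b \<in> carrier R" "\<kappa> p = e b" using orderD(8)[OF order] BE by blast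
  have "b \<noteq> \<zero>\<^bsub>R\<^esub>" using b p(1) e_zero by auto
  moreover have "z = e a / e b" using p(1) by (simp flip: a(2) b(2))
  ultimately show "z \<in> frac_field R e" unfolding frac_field_def using a(1) b(1) by blast
qed

lemma localization_eq:
  assumes "P \<subseteq> carrier R" shows "localization R e P = loc B (e ` P)"
proof (intro equalityI subsetI)
  fix z assume "z \<in> localization R e P"
  then obtain a b where ab: "a \<in> carrier R" "b \<in> carrier R" "b \<notin> P" "z = e a / e b" unfolding localization_def by blast
  have "e b \<notin> e ` P" using mem_image_iff[OF assms ab(2)] ab(3) by blast
  then show "z \<in> loc B (e ` P)" unfolding loc_def using ab e_in_B by blast
next
  fix z assume "z \<in> loc B (e ` P)"
  then obtain v w where vw: "v \<in> B" "w \<in> B" "w \<notin> e ` P" "z = v / w" unfolding loc_def by blast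
  obtain a where a: "a \<in> carrier R" "v = e a" using vw(1) by (rule BE)
  obtain b where b: "b \<in> carrier R" "w = e b" using vw(2) by (rule BE)
  have "b \<notin> P" using vw(3) b(2) by blast
  then show "z \<in> localization R e P" unfolding localization_def using a b vw(4) by blast
qed

lemma prime_image:
  assumes "primeideal P R" shows "prime_in B (e ` P)"
proof -
  interpret P: primeideal P R by (rule assms)
  note I = ideal_image[OF P.ideal_axioms]
  have one: "\<one>\<^bsub>R\<^esub> \<notin> P" using P.I_notcarr P.one_imp_carrier by blast
  show ?thesis
    unfolding prime_in_def
  proof (intro conjI ballI impI)
    show "e ` P \<subseteq> B" "0 \<in> e ` P" by (rule I)+
    show "1 \<notin> e ` P" using one mem_image_iff[OF P.a_subset R.one_closed] by (simp add: e_one)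
    show "a + b \<in> e ` P" if "a \<in> e ` P" "b \<in> e ` P" for a b using that by (rule I)
    show "b * a \<in> e ` P" if "a \<in> e ` P" "b \<in> B" for a b using that by (rule I)
    fix a b assume ab: "a \<in> B" "b \<in> B" "a * b \<in> e ` P"
    obtain a' where a': "a' \<in> carrier R" "a = e a'" using ab(1) by (rule BE)
    obtain b' where b': "b' \<in> carrier R" "b = e b'" using ab(2) by (rule BE)
    have "e (a' \<otimes>\<^bsub>R\<^esub> b') \<in> e ` P" using ab(3) by (simp add: a' b' e_mult)
    then have "a' \<otimes>\<^bsub>R\<^esub> b' \<in> P" using mem_image_iff[OF P.a_subset] a' b' by simp
    then show "a \<in> e ` P \<or> b \<in> e ` P" using P.I_prime[OF a'(1) b'(1)] a' b' by blast
  qed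
qed

lemma prime_preimage:
  assumes "prime_in B P" shows "primeideal {x \<in> carrier R. e x \<in> P} R" "e ` {x \<in> carrier R. e x \<in> P} = P"
proof -
  have P: "P \<subseteq> B" "1 \<notin> P" "0 \<in> P" "\<And>a b. a \<in> P \<Longrightarrow> b \<in> P \<Longrightarrow> a + b \<in> P"
    "\<And>a b. a \<in> P \<Longrightarrow> b \<in> B \<Longrightarrow> b * a \<in> P" "\<And>a b. a \<in> B \<Longrightarrow> b \<in> B \<Longrightarrow> a * b \<in> P \<Longrightarrow> a \<in> P \<or> b \<in> P"
    using assms unfolding prime_in_def by blast+
  show "primeideal {x \<in> carrier R. e x \<in> P} R"
  proof (rule primeidealI[OF ideal_preimage cring])
    show "carrier R \<noteq> {x \<in> carrier R. e x \<in> P}" using P(2) e_one R.one_closed by force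
    show "a \<in> {x \<in> carrier R. e x \<in> P} \<or> b \<in> {x \<in> carrier R. e x \<in> P}"
      if "a \<in> carrier R" "b \<in> carrier R" "a \<otimes>\<^bsub>R\<^esub> b \<in> {x \<in> carrier R. e x \<in> P}" for a b
      using that P(6)[of "e a" "e b"] e_in_B by (simp add: e_mult)
  qed (use P in blast)+
  show "e ` {x \<in> carrier R. e x \<in> P} = P" using P(1) unfolding B_def by blast
qed

lemma non_normal_iff:
  assumes "primeideal P R"
  shows "P \<in> non_normal_locus R e \<longleftrightarrow> not_normal_at B (e ` P)"
proof -
  interpret P: primeideal P R by (rule assms)
  show ?thesis unfolding non_normal_locus_def mem_Collect_eq not_normal_at_def frac_field_eq localization_eq[OF P.a_subset]
    using assms by blast
qed

lemma colon_image:
  assumes J: "J \<subseteq> carrier R" and a: "a \<in> carrier R"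
  shows "e ` test_colon R J a = colon B (e ` J) (e a)"
proof (intro equalityI subsetI)
  fix v assume "v \<in> e ` test_colon R J a"
  then obtain b where b: "b \<in> carrier R" "(\<lambda>c. b \<otimes>\<^bsub>R\<^esub> c) ` J \<subseteq> (\<lambda>c. a \<otimes>\<^bsub>R\<^esub> c) ` J" "v = e b"
    unfolding test_colon_def by blast
  show "v \<in> colon B (e ` J) (e a)"
    unfolding colon_def b(3)
  proof (intro CollectI conjI ballI)
    show "e b \<in> B" by (rule e_in_B[OF b(1)])
    fix w assume "w \<in> e ` J"
    then obtain c where c: "c \<in> J" "w = e c" by blast
    obtain c' where c': "c' \<in> J" "b \<otimes>\<^bsub>R\<^esub> c = a \<otimes>\<^bsub>R\<^esub> c'" using b(2) c(1) by blast
    have "e b * w = e (b \<otimes>\<^bsub>R\<^esub> c)" using c J b(1) by (simp add: e_mult subset_iff)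
    also have "\<dots> = e a * e c'" unfolding c'(2) using c' J a by (simp add: e_mult subset_iff)
    finally show "\<exists>c'\<in>e ` J. e b * w = e a * c'" using c'(1) by blast
  qed
next
  fix v assume v: "v \<in> colon B (e ` J) (e a)"
  then obtain b where b: "b \<in> carrier R" "v = e b" unfolding colon_def using BE by blast
  have "b \<otimes>\<^bsub>R\<^esub> c \<in> (\<lambda>c. a \<otimes>\<^bsub>R\<^esub> c) ` J" if c: "c \<in> J" for c
  proof -
    obtain c' where c': "c' \<in> J" "e b * e c = e a * e c'" using v c unfolding colon_def b(2) by blast
    have "e (b \<otimes>\<^bsub>R\<^esub> c) = e (a \<otimes>\<^bsub>R\<^esub> c')" using c c' J a b(1) by (simp add: e_mult subset_iff)
    then have "b \<otimes>\<^bsub>R\<^esub> c = a \<otimes>\<^bsub>R\<^esub> c'" using c c' J a b(1) by (subst (asm) e_eq_iff) (auto)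
    then show ?thesis using c' by blast
  qed
  then have "b \<in> test_colon R J a" unfolding test_colon_def using b(1) by blast
  then show "v \<in> e ` test_colon R J a" unfolding b(2) by (rule imageI)
qed

lemma test_pairD:
  assumes "test_pair R e J a"
  shows "ideal J R" "J \<subseteq> carrier R" "ideal_in B (e ` J)" "e a \<in> e ` J" "e a \<noteq> 0" "a \<in> carrier R"
proof -
  show J: "ideal J R" using assms unfolding test_pair_def radical_ideal_def by blast
  then interpret J: ideal J R .
  show "J \<subseteq> carrier R" by (rule J.a_subset)
  then show a: "a \<in> carrier R" "e a \<in> e ` J" using assms unfolding test_pair_def by blast+
  show "ideal_in B (e ` J)" unfolding ideal_in_def by (intro conjI ballI ideal_image[OF J])
  show "e a \<noteq> 0" using e_eq_0_iff[OF a(1)] assms unfolding test_pair_def by blast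
qed

text \<open>Primes of B pull back to primes of R, so the condition on the non-normal locus passes to
  B, where the Grauert-Remmert criterion applies.\<close>

lemma stop_normal:
  assumes tp: "test_pair R e J a" and stop: "test_colon R J a = PIdl\<^bsub>R\<^esub> a"
  shows "B = Abar"
proof (rule grauert_remmert[OF order])
  note J = test_pairD[OF tp]
  show "ideal_in B (e ` J)" "e a \<in> e ` J" "e a \<noteq> 0" by (rule J)+
  show "colon B (e ` J) (e a) \<subseteq> (\<lambda>r. r * e a) ` B"
    unfolding colon_image[OF J(2,6), symmetric] stop principal_image[OF J(6)] ..
  show "v \<in> e ` J" if v: "v \<in> B" "v ^ n \<in> e ` J" for v n
  proof -
    obtain x where x: "x \<in> carrier R" "v = e x" using v(1) by (rule BE)
    have "e (x [^]\<^bsub>R\<^esub> n) \<in> e ` J" using v(2) by (simp add: x e_pow)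
    then have "x [^]\<^bsub>R\<^esub> n \<in> J" using mem_image_iff[OF J(2)] x(1) by simp
    then have "x \<in> J" using tp x(1) unfolding test_pair_def radical_ideal_def by blast
    then show ?thesis unfolding x(2) by (rule imageI)
  qed
  show "e ` J \<subseteq> P" if P: "prime_in B P" "not_normal_at B P" for P
  proof -
    note P' = prime_preimage[OF P(1)]
    have "{x \<in> carrier R. e x \<in> P} \<in> non_normal_locus R e"
      using non_normal_iff[OF P'(1)] P(2) unfolding P'(2) by blast
    then have "J \<subseteq> {x \<in> carrier R. e x \<in> P}" using tp unfolding test_pair_def vanishing_locus_def by blast
    then show ?thesis by blast
  qed
qed

text \<open>J is the radical of the principal ideal generated by d, written out by elements.\<close>

lemma radical_in:
  assumes "d \<in> B"
  defines "J \<equiv> {v \<in> B. \<exists>n. \<exists>r\<in>B. v ^ n = r * d}"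
  shows "ideal_in B J" "\<And>x n. x \<in> B \<Longrightarrow> x ^ n \<in> J \<Longrightarrow> x \<in> J" "d \<in> J"
    "\<And>P. prime_in B P \<Longrightarrow> d \<in> P \<Longrightarrow> J \<subseteq> P"
proof -
  note B = orderD(3,4,6,7)[OF order] order_power[OF order] order_sum[OF order]
  have JI: "v \<in> J" if "v \<in> B" "v ^ n = r * d" "r \<in> B" for v n r unfolding J_def using that by blast
  have JE: "\<exists>n r. r \<in> B \<and> v \<in> B \<and> v ^ n = r * d" if "v \<in> J" for v using that unfolding J_def by blast
  show "d \<in> J" using JI[OF assms(1), of 1 1] B(4) by simp
  show "ideal_in B J"
    unfolding ideal_in_def
  proof (intro conjI ballI)
    show "J \<subseteq> B" unfolding J_def by blast
    show "0 \<in> J" using JI[OF B(3), of 1 0] B(3) by simp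
    fix a b assume a: "a \<in> J"
    from JE[OF a] obtain n r where r: "r \<in> B" "a \<in> B" "a ^ n = r * d" by blast
    {
      assume "b \<in> J"
      from JE[OF this] obtain m s where s: "s \<in> B" "b \<in> B" "b ^ m = s * d" by blast
      \<comment> \<open>Each term of the binomial expansion of (a + b)^(n + m) contains a^n or b^m,
        both multiples of d.\<close>
      have "\<exists>t\<in>B. of_nat ((n + m) choose k) * a ^ k * b ^ (n + m - k) = t * d" if "k \<le> n + m" for k
      proof (cases "n \<le> k")
        case True
        then have "a ^ k = r * d * a ^ (k - n)" by (simp flip: r(3) power_add)
        then have eq: "of_nat ((n + m) choose k) * a ^ k * b ^ (n + m - k)
            = (of_nat ((n + m) choose k) * r * a ^ (k - n) * b ^ (n + m - k)) * d" by simp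
        have "of_nat l \<in> B" for l by (induction l) (simp_all add: B)
        then have "of_nat ((n + m) choose k) * r * a ^ (k - n) * b ^ (n + m - k) \<in> B"
          using r s by (intro B)
        with eq show ?thesis by blast
      next
        case False
        then have "b ^ (n + m - k) = s * d * b ^ (n - k)"
          by (simp add: add.commute flip: s(3) power_add)
        then have eq: "of_nat ((n + m) choose k) * a ^ k * b ^ (n + m - k)
            = (of_nat ((n + m) choose k) * a ^ k * s * b ^ (n - k)) * d" by simp
        have "of_nat l \<in> B" for l by (induction l) (simp_all add: B)
        then have "of_nat ((n + m) choose k) * a ^ k * s * b ^ (n - k) \<in> B"
          using r s by (intro B)
        with eq show ?thesis by blast
      qed
      then have "\<forall>k. \<exists>t. k \<le> n + m \<longrightarrow> t \<in> B \<and> of_nat ((n + m) choose k) * a ^ k * b ^ (n + m - k) = t * d" by blast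
      from choice[OF this] obtain t where t: "\<And>k. k \<le> n + m \<Longrightarrow>
        t k \<in> B \<and> of_nat ((n + m) choose k) * a ^ k * b ^ (n + m - k) = t k * d" by blast
      have "(a + b) ^ (n + m) = (\<Sum>k\<le>n + m. t k * d)"
        unfolding binomial_ring using t by (intro sum.cong) auto
      also have "\<dots> = (\<Sum>k\<le>n + m. t k) * d" by (simp add: sum_distrib_right)
      finally show "a + b \<in> J"
        by (rule JI[rotated]) (use t r(2) s(2) in \<open>auto intro!: B\<close>)
    next
      assume b: "b \<in> B"
      have "(b * a) ^ n = (b ^ n * r) * d" by (simp add: power_mult_distrib r(3))
      then show "b * a \<in> J" by (rule JI[rotated]) (use b r in \<open>auto intro!: B\<close>)
    }
  qed
  show "x \<in> J" if x: "x \<in> B" "x ^ n \<in> J" for x n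
  proof -
    from JE[OF x(2)] obtain m r where r: "r \<in> B" "(x ^ n) ^ m = r * d" by blast
    show ?thesis by (rule JI[OF x(1) _ r(1), of "n * m"]) (simp add: power_mult r(2))
  qed
  show "J \<subseteq> P" if P: "prime_in B P" "d \<in> P" for P
  proof
    fix v assume "v \<in> J"
    from JE[OF this] obtain n r where r: "r \<in> B" "v \<in> B" "v ^ n = r * d" by blast
    have vn: "v ^ n \<in> P" unfolding r(3) using P r(1) unfolding prime_in_def by blast
    have "v ^ k \<in> P \<Longrightarrow> v \<in> P" for k
    proof (induction k)
      case 0
      then show ?case using P(1) unfolding prime_in_def by simp
    next
      case (Suc k)
      have "v ^ k \<in> B" using r(2) by (rule B)
      with Suc P(1) r(2) show ?case unfolding prime_in_def power_Suc by blast
    qed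
    with vn show "v \<in> P" by blast
  qed
qed

text \<open>The radical of Fy together with the nonzero element Fy: every non-normal prime contains
  Fy and hence this radical. As Fy lies in A, the choice works at every stage.\<close>

lemma test_pair_exists:
  obtains J a where "test_pair R e J a"
proof -
  have FyB: "Fy \<in> B" using Fy_in_A orderD(1)[OF order] by blast
  then obtain a where a: "a \<in> carrier R" "Fy = e a" by (rule BE)
  define J where "J = {v \<in> B. \<exists>n. \<exists>r\<in>B. v ^ n = r * Fy}"
  have J1: "ideal_in B J" unfolding J_def by (rule radical_in(1)[OF FyB])
  have J2: "x \<in> J" if "x \<in> B" "x ^ n \<in> J" for x n
    using that unfolding J_def by (rule radical_in(2)[OF FyB])
  have J3: "Fy \<in> J" unfolding J_def by (rule radical_in(3)[OF FyB])
  have J4: "J \<subseteq> P" if "prime_in B P" "Fy \<in> P" for P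
    using that unfolding J_def by (rule radical_in(4)[OF FyB])
  define J' where "J' = {x \<in> carrier R. e x \<in> J}"
  have "ideal J' R" unfolding J'_def by (rule ideal_preimage[OF ideal_inD[OF J1]])
  moreover have "x \<in> J'" if "x \<in> carrier R" "x [^]\<^bsub>R\<^esub> (n::nat) \<in> J'" for x n
    using that J2[of "e x" n] e_in_B by (simp add: J'_def e_pow)
  moreover have "J' \<subseteq> P" if P: "P \<in> non_normal_locus R e" for P
  proof -
    have prime: "primeideal P R" using P unfolding non_normal_locus_def by blast
    then interpret P: primeideal P R .
    have "Fy \<in> e ` P"
      using Fy_in_non_normal_prime[OF order prime_image[OF prime]] non_normal_iff[OF prime] P by blast
    then have JP: "J \<subseteq> e ` P" by (rule J4[OF prime_image[OF prime]])
    show "J' \<subseteq> P"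
    proof
      fix x assume "x \<in> J'"
      then have "x \<in> carrier R" "e x \<in> e ` P" using JP unfolding J'_def by auto
      then show "x \<in> P" using mem_image_iff[OF P.a_subset] by simp
    qed
  qed
  then have "non_normal_locus R e \<subseteq> vanishing_locus R J'"
    unfolding vanishing_locus_def non_normal_locus_def by blast
  moreover have "a \<in> J'" unfolding J'_def using a J3 by simp
  moreover have "a \<noteq> \<zero>\<^bsub>R\<^esub>" using a(2) Fy_nonzero e_zero by auto
  ultimately have "test_pair R e J' a" unfolding test_pair_def radical_ideal_def by blast
  then show ?thesis by (rule that)
qed

end


section \<open>Bases from relation matrices\<close>

lemma mult_mat_vec_transpose:
  fixes U :: "'r::comm_ring_1 mat"
  assumes "U \<in> carrier_mat m r" "c \<in> carrier_vec m" "j < r"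
  shows "(transpose_mat U *\<^sub>v c) $ j = (\<Sum>i<m. c $ i * U $$ (i, j))"
  using assms by (simp add: scalar_prod_def atLeast0LessThan mult.commute)

lemma mat_mult_entry:
  fixes M1 :: "'r::comm_ring_1 mat"
  assumes "M1 \<in> carrier_mat n m" "M2 \<in> carrier_mat m r" "i < n" "j < r"
  shows "(M1 * M2) $$ (i, j) = (\<Sum>k<m. M1 $$ (i, k) * M2 $$ (k, j))"
  using assms by (simp add: scalar_prod_def atLeast0LessThan)

context separable_curve
begin

definition relations :: "nat \<Rightarrow> (nat \<Rightarrow> 'l) \<Rightarrow> 'a poly vec set" where
  "relations r b = {v \<in> carrier_vec r. lincomb r (\<lambda>i. v $ i) b = 0}"

text \<open>The span of \<open>b\<close> is torsion free, so a diagonal entry of the Smith normal form is \<open>0\<close> or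
  kills (hence annihilates) the corresponding row of \<open>H'\<close>; the remaining rows map to a basis.\<close>

theorem basis_of_smith_normal_form:
  assumes span: "Abar = fam_span r b"
    and U: "U \<in> carrier_mat m r" "relations r b = (\<lambda>c. transpose_mat U *\<^sub>v c) ` carrier_vec m"
    and P: "mutually_inverse m P P'" and H: "mutually_inverse r H H'"
    and D: "smith_normal_form (P * U * H)"
  defines "w \<equiv> \<lambda>i. lincomb r (\<lambda>j. row H' (r - N + i) $ j) b"
  shows "is_basis w" "Abar = fam_span N w"
proof -
  define D where "D = P * U * H"
  have Pc: "P \<in> carrier_mat m m" "P' \<in> carrier_mat m m" "P' * P = 1\<^sub>m m"
    using P unfolding mutually_inverse_def inverts_mat_def by auto
  have Qc: "H \<in> carrier_mat r r" "H' \<in> carrier_mat r r" "H * H' = 1\<^sub>m r" "H' * H = 1\<^sub>m r"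
    using H unfolding mutually_inverse_def inverts_mat_def by auto
  have PU: "P * U \<in> carrier_mat m r" using Pc(1) U(1) by (rule mult_carrier_mat)
  have Dc: "D \<in> carrier_mat m r" unfolding D_def using PU Qc(1) by (rule mult_carrier_mat)
  have DQ: "D * H' = P * U"
    unfolding D_def by (simp only: assoc_mult_mat[OF PU Qc(1,2)] Qc(3) right_mult_one_mat[OF PU])
  have UD: "U = P' * (D * H')"
    unfolding DQ by (simp only: assoc_mult_mat[OF Pc(2,1) U(1), symmetric] Pc(3) left_mult_one_mat[OF U(1)])
  have diag: "D $$ (i, j) = 0" if "i < m" "j < r" "i \<noteq> j" for i j
    using D that Dc unfolding smith_normal_form_def D_def[symmetric] diagonal_mat_def by auto
  have chain: "D $$ (i, i) dvd D $$ (Suc i, Suc i)" if "Suc i < min m r" for i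
    using D that Dc unfolding smith_normal_form_def D_def[symmetric] by auto
  \<comment> \<open>\<open>q i\<close> is the element of Abar whose coefficients form row i of
    \<open>H'\<close>; the w i will be the last N of these.\<close>
  define q where "q = (\<lambda>i. lincomb r (\<lambda>j. H' $$ (i, j)) b)"
  \<comment> \<open>Rows without a nonzero diagonal entry. D has only m rows, so an index from m on
    counts as zero.\<close>
  define zr where "zr = (\<lambda>i. i \<ge> m \<or> D $$ (i, i) = 0)"
  have comb: "lincomb r (\<lambda>j. \<Sum>i<n. c i * H i j) b = (\<Sum>i<n. \<kappa> (c i) * lincomb r (H i) b)" for n :: nat and c H
  proof -
    have "lincomb r (\<lambda>j. \<Sum>i<n. c i * H i j) b = (\<Sum>j<r. \<Sum>i<n. \<kappa> (c i) * (\<kappa> (H i j) * b j))"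
      unfolding lincomb_def
    proof (rule sum.cong)
      fix j
      have "\<kappa> (\<Sum>i<n. c i * H i j) = (\<Sum>i<n. \<kappa> (c i) * \<kappa> (H i j))"
        by (induction n) (simp_all add: \<kappa>_add \<kappa>_mult)
      then show "\<kappa> (\<Sum>i<n. c i * H i j) * b j = (\<Sum>i<n. \<kappa> (c i) * (\<kappa> (H i j) * b j))"
        by (simp add: sum_distrib_right mult.assoc)
    qed simp
    also have "\<dots> = (\<Sum>i<n. \<Sum>j<r. \<kappa> (c i) * (\<kappa> (H i j) * b j))" by (rule sum.swap)
    finally show ?thesis by (simp only: lincomb_def sum_distrib_left)
  qed
  have rel_row: "lincomb r (\<lambda>j. (P * U) $$ (i, j)) b = 0" if i: "i < m" for i
  proof -
    have c: "row P i \<in> carrier_vec m" using Pc(1) i by simp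
    then have "transpose_mat U *\<^sub>v row P i \<in> relations r b" unfolding U(2) by (rule imageI)
    then have "lincomb r (\<lambda>j. (transpose_mat U *\<^sub>v row P i) $ j) b = 0" unfolding relations_def by blast
    moreover have "(transpose_mat U *\<^sub>v row P i) $ j = (P * U) $$ (i, j)" if j: "j < r" for j
    proof -
      have "row P i $ k = P $$ (i, k)" if "k < m" for k using that i Pc(1) by simp
      then show ?thesis
        unfolding mult_mat_vec_transpose[OF U(1) c j] mat_mult_entry[OF Pc(1) U(1) i j] by simp
    qed
    ultimately show ?thesis by (simp add: lincomb_def)
  qed
  have DQ_entry: "(D * H') $$ (i, j) = (if i < r then D $$ (i, i) * H' $$ (i, j) else 0)"
    if "i < m" "j < r" for i j
  proof -
    have "(D * H') $$ (i, j) = (\<Sum>k<r. if k = i then D $$ (i, i) * H' $$ (i, j) else 0)"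
      unfolding mat_mult_entry[OF Dc Qc(2) that] using diag[OF that(1)]
      by (intro sum.cong) auto
    then show ?thesis by simp
  qed
  have q0: "q i = 0" if i: "i < r" "\<not> zr i" for i
  proof -
    have im: "i < m" "D $$ (i, i) \<noteq> 0" using i unfolding zr_def by auto
    have "lincomb r (\<lambda>j. D $$ (i, i) * H' $$ (i, j)) b = lincomb r (\<lambda>j. (P * U) $$ (i, j)) b"
      using DQ_entry[OF im(1)] i(1) unfolding DQ by (intro lincomb_cong) auto
    then have "\<kappa> (D $$ (i, i)) * q i = 0"
      unfolding q_def lincomb_scale rel_row[OF im(1)] .
    then show ?thesis using im(2) by simp
  qed
  have b_q: "b j = (\<Sum>i<r. \<kappa> (H $$ (j, i)) * q i)" if j: "j < r" for j
  proof -
    have e: "(\<Sum>i<r. H $$ (j, i) * H' $$ (i, k)) = (if k = j then 1 else 0)" if k: "k < r" for k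
      unfolding mat_mult_entry[OF Qc(1,2) j k, symmetric] Qc(3) using j k by simp
    have "(\<Sum>i<r. \<kappa> (H $$ (j, i)) * q i) = lincomb r (\<lambda>k. \<Sum>i<r. H $$ (j, i) * H' $$ (i, k)) b"
      unfolding q_def by (rule comb[symmetric])
    also have "\<dots> = lincomb r (\<lambda>k. if k = j then 1 else 0) b" using e by (intro lincomb_cong) auto
    also have "\<dots> = b j" using lincomb_single[OF j, of 1 b] by (simp add: \<kappa>_1)
    finally show ?thesis by simp
  qed
  have q_Abar: "q i \<in> Abar" for i unfolding span q_def fam_span_def by blast
  \<comment> \<open>A relation among the q i makes v = c H' a vector in the row space of U = P' D
    H'. Multiplying by H on the right gives c = e D for some row e, and this has entry 0 wherever
    the diagonal of D is 0 or missing.\<close>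
  have indep_q: "c i = 0" if c: "(\<Sum>i<r. \<kappa> (c i) * q i) = 0" "\<And>i. i < r \<Longrightarrow> \<not> zr i \<Longrightarrow> c i = 0" and i: "i < r" for c i
  proof (cases "zr i")
    case False
    then show ?thesis using c(2) i by blast
  next
    case True
    define v where "v = vec r (\<lambda>j. \<Sum>k<r. c k * H' $$ (k, j))"
    have "lincomb r (\<lambda>j. v $ j) b = lincomb r (\<lambda>j. \<Sum>k<r. c k * H' $$ (k, j)) b"
      by (rule lincomb_cong) (simp_all add: v_def)
    also have "\<dots> = 0" using c(1) unfolding comb q_def .
    finally have "v \<in> relations r b" unfolding relations_def v_def by simp
    then obtain d where d: "d \<in> carrier_vec m" "v = transpose_mat U *\<^sub>v d" unfolding U(2) by blast
    define e where "e = (\<lambda>k. \<Sum>l<m. d $ l * P' $$ (l, k))"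
    have vj: "v $ j = (\<Sum>k<m. e k * (if k < r then D $$ (k, k) * H' $$ (k, j) else 0))" if j: "j < r" for j
    proof -
      have "v $ j = (\<Sum>l<m. d $ l * (\<Sum>k<m. P' $$ (l, k) * (D * H') $$ (k, j)))"
        unfolding d(2) mult_mat_vec_transpose[OF U(1) d(1) j]
      proof (rule sum.cong)
        fix l assume "l \<in> {..<m}"
        then have l: "l < m" by simp
        have "U $$ (l, j) = (\<Sum>k<m. P' $$ (l, k) * (D * H') $$ (k, j))"
          by (subst UD) (rule mat_mult_entry[OF Pc(2) mult_carrier_mat[OF Dc Qc(2)] l j])
        then show "d $ l * U $$ (l, j) = d $ l * (\<Sum>k<m. P' $$ (l, k) * (D * H') $$ (k, j))" by simp
      qed simp
      also have "\<dots> = (\<Sum>k<m. e k * (D * H') $$ (k, j))"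
        unfolding e_def sum_distrib_right sum_distrib_left
        by (subst sum.swap) (simp add: mult.assoc)
      also have "\<dots> = (\<Sum>k<m. e k * (if k < r then D $$ (k, k) * H' $$ (k, j) else 0))"
        using DQ_entry[OF _ j] by (intro sum.cong) auto
      finally show ?thesis .
    qed
    have QQ: "(\<Sum>j<r. H' $$ (k, j) * H $$ (j, i)) = (if k = i then 1 else 0)" if k: "k < r" for k
      unfolding mat_mult_entry[OF Qc(2,1) k i, symmetric] Qc(4) using k i by simp
    have "(\<Sum>j<r. v $ j * H $$ (j, i)) = (\<Sum>j<r. \<Sum>k<r. c k * (H' $$ (k, j) * H $$ (j, i)))"
      by (intro sum.cong) (simp_all add: v_def sum_distrib_right mult.assoc)
    also have "\<dots> = (\<Sum>k<r. c k * (\<Sum>j<r. H' $$ (k, j) * H $$ (j, i)))"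
      unfolding sum_distrib_left by (rule sum.swap)
    also have "\<dots> = (\<Sum>k<r. if k = i then c k else 0)" using QQ by (intro sum.cong) auto
    also have "\<dots> = c i" using i by simp
    finally have 1: "(\<Sum>j<r. v $ j * H $$ (j, i)) = c i" .
    have "(\<Sum>j<r. v $ j * H $$ (j, i))
        = (\<Sum>j<r. \<Sum>k<m. e k * (if k < r then D $$ (k, k) * (H' $$ (k, j) * H $$ (j, i)) else 0))"
    proof (rule sum.cong)
      fix j assume "j \<in> {..<r}"
      then show "v $ j * H $$ (j, i) = (\<Sum>k<m. e k * (if k < r then D $$ (k, k) * (H' $$ (k, j) * H $$ (j, i)) else 0))"
        using vj[of j] by (simp add: sum_distrib_right mult.assoc if_distrib[of "\<lambda>x. x * _"] cong: if_cong)
    qed simp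
    also have "\<dots> = (\<Sum>k<m. \<Sum>j<r. e k * (if k < r then D $$ (k, k) * (H' $$ (k, j) * H $$ (j, i)) else 0))"
      by (rule sum.swap)
    also have "\<dots> = 0"
    proof (rule sum.neutral, rule ballI)
      fix k assume k: "k \<in> {..<m}"
      show "(\<Sum>j<r. e k * (if k < r then D $$ (k, k) * (H' $$ (k, j) * H $$ (j, i)) else 0)) = 0"
      proof (cases "k < r")
        case kr: True
        have "(\<Sum>j<r. e k * (if k < r then D $$ (k, k) * (H' $$ (k, j) * H $$ (j, i)) else 0))
            = e k * D $$ (k, k) * (\<Sum>j<r. H' $$ (k, j) * H $$ (j, i))"
          using kr by (simp add: sum_distrib_left mult.assoc)
        also have "\<dots> = 0" unfolding QQ[OF kr] using True k by (auto simp: zr_def)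
        finally show ?thesis .
      qed simp
    qed
    finally show "c i = 0" using 1 by simp
  qed
  \<comment> \<open>In the divisibility chain a zero entry is followed only by zeros. So the nonzero
    diagonal entries come first, and t is their number.\<close>
  have zr_Suc: "zr (Suc i)" if "zr i" "Suc i < r" for i
    using that chain[of i] by (cases "Suc i < m") (auto simp: zr_def)
  define t where "t = (LEAST i. zr i \<or> i = r)"
  have tP: "zr t \<or> t = r" unfolding t_def by (rule LeastI[of _ r]) simp
  have t_r: "t \<le> r" unfolding t_def by (rule Least_le) simp
  have not_zr: "\<not> zr i" if "i < t" for i using not_less_Least[of i "\<lambda>i. zr i \<or> i = r"] that unfolding t_def by blast
  have zr_ge: "zr i" if "t \<le> i" "i < r" for i
    using that
  proof (induction i rule: dec_induct)
    case base
    then show ?case using tP by auto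
  next
    case (step n)
    then show ?case using zr_Suc[of n] by simp
  qed
  have split_sum: "(\<Sum>i<r. h i) = (\<Sum>i<t. h i) + (\<Sum>i<r - t. h (t + i))" for h :: "nat \<Rightarrow> 'l"
  proof -
    have "(\<Sum>i<r - t. h (t + i)) = (\<Sum>i\<in>{t..<r}. h i)"
      by (rule sum.reindex_bij_witness[of _ "\<lambda>i. i - t" "\<lambda>i. t + i"]) auto
    moreover have sp: "{..<r} = {..<t} \<union> {t..<r}" using t_r by auto
    have "(\<Sum>i<r. h i) = (\<Sum>i<t. h i) + (\<Sum>i\<in>{t..<r}. h i)"
      unfolding sp by (rule sum.union_disjoint) auto
    ultimately show ?thesis by simp
  qed
  have split_q: "(\<Sum>i<r. \<kappa> (c i) * q i) = lincomb (r - t) (\<lambda>i. c (t + i)) (\<lambda>i. q (t + i))" for c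
    unfolding split_sum lincomb_def using q0 not_zr t_r by simp
  have span_t: "Abar = fam_span (r - t) (\<lambda>i. q (t + i))"
  proof
    show "fam_span (r - t) (\<lambda>i. q (t + i)) \<subseteq> Abar"
      by (rule fam_span_subset[OF order_subspace[OF order_Abar]]) (rule q_Abar)
    show "Abar \<subseteq> fam_span (r - t) (\<lambda>i. q (t + i))"
      unfolding span
    proof (rule fam_span_subset[OF subspace_fam_span])
      fix j assume "j < r"
      show "b j \<in> fam_span (r - t) (\<lambda>i. q (t + i))"
        unfolding b_q[OF \<open>j < r\<close>] split_q fam_span_def by (rule rangeI)
    qed
  qed
  have ind_t: "fam_indep (r - t) (\<lambda>i. q (t + i))"
    unfolding fam_indep_def
  proof (intro allI impI)
    fix c i assume c: "lincomb (r - t) c (\<lambda>i. q (t + i)) = 0" and i: "i < r - t"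
    define d where "d = (\<lambda>k. if k < t then 0 else c (k - t))"
    have "(\<Sum>i<r. \<kappa> (d i) * q i) = lincomb (r - t) c (\<lambda>i. q (t + i))"
      unfolding split_q by (rule lincomb_cong) (simp_all add: d_def)
    with c have "(\<Sum>i<r. \<kappa> (d i) * q i) = 0" by simp
    moreover have "d k = 0" if "k < r" "\<not> zr k" for k using that zr_ge[of k] by (auto simp: d_def)
    moreover have "t + i < r" using i by simp
    ultimately have "d (t + i) = 0" by (rule indep_q[of d "t + i"])
    then show "c i = 0" by (simp add: d_def)
  qed
  obtain h where h: "is_basis h" "Abar = fam_span N h" using order_basis[OF order_Abar] .
  \<comment> \<open>Two k[x]-bases of Abar have equal length, so r - t = N and the surviving rows
    are exactly those with index r - N + i for i < N.\<close>
  have "r - t \<le> N"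
    by (rule indep_in_span_le[OF ind_t, of N h]) (use q_Abar h(2) in blast)
  moreover have "N \<le> r - t"
  proof (rule indep_in_span_le[of N h])
    show "fam_indep N h" using h(1) by (simp add: is_basis_def)
    show "h i \<in> fam_span (r - t) (\<lambda>i. q (t + i))" if "i < N" for i
      using fam_span_base[OF that, of h] unfolding h(2)[symmetric] span_t[symmetric] .
  qed
  ultimately have rt: "r - t = N" by simp
  then have t: "t = r - N" "N \<le> r" using N_pos t_r by auto
  have wq: "w i = q (t + i)" if "i < N" for i
    unfolding w_def q_def t(1) using that t(2) Qc(2) by (intro lincomb_cong) auto
  have "lincomb N c w = lincomb N c (\<lambda>i. q (t + i))" for c by (rule lincomb_cong) (simp_all add: wq)
  then have *: "fam_span N w = fam_span N (\<lambda>i. q (t + i))" "fam_indep N w = fam_indep N (\<lambda>i. q (t + i))"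
    unfolding fam_span_def fam_indep_def by simp_all
  show "Abar = fam_span N w" using span_t unfolding rt * .
  show "is_basis w"
    unfolding is_basis_def *(2) using ind_t q_Abar orderD(2)[OF order_Abar] by (auto simp: rt wq)
qed

end

section \<open>Row vectors over k[x] and the existence of a Smith normal form\<close>

global_interpretation rowmod: pid_module "\<lambda>p (v::nat \<Rightarrow> 'a::field poly) i. p * v i"
  by unfold_locales (auto simp: fun_eq_iff algebra_simps)

lemma rowmod_lincomb: "rowmod.lincomb n c g = (\<lambda>j. \<Sum>i<n. c i * g i j)"
proof
  fix j
  show "rowmod.lincomb n c g j = (\<Sum>i<n. c i * g i j)"
    unfolding rowmod.lincomb_def by (induction n) simp_all
qed

definition unit_row :: "nat \<Rightarrow> nat \<Rightarrow> 'a::field poly" where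
  "unit_row i j = (if i = j then 1 else 0)"

lemma unit_row_comb: "rowmod.lincomb r c unit_row = (\<lambda>j. if j < r then c j else 0)"
proof
  fix j
  have "(\<Sum>i<r. c i * unit_row i j) = (\<Sum>i<r. if i = j then c i else 0)"
    by (rule sum.cong) (auto simp: unit_row_def)
  then show "rowmod.lincomb r c unit_row j = (if j < r then c j else 0)"
    by (simp add: rowmod_lincomb)
qed

lemma unit_row_indep: "rowmod.fam_indep r unit_row"
  unfolding rowmod.fam_indep_def unit_row_comb
proof (intro allI impI)
  fix c :: "nat \<Rightarrow> 'a poly" and i assume *: "(\<lambda>j. if j < r then c j else 0) = 0" "i < r"
  from fun_cong[OF *(1), of i] *(2) show "c i = 0" by simp
qed

context separable_curve
begin

text \<open>The relation module is a direct summand of \<open>k[x]^r\<close>: a basis of it and lifts of a basis of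
  \<open>Abar\<close> are the rows of an invertible matrix \<open>H'\<close>.\<close>

theorem smith_normal_form_exists:
  assumes span: "Abar = fam_span r b"
  shows "\<exists>m U H H'. U \<in> carrier_mat m r \<and> relations r b = (\<lambda>c. transpose_mat U *\<^sub>v c) ` carrier_vec m \<and>
    mutually_inverse m (1\<^sub>m m :: 'a poly mat) (1\<^sub>m m) \<and> mutually_inverse r H H' \<and> smith_normal_form (1\<^sub>m m * U * H)"
proof -
  \<comment> \<open>The relation module. Rows are functions on all of nat, and a row of length r is
    one that vanishes from r on, so K lies in the span of the first r unit rows.\<close>
  define K where "K = {v. (\<forall>j\<ge>r. v j = 0) \<and> lincomb r v b = 0}"
  have "rowmod.subspace K"
  proof (rule rowmod.subspaceI)
    show "0 \<in> K" by (simp add: K_def lincomb_def)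
    fix v w assume vw: "v \<in> K" "w \<in> K"
    have "lincomb r (\<lambda>i. v i + w i) b = 0" using vw unfolding K_def lincomb_add[symmetric] by simp
    then show "v + w \<in> K" using vw by (simp add: K_def plus_fun_def)
  next
    fix p v assume v: "v \<in> K"
    have "lincomb r (\<lambda>i. p * v i) b = 0" using v unfolding K_def lincomb_scale[symmetric] by simp
    then show "(\<lambda>i. p * v i) \<in> K" using v by (simp add: K_def)
  qed
  moreover have unit_span: "v \<in> rowmod.fam_span r unit_row" if "\<forall>j\<ge>r. v j = 0" for v
  proof -
    have eq: "v = rowmod.lincomb r v unit_row" unfolding unit_row_comb using that by (auto simp: fun_eq_iff)
    show ?thesis unfolding rowmod.fam_span_def by (subst eq) (rule rangeI)
  qed
  then have "K \<subseteq> rowmod.fam_span r unit_row" unfolding K_def by blast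
  ultimately obtain m g where g: "K = rowmod.fam_span m g" "rowmod.fam_indep m g"
    using rowmod.submodule_fin_gen unit_row_indep by metis
  have gK: "g i \<in> K" if "i < m" for i unfolding g(1) using that by (rule rowmod.fam_span_base)
  obtain h where h: "is_basis h" "Abar = fam_span N h" using order_basis[OF order_Abar] .
  have h_ind: "fam_indep N h" using h(1) by (simp add: is_basis_def)
  have "\<exists>c. j < N \<longrightarrow> (\<forall>i\<ge>r. c i = 0) \<and> lincomb r c b = h j" for j
  proof (cases "j < N")
    case True
    then have "h j \<in> fam_span r b" unfolding span[symmetric] h(2) by (rule fam_span_base)
    then obtain c where c: "h j = lincomb r c b" unfolding fam_span_def by blast
    have "lincomb r (\<lambda>i. if i < r then c i else 0) b = h j" unfolding c by (rule lincomb_cong) auto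
    then show ?thesis by (intro exI[of _ "\<lambda>i. if i < r then c i else 0"]) auto
  qed simp
  then have "\<forall>j. \<exists>c. j < N \<longrightarrow> (\<forall>i\<ge>r. c i = 0) \<and> lincomb r c b = h j" by blast
  from choice[OF this] obtain l
    where l: "\<And>j. j < N \<Longrightarrow> (\<forall>i\<ge>r. l j i = 0) \<and> lincomb r (l j) b = h j" by blast
  \<comment> \<open>The rows of the future matrix \<open>H'\<close>: a basis g of the relations,
    followed by lifts l of a basis of Abar.\<close>
  define V where "V = (\<lambda>i. if i < m then g i else l (i - m))"
  have V0: "V i j = 0" if "i < m + N" "r \<le> j" for i j
    using gK[of i] l[of "i - m"] that by (auto simp: V_def K_def)
  have split: "rowmod.lincomb (m + N) c V = rowmod.lincomb m c g + rowmod.lincomb N (\<lambda>i. c (m + i)) l" for c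
  proof
    fix j
    have sp: "(\<Sum>i<m + n. f' i) = (\<Sum>i<m. f' i) + (\<Sum>i<n. f' (m + i))" for n and f' :: "nat \<Rightarrow> 'a poly"
      by (induction n) (simp_all add: add.assoc)
    show "rowmod.lincomb (m + N) c V j = (rowmod.lincomb m c g + rowmod.lincomb N (\<lambda>i. c (m + i)) l) j"
      by (simp add: rowmod_lincomb sp V_def)
  qed
  have pi: "lincomb r (rowmod.lincomb n c u) b = lincomb n c (\<lambda>i. lincomb r (u i) b)" for n c u
  proof (induction n)
    case 0
    then show ?case by (simp add: lincomb_def rowmod_lincomb)
  next
    case (Suc n)
    have "rowmod.lincomb (Suc n) c u = (\<lambda>j. rowmod.lincomb n c u j + c n * u n j)"
      by (simp add: rowmod_lincomb)
    then show ?case using Suc by (simp add: lincomb_Suc flip: lincomb_add lincomb_scale)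
  qed
  have pi_add: "lincomb r (u + v) b = lincomb r u b + lincomb r v b" for u v
    by (simp add: lincomb_add plus_fun_def)
  have pi_l: "lincomb r (rowmod.lincomb N c l) b = lincomb N c h" for c
    unfolding pi by (rule lincomb_cong) (use l in auto)
  have pi_g: "lincomb r (rowmod.lincomb m c g) b = 0" for c
  proof -
    have "rowmod.lincomb m c g \<in> K" unfolding g(1) rowmod.fam_span_def by (rule rangeI)
    then show ?thesis by (simp add: K_def)
  qed
  have V_ind: "rowmod.fam_indep (m + N) V"
    unfolding rowmod.fam_indep_def
  proof (intro allI impI)
    fix c i assume c: "rowmod.lincomb (m + N) c V = 0" and i: "i < m + N"
    have "lincomb r (rowmod.lincomb (m + N) c V) b = 0" unfolding c by (simp add: lincomb_def)
    then have "lincomb N (\<lambda>i. c (m + i)) h = 0" unfolding split pi_add pi_l pi_g by simp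
    then have cl: "c (m + j) = 0" if "j < N" for j using fam_indepD[OF h_ind _ that] by blast
    have "rowmod.lincomb N (\<lambda>i. c (m + i)) l = 0"
      using cl by (simp add: rowmod_lincomb fun_eq_iff)
    with c have "rowmod.lincomb m c g = 0" unfolding split by simp
    then have cg: "c j = 0" if "j < m" for j using rowmod.fam_indepD[OF g(2) _ that] by blast
    show "c i = 0"
    proof (cases "i < m")
      case False
      then show ?thesis using cl[of "i - m"] i by simp
    qed (rule cg)
  qed
  have V_span: "unit_row k \<in> rowmod.fam_span (m + N) V" if k: "k < r" for k
  proof -
    have ub: "lincomb r (unit_row k) b = b k"
      using lincomb_single[OF k, of 1 b] unfolding unit_row_def by (simp add: \<kappa>_1 eq_commute cong: if_cong)
    have "b k \<in> Abar" unfolding span using k by (rule fam_span_base)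
    then obtain d where d: "b k = lincomb N d h" unfolding h(2) fam_span_def by blast
    \<comment> \<open>A unit row differs from a lift of its image b k by a relation, so the two
      blocks of V together reach it.\<close>
    define u where "u = (\<lambda>j. unit_row k j - rowmod.lincomb N d l j)"
    have "lincomb r u b = 0" unfolding u_def lincomb_diff[symmetric] pi_l ub d by simp
    moreover have "u j = 0" if "j \<ge> r" for j
      using that k l by (simp add: u_def unit_row_def rowmod_lincomb)
    ultimately have "u \<in> K" by (simp add: K_def)
    then obtain c where c: "u = rowmod.lincomb m c g" unfolding g(1) rowmod.fam_span_def by blast
    define e where "e = (\<lambda>i. if i < m then c i else d (i - m))"
    have "rowmod.lincomb m e g = rowmod.lincomb m c g" by (rule rowmod.lincomb_cong) (simp_all add: e_def)
    moreover have "rowmod.lincomb N (\<lambda>i. e (m + i)) l = rowmod.lincomb N d l"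
      by (rule rowmod.lincomb_cong) (simp_all add: e_def)
    ultimately have "rowmod.lincomb (m + N) e V = unit_row k"
      unfolding split by (simp add: c[symmetric] u_def fun_eq_iff)
    then show ?thesis unfolding rowmod.fam_span_def by (metis rangeI)
  qed
  have "r \<le> m + N" by (rule rowmod.indep_in_span_le[OF unit_row_indep V_span])
  moreover have "m + N \<le> r"
    by (rule rowmod.indep_in_span_le[OF V_ind unit_span]) (use V0 in blast)
  ultimately have r: "r = m + N" by simp
  have "\<exists>c. k < r \<longrightarrow> unit_row k = rowmod.lincomb r c V" for k
    using V_span[of k] unfolding rowmod.fam_span_def r by (cases "k < m + N") auto
  then have "\<forall>k. \<exists>c. k < r \<longrightarrow> unit_row k = rowmod.lincomb r c V" by blast
  from choice[OF this] obtain q where q: "\<And>k. k < r \<Longrightarrow> unit_row k = rowmod.lincomb r (q k) V" by blast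
  define H' where "H' = mat r r (\<lambda>(i, j). V i j)"
  define H where "H = mat r r (\<lambda>(i, j). q i j)"
  have Qc: "H \<in> carrier_mat r r" "H' \<in> carrier_mat r r" by (simp_all add: H_def H'_def)
  have QQ': "H * H' = 1\<^sub>m r"
  proof (rule eq_matI)
    fix i j assume "i < dim_row (1\<^sub>m r)" "j < dim_col (1\<^sub>m r)"
    then have ij: "i < r" "j < r" by simp_all
    have "(H * H') $$ (i, j) = (\<Sum>k<r. q i k * V k j)"
      unfolding mat_mult_entry[OF Qc ij] using ij by (intro sum.cong) (auto simp: H_def H'_def)
    also have "\<dots> = unit_row i j" using fun_cong[OF q[OF ij(1)], of j] by (simp add: rowmod_lincomb)
    finally show "(H * H') $$ (i, j) = 1\<^sub>m r $$ (i, j)" using ij by (simp add: unit_row_def)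
  qed (use Qc in simp_all)
  have H'H: "H' * H = 1\<^sub>m r"
  proof (rule eq_matI)
    fix i j assume "i < dim_row (1\<^sub>m r)" "j < dim_col (1\<^sub>m r)"
    then have ij: "i < r" "j < r" by simp_all
    have "H' * H * H' = H'"
      by (simp only: assoc_mult_mat[OF Qc(2,1,2)] QQ' right_mult_one_mat[OF Qc(2)])
    then have "(H' * H * H') $$ (i, k) = V i k" if "k < r" for k using ij that by (simp add: H'_def)
    moreover have "(H' * H * H') $$ (i, k) = (\<Sum>t<r. (H' * H) $$ (i, t) * V t k)" if k: "k < r" for k
      unfolding mat_mult_entry[OF mult_carrier_mat[OF Qc(2,1)] Qc(2) ij(1) k]
      using k by (intro sum.cong) (auto simp: H'_def)
    ultimately have e: "(\<Sum>t<r. (H' * H) $$ (i, t) * V t k) = V i k" if "k < r" for k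
      using that by simp
    \<comment> \<open>From H' H H' = H', row i of H' H and row i of the identity give the same
      combination of the rows V; these are independent, so the two rows agree. Thus the right
      inverse of H is also its left inverse.\<close>
    have "rowmod.lincomb r (\<lambda>t. (H' * H) $$ (i, t)) V = rowmod.lincomb r (\<lambda>t. if t = i then 1 else 0) V"
      unfolding rowmod.lincomb_single[OF ij(1)]
    proof
      fix k
      show "rowmod.lincomb r (\<lambda>t. (H' * H) $$ (i, t)) V k = 1 * V i k"
      proof (cases "k < r")
        case True
        then show ?thesis using e[OF True] by (simp add: rowmod_lincomb)
      next
        case False
        then show ?thesis using V0 ij(1) by (simp add: rowmod_lincomb r)
      qed
    qed
    from rowmod.fam_indep_eq[OF V_ind[folded r] this ij(2)]
    show "(H' * H) $$ (i, j) = 1\<^sub>m r $$ (i, j)" using ij by auto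
  qed (use Qc in simp_all)
  define U where "U = mat m r (\<lambda>(i, j). V i j)"
  have U: "U \<in> carrier_mat m r" by (simp add: U_def)
  have rel: "relations r b = (\<lambda>c. transpose_mat U *\<^sub>v c) ` carrier_vec m"
  proof (intro equalityI subsetI)
    fix v assume v: "v \<in> relations r b"
    define v' where "v' = (\<lambda>j. if j < r then v $ j else 0)"
    have "lincomb r v' b = lincomb r (\<lambda>i. v $ i) b" by (rule lincomb_cong) (simp_all add: v'_def)
    then have "v' \<in> K" using v by (simp add: K_def v'_def relations_def)
    then obtain c where c: "v' = rowmod.lincomb m c g" unfolding g(1) rowmod.fam_span_def by blast
    have "v = transpose_mat U *\<^sub>v vec m c"
    proof (rule eq_vecI)
      have dv: "dim_vec v = r" using v by (simp add: relations_def)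
      then show "dim_vec v = dim_vec (transpose_mat U *\<^sub>v vec m c)" using U by simp
      fix j assume "j < dim_vec (transpose_mat U *\<^sub>v vec m c)"
      then have j: "j < r" using U by simp
      have "(transpose_mat U *\<^sub>v vec m c) $ j = (\<Sum>i<m. c i * g i j)"
        unfolding mult_mat_vec_transpose[OF U vec_carrier j]
        using j by (intro sum.cong) (auto simp: U_def V_def)
      also have "\<dots> = v $ j" using fun_cong[OF c, of j] j by (simp add: v'_def rowmod_lincomb)
      finally show "v $ j = (transpose_mat U *\<^sub>v vec m c) $ j" by simp
    qed
    then show "v \<in> (\<lambda>c. transpose_mat U *\<^sub>v c) ` carrier_vec m" by (rule image_eqI) simp
  next
    fix v assume "v \<in> (\<lambda>c. transpose_mat U *\<^sub>v c) ` carrier_vec m"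
    then obtain c where c: "c \<in> carrier_vec m" "v = transpose_mat U *\<^sub>v c" by blast
    have "lincomb r (\<lambda>i. v $ i) b = lincomb r (rowmod.lincomb m (\<lambda>i. c $ i) g) b"
    proof (rule lincomb_cong)
      fix j assume j: "j < r"
      show "v $ j = rowmod.lincomb m (\<lambda>i. c $ i) g j"
        unfolding c(2) mult_mat_vec_transpose[OF U c(1) j] rowmod_lincomb
        using j by (intro sum.cong) (auto simp: U_def V_def)
    qed simp
    moreover have "v \<in> carrier_vec r" unfolding c(2) using U c(1) by simp
    ultimately show "v \<in> relations r b" by (simp add: relations_def pi_g)
  qed
  have snf: "smith_normal_form (1\<^sub>m m * U * H)"
  proof -
    \<comment> \<open>U consists of the first m rows of H', so U H consists of the first m rows of
      the identity and is in Smith normal form already, with P = 1.\<close>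
    have "U * H = mat m r (\<lambda>(i, j). if i = j then 1 else 0)"
    proof (rule eq_matI)
      fix i j assume "i < dim_row (mat m r (\<lambda>(i, j). if i = j then 1 else (0::'a poly)))"
        "j < dim_col (mat m r (\<lambda>(i, j). if i = j then 1 else (0::'a poly)))"
      then have ij: "i < m" "j < r" by simp_all
      then have ir: "i < r" using r by simp
      have "(U * H) $$ (i, j) = (H' * H) $$ (i, j)"
        unfolding mat_mult_entry[OF U Qc(1) ij] mat_mult_entry[OF Qc(2,1) ir ij(2)]
        using ij ir by (intro sum.cong) (auto simp: U_def H'_def)
      then show "(U * H) $$ (i, j) = mat m r (\<lambda>(i, j). if i = j then 1 else 0) $$ (i, j)"
        using ij ir by (simp add: H'H)
    qed (use U Qc in simp_all)
    then show ?thesis using U by (simp add: smith_normal_form_def diagonal_mat_def)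
  qed
  have inv: "mutually_inverse r H H'" "mutually_inverse m (1\<^sub>m m :: 'a poly mat) (1\<^sub>m m)"
    unfolding mutually_inverse_def inverts_mat_def using Qc QQ' H'H by simp_all
  show ?thesis
    by (rule exI[of _ m], rule exI[of _ U], rule exI[of _ H], rule exI[of _ H'], intro conjI U rel snf inv)
qed

end


section \<open>Truncation\<close>

lemma coeff2_add [simp]: "coeff2 (p + q) e = coeff2 p e + coeff2 q e"
  and coeff2_diff [simp]: "coeff2 (u - v) e = coeff2 u e - coeff2 v e"
  and coeff2_0 [simp]: "coeff2 0 e = 0"
  for p q :: "'a::comm_ring_1 poly poly" and u v :: "'b::ab_group_add poly poly"
  by (simp_all add: coeff2_def)

lemma coeff2_smult [simp]: "coeff2 (Polynomial.smult [:c:] p) e = c * coeff2 p e"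
  for p :: "'a::comm_ring_1 poly poly"
  by (simp add: coeff2_def)

lemma coeff2_sum: "coeff2 (sum h I) e = (\<Sum>i\<in>I. coeff2 (h i) e)"
  for h :: "'i \<Rightarrow> 'a::comm_ring_1 poly poly"
  by (induction I rule: infinite_finite_induct) simp_all

lemma coeff2_monom2: "coeff2 (monom2 e :: 'a::comm_ring_1 poly poly) e' = (if e = e' then 1 else 0)"
  by (cases e; cases e') (auto simp: coeff2_def monom2_def)

lemma coeff2_monom2_mult:
  fixes p :: "'a::comm_ring_1 poly poly"
  shows "coeff2 (monom2 (a, b) * p) (c, d) = (if a \<le> c \<and> b \<le> d then coeff2 p (c - a, d - b) else 0)"
  by (simp add: coeff2_def monom2_def coeff_monom_mult)

lemma poly2_eqI: "(\<And>e. coeff2 p e = coeff2 q e) \<Longrightarrow> p = q"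
  by (intro poly_eqI) (force simp: coeff2_def)

lemma finite_supp2: "finite (supp2 p)"
proof -
  have "supp2 p \<subseteq> (\<Union>b\<in>{..Polynomial.degree p}. (\<lambda>a. (a, b)) ` {..Polynomial.degree (poly.coeff p b)})"
  proof
    fix e assume "e \<in> supp2 p"
    then have *: "poly.coeff (poly.coeff p (snd e)) (fst e) \<noteq> 0" by (simp add: supp2_def coeff2_def)
    then have "poly.coeff p (snd e) \<noteq> 0" by auto
    with * have "snd e \<le> Polynomial.degree p" "fst e \<le> Polynomial.degree (poly.coeff p (snd e))"
      by (auto intro: le_degree)
    then show "e \<in> (\<Union>b\<in>{..Polynomial.degree p}. (\<lambda>a. (a, b)) ` {..Polynomial.degree (poly.coeff p b)})"
      by (intro UN_I[of "snd e"] image_eqI[of _ _ "fst e"]) auto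
  qed
  then show ?thesis by (rule finite_subset) simp
qed

lemma supp2_empty_iff: "supp2 p = {} \<longleftrightarrow> p = 0"
proof
  assume "supp2 p = {}"
  then show "p = 0" by (intro poly2_eqI) (auto simp: supp2_def coeff2_def)
qed (auto simp: supp2_def coeff2_def)

text \<open>With deg 0 minus infinity, the bound is a condition on the support alone, and in this
  form it needs no special treatment of p = 0 or of a negative d.\<close>

lemma deg_le_iff: "deg_le p d \<longleftrightarrow> (\<forall>e\<in>supp2 p. int (fst e + snd e) \<le> d)"
proof (cases "p = 0")
  case True
  then show ?thesis using supp2_empty_iff[of p] by (simp add: deg_le_def)
next
  case False
  let ?D = "insert 0 ((\<lambda>e. fst e + snd e) ` supp2 p)"
  have fin: "finite ?D" using finite_supp2 by auto
  obtain e0 where e0: "e0 \<in> supp2 p" using False supp2_empty_iff by blast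
  have "int (Max ?D) \<le> d \<longleftrightarrow> (\<forall>x\<in>?D. int x \<le> d)"
  proof
    assume "int (Max ?D) \<le> d"
    then show "\<forall>x\<in>?D. int x \<le> d" using Max_ge[OF fin] by (meson of_nat_mono order_trans)
  next
    assume "\<forall>x\<in>?D. int x \<le> d"
    then show "int (Max ?D) \<le> d" using Max_in[OF fin] by blast
  qed
  also have "\<dots> \<longleftrightarrow> (\<forall>e\<in>supp2 p. int (fst e + snd e) \<le> d)"
    using e0 by force
  finally show ?thesis using False by (simp add: deg_le_def total_degree_def)
qed

lemma deg_le_add: "deg_le p d \<Longrightarrow> deg_le q d \<Longrightarrow> deg_le (p + q) d"
  and deg_le_diff: "deg_le p d \<Longrightarrow> deg_le q d \<Longrightarrow> deg_le (p - q) d"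
  and deg_le_smult: "deg_le p d \<Longrightarrow> deg_le (Polynomial.smult [:c:] p) d"
  and deg_le_0: "deg_le 0 d"
  for p q :: "'a::comm_ring_1 poly poly"
  unfolding deg_le_iff supp2_def by force+

global_interpretation k_space: Modules.module "\<lambda>c (p::'a::field poly poly). Polynomial.smult [:c:] p"
  by unfold_locales (simp_all add: smult_add_right smult_add_left[symmetric] mult.commute flip: one_pCons)


subsection \<open>Graded monomial orders\<close>

lemma gmoD:
  assumes "graded_monomial_order r"
  shows "(e, e) \<in> r" "(e, e') \<in> r \<Longrightarrow> (e', e'') \<in> r \<Longrightarrow> (e, e'') \<in> r"
    "(e, e') \<in> r \<Longrightarrow> (e', e) \<in> r \<Longrightarrow> e = e'" "(e, e') \<in> r \<or> (e', e) \<in> r"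
    "((a, b), (c, d)) \<in> r \<Longrightarrow> ((a + a', b + b'), (c + a', d + b')) \<in> r"
    "fst e + snd e < fst e' + snd e' \<Longrightarrow> (e, e') \<in> r"
proof -
  have lin: "linear_order r" using assms unfolding graded_monomial_order_def by blast
  then have r: "refl r" "trans r" "antisym r" "total r"
    by (auto simp: linear_order_on_def partial_order_on_def preorder_on_def)
  show "(e, e) \<in> r" using r(1) by (cases e) (auto simp: refl_on_def)
  then show "(e, e') \<in> r \<or> (e', e) \<in> r" using r(4) unfolding total_on_def by (metis UNIV_I)
  show "(e, e') \<in> r \<Longrightarrow> (e', e'') \<in> r \<Longrightarrow> (e, e'') \<in> r" using r(2) by (rule transD)
  show "(e, e') \<in> r \<Longrightarrow> (e', e) \<in> r \<Longrightarrow> e = e'" using r(3) by (rule antisymD)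
  show "((a, b), (c, d)) \<in> r \<Longrightarrow> ((a + a', b + b'), (c + a', d + b')) \<in> r"
    using assms unfolding graded_monomial_order_def by blast
  show "fst e + snd e < fst e' + snd e' \<Longrightarrow> (e, e') \<in> r"
    using assms unfolding graded_monomial_order_def by (cases e; cases e') simp
qed

lemma gmo_degree_mono:
  assumes "graded_monomial_order r" "(e, e') \<in> r" shows "fst e + snd e \<le> fst e' + snd e'"
  using gmoD(6)[OF assms(1), of e' e] gmoD(3)[OF assms] by force

lemma finite_max_exists:
  assumes r: "graded_monomial_order r" and "finite Z" "Z \<noteq> {}"
  shows "\<exists>e\<in>Z. \<forall>e'\<in>Z. (e', e) \<in> r"
  using assms(2,3)
proof (induction Z rule: finite_ne_induct)
  case (singleton x)
  then show ?case using gmoD(1)[OF r] by simp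
next
  case (insert x Z)
  then obtain e where e: "e \<in> Z" "\<forall>e'\<in>Z. (e', e) \<in> r" by blast
  show ?case
  proof (cases "(x, e) \<in> r")
    case True
    then show ?thesis using e by blast
  next
    case False
    then have "(e, x) \<in> r" using gmoD(4)[OF r] by blast
    then have "\<forall>e'\<in>insert x Z. (e', x) \<in> r" using e gmoD(1)[OF r] gmoD(2)[OF r] by blast
    then show ?thesis by blast
  qed
qed

lemma lead_exp:
  assumes r: "graded_monomial_order r" and p: "p \<noteq> 0"
  shows "lead_exp r p \<in> supp2 p" "\<And>e. e \<in> supp2 p \<Longrightarrow> (e, lead_exp r p) \<in> r"
proof -
  obtain e where e: "e \<in> supp2 p" "\<forall>e'\<in>supp2 p. (e', e) \<in> r"
    using finite_max_exists[OF r finite_supp2, of p] p supp2_empty_iff by blast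
  have "lead_exp r p \<in> supp2 p \<and> (\<forall>e' \<in> supp2 p. (e', lead_exp r p) \<in> r)"
    unfolding lead_exp_def
  proof (rule theI)
    show "e \<in> supp2 p \<and> (\<forall>e'\<in>supp2 p. (e', e) \<in> r)" using e by blast
    show "e'' = e" if "e'' \<in> supp2 p \<and> (\<forall>e'\<in>supp2 p. (e', e'') \<in> r)" for e''
      using that e gmoD(3)[OF r] by blast
  qed
  then show "lead_exp r p \<in> supp2 p" "\<And>e. e \<in> supp2 p \<Longrightarrow> (e, lead_exp r p) \<in> r" by blast+
qed

lemma graded_monomial_order_exists: "\<exists>r. graded_monomial_order r"
proof
  let ?r = "{((a, b), (c, d)). a + b < c + d \<or> (a + b = c + d \<and> a \<le> (c::nat))} :: (nat \<times> nat) rel"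
  show "graded_monomial_order ?r"
    unfolding graded_monomial_order_def linear_order_on_def partial_order_on_def preorder_on_def
    by (auto simp: refl_on_def antisym_def total_on_def intro!: transI)
qed

lemma finite_degree_le: "finite {e::nat \<times> nat. int (fst e + snd e) \<le> d}"
proof (rule finite_subset)
  show "{e. int (fst e + snd e) \<le> d} \<subseteq> {..nat d} \<times> {..nat d}" by auto
qed simp

text \<open>h is the monomial multiple of g whose leading exponent is moved to m; compatibility of
  the order with multiplication keeps all other exponents below m.\<close>

lemma groebner_step:
  fixes g :: "'a::field poly poly"
  assumes r: "graded_monomial_order r" and g: "g \<noteq> 0"
    and le: "fst (lead_exp r g) \<le> fst m" "snd (lead_exp r g) \<le> snd m"
  defines "h \<equiv> monom2 (fst m - fst (lead_exp r g), snd m - snd (lead_exp r g)) * g"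
  shows "coeff2 h m = coeff2 g (lead_exp r g)" "\<And>e. e \<in> supp2 h \<Longrightarrow> (e, m) \<in> r"
proof -
  obtain a b where ab: "lead_exp r g = (a, b)" by (cases "lead_exp r g")
  obtain c d where cd: "m = (c, d)" by (cases m)
  have le': "a \<le> c" "b \<le> d" using le by (auto simp: ab cd)
  have h: "h = monom2 (c - a, d - b) * g" by (simp add: h_def ab cd)
  show "coeff2 h m = coeff2 g (lead_exp r g)"
    unfolding h cd ab coeff2_monom2_mult using le' by simp
  fix e assume e: "e \<in> supp2 h"
  obtain u v where uv: "e = (u, v)" by (cases e)
  have "c - a \<le> u \<and> d - b \<le> v \<and> coeff2 g (u - (c - a), v - (d - b)) \<noteq> 0"
    using e unfolding supp2_def h uv mem_Collect_eq coeff2_monom2_mult by (auto split: if_splits)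
  then have s: "c - a \<le> u" "d - b \<le> v" "(u - (c - a), v - (d - b)) \<in> supp2 g" unfolding supp2_def by auto
  have "((u - (c - a), v - (d - b)), (a, b)) \<in> r" using lead_exp(2)[OF r g s(3)] by (simp only: ab)
  from gmoD(5)[OF r this, of "c - a" "d - b"] show "(e, m) \<in> r" using s(1,2) le' by (simp add: uv cd)
qed

text \<open>One division step subtracts a monomial multiple of an element of G with the same leading
  exponent as p; this multiple respects the degree bound, since the order is graded.\<close>

lemma macaulay_span:
  fixes I G :: "'a::field poly poly set"
  assumes r: "graded_monomial_order r" and G: "groebner_basis r I G"
    and I: "\<And>p q. p \<in> I \<Longrightarrow> q \<in> I \<Longrightarrow> p + q \<in> I" "\<And>p q. p \<in> I \<Longrightarrow> q * p \<in> I"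
    and p: "p \<in> I" "deg_le p (int N - 3)"
  shows "p \<in> k_space.span (macaulay_set N G)"
proof -
  let ?d = "int N - 3"
  \<comment> \<open>The induction measure counts the exponents within the degree bound up to the
    leading one. The bound makes this set finite, so a count replaces a well-foundedness argument
    for the order.\<close>
  define below where "below = (\<lambda>p::'a poly poly. {e. int (fst e + snd e) \<le> ?d \<and> (e, lead_exp r p) \<in> r})"
  have fin: "finite (below p)" for p
    unfolding below_def by (rule finite_subset[OF _ finite_degree_le[of ?d]]) blast
  show ?thesis using p
  proof (induction "card (below p)" arbitrary: p rule: less_induct)
    case less
    show ?case
    proof (cases "p = 0")
      case True
      then show ?thesis using k_space.span_zero by blast
    next
      case False
      define m where "m = lead_exp r p"
      have m: "m \<in> supp2 p" "\<And>e. e \<in> supp2 p \<Longrightarrow> (e, m) \<in> r"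
        unfolding m_def using lead_exp[OF r False] by blast+
      have md: "int (fst m + snd m) \<le> ?d" using m(1) less.prems(2) unfolding deg_le_iff by blast
      obtain g where g: "g \<in> G" "g \<noteq> 0" "fst (lead_exp r g) \<le> fst m" "snd (lead_exp r g) \<le> snd m"
        using G False less.prems(1) unfolding groebner_basis_def m_def by blast
      define h where "h = monom2 (fst m - fst (lead_exp r g), snd m - snd (lead_exp r g)) * g"
      have hm: "coeff2 h m = coeff2 g (lead_exp r g)" and hle: "\<And>e. e \<in> supp2 h \<Longrightarrow> (e, m) \<in> r"
        unfolding h_def using groebner_step[OF r g(2-4)] by blast+
      have "deg_le h ?d"
        unfolding deg_le_iff
      proof
        fix e assume "e \<in> supp2 h"
        from gmo_degree_mono[OF r hle[OF this]] md show "int (fst e + snd e) \<le> ?d" by linarith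
      qed
      then have h_mac: "h \<in> macaulay_set N G" unfolding macaulay_set_def h_def using g(1) by blast
      have c0: "coeff2 g (lead_exp r g) \<noteq> 0" using lead_exp(1)[OF r g(2)] by (simp add: supp2_def)
      define c where "c = coeff2 p m / coeff2 g (lead_exp r g)"
      define q where "q = p - Polynomial.smult [:c:] h"
      have q_deg: "deg_le q ?d" unfolding q_def by (intro deg_le_diff deg_le_smult less.prems(2) \<open>deg_le h ?d\<close>)
      have "h \<in> I" unfolding h_def using I(2) g(1) G unfolding groebner_basis_def by blast
      then have "p + [:[:-c:]:] * h \<in> I" by (intro I less.prems(1))
      moreover have "p + [:[:-c:]:] * h = q" by (simp add: q_def)
      ultimately have qI: "q \<in> I" by simp
      have qm: "coeff2 q m = 0" using c0 by (simp add: q_def c_def hm)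
      have "q \<in> k_space.span (macaulay_set N G)"
      proof (cases "q = 0")
        case True
        then show ?thesis using k_space.span_zero by blast
      next
        case q0: False
        define l where "l = lead_exp r q"
        have l: "l \<in> supp2 q" unfolding l_def by (rule lead_exp(1)[OF r q0])
        have lm: "(l, m) \<in> r"
        proof -
          have "coeff2 p l \<noteq> 0 \<or> coeff2 h l \<noteq> 0" using l by (auto simp: q_def supp2_def)
          then show ?thesis using m(2)[of l] hle[of l] by (auto simp: supp2_def)
        qed
        have "l \<noteq> m" using l qm by (auto simp: supp2_def)
        have "below q \<subset> below p"
        proof
          show "below q \<subseteq> below p"
            unfolding below_def l_def[symmetric] m_def[symmetric] using gmoD(2)[OF r _ lm] by blast
          have "m \<in> below p" unfolding below_def m_def[symmetric] using md gmoD(1)[OF r] by blast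
          moreover have "m \<notin> below q"
            unfolding below_def l_def[symmetric] using gmoD(3)[OF r _ lm] \<open>l \<noteq> m\<close> by blast
          ultimately show "below q \<noteq> below p" by blast
        qed
        then have "card (below q) < card (below p)" by (rule psubset_card_mono[OF fin])
        then show ?thesis by (rule less.hyps[OF _ qI q_deg])
      qed
      moreover have "p = q + Polynomial.smult [:c:] h" by (simp add: q_def)
      ultimately show ?thesis
        using k_space.span_add k_space.span_scale[OF k_space.span_base[OF h_mac]] by metis
    qed
  qed
qed

text \<open>Dickson's lemma for two variables. Given one point (a0, b0) of E, every point not above
  it has first coordinate below a0 or second below b0; in each of these finitely many columns and
  rows the lowest point of E suffices.\<close>

lemma dickson_nat_pair:
  fixes E :: "(nat \<times> nat) set"
  shows "\<exists>B. finite B \<and> B \<subseteq> E \<and> (\<forall>e\<in>E. \<exists>b\<in>B. fst b \<le> fst e \<and> snd b \<le> snd e)"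
proof (cases "E = {}")
  case False
  then obtain a0 b0 where e0: "(a0, b0) \<in> E" by auto
  define m1 where "m1 = (\<lambda>a. (a, LEAST b. (a, b) \<in> E))"
  define m2 where "m2 = (\<lambda>b. (LEAST a. (a, b) \<in> E, b))"
  \<comment> \<open>Intersecting with E discards the empty columns and rows, for which LEAST is
    meaningless.\<close>
  define B where "B = insert (a0, b0) ((m1 ` {..<a0} \<union> m2 ` {..<b0}) \<inter> E)"
  have "\<exists>b\<in>B. fst b \<le> fst e \<and> snd b \<le> snd e" if e: "e \<in> E" for e
  proof -
    obtain a b where ab: "e = (a, b)" by (cases e)
    consider "a0 \<le> a \<and> b0 \<le> b" | "a < a0" | "b < b0" by linarith
    then show ?thesis
    proof cases
      case 1
      then show ?thesis by (auto simp: B_def ab)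
    next
      case 2
      have "m1 a \<in> E" unfolding m1_def using e ab by (auto intro: LeastI)
      moreover have "snd (m1 a) \<le> b" unfolding m1_def using e ab by (auto intro: Least_le)
      ultimately show ?thesis using 2 by (intro bexI[of _ "m1 a"]) (auto simp: B_def ab m1_def)
    next
      case 3
      have "m2 b \<in> E" unfolding m2_def using e ab by (auto intro: LeastI)
      moreover have "fst (m2 b) \<le> a" unfolding m2_def using e ab by (auto intro: Least_le)
      ultimately show ?thesis using 3 by (intro bexI[of _ "m2 b"]) (auto simp: B_def ab m2_def)
    qed
  qed
  moreover have "finite B" "B \<subseteq> E" using e0 by (auto simp: B_def)
  ultimately show ?thesis by blast
qed auto

text \<open>Dickson's lemma for the set of leading exponents, with one polynomial of I chosen for
  each exponent kept.\<close>

lemma groebner_basis_exists: "\<exists>G. groebner_basis r I G"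
proof -
  obtain B where B: "finite B" "B \<subseteq> lead_exp r ` (I - {0})"
    "\<And>e. e \<in> lead_exp r ` (I - {0}) \<Longrightarrow> \<exists>b\<in>B. fst b \<le> fst e \<and> snd b \<le> snd e"
    using dickson_nat_pair[of "lead_exp r ` (I - {0})"] by blast
  obtain G where G: "G \<subseteq> I - {0}" "finite G" "B = lead_exp r ` G"
    using finite_subset_image[OF B(1,2)] by blast
  show ?thesis
  proof (intro exI[of _ G], unfold groebner_basis_def, intro conjI ballI)
    fix p assume "p \<in> I - {0}"
    then show "\<exists>g\<in>G - {0}. fst (lead_exp r g) \<le> fst (lead_exp r p) \<and> snd (lead_exp r g) \<le> snd (lead_exp r p)"
      using B(3)[of "lead_exp r p"] G by blast
  qed (use G in blast)+
qed

text \<open>A monomial shifts every exponent of g \<noteq> 0 by its own, so the degree bound on the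
  product bounds the monomial; g = 0 contributes only 0. Finiteness is what allows a Macaulay matrix
  to exist.\<close>

lemma finite_macaulay_set:
  fixes G :: "'a::field poly poly set"
  assumes "finite G" shows "finite (macaulay_set N G)"
proof -
  have "macaulay_set N G \<subseteq> insert 0 ((\<lambda>(e, g). monom2 e * g) ` ({e. int (fst e + snd e) \<le> int N - 3} \<times> G))"
  proof
    fix p assume "p \<in> macaulay_set N G"
    then obtain e g where eg: "g \<in> G" "p = monom2 e * g" "deg_le p (int N - 3)"
      unfolding macaulay_set_def by blast
    show "p \<in> insert 0 ((\<lambda>(e, g). monom2 e * g) ` ({e. int (fst e + snd e) \<le> int N - 3} \<times> G))"
    proof (cases "g = 0")
      case True
      then show ?thesis using eg by simp
    next
      case False
      then obtain u v where uv: "coeff2 g (u, v) \<noteq> 0" using supp2_empty_iff[of g] by (auto simp: supp2_def)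
      obtain a b where e: "e = (a, b)" by (cases e)
      have "coeff2 p (a + u, b + v) \<noteq> 0" unfolding eg(2) e coeff2_monom2_mult using uv by simp
      then have "(a + u, b + v) \<in> supp2 p" by (simp add: supp2_def)
      then have "int (a + u + (b + v)) \<le> int N - 3" using eg(3) unfolding deg_le_iff by fastforce
      then have "int (fst e + snd e) \<le> int N - 3" by (simp add: e)
      then show ?thesis using eg(1,2) by (intro insertI2 image_eqI[of _ _ "(e, g)"]) simp_all
    qed
  qed
  then show ?thesis by (rule finite_subset) (use finite_degree_le assms in blast)
qed


subsection \<open>Row reduction\<close>

definition poly_of :: "(nat \<times> nat) list \<Rightarrow> 'a::field vec \<Rightarrow> 'a poly poly" where
  "poly_of ms v = (\<Sum>j < length ms. Polynomial.smult [:v $ j:] (monom2 (ms ! j)))"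

lemma coeff2_poly_of:
  assumes "distinct ms" "j < length ms" shows "coeff2 (poly_of ms v) (ms ! j) = v $ j"
proof -
  have "coeff2 (poly_of ms v) (ms ! j) = (\<Sum>i<length ms. if i = j then v $ i else 0)"
    unfolding poly_of_def coeff2_sum using assms
    by (intro sum.cong) (auto simp: coeff2_monom2 nth_eq_iff_index_eq)
  then show ?thesis using assms(2) by simp
qed

lemma coeff2_poly_of_notin: "e \<notin> set ms \<Longrightarrow> coeff2 (poly_of ms v) e = 0"
  unfolding poly_of_def coeff2_sum by (intro sum.neutral) (auto simp: coeff2_monom2)

lemma poly_of_macaulay_row:
  assumes "distinct ms" "set ms = {e. int (fst e + snd e) \<le> d}" "i < length fs" "deg_le (fs ! i) d"
  shows "poly_of ms (row (macaulay_mat fs ms) i) = fs ! i"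
proof (rule poly2_eqI)
  fix e
  show "coeff2 (poly_of ms (row (macaulay_mat fs ms) i)) e = coeff2 (fs ! i) e"
  proof (cases "e \<in> set ms")
    case True
    then obtain j where j: "j < length ms" "e = ms ! j" by (metis in_set_conv_nth)
    then show ?thesis
      using coeff2_poly_of[OF assms(1) j(1), of "row (macaulay_mat fs ms) i"] assms(3) j(1)
      by (simp add: macaulay_mat_def)
  next
    case False
    then have "coeff2 (fs ! i) e = 0" using assms(2,4) unfolding deg_le_iff by (auto simp: supp2_def)
    then show ?thesis using coeff2_poly_of_notin[OF False] by simp
  qed
qed

lemma poly_of_row_mult:
  assumes P: "P \<in> carrier_mat n m" and M: "M \<in> carrier_mat m (length ms)" and i: "i < n"
  shows "poly_of ms (row (P * M) i) = (\<Sum>k<m. Polynomial.smult [:P $$ (i, k):] (poly_of ms (row M k)))"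
proof (rule poly2_eqI)
  fix e
  have entry: "row (P * M) i $ j = (\<Sum>k<m. P $$ (i, k) * row M k $ j)" if "j < length ms" for j
    using that assms by (simp add: scalar_prod_def atLeast0LessThan)
  have "coeff2 (poly_of ms (row (P * M) i)) e
      = (\<Sum>j<length ms. \<Sum>k<m. P $$ (i, k) * (row M k $ j * coeff2 (monom2 (ms ! j)) e))"
    unfolding poly_of_def coeff2_sum by (intro sum.cong) (auto simp: entry sum_distrib_right mult.assoc)
  also have "\<dots> = (\<Sum>k<m. \<Sum>j<length ms. P $$ (i, k) * (row M k $ j * coeff2 (monom2 (ms ! j)) e))"
    by (rule sum.swap)
  also have "\<dots> = coeff2 (\<Sum>k<m. Polynomial.smult [:P $$ (i, k):] (poly_of ms (row M k))) e"
    by (simp add: poly_of_def coeff2_sum sum_distrib_left)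
  finally show "coeff2 (poly_of ms (row (P * M) i)) e
      = coeff2 (\<Sum>k<m. Polynomial.smult [:P $$ (i, k):] (poly_of ms (row M k))) e" .
qed

lemma row_polys_eq:
  assumes "E \<in> carrier_mat m (length ms)"
  shows "row_polys ms E = map (\<lambda>i. poly_of ms (row E i)) (filter (\<lambda>i. row E i \<noteq> 0\<^sub>v (length ms)) [0..<m])"
proof -
  have "rows E = map (row E) [0..<m]" using assms by (simp add: rows_def)
  then show ?thesis by (simp add: row_polys_def poly_of_def filter_map o_def)
qed

text \<open>At the monomial of the pivot of one row, that row has coefficient 1 and every other row
  0, so the coefficients of a relation can be read off there.\<close>

lemma row_polys_indep:
  fixes E :: "'a::field mat"
  assumes E: "E \<in> carrier_mat m (length ms)" "row_echelon_form E" and ms: "distinct ms"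
    and zero: "(\<Sum>i<length (row_polys ms E). Polynomial.smult [:c i:] (row_polys ms E ! i)) = 0"
    and i: "i < length (row_polys ms E)"
  shows "c i = 0"
proof -
  define idx where "idx = filter (\<lambda>i. row E i \<noteq> 0\<^sub>v (length ms)) [0..<m]"
  have out: "row_polys ms E = map (\<lambda>i. poly_of ms (row E i)) idx"
    unfolding idx_def by (rule row_polys_eq[OF E(1)])
  have idx: "distinct idx" "\<And>k. k < length idx \<Longrightarrow> idx ! k < m \<and> row E (idx ! k) \<noteq> 0\<^sub>v (length ms)"
    using nth_mem[of _ idx] unfolding idx_def by auto
  have il: "i < length idx" using i by (simp add: out)
  obtain f where f: "pivot_fun E f (length ms)" using E unfolding row_echelon_form_def by auto
  have dim: "dim_row E = m" using E(1) by simp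
  note piv = pivot_funD[OF dim f]
  define j where "j = f (idx ! i)"
  have ii: "idx ! i < m" using idx(2)[OF il] by blast
  have j: "j < length ms"
  proof (rule ccontr)
    assume "\<not> j < length ms"
    with piv(1)[OF ii] have "f (idx ! i) = length ms" by (simp add: j_def)
    then have "row E (idx ! i) = 0\<^sub>v (length ms)" using piv(2)[OF ii] E(1) ii by (intro eq_vecI) auto
    then show False using idx(2)[OF il] by blast
  qed
  have "coeff2 (row_polys ms E ! k) (ms ! j) = (if k = i then 1 else 0)" if k: "k < length idx" for k
  proof -
    have "idx ! k < m" using idx(2)[OF k] by blast
    moreover have "idx ! k = idx ! i \<longleftrightarrow> k = i" using idx(1) k il by (simp add: nth_eq_iff_index_eq)
    ultimately have "E $$ (idx ! k, j) = (if k = i then 1 else 0)"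
      using piv(4)[OF ii] piv(5)[OF ii] j unfolding j_def by auto
    then show ?thesis
      using coeff2_poly_of[OF ms j, of "row E (idx ! k)"] k \<open>idx ! k < m\<close> E(1) j by (simp add: out)
  qed
  then have "(\<Sum>k<length idx. c k * coeff2 (row_polys ms E ! k) (ms ! j)) = (\<Sum>k<length idx. if k = i then c k else 0)"
    by (intro sum.cong) auto
  moreover have "(\<Sum>k<length idx. c k * coeff2 (row_polys ms E ! k) (ms ! j)) = 0"
    using arg_cong[OF zero, of "\<lambda>p. coeff2 p (ms ! j)"] by (simp add: coeff2_sum out)
  ultimately show ?thesis using il by simp
qed

lemma k_span_list:
  "k_space.span (set L) = {(\<Sum>i<length L. Polynomial.smult [:c i:] (L ! i)) | c. True}"
proof
  let ?R = "{(\<Sum>i<length L. Polynomial.smult [:c i:] (L ! i)) | c. True}"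
  show "?R \<subseteq> k_space.span (set L)"
  proof
    fix x assume "x \<in> ?R"
    then obtain c where x: "x = (\<Sum>i<length L. Polynomial.smult [:c i:] (L ! i))" by blast
    show "x \<in> k_space.span (set L)" unfolding x
      by (intro k_space.span_sum k_space.span_scale k_space.span_base) simp
  qed
  show "k_space.span (set L) \<subseteq> ?R"
  proof (rule k_space.span_minimal)
    show "set L \<subseteq> ?R"
    proof
      fix x assume "x \<in> set L"
      then obtain k where k: "k < length L" "x = L ! k" by (metis in_set_conv_nth)
      have "(\<Sum>i<length L. Polynomial.smult [:if i = k then 1 else 0:] (L ! i)) = (\<Sum>i<length L. if i = k then L ! i else 0)"
        by (rule sum.cong) (auto simp flip: one_pCons)
      also have "\<dots> = x" using k by simp
      finally show "x \<in> ?R" by (intro CollectI exI[of _ "\<lambda>i. if i = k then 1 else 0"]) simp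
    qed
    show "k_space.subspace ?R"
    proof (rule k_space.subspaceI)
      show "0 \<in> ?R" by (intro CollectI exI[of _ "\<lambda>_. 0"]) simp
      fix x z assume "x \<in> ?R" "z \<in> ?R"
      then obtain c d where "x = (\<Sum>i<length L. Polynomial.smult [:c i:] (L ! i))"
        "z = (\<Sum>i<length L. Polynomial.smult [:d i:] (L ! i))" by blast
      then have "x + z = (\<Sum>i<length L. Polynomial.smult [:c i + d i:] (L ! i))"
        by (simp add: sum.distrib k_space.scale_left_distrib)
      then show "x + z \<in> ?R" by (intro CollectI exI[of _ "\<lambda>i. c i + d i"]) simp
    next
      fix a x assume "x \<in> ?R"
      then obtain c where "x = (\<Sum>i<length L. Polynomial.smult [:c i:] (L ! i))" by blast
      then have "Polynomial.smult [:a:] x = (\<Sum>i<length L. Polynomial.smult [:a * c i:] (L ! i))"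
        by (simp add: k_space.scale_sum_right mult.commute)
      then show "Polynomial.smult [:a:] x \<in> ?R" by (intro CollectI exI[of _ "\<lambda>i. a * c i"]) simp
    qed
  qed
qed

text \<open>From E = P M and M = P' E the rows of E and of M have the same span, and zero rows of E
  contribute nothing to it; the rows of M are the elements of the Macaulay set.\<close>

theorem truncation_output_basis:
  fixes I :: "'a::field poly poly set"
  assumes out: "truncation_output N I out" and I0: "0 \<in> I"
    and I: "\<And>p q. p \<in> I \<Longrightarrow> q \<in> I \<Longrightarrow> p + q \<in> I" "\<And>p q. p \<in> I \<Longrightarrow> q * p \<in> I"
  shows "(\<Sum>i<length out. Polynomial.smult [:c i:] (out ! i)) = 0 \<Longrightarrow> i < length out \<Longrightarrow> c i = 0"
    and "{(\<Sum>i<length out. Polynomial.smult [:c i:] (out ! i)) | c. True} = {p \<in> I. deg_le p (int N - 3)}"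
proof -
  obtain r G fs ms E where r: "graded_monomial_order r" and G: "groebner_basis r I G"
    and fs: "set fs = macaulay_set N G"
    and ms: "distinct ms" "set ms = {e. int (fst e + snd e) \<le> int N - 3}"
    and E: "rref_of (macaulay_mat fs ms) E" and out_eq: "out = row_polys ms E"
    using out unfolding truncation_output_def by blast
  define M where "M = macaulay_mat fs ms"
  define m where "m = length fs"
  have M: "M \<in> carrier_mat m (length ms)" by (simp add: M_def m_def macaulay_mat_def)
  obtain P P' where ref: "row_echelon_form E" and inv: "mutually_inverse m P P'" and EP: "E = P * M"
    using E M unfolding rref_of_def M_def[symmetric] by auto
  have P: "P \<in> carrier_mat m m" "P' \<in> carrier_mat m m" "P' * P = 1\<^sub>m m"
    using inv unfolding mutually_inverse_def inverts_mat_def by auto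
  have Ec: "E \<in> carrier_mat m (length ms)" unfolding EP using P(1) M by (rule mult_carrier_mat)
  have ME: "M = P' * E" unfolding EP using P M by (simp add: assoc_mult_mat[symmetric, of _ m m _ m _ "length ms"])
  show "(\<Sum>i<length out. Polynomial.smult [:c i:] (out ! i)) = 0 \<Longrightarrow> i < length out \<Longrightarrow> c i = 0"
    unfolding out_eq by (rule row_polys_indep[OF Ec ref ms(1)])
  have out_set: "set out \<subseteq> (\<lambda>i. poly_of ms (row E i)) ` {..<m}"
    unfolding out_eq row_polys_eq[OF Ec] by auto
  have out_sup: "poly_of ms (row E i) \<in> k_space.span (set out)" if i: "i < m" for i
  proof (cases "row E i = 0\<^sub>v (length ms)")
    case True
    then have "poly_of ms (row E i) = 0" by (simp add: poly_of_def)
    then show ?thesis using k_space.span_zero by simp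
  next
    case False
    then have "poly_of ms (row E i) \<in> set out" unfolding out_eq row_polys_eq[OF Ec] using i by auto
    then show ?thesis by (rule k_space.span_base)
  qed
  have fsM: "poly_of ms (row M k) = fs ! k" "fs ! k \<in> macaulay_set N G" if "k < m" for k
  proof -
    show *: "fs ! k \<in> macaulay_set N G" using that fs nth_mem[of k fs] by (simp add: m_def)
    then have "deg_le (fs ! k) (int N - 3)" unfolding macaulay_set_def by blast
    then show "poly_of ms (row M k) = fs ! k"
      unfolding M_def using that by (intro poly_of_macaulay_row[OF ms]) (simp_all add: m_def)
  qed
  have "k_space.span (set out) = k_space.span (macaulay_set N G)"
  proof
    have "set out \<subseteq> k_space.span (macaulay_set N G)"
    proof
      fix x assume "x \<in> set out"
      then obtain i where i: "i < m" "x = poly_of ms (row E i)" using out_set by blast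
      have "x = (\<Sum>k<m. Polynomial.smult [:P $$ (i, k):] (poly_of ms (row M k)))"
        unfolding i(2) EP by (rule poly_of_row_mult[OF P(1) M i(1)])
      also have "\<dots> \<in> k_space.span (macaulay_set N G)"
        by (intro k_space.span_sum k_space.span_scale k_space.span_base) (simp add: fsM)
      finally show "x \<in> k_space.span (macaulay_set N G)" .
    qed
    then show "k_space.span (set out) \<subseteq> k_space.span (macaulay_set N G)"
      by (rule k_space.span_minimal) (rule k_space.subspace_span)
    have "macaulay_set N G \<subseteq> k_space.span (set out)"
    proof
      fix x assume "x \<in> macaulay_set N G"
      then obtain k where k: "k < m" "x = fs ! k" using fs by (metis in_set_conv_nth m_def)
      have "x = (\<Sum>i<m. Polynomial.smult [:P' $$ (k, i):] (poly_of ms (row E i)))"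
        unfolding k(2) fsM(1)[OF k(1), symmetric] by (subst ME) (rule poly_of_row_mult[OF P(2) Ec k(1)])
      also have "\<dots> \<in> k_space.span (set out)"
        by (intro k_space.span_sum k_space.span_scale) (simp add: out_sup)
      finally show "x \<in> k_space.span (set out)" .
    qed
    then show "k_space.span (macaulay_set N G) \<subseteq> k_space.span (set out)"
      by (rule k_space.span_minimal) (rule k_space.subspace_span)
  qed
  also have "\<dots> = {p \<in> I. deg_le p (int N - 3)}"
  proof
    show "{p \<in> I. deg_le p (int N - 3)} \<subseteq> k_space.span (macaulay_set N G)"
      using macaulay_span[OF r G I] by blast
    show "k_space.span (macaulay_set N G) \<subseteq> {p \<in> I. deg_le p (int N - 3)}"
    proof (rule k_space.span_minimal)
      show "macaulay_set N G \<subseteq> {p \<in> I. deg_le p (int N - 3)}"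
        using G I(2) unfolding macaulay_set_def groebner_basis_def by blast
      have "Polynomial.smult [:a:] p \<in> I" if "p \<in> I" for a p using I(2)[OF that, of "[:[:a:]:]"] by simp
      then show "k_space.subspace {p \<in> I. deg_le p (int N - 3)}"
        by (intro k_space.subspaceI) (auto intro: I0 I(1) deg_le_add deg_le_smult deg_le_0)
    qed
  qed
  finally show "{(\<Sum>i<length out. Polynomial.smult [:c i:] (out ! i)) | c. True} = {p \<in> I. deg_le p (int N - 3)}"
    by (simp only: k_span_list)
qed

lemma truncation_output_exists:
  fixes I :: "'a::field poly poly set"
  shows "\<exists>out. truncation_output N I out"
proof -
  obtain r where r: "graded_monomial_order r" using graded_monomial_order_exists by blast
  obtain G where G: "groebner_basis r I G" using groebner_basis_exists by blast
  have "finite (macaulay_set N G)" using G finite_macaulay_set unfolding groebner_basis_def by blast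
  then obtain fs where fs: "set fs = macaulay_set N G" "distinct fs" using finite_distinct_list by blast
  obtain ms where ms: "set ms = {e::nat \<times> nat. int (fst e + snd e) \<le> int N - 3}" "distinct ms"
    using finite_distinct_list[OF finite_degree_le] by blast
  define M where "M = macaulay_mat fs ms"
  have M: "M \<in> carrier_mat (length fs) (length ms)" by (simp add: M_def macaulay_mat_def)
  note gj = gauss_jordan_single[OF M refl]
  from gj(4) obtain P P' where P: "gauss_jordan_single M = P * M" "P \<in> carrier_mat (length fs) (length fs)"
    "P' \<in> carrier_mat (length fs) (length fs)" "P * P' = 1\<^sub>m (length fs)" "P' * P = 1\<^sub>m (length fs)"
    by blast
  have "mutually_inverse (dim_row M) P P'"
    unfolding mutually_inverse_def inverts_mat_def using P(2-5) M by simp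
  with gj(3) P(1) have "rref_of M (gauss_jordan_single M)" unfolding rref_of_def by metis
  then have E: "rref_of (macaulay_mat fs ms) (gauss_jordan_single (macaulay_mat fs ms))" by (simp only: M_def)
  have "truncation_output N I (row_polys ms (gauss_jordan_single (macaulay_mat fs ms)))"
    unfolding truncation_output_def
    by (rule exI[of _ r], rule exI[of _ G], rule exI[of _ fs], rule exI[of _ ms],
        rule exI[of _ "gauss_jordan_single (macaulay_mat fs ms)"], intro conjI r G fs ms E refl)
  then show ?thesis by (rule exI)
qed


section \<open>Evaluation of tower polynomials\<close>

definition mon_eval :: "(nat \<times> nat \<Rightarrow> 'l::field) \<Rightarrow> (nat \<times> nat \<Rightarrow>\<^sub>0 nat) \<Rightarrow> 'l" where
  "mon_eval \<tau> m = (\<Prod>v \<in> Poly_Mapping.keys m. \<tau> v ^ Poly_Mapping.lookup m v)"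

lemma mon_eval_superset:
  assumes "finite V" "Poly_Mapping.keys m \<subseteq> V"
  shows "mon_eval \<tau> m = (\<Prod>v\<in>V. \<tau> v ^ Poly_Mapping.lookup m v)"
  unfolding mon_eval_def using assms
  by (intro prod.mono_neutral_left) (auto simp: in_keys_iff)

lemma mon_eval_0 [simp]: "mon_eval \<tau> 0 = 1"
  by (simp add: mon_eval_def)

lemma mon_eval_add: "mon_eval \<tau> (m + m') = mon_eval \<tau> m * mon_eval \<tau> m'"
proof -
  let ?V = "Poly_Mapping.keys m \<union> Poly_Mapping.keys m'"
  have "mon_eval \<tau> (m + m') = (\<Prod>v\<in>?V. \<tau> v ^ Poly_Mapping.lookup (m + m') v)"
    by (rule mon_eval_superset) (use keys_add[of m m'] in auto)
  also have "\<dots> = mon_eval \<tau> m * mon_eval \<tau> m'"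
    using mon_eval_superset[of ?V m \<tau>] mon_eval_superset[of ?V m' \<tau>]
    by (simp add: lookup_add power_add prod.distrib)
  finally show ?thesis .
qed

lemma sum_single_lookup: "p = (\<Sum>m\<in>Poly_Mapping.keys p. Poly_Mapping.single m (Poly_Mapping.lookup p m))"
proof (rule poly_mapping_eqI)
  fix k
  have "(\<Sum>m\<in>Poly_Mapping.keys p. Poly_Mapping.lookup (Poly_Mapping.single m (Poly_Mapping.lookup p m)) k)
      = (\<Sum>m\<in>Poly_Mapping.keys p. if m = k then Poly_Mapping.lookup p m else 0)"
    by (rule sum.cong) (auto simp: lookup_single when_def)
  then show "Poly_Mapping.lookup p k = Poly_Mapping.lookup (\<Sum>m\<in>Poly_Mapping.keys p. Poly_Mapping.single m (Poly_Mapping.lookup p m)) k"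
    by (simp add: lookup_sum in_keys_iff)
qed

definition tower_set :: "nat list \<Rightarrow> 'a::field tpoly set" where
  "tower_set ss = {p. \<forall>m \<in> Poly_Mapping.keys p. Poly_Mapping.keys m \<subseteq> tower_vars ss}"

lemma tower_set_add: "p \<in> tower_set ss \<Longrightarrow> q \<in> tower_set ss \<Longrightarrow> p + q \<in> tower_set ss"
  unfolding tower_set_def using keys_add[of p q] by blast

lemma tower_set_minus: "p \<in> tower_set ss \<Longrightarrow> - p \<in> tower_set ss"
  unfolding tower_set_def by simp

lemma tower_set_mult: assumes "p \<in> tower_set ss" "q \<in> tower_set ss" shows "p * q \<in> tower_set ss"
  unfolding tower_set_def
proof (intro CollectI ballI)
  fix m assume "m \<in> Poly_Mapping.keys (p * q)"
  then obtain a b where "m = a + b" "a \<in> Poly_Mapping.keys p" "b \<in> Poly_Mapping.keys q"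
    using keys_mult[of p q] by blast
  then show "Poly_Mapping.keys m \<subseteq> tower_vars ss"
    using keys_add[of a b] assms unfolding tower_set_def by blast
qed

lemma tower_set_const: "t_const c \<in> tower_set ss"
  by (simp add: tower_set_def t_const_def)

lemma tower_set_0: "0 \<in> tower_set ss" and tower_set_1: "1 \<in> tower_set ss"
  by (simp_all add: tower_set_def)

lemma tower_set_var: "j = 0 \<or> (i, j) \<in> tower_vars ss \<Longrightarrow> t_var i j \<in> tower_set ss"
  by (auto simp: tower_set_def t_var_def)

lemma tower_set_sum: "(\<And>i. i \<in> I \<Longrightarrow> h i \<in> tower_set ss) \<Longrightarrow> sum h I \<in> tower_set ss"
  by (induction I rule: infinite_finite_induct) (simp_all add: tower_set_0 tower_set_add)

lemma tower_set_mono: "tower_vars ss \<subseteq> tower_vars ss' \<Longrightarrow> tower_set ss \<subseteq> tower_set ss'"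
  unfolding tower_set_def by blast

text \<open>Every monomial is built up from a constant by one variable at a time, by induction on
  the sum of its exponents.\<close>

lemma tower_induct [consumes 1, case_names add const var]:
  assumes p: "p \<in> tower_set ss"
    and add: "\<And>p q. P p \<Longrightarrow> P q \<Longrightarrow> P (p + q)"
    and const: "\<And>c. P (t_const c)"
    and var: "\<And>p i j. P p \<Longrightarrow> (i, j) \<in> tower_vars ss \<Longrightarrow> P (p * t_var i j)"
  shows "P p"
proof -
  have mono: "P (Poly_Mapping.single m c)" if "Poly_Mapping.keys m \<subseteq> tower_vars ss" for m c
    using that
  proof (induction "\<Sum>v\<in>Poly_Mapping.keys m. Poly_Mapping.lookup m v" arbitrary: m rule: less_induct)
    case less
    show ?case
    proof (cases "m = 0")
      case True
      then show ?thesis using const[of c] by (simp add: t_const_def)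
    next
      case False
      then obtain v where v: "v \<in> Poly_Mapping.keys m" by (meson all_not_in_conv keys_eq_empty)
      obtain i j where ij: "v = (i, j)" by (cases v)
      define m' where "m' = m - Poly_Mapping.single v 1"
      have mm': "m = m' + Poly_Mapping.single v 1"
        using v by (intro poly_mapping_eqI) (auto simp: m'_def lookup_add lookup_minus lookup_single when_def in_keys_iff)
      have keys: "Poly_Mapping.keys m' \<subseteq> Poly_Mapping.keys m"
        unfolding m'_def by (auto simp: in_keys_iff lookup_minus)
      have "(\<Sum>v\<in>Poly_Mapping.keys m'. Poly_Mapping.lookup m' v) = (\<Sum>v\<in>Poly_Mapping.keys m. Poly_Mapping.lookup m' v)"
        by (rule sum.mono_neutral_left) (use keys in \<open>auto simp: in_keys_iff\<close>)
      also have "\<dots> < (\<Sum>v\<in>Poly_Mapping.keys m. Poly_Mapping.lookup m v)"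
        by (rule sum_strict_mono_ex1) (use v in \<open>auto simp: m'_def lookup_minus lookup_single when_def in_keys_iff\<close>)
      finally have "P (Poly_Mapping.single m' c)" using less.hyps[of m'] keys less.prems by blast
      moreover have vt: "(i, j) \<in> tower_vars ss" using v less.prems ij by blast
      ultimately have "P (Poly_Mapping.single m' c * t_var i j)" by (rule var)
      moreover have "j \<noteq> 0" using vt by (auto simp: tower_vars_def)
      ultimately show ?thesis by (simp add: t_var_def mult_single mm' ij)
    qed
  qed
  have "P (\<Sum>m\<in>K. Poly_Mapping.single m (Poly_Mapping.lookup p m))"
    if "finite K" "K \<subseteq> Poly_Mapping.keys p" for K
    using that
  proof (induction K rule: finite_induct)
    case empty
    then show ?case using const[of 0] by (simp add: t_const_def)
  next
    case (insert m K)
    then have "P (Poly_Mapping.single m (Poly_Mapping.lookup p m))"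
      using p unfolding tower_set_def by (intro mono) blast
    with insert show ?case by (simp add: add)
  qed
  from this[OF finite_keys order_refl] show ?thesis by (simp flip: sum_single_lookup)
qed

lemma tower_ring_simps [simp]:
  "carrier (tower_ring ss) = tower_set ss" "\<one>\<^bsub>tower_ring ss\<^esub> = 1" "\<zero>\<^bsub>tower_ring ss\<^esub> = 0"
  "p \<otimes>\<^bsub>tower_ring ss\<^esub> q = p * q" "p \<oplus>\<^bsub>tower_ring ss\<^esub> q = p + q"
  by (simp_all add: tower_ring_def tower_set_def)

lemma tower_ring_cring: "cring (tower_ring ss :: 'a::field tpoly ring)"
proof -
  interpret T: cring "ring_of_type_algebra :: 'a tpoly ring" by (rule cring_from_type_algebra)
  have "subring (tower_set ss :: 'a tpoly set) ring_of_type_algebra"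
    by (rule T.subringI) (auto simp: tower_set_1 tower_set_add tower_set_mult tower_set_minus)
  then have "subcring (tower_set ss :: 'a tpoly set) ring_of_type_algebra" by (rule T.subcringI')
  then show ?thesis
    using T.subcring_iff[of "tower_set ss"] by (simp add: tower_ring_def tower_set_def)
qed

lemma tower_coset: "I +>\<^bsub>tower_ring ss\<^esub> p = {h + p | h. h \<in> I}"
  unfolding a_r_coset_def' by auto

context curve_setup
begin

abbreviation ev :: "(nat \<times> nat \<Rightarrow> 'l) \<Rightarrow> 'a tpoly \<Rightarrow> 'l" where "ev \<equiv> t_eval F \<iota>"

lemma ev_superset:
  assumes "finite K" "Poly_Mapping.keys p \<subseteq> K"
  shows "ev \<tau> p = (\<Sum>m\<in>K. \<rho> (Poly_Mapping.lookup p m) * mon_eval \<tau> m)"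
  unfolding t_eval_def mon_eval_def[symmetric] \<rho>_def[symmetric] using assms
  by (intro sum.mono_neutral_left) (auto simp: in_keys_iff)

lemma ev_add: "ev \<tau> (p + q) = ev \<tau> p + ev \<tau> q"
proof -
  let ?K = "Poly_Mapping.keys p \<union> Poly_Mapping.keys q"
  have "ev \<tau> (p + q) = (\<Sum>m\<in>?K. \<rho> (Poly_Mapping.lookup (p + q) m) * mon_eval \<tau> m)"
    by (rule ev_superset) (use keys_add[of p q] in auto)
  also have "\<dots> = ev \<tau> p + ev \<tau> q"
    using ev_superset[of ?K p \<tau>] ev_superset[of ?K q \<tau>]
    by (simp add: lookup_add \<rho>_add distrib_right sum.distrib)
  finally show ?thesis .
qed

lemma ev_single: "ev \<tau> (Poly_Mapping.single m c) = \<rho> c * mon_eval \<tau> m"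
  using ev_superset[of "{m}" "Poly_Mapping.single m c" \<tau>] by (simp split: if_splits)

lemma ev_0 [simp]: "ev \<tau> 0 = 0" by (simp add: t_eval_def)

lemma ev_sum: "ev \<tau> (sum h I) = (\<Sum>i\<in>I. ev \<tau> (h i))"
  by (induction I rule: infinite_finite_induct) (simp_all add: ev_add)

lemma ev_mult: "ev \<tau> (p * q) = ev \<tau> p * ev \<tau> q"
proof -
  have "p * q = (\<Sum>m\<in>Poly_Mapping.keys p. \<Sum>m'\<in>Poly_Mapping.keys q.
      Poly_Mapping.single (m + m') (Poly_Mapping.lookup p m * Poly_Mapping.lookup q m'))"
    using arg_cong2[OF sum_single_lookup[of p] sum_single_lookup[of q], of "(*)"]
    by (simp add: sum_product mult_single)
  then have "ev \<tau> (p * q) = (\<Sum>m\<in>Poly_Mapping.keys p. \<Sum>m'\<in>Poly_Mapping.keys q.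
      (\<rho> (Poly_Mapping.lookup p m) * mon_eval \<tau> m) * (\<rho> (Poly_Mapping.lookup q m') * mon_eval \<tau> m'))"
    by (simp add: ev_sum ev_single \<rho>_mult mon_eval_add mult_ac)
  then show ?thesis
    by (simp add: sum_product ev_superset[OF finite_keys order_refl])
qed

lemma ev_1 [simp]: "ev \<tau> 1 = 1"
  using ev_single[of \<tau> 0 1] by (simp add: \<rho>_1)

lemma ev_minus: "ev \<tau> (- p) = - ev \<tau> p"
  using ev_add[of \<tau> p "- p"] by (simp add: eq_neg_iff_add_eq_0 add.commute)

lemma ev_diff: "ev \<tau> (p - q) = ev \<tau> p - ev \<tau> q"
  using ev_add[of \<tau> p "- q"] by (simp add: ev_minus)

lemma ev_prod: "ev \<tau> (prod h I) = (\<Prod>i\<in>I. ev \<tau> (h i))"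
  by (induction I rule: infinite_finite_induct) (simp_all add: ev_mult)

lemma ev_const: "ev \<tau> (t_const c) = \<rho> c"
  by (simp add: t_const_def ev_single)

lemma ev_var: "ev \<tau> (t_var i j) = (if j = 0 then 1 else \<tau> (i, j))"
  by (simp add: t_var_def ev_single mon_eval_def \<rho>_1)

lemma ev_cong:
  assumes "p \<in> tower_set ss" "\<And>v. v \<in> tower_vars ss \<Longrightarrow> \<tau> v = \<tau>' v"
  shows "ev \<tau> p = ev \<tau>' p"
proof -
  have "mon_eval \<tau> m = mon_eval \<tau>' m" if "m \<in> Poly_Mapping.keys p" for m
  proof -
    have "Poly_Mapping.keys m \<subseteq> tower_vars ss" using assms(1) that unfolding tower_set_def by blast
    then show ?thesis unfolding mon_eval_def using assms(2) by (intro prod.cong) auto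
  qed
  then show ?thesis unfolding ev_superset[OF finite_keys order_refl] by (intro sum.cong) auto
qed

lemma ev_hom: "ring_hom_ring (tower_ring ss) (ring_of_type_algebra :: 'l ring) (ev \<tau>)"
proof (rule ring_hom_ringI2)
  show "ring (tower_ring ss :: 'a tpoly ring)" using tower_ring_cring by (rule cring.axioms)
  show "ring (ring_of_type_algebra :: 'l ring)" by (rule ring_from_type_algebra)
  show "ev \<tau> \<in> Ring.ring_hom (tower_ring ss) ring_of_type_algebra"
    by (rule ring_hom_memI) (simp_all add: ev_add ev_mult)
qed

lemma ev_kernel: "a_kernel (tower_ring ss) (ring_of_type_algebra :: 'l ring) (ev \<tau>) = {p \<in> tower_set ss. ev \<tau> p = 0}"
  by (simp add: a_kernel_def')


subsection \<open>Stages of the normalization\<close>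

text \<open>The values in the field of the members of \<open>candidate_set\<close>, as shown in
  \<open>candidate_image\<close>.\<close>

definition cand_vals :: "nat list \<Rightarrow> (nat \<times> nat \<Rightarrow> 'l) \<Rightarrow> 'l set" where
  "cand_vals ss \<tau> = {(\<Prod>i\<in>{1..length ss}. ev \<tau> (t_var i (c i))) * y ^ j | c j.
     (\<forall>i\<in>{1..length ss}. c i \<le> ss ! (i - 1)) \<and> j < N}"

text \<open>Invariant of the normalization. The first clause makes evaluation injective on the stage
  ring; the last one is what makes the candidate set generate Abar at the end.\<close>

fun good_state :: "('a, 'l) state \<Rightarrow> bool" where
  "good_state (ss, I, \<tau>) \<longleftrightarrow> I = {p \<in> tower_set ss. ev \<tau> p = 0} \<and> is_order (ev \<tau> ` tower_set ss)
     \<and> ev \<tau> ` tower_set ss \<subseteq> span (cand_vals ss \<tau>)"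

fun state_order :: "('a, 'l) state \<Rightarrow> 'l set" where
  "state_order (ss, I, \<tau>) = ev \<tau> ` tower_set ss"

lemma stage_emb_coset:
  assumes "good_state (ss, I, \<tau>)" "p \<in> tower_set ss"
  shows "stage_emb F \<iota> (ss, I, \<tau>) (stage_class (ss, I, \<tau>) p) = ev \<tau> p"
proof -
  have "ev \<tau> ` stage_class (ss, I, \<tau>) p = {ev \<tau> p}"
  proof -
    have "0 \<in> I" "\<And>h. h \<in> I \<Longrightarrow> ev \<tau> h = 0" using assms(1) tower_set_0 by auto
    then show ?thesis by (auto simp: tower_coset ev_add image_iff intro!: exI[of _ p] exI[of _ 0])
  qed
  then show ?thesis by simp
qed

lemma stage_carrier:
  "carrier (stage_ring (ss, I, \<tau>)) = stage_class (ss, I, \<tau>) ` tower_set ss"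
  by (auto simp: FactRing_def A_RCOSETS_def')

text \<open>First isomorphism theorem for evaluation, whose kernel is I: on a coset evaluation is
  constant, and \<open>stage_emb\<close> picks this common value.\<close>

lemma stage_embedded_ring:
  assumes good: "good_state (ss, I, \<tau>)"
  shows "embedded_ring (stage_ring (ss, I, \<tau>)) (stage_emb F \<iota> (ss, I, \<tau>))"
    and "stage_emb F \<iota> (ss, I, \<tau>) ` carrier (stage_ring (ss, I, \<tau>)) = ev \<tau> ` tower_set ss"
proof -
  interpret T: cring "tower_ring ss :: 'a tpoly ring" by (rule tower_ring_cring)
  interpret h: ring_hom_ring "tower_ring ss" "ring_of_type_algebra :: 'l ring" "ev \<tau>" by (rule ev_hom)
  have I: "I = a_kernel (tower_ring ss) (ring_of_type_algebra :: 'l ring) (ev \<tau>)"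
    using good unfolding ev_kernel by simp
  have ideal: "ideal I (tower_ring ss)" unfolding I by (rule h.kernel_is_ideal)
  have em: "stage_emb F \<iota> (ss, I, \<tau>) = (\<lambda>C. the_elem (ev \<tau> ` C))" by (simp add: fun_eq_iff)
  have iso: "stage_emb F \<iota> (ss, I, \<tau>) \<in> ring_iso (tower_ring ss Quot I)
      ((ring_of_type_algebra :: 'l ring) \<lparr> carrier := ev \<tau> ` tower_set ss \<rparr>)"
    unfolding em unfolding I using h.FactRing_iso_set_aux by simp
  then have bij: "bij_betw (stage_emb F \<iota> (ss, I, \<tau>)) (carrier (tower_ring ss Quot I)) (ev \<tau> ` tower_set ss)"
    and hom: "stage_emb F \<iota> (ss, I, \<tau>) \<in> Ring.ring_hom (tower_ring ss Quot I)
      ((ring_of_type_algebra :: 'l ring) \<lparr> carrier := ev \<tau> ` tower_set ss \<rparr>)"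
    unfolding ring_iso_def by auto
  have hom': "stage_emb F \<iota> (ss, I, \<tau>) \<in> Ring.ring_hom (stage_ring (ss, I, \<tau>)) ring_of_type_algebra"
    using hom unfolding Ring.ring_hom_def by auto
  have "cring (stage_ring (ss, I, \<tau>))"
    using ideal.quotient_is_cring[OF ideal tower_ring_cring] by simp
  then show "embedded_ring (stage_ring (ss, I, \<tau>)) (stage_emb F \<iota> (ss, I, \<tau>))"
    unfolding embedded_ring_def using hom' bij by (auto simp: bij_betw_def)
  show "stage_emb F \<iota> (ss, I, \<tau>) ` carrier (stage_ring (ss, I, \<tau>)) = ev \<tau> ` tower_set ss"
    using bij by (simp add: bij_betw_def)
qed

lemma stage_embedded_order:
  assumes good: "good_state (ss, I, \<tau>)"
  shows "embedded_order \<kappa> (poly.coeff F) N y (stage_ring (ss, I, \<tau>)) (stage_emb F \<iota> (ss, I, \<tau>))"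
proof -
  interpret E: embedded_ring "stage_ring (ss, I, \<tau>)" "stage_emb F \<iota> (ss, I, \<tau>)"
    by (rule stage_embedded_ring(1)[OF good])
  have "is_order E.B" unfolding E.B_def stage_embedded_ring(2)[OF good] using good by simp
  then show ?thesis
    using separable_curve_axioms E.embedded_ring_axioms
    by (simp add: embedded_order_def embedded_order_axioms_def)
qed

lemma tower_set_Nil: "tower_set [] = range (t_const :: 'a poly poly \<Rightarrow> 'a tpoly)"
proof (intro equalityI subsetI)
  fix p :: "'a tpoly" assume "p \<in> tower_set []"
  then show "p \<in> range t_const"
  proof (induction p rule: tower_induct)
    case (add p q)
    then obtain c d where "p = t_const c" "q = t_const d" by blast
    then have "p + q = t_const (c + d)" by (simp add: t_const_def single_add)
    then show ?case by blast
  qed (auto simp: tower_vars_def)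
qed (auto simp: tower_set_const)

lemma initial_good: "good_state (initial_state F)"
proof -
  have im: "ev \<tau> ` tower_set [] = A" for \<tau>
    unfolding tower_set_Nil image_image ev_const by (rule range_\<rho>)
  have "PIdl\<^bsub>S_ring\<^esub> F = {x. F dvd x}"
    by (auto simp: cgenideal_def dvd_def mult.commute)
  then have "t_const ` (PIdl\<^bsub>S_ring\<^esub> F) = {p \<in> tower_set []. ev (\<lambda>_. 0) p = 0}"
    unfolding tower_set_Nil by (auto simp: ev_const \<rho>_eq_0_iff)
  moreover have "A \<subseteq> span (cand_vals [] \<tau>)" for \<tau>
  proof -
    have "y ^ i \<in> cand_vals [] \<tau>" if "i < N" for i
      unfolding cand_vals_def using that by (intro CollectI exI[of _ "\<lambda>_. 0"] exI[of _ i]) simp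
    then show ?thesis unfolding A_def by (intro fam_span_subset subspace_span span_base) blast
  qed
  ultimately show ?thesis unfolding initial_state_def good_state.simps im using order_A by blast
qed

lemma tower_vars_snoc: "tower_vars (ss @ [s]) = tower_vars ss \<union> {(Suc (length ss), j) | j. 1 \<le> j \<and> j \<le> s}"
  unfolding tower_vars_def by (auto simp: nth_append less_Suc_eq_le le_Suc_eq split: if_splits)

end


context pid_module
begin

lemma span_finite_fam:
  assumes "finite G" obtains n g where "span G \<subseteq> fam_span n g"
proof -
  obtain n :: nat and g where g: "G = g ` {..<n}"
    using assms by (metis finite_imp_nat_seg_image_inj_on lessThan_def)
  have "span G \<subseteq> fam_span n g"
    by (rule span_minimal[OF _ subspace_fam_span]) (auto simp: g fam_span_base)
  then show ?thesis by (rule that)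
qed

end

context curve_setup
begin

subsection \<open>One step of the normalization\<close>

text \<open>An element of the stage ring, being a coset of the kernel, is a full fibre of
  evaluation. This allows the entries \<open>\<xi>\<close> and \<open>\<eta>\<close> of a step to be
  handled through their values.\<close>

lemma stage_coset_eq:
  assumes good: "good_state (ss, I, \<tau>)" and C: "C \<in> carrier (stage_ring (ss, I, \<tau>))"
  shows "C = {x \<in> tower_set ss. ev \<tau> x = stage_emb F \<iota> (ss, I, \<tau>) C}"
proof -
  obtain p where p: "p \<in> tower_set ss" "C = stage_class (ss, I, \<tau>) p" using C unfolding stage_carrier by blast
  have e: "stage_emb F \<iota> (ss, I, \<tau>) C = ev \<tau> p" unfolding p(2) by (rule stage_emb_coset[OF good p(1)])
  have I: "h \<in> I \<longleftrightarrow> h \<in> tower_set ss \<and> ev \<tau> h = 0" for h using good by auto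
  show ?thesis
    unfolding e
  proof (intro equalityI subsetI)
    fix x assume "x \<in> C"
    then obtain h where h: "h \<in> I" "x = h + p" unfolding p(2) by (auto simp: tower_coset)
    then have "x \<in> tower_set ss" "ev \<tau> x = ev \<tau> p" using I p(1) by (auto simp: ev_add tower_set_add)
    then show "x \<in> {x \<in> tower_set ss. ev \<tau> x = ev \<tau> p}" by blast
  next
    fix x assume x: "x \<in> {x \<in> tower_set ss. ev \<tau> x = ev \<tau> p}"
    then have "x - p \<in> I" unfolding I using tower_set_add[of x ss "- p"] tower_set_minus[OF p(1)] by (simp add: ev_diff)
    then have "x - p + p \<in> {h + p | h. h \<in> I}" by blast
    then show "x \<in> C" unfolding p(2) by (simp add: tower_coset)
  qed
qed

text \<open>Stated through values in the field: \<open>uv\<close>, \<open>t\<close>,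
  \<open>xv\<close>, \<open>hv\<close> stand for the values of u, u/a, \<open>\<xi>\<close>,
  \<open>\<eta>\<close>. The quadratic relations reduce every polynomial to one that is linear in
  the new variables; a linear one in the kernel gives a syzygy of the u, hence is a combination of
  the given linear relations up to I.\<close>

lemma next_ideal_eq_kernel:
  fixes ss :: "nat list" and s h :: nat and uv t :: "nat \<Rightarrow> 'l" and \<tau> \<tau>' :: "nat \<times> nat \<Rightarrow> 'l"
  defines "i \<equiv> Suc (length ss)" and "R \<equiv> ev \<tau> ` tower_set ss"
  assumes I: "I = {p \<in> tower_set ss. ev \<tau> p = 0}" and R: "is_order R"
    and a: "uv 0 \<noteq> 0" and t: "\<And>\<nu>. \<nu> \<le> s \<Longrightarrow> t \<nu> * uv 0 = uv \<nu>"
    and \<tau>'_old: "\<And>v. v \<in> tower_vars ss \<Longrightarrow> \<tau>' v = \<tau> v"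
    and \<tau>'_new: "\<And>\<nu>. 1 \<le> \<nu> \<Longrightarrow> \<nu> \<le> s \<Longrightarrow> \<tau>' (i, \<nu>) = t \<nu>"
    and \<xi>: "\<And>j l \<nu>. 1 \<le> j \<Longrightarrow> j \<le> l \<Longrightarrow> l \<le> s \<Longrightarrow> \<nu> \<le> s \<Longrightarrow>
        \<xi> j l \<nu> = {x \<in> tower_set ss. ev \<tau> x = xv j l \<nu>} \<and> xv j l \<nu> \<in> R"
    and xv: "\<And>j l. 1 \<le> j \<Longrightarrow> j \<le> l \<Longrightarrow> l \<le> s \<Longrightarrow> t j * t l = (\<Sum>\<nu>\<le>s. xv j l \<nu> * t \<nu>)"
    and \<eta>: "\<And>q \<nu>. q < h \<Longrightarrow> \<nu> \<le> s \<Longrightarrow> \<eta> q \<nu> = {x \<in> tower_set ss. ev \<tau> x = hv q \<nu>} \<and> hv q \<nu> \<in> R"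
    and hv: "\<And>q. q < h \<Longrightarrow> (\<Sum>\<nu>\<le>s. hv q \<nu> * uv \<nu>) = 0"
    and gen: "\<And>v. (\<And>\<nu>. \<nu> \<le> s \<Longrightarrow> v \<nu> \<in> R) \<Longrightarrow> (\<Sum>\<nu>\<le>s. v \<nu> * uv \<nu>) = 0 \<Longrightarrow>
        \<exists>c. (\<forall>q<h. c q \<in> R) \<and> (\<forall>\<nu>\<le>s. v \<nu> = (\<Sum>q<h. c q * hv q \<nu>))"
  shows "next_ideal ss I s \<xi> h \<eta> = {p \<in> tower_set (ss @ [s]). ev \<tau>' p = 0}"
    and "ev \<tau>' ` tower_set (ss @ [s]) = {\<Sum>\<nu>\<le>s. r \<nu> * t \<nu> | r. \<forall>\<nu>. r \<nu> \<in> R}"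
proof -
  let ?ss = "ss @ [s]"
  let ?T = "\<lambda>\<nu>. t_var i \<nu> :: 'a tpoly"
  interpret T: cring "tower_ring ?ss :: 'a tpoly ring" by (rule tower_ring_cring)
  interpret ker: ring_hom_ring "tower_ring ?ss" "ring_of_type_algebra :: 'l ring" "ev \<tau>'" by (rule ev_hom)
  have ker_ideal: "ideal {p \<in> tower_set ?ss. ev \<tau>' p = 0} (tower_ring ?ss)"
    using ker.kernel_is_ideal unfolding ev_kernel .
  have old_new: "tower_set ss \<subseteq> tower_set ?ss" by (rule tower_set_mono) (auto simp: tower_vars_snoc)
  have ev_old: "ev \<tau>' p = ev \<tau> p" if "p \<in> tower_set ss" for p
    by (rule ev_cong[OF that]) (rule \<tau>'_old)
  have t0: "t 0 = 1" using t[of 0] a by simp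
  have T_in: "?T \<nu> \<in> tower_set ?ss" if "\<nu> \<le> s" for \<nu>
    by (rule tower_set_var) (use that in \<open>auto simp: tower_vars_snoc i_def\<close>)
  have ev_T: "ev \<tau>' (?T \<nu>) = t \<nu>" if "\<nu> \<le> s" for \<nu>
    using \<tau>'_new[of \<nu>] that t0 by (auto simp: ev_var)
  have ev_lin: "ev \<tau>' (\<Sum>\<nu>\<le>s. x \<nu> * ?T \<nu>) = (\<Sum>\<nu>\<le>s. ev \<tau> (x \<nu>) * t \<nu>)" if "\<And>\<nu>. \<nu> \<le> s \<Longrightarrow> x \<nu> \<in> tower_set ss" for x
    unfolding ev_sum ev_mult using that by (intro sum.cong) (auto simp: ev_T ev_old)
  have lin_in: "(\<Sum>\<nu>\<le>s. x \<nu> * ?T \<nu>) \<in> tower_set ?ss" if "\<And>\<nu>. \<nu> \<le> s \<Longrightarrow> x \<nu> \<in> tower_set ss" for x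
    using that old_new by (intro tower_set_sum tower_set_mult T_in) auto
  define G1 where "G1 = {?T j * ?T l - (\<Sum>\<nu>\<le>s. x \<nu> * ?T \<nu>) | j l x.
      1 \<le> j \<and> j \<le> l \<and> l \<le> s \<and> (\<forall>\<nu>\<le>s. x \<nu> \<in> \<xi> j l \<nu>)}"
  define G2 where "G2 = {(\<Sum>\<nu>\<le>s. x \<nu> * ?T \<nu>) | q x. q < h \<and> (\<forall>\<nu>\<le>s. x \<nu> \<in> \<eta> q \<nu>)}"
  define I' where "I' = Idl\<^bsub>tower_ring ?ss\<^esub> (I \<union> G1 \<union> G2)"
  have next_eq: "next_ideal ss I s \<xi> h \<eta> = I'"
    unfolding next_ideal_def Let_def I'_def G1_def G2_def i_def ..
  have \<xi>_mem: "x \<in> tower_set ss" "ev \<tau> x = xv j l \<nu>" if "1 \<le> j" "j \<le> l" "l \<le> s" "\<nu> \<le> s" "x \<in> \<xi> j l \<nu>" for x j l \<nu>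
    using \<xi>[OF that(1-4)] that(5) by auto
  have \<eta>_mem: "x \<in> tower_set ss" "ev \<tau> x = hv q \<nu>" if "q < h" "\<nu> \<le> s" "x \<in> \<eta> q \<nu>" for x q \<nu>
    using \<eta>[OF that(1,2)] that(3) by auto
  have diff_in: "p - q \<in> tower_set ?ss" if "p \<in> tower_set ?ss" "q \<in> tower_set ?ss" for p q
    using tower_set_add[OF that(1) tower_set_minus[OF that(2)]] by simp
  have "I \<subseteq> {p \<in> tower_set ?ss. ev \<tau>' p = 0}" unfolding I using ev_old old_new by auto
  moreover have "G1 \<subseteq> {p \<in> tower_set ?ss. ev \<tau>' p = 0}"
  proof
    fix p assume "p \<in> G1"
    then obtain j l x where jl: "1 \<le> j" "j \<le> l" "l \<le> s" "\<And>\<nu>. \<nu> \<le> s \<Longrightarrow> x \<nu> \<in> \<xi> j l \<nu>"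
      and p: "p = ?T j * ?T l - (\<Sum>\<nu>\<le>s. x \<nu> * ?T \<nu>)" unfolding G1_def by blast
    have x: "x \<nu> \<in> tower_set ss" "ev \<tau> (x \<nu>) = xv j l \<nu>" if "\<nu> \<le> s" for \<nu>
      using \<xi>_mem[OF jl(1-3) that jl(4)[OF that]] by blast+
    have "ev \<tau>' p = t j * t l - (\<Sum>\<nu>\<le>s. ev \<tau> (x \<nu>) * t \<nu>)"
      unfolding p ev_diff ev_mult using jl x(1) by (simp add: ev_lin ev_T)
    also have "\<dots> = 0" using xv[OF jl(1-3)] x(2) by simp
    finally have "ev \<tau>' p = 0" .
    moreover have "p \<in> tower_set ?ss" unfolding p using jl
      by (intro diff_in tower_set_mult T_in lin_in x) auto
    ultimately show "p \<in> {p \<in> tower_set ?ss. ev \<tau>' p = 0}" by blast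
  qed
  moreover have "G2 \<subseteq> {p \<in> tower_set ?ss. ev \<tau>' p = 0}"
  proof
    fix p assume "p \<in> G2"
    then obtain q x where q: "q < h" "\<And>\<nu>. \<nu> \<le> s \<Longrightarrow> x \<nu> \<in> \<eta> q \<nu>"
      and p: "p = (\<Sum>\<nu>\<le>s. x \<nu> * ?T \<nu>)" unfolding G2_def by blast
    have x: "x \<nu> \<in> tower_set ss" "ev \<tau> (x \<nu>) = hv q \<nu>" if "\<nu> \<le> s" for \<nu>
      using \<eta>_mem[OF q(1) that q(2)[OF that]] by blast+
    have "uv 0 * ev \<tau>' p = (\<Sum>\<nu>\<le>s. hv q \<nu> * (t \<nu> * uv 0))"
      unfolding p using x by (simp add: ev_lin sum_distrib_left mult_ac)
    also have "\<dots> = (\<Sum>\<nu>\<le>s. hv q \<nu> * uv \<nu>)" using t by simp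
    finally have "ev \<tau>' p = 0" using hv[OF q(1)] a by simp
    moreover have "p \<in> tower_set ?ss" unfolding p by (rule lin_in) (rule x)
    ultimately show "p \<in> {p \<in> tower_set ?ss. ev \<tau>' p = 0}" by blast
  qed
  ultimately have gens: "I \<union> G1 \<union> G2 \<subseteq> {p \<in> tower_set ?ss. ev \<tau>' p = 0}" by blast
  then have gens': "I \<union> G1 \<union> G2 \<subseteq> carrier (tower_ring ?ss)" by auto
  have I'_ker: "I' \<subseteq> {p \<in> tower_set ?ss. ev \<tau>' p = 0}"
    unfolding I'_def by (rule T.genideal_minimal[OF ker_ideal gens])
  interpret I': ideal I' "tower_ring ?ss" unfolding I'_def by (rule T.genideal_ideal[OF gens'])
  have I'_gen: "p \<in> I'" if "p \<in> I \<union> G1 \<union> G2" for p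
    using T.genideal_self[OF gens'] that unfolding I'_def by blast
  have I'_add: "p + q \<in> I'" if "p \<in> I'" "q \<in> I'" for p q using I'.a_closed[OF that] by simp
  have I'_0: "0 \<in> I'" using I'.zero_closed by simp
  have I'_mult: "q * p \<in> I'" if "p \<in> I'" "q \<in> tower_set ?ss" for p q using I'.I_l_closed[of p q] that by simp
  have I'_sum: "sum g K \<in> I'" if "\<And>k. k \<in> K \<Longrightarrow> g k \<in> I'" for g and K :: "nat set"
    using that by (induction K rule: infinite_finite_induct) (auto simp: I'_0 I'_add)
  \<comment> \<open>Polynomials that are, modulo \<open>I'\<close>, linear in the new variables with
    coefficients from the previous stage; the constant term is the coefficient of T_0 = 1.\<close>
  define lin where "lin = (\<lambda>p. \<exists>x. (\<forall>\<nu>. x \<nu> \<in> tower_set ss) \<and> p - (\<Sum>\<nu>\<le>s. x \<nu> * ?T \<nu>) \<in> I')"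
  have linI: "lin p" if "\<And>\<nu>. x \<nu> \<in> tower_set ss" "p - (\<Sum>\<nu>\<le>s. x \<nu> * ?T \<nu>) \<in> I'" for p x
    unfolding lin_def using that by blast
  have linE: "\<exists>x r. (\<forall>\<nu>. x \<nu> \<in> tower_set ss) \<and> r \<in> I' \<and> p = r + (\<Sum>\<nu>\<le>s. x \<nu> * ?T \<nu>)" if lp: "lin p" for p
  proof -
    obtain x where "\<forall>\<nu>. x \<nu> \<in> tower_set ss" "p - (\<Sum>\<nu>\<le>s. x \<nu> * ?T \<nu>) \<in> I'" using lp unfolding lin_def by blast
    then show ?thesis by (intro exI[of _ x] exI[of _ "p - (\<Sum>\<nu>\<le>s. x \<nu> * ?T \<nu>)"]) simp
  qed
  have lin_I': "lin p" if "p \<in> I'" for p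
    by (rule linI[of "\<lambda>_. 0"]) (simp_all add: tower_set_0 that)
  have lin_add: "lin (p + q)" if pq: "lin p" "lin q" for p q
  proof -
    from linE[OF pq(1)] obtain x r where x: "\<forall>\<nu>. x \<nu> \<in> tower_set ss" "r \<in> I'" "p = r + (\<Sum>\<nu>\<le>s. x \<nu> * ?T \<nu>)" by blast
    from linE[OF pq(2)] obtain z w where z: "\<forall>\<nu>. z \<nu> \<in> tower_set ss" "w \<in> I'" "q = w + (\<Sum>\<nu>\<le>s. z \<nu> * ?T \<nu>)" by blast
    have "p + q - (\<Sum>\<nu>\<le>s. (x \<nu> + z \<nu>) * ?T \<nu>) = r + w"
      by (simp add: x(3) z(3) distrib_right sum.distrib)
    then show ?thesis using x(1,2) z(1,2) by (intro linI[of "\<lambda>\<nu>. x \<nu> + z \<nu>"]) (simp_all add: tower_set_add I'_add)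
  qed
  have lin_mult: "lin (c * p)" if c: "c \<in> tower_set ss" and p: "lin p" for c p
  proof -
    from linE[OF p] obtain x r where x: "\<forall>\<nu>. x \<nu> \<in> tower_set ss" "r \<in> I'" "p = r + (\<Sum>\<nu>\<le>s. x \<nu> * ?T \<nu>)" by blast
    have "c * p - (\<Sum>\<nu>\<le>s. (c * x \<nu>) * ?T \<nu>) = c * r"
      by (simp add: x(3) distrib_left sum_distrib_left mult.assoc)
    moreover have "c * r \<in> I'" using I'_mult[OF x(2)] c old_new by blast
    ultimately show ?thesis using x(1) c by (intro linI[of "\<lambda>\<nu>. c * x \<nu>"]) (simp_all add: tower_set_mult)
  qed
  have lin_sum: "lin (sum g K)" if "\<And>k. k \<in> K \<Longrightarrow> lin (g k)" for g and K :: "nat set"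
    using that by (induction K rule: infinite_finite_induct) (auto simp: lin_add lin_I'[OF I'_0])
  have lin_T: "lin (?T \<nu>)" if \<nu>: "\<nu> \<le> s" for \<nu>
  proof (rule linI[of "\<lambda>\<mu>. if \<mu> = \<nu> then 1 else 0"])
    have "(\<Sum>\<mu>\<le>s. (if \<mu> = \<nu> then 1 else 0) * ?T \<mu>) = (\<Sum>\<mu>\<le>s. if \<mu> = \<nu> then ?T \<mu> else 0)"
      by (rule sum.cong) auto
    also have "\<dots> = ?T \<nu>" using \<nu> by simp
    finally show "?T \<nu> - (\<Sum>\<mu>\<le>s. (if \<mu> = \<nu> then 1 else 0) * ?T \<mu>) \<in> I'" by (simp add: I'_0)
  qed (simp_all add: tower_set_0 tower_set_1)
  have T0: "?T 0 = 1" by (simp add: t_var_def)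
  have lin_old: "lin c" if "c \<in> tower_set ss" for c
    using lin_mult[OF that lin_T[of 0]] by (simp add: T0)
  have lin_TT_ord: "lin (?T j * ?T l)" if jl: "1 \<le> j" "j \<le> l" "l \<le> s" for j l
  proof -
    \<comment> \<open>Up to s a representative of the coset is chosen; beyond s any element of the
      previous stage will do, and 0 is taken.\<close>
    have "\<forall>\<nu>. \<exists>x. x \<in> tower_set ss \<and> (\<nu> \<le> s \<longrightarrow> x \<in> \<xi> j l \<nu>)"
    proof
      fix \<nu>
      show "\<exists>x. x \<in> tower_set ss \<and> (\<nu> \<le> s \<longrightarrow> x \<in> \<xi> j l \<nu>)"
      proof (cases "\<nu> \<le> s")
        case True
        note e = \<xi>[OF jl True]
        then obtain x where "x \<in> tower_set ss" "xv j l \<nu> = ev \<tau> x" unfolding R_def by blast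
        then show ?thesis using e by (intro exI[of _ x]) auto
      next
        case False
        then show ?thesis using tower_set_0[of ss] by blast
      qed
    qed
    from choice[OF this] obtain x where x: "\<And>\<nu>. x \<nu> \<in> tower_set ss" "\<And>\<nu>. \<nu> \<le> s \<Longrightarrow> x \<nu> \<in> \<xi> j l \<nu>" by blast
    have "?T j * ?T l - (\<Sum>\<nu>\<le>s. x \<nu> * ?T \<nu>) \<in> G1" unfolding G1_def using jl x(2) by blast
    then have "?T j * ?T l - (\<Sum>\<nu>\<le>s. x \<nu> * ?T \<nu>) \<in> I'" by (intro I'_gen) blast
    then show ?thesis by (rule linI[of x, OF x(1)])
  qed
  have lin_TT: "lin (?T j * ?T l)" if "j \<le> s" "l \<le> s" for j l
  proof -
    \<comment> \<open>The relations are listed only for 1 \<le> j \<le> l; the remaining products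
      follow from T_0 = 1 and commutativity.\<close>
    consider "j = 0" | "l = 0" | "1 \<le> j" "j \<le> l" | "1 \<le> l" "l \<le> j" by linarith
    then show ?thesis
    proof cases
      case 1
      then show ?thesis using lin_T[OF that(2)] by (simp add: T0)
    next
      case 2
      then show ?thesis using lin_T[OF that(1)] by (simp add: T0)
    next
      case 3
      then show ?thesis using lin_TT_ord[of j l] that by blast
    next
      case 4
      then have "lin (?T l * ?T j)" using lin_TT_ord[of l j] that by blast
      then show ?thesis by (simp only: mult.commute)
    qed
  qed
  have reduce: "lin p" if "p \<in> tower_set ?ss" for p
    using that
  proof (induction p rule: tower_induct)
    case (add p q)
    then show ?case by (rule lin_add)
  next
    case (const c)
    then show ?case by (rule lin_old[OF tower_set_const])
  next
    case (var p i' j)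
    show ?case
    proof (cases "(i', j) \<in> tower_vars ss")
      case True
      then have "t_var i' j \<in> tower_set ss" by (intro tower_set_var) blast
      from lin_mult[OF this var.IH] show ?thesis by (simp add: mult.commute)
    next
      case False
      then have ij: "i' = i" "j \<le> s" using var.hyps unfolding tower_vars_snoc i_def by auto
      from linE[OF var.IH] obtain x r where x: "\<forall>\<nu>. x \<nu> \<in> tower_set ss" "r \<in> I'" "p = r + (\<Sum>\<nu>\<le>s. x \<nu> * ?T \<nu>)" by blast
      have eq: "p * ?T j = ?T j * r + (\<Sum>\<nu>\<le>s. x \<nu> * (?T \<nu> * ?T j))"
        by (simp add: x(3) distrib_right sum_distrib_right mult.assoc mult.commute[of r])
      have "lin (?T j * r)" by (rule lin_I'[OF I'_mult[OF x(2) T_in[OF ij(2)]]])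
      moreover have "lin (\<Sum>\<nu>\<le>s. x \<nu> * (?T \<nu> * ?T j))"
        by (intro lin_sum lin_mult lin_TT) (use x(1) ij(2) in auto)
      ultimately show ?thesis unfolding ij(1) eq by (rule lin_add)
    qed
  qed
  show "next_ideal ss I s \<xi> h \<eta> = {p \<in> tower_set ?ss. ev \<tau>' p = 0}"
    unfolding next_eq
  proof (intro equalityI[OF I'_ker] subsetI)
    fix p assume "p \<in> {p \<in> tower_set ?ss. ev \<tau>' p = 0}"
    then have p: "p \<in> tower_set ?ss" "ev \<tau>' p = 0" by auto
    from linE[OF reduce[OF p(1)]] obtain x r
      where x: "\<forall>\<nu>. x \<nu> \<in> tower_set ss" "r \<in> I'" "p = r + (\<Sum>\<nu>\<le>s. x \<nu> * ?T \<nu>)" by blast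
    have "ev \<tau>' r = 0" using I'_ker x(2) by blast
    then have "(\<Sum>\<nu>\<le>s. ev \<tau> (x \<nu>) * t \<nu>) = 0" using p(2) x(1) unfolding x(3) ev_add by (simp add: ev_lin)
    \<comment> \<open>Multiplication by the value of a turns each t into the value of u, so the
      coefficients of a linear element of the kernel form a syzygy.\<close>
    then have "(\<Sum>\<nu>\<le>s. ev \<tau> (x \<nu>) * t \<nu>) * uv 0 = 0" by simp
    then have "(\<Sum>\<nu>\<le>s. ev \<tau> (x \<nu>) * uv \<nu>) = 0" using t by (simp add: sum_distrib_right mult.assoc)
    moreover have "ev \<tau> (x \<nu>) \<in> R" for \<nu> unfolding R_def using x(1) by blast
    ultimately obtain c where c: "\<And>q. q < h \<Longrightarrow> c q \<in> R" "\<And>\<nu>. \<nu> \<le> s \<Longrightarrow> ev \<tau> (x \<nu>) = (\<Sum>q<h. c q * hv q \<nu>)"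
      using gen[of "\<lambda>\<nu>. ev \<tau> (x \<nu>)"] by blast
    have "\<forall>q. \<exists>z. q < h \<longrightarrow> z \<in> tower_set ss \<and> ev \<tau> z = c q" using c(1) unfolding R_def by fastforce
    from choice[OF this] obtain z where z: "\<And>q. q < h \<Longrightarrow> z q \<in> tower_set ss \<and> ev \<tau> (z q) = c q" by blast
    have "\<forall>q. \<forall>\<nu>. \<exists>w. q < h \<longrightarrow> \<nu> \<le> s \<longrightarrow> w \<in> tower_set ss \<and> ev \<tau> w = hv q \<nu>"
      using \<eta> unfolding R_def by fastforce
    then have "\<forall>q. \<exists>w. \<forall>\<nu>. q < h \<longrightarrow> \<nu> \<le> s \<longrightarrow> w \<nu> \<in> tower_set ss \<and> ev \<tau> (w \<nu>) = hv q \<nu>"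
      by (intro allI choice) blast
    from choice[OF this] obtain w where w: "\<And>q \<nu>. q < h \<Longrightarrow> \<nu> \<le> s \<Longrightarrow> w q \<nu> \<in> tower_set ss \<and> ev \<tau> (w q \<nu>) = hv q \<nu>" by blast
    have w\<eta>: "w q \<nu> \<in> \<eta> q \<nu>" if "q < h" "\<nu> \<le> s" for q \<nu> using \<eta>[OF that] w[OF that] by auto
    \<comment> \<open>The coefficients x and the chosen combination of the syzygy generators have
      equal values; their difference therefore lies in the old ideal I.\<close>
    define d where "d = (\<lambda>\<nu>. x \<nu> - (\<Sum>q<h. z q * w q \<nu>))"
    have d: "d \<nu> \<in> I'" if \<nu>: "\<nu> \<le> s" for \<nu>
    proof -
      have in_ss: "(\<Sum>q<h. z q * w q \<nu>) \<in> tower_set ss"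
        using z w \<nu> by (intro tower_set_sum tower_set_mult) auto
      then have "d \<nu> \<in> tower_set ss"
        unfolding d_def using tower_set_add[of "x \<nu>" ss "- (\<Sum>q<h. z q * w q \<nu>)"] x(1) tower_set_minus[OF in_ss] by simp
      moreover have "ev \<tau> (d \<nu>) = 0"
        unfolding d_def ev_diff ev_sum ev_mult c(2)[OF \<nu>] using z w \<nu> by simp
      ultimately have "d \<nu> \<in> I" unfolding I by blast
      then show ?thesis by (intro I'_gen) blast
    qed
    have "(\<Sum>\<nu>\<le>s. x \<nu> * ?T \<nu>) = (\<Sum>\<nu>\<le>s. ?T \<nu> * d \<nu>) + (\<Sum>\<nu>\<le>s. (\<Sum>q<h. z q * w q \<nu>) * ?T \<nu>)"
      unfolding sum.distrib[symmetric] by (rule sum.cong) (simp_all add: d_def algebra_simps)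
    also have "(\<Sum>\<nu>\<le>s. (\<Sum>q<h. z q * w q \<nu>) * ?T \<nu>) = (\<Sum>q<h. z q * (\<Sum>\<nu>\<le>s. w q \<nu> * ?T \<nu>))"
      unfolding sum_distrib_right sum_distrib_left by (subst sum.swap) (simp add: mult.assoc)
    finally have eq: "(\<Sum>\<nu>\<le>s. x \<nu> * ?T \<nu>) = (\<Sum>\<nu>\<le>s. ?T \<nu> * d \<nu>) + (\<Sum>q<h. z q * (\<Sum>\<nu>\<le>s. w q \<nu> * ?T \<nu>))" .
    have 1: "(\<Sum>\<nu>\<le>s. ?T \<nu> * d \<nu>) \<in> I'" by (intro I'_sum I'_mult d T_in) auto
    have 2: "(\<Sum>q<h. z q * (\<Sum>\<nu>\<le>s. w q \<nu> * ?T \<nu>)) \<in> I'"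
    proof (rule I'_sum)
      fix q assume "q \<in> {..<h}"
      then have q: "q < h" by simp
      have "(\<Sum>\<nu>\<le>s. w q \<nu> * ?T \<nu>) \<in> G2" unfolding G2_def using q w\<eta>[OF q] by blast
      then show "z q * (\<Sum>\<nu>\<le>s. w q \<nu> * ?T \<nu>) \<in> I'"
        using z[OF q] old_new by (intro I'_mult I'_gen) blast+
    qed
    show "p \<in> I'" unfolding x(3) eq by (intro I'_add x(2) 1 2)
  qed
  show "ev \<tau>' ` tower_set ?ss = {\<Sum>\<nu>\<le>s. r \<nu> * t \<nu> | r. \<forall>\<nu>. r \<nu> \<in> R}"
  proof (intro equalityI subsetI)
    fix v assume "v \<in> ev \<tau>' ` tower_set ?ss"
    then obtain p where p: "p \<in> tower_set ?ss" "v = ev \<tau>' p" by blast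
    from linE[OF reduce[OF p(1)]] obtain x r
      where x: "\<forall>\<nu>. x \<nu> \<in> tower_set ss" "r \<in> I'" "p = r + (\<Sum>\<nu>\<le>s. x \<nu> * ?T \<nu>)" by blast
    have "ev \<tau>' r = 0" using I'_ker x(2) by blast
    then have "v = (\<Sum>\<nu>\<le>s. ev \<tau> (x \<nu>) * t \<nu>)" using x(1) unfolding p(2) x(3) ev_add by (simp add: ev_lin)
    then show "v \<in> {\<Sum>\<nu>\<le>s. r \<nu> * t \<nu> | r. \<forall>\<nu>. r \<nu> \<in> R}"
      using x(1) unfolding R_def by (intro CollectI exI[of _ "\<lambda>\<nu>. ev \<tau> (x \<nu>)"]) blast
  next
    fix v assume "v \<in> {\<Sum>\<nu>\<le>s. r \<nu> * t \<nu> | r. \<forall>\<nu>. r \<nu> \<in> R}"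
    then obtain r where r: "\<forall>\<nu>. r \<nu> \<in> R" "v = (\<Sum>\<nu>\<le>s. r \<nu> * t \<nu>)" by blast
    have "\<forall>\<nu>. \<exists>x. x \<in> tower_set ss \<and> r \<nu> = ev \<tau> x" using r(1) unfolding R_def by blast
    from choice[OF this] obtain x where x: "\<And>\<nu>. x \<nu> \<in> tower_set ss \<and> r \<nu> = ev \<tau> (x \<nu>)" by blast
    have "v = ev \<tau>' (\<Sum>\<nu>\<le>s. x \<nu> * ?T \<nu>)" using x by (simp add: r(2) ev_lin)
    then show "v \<in> ev \<tau>' ` tower_set ?ss" by (rule image_eqI) (use x lin_in in blast)
  qed
qed

end


context embedded_ring
begin

lemma
  fixes s :: nat
  assumes "\<And>\<nu>. \<nu> \<le> s \<Longrightarrow> v \<nu> \<in> carrier R" "\<And>\<nu>. \<nu> \<le> s \<Longrightarrow> u \<nu> \<in> carrier R"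
  shows lincomb_closed: "(\<Oplus>\<nu>\<in>{..s}. v \<nu> \<otimes> u \<nu>) \<in> carrier R"
    and e_lincomb: "e (\<Oplus>\<nu>\<in>{..s}. v \<nu> \<otimes> u \<nu>) = (\<Sum>\<nu>\<le>s. e (v \<nu>) * e (u \<nu>))"
proof -
  show "(\<Oplus>\<nu>\<in>{..s}. v \<nu> \<otimes> u \<nu>) \<in> carrier R"
    using assms by (intro R.finsum_closed) auto
  have "e (\<Oplus>\<nu>\<in>{..s}. v \<nu> \<otimes> u \<nu>) = (\<Sum>\<nu>\<in>{..s}. e (v \<nu> \<otimes> u \<nu>))"
    by (rule e_finsum) (use assms in auto)
  also have "\<dots> = (\<Sum>\<nu>\<le>s. e (v \<nu>) * e (u \<nu>))"
    by (rule sum.cong) (use assms in \<open>auto simp: e_mult\<close>)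
  finally show "e (\<Oplus>\<nu>\<in>{..s}. v \<nu> \<otimes> u \<nu>) = (\<Sum>\<nu>\<le>s. e (v \<nu>) * e (u \<nu>))" .
qed

end

context curve_setup
begin

text \<open>A choice of factors at the old levels is extended by the factor at the new level; index
  0 stands for the factor 1.\<close>

lemma cand_vals_snoc:
  assumes \<tau>'_old: "\<And>v. v \<in> tower_vars ss \<Longrightarrow> \<tau>' v = \<tau> v" and \<nu>: "\<nu> \<le> s"
    and x: "x \<in> cand_vals ss \<tau>"
  shows "x * ev \<tau>' (t_var (Suc (length ss)) \<nu>) \<in> cand_vals (ss @ [s]) \<tau>'"
proof -
  let ?n = "length ss"
  obtain c j where c: "\<forall>i\<in>{1..?n}. c i \<le> ss ! (i - 1)" "j < N"
    and x: "x = (\<Prod>i\<in>{1..?n}. ev \<tau> (t_var i (c i))) * y ^ j" using x unfolding cand_vals_def by blast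
  define d where "d = c(Suc ?n := \<nu>)"
  have "ev \<tau>' (t_var i (d i)) = ev \<tau> (t_var i (c i))" if i: "i \<in> {1..?n}" for i
  proof -
    have "t_var i (c i) \<in> tower_set ss"
      using c(1) i by (intro tower_set_var) (auto simp: tower_vars_def)
    then have "ev \<tau>' (t_var i (c i)) = ev \<tau> (t_var i (c i))" by (rule ev_cong) (rule \<tau>'_old)
    then show ?thesis using i by (simp add: d_def)
  qed
  then have "(\<Prod>i\<in>{1..?n}. ev \<tau>' (t_var i (d i))) = (\<Prod>i\<in>{1..?n}. ev \<tau> (t_var i (c i)))" by (rule prod.cong[OF refl])
  then have "x * ev \<tau>' (t_var (Suc ?n) \<nu>) = (\<Prod>i\<in>{1..length (ss @ [s])}. ev \<tau>' (t_var i (d i))) * y ^ j"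
    by (simp add: x prod.nat_ivl_Suc' d_def mult_ac)
  moreover have "\<forall>i\<in>{1..length (ss @ [s])}. d i \<le> (ss @ [s]) ! (i - 1)"
    using c(1) \<nu> by (auto simp: d_def nth_append)
  ultimately show ?thesis unfolding cand_vals_def using c(2) by blast
qed

text \<open>The image of the new stage ring is (1/a)(aJ : J), an order by
  \<open>order_colon_quotient\<close>. It is strictly larger, since otherwise aJ : J would be the
  principal ideal of a, which a step excludes.\<close>

lemma step_good:
  assumes good: "good_state st" and step: "normalization_step F \<iota> st st'"
  shows "good_state st'" "state_order st \<subset> state_order st'"
proof -
  obtain ss I \<tau> where st: "st = (ss, I, \<tau>)" by (cases st)
  obtain ss' I' \<tau>' where st': "st' = (ss', I', \<tau>')" by (cases st')
  define R where "R = stage_ring (ss, I, \<tau>)"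
  define e where "e = stage_emb F \<iota> (ss, I, \<tau>)"
  have good1: "good_state (ss, I, \<tau>)" using good st by simp
  interpret E: embedded_order \<kappa> "poly.coeff F" N y R e
    unfolding R_def e_def by (rule stage_embedded_order[OF good1])
  have B: "E.B = ev \<tau> ` tower_set ss" unfolding E.B_def unfolding R_def e_def by (rule stage_embedded_ring(2)[OF good1])
  let ?i = "Suc (length ss)"
  obtain J s u \<xi> h \<eta> where tp: "test_pair R e J (u 0)"
    and ns: "test_colon R J (u 0) \<noteq> PIdl\<^bsub>R\<^esub> (u 0)"
    and u: "\<forall>j\<le>s. u j \<in> carrier R" "test_colon R J (u 0) = Idl\<^bsub>R\<^esub> (u ` {..s})"
    and \<xi>: "\<forall>j l. 1 \<le> j \<and> j \<le> l \<and> l \<le> s \<longrightarrow> (\<forall>\<nu>\<le>s. \<xi> j l \<nu> \<in> carrier R) \<and>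
       u j \<otimes>\<^bsub>R\<^esub> u l = (\<Oplus>\<^bsub>R\<^esub>\<nu>\<in>{..s}. u 0 \<otimes>\<^bsub>R\<^esub> \<xi> j l \<nu> \<otimes>\<^bsub>R\<^esub> u \<nu>)"
    and syz: "syzygy_generators R s u h \<eta>"
    and ss': "ss' = ss @ [s]" and I': "I' = next_ideal ss I s \<xi> h \<eta>"
    and \<tau>': "\<tau>' = (\<lambda>(i', j). if i' = ?i \<and> 1 \<le> j \<and> j \<le> s then e (u j) / e (u 0) else \<tau> (i', j))"
    using step unfolding st st' normalization_step.simps Let_def R_def[symmetric] e_def[symmetric] by blast
  note J = E.test_pairD[OF tp]
  define uv where "uv = (\<lambda>\<nu>. e (u \<nu>))"
  define t where "t = (\<lambda>\<nu>. uv \<nu> / uv 0)"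
  have a: "uv 0 \<noteq> 0" unfolding uv_def by (rule J(5))
  have t: "t \<nu> * uv 0 = uv \<nu>" for \<nu> using a by (simp add: t_def)
  have uc: "u \<nu> \<in> carrier R" if "\<nu> \<le> s" for \<nu> using u(1) that by blast
  have old: "\<tau>' v = \<tau> v" if "v \<in> tower_vars ss" for v
    using that unfolding \<tau>' tower_vars_def by auto
  have new: "\<tau>' (?i, \<nu>) = t \<nu>" if "1 \<le> \<nu>" "\<nu> \<le> s" for \<nu>
    using that by (simp add: \<tau>' t_def uv_def)
  have coset: "C = {x \<in> tower_set ss. ev \<tau> x = e C} \<and> e C \<in> ev \<tau> ` tower_set ss" if C: "C \<in> carrier R" for C
  proof
    show "C = {x \<in> tower_set ss. ev \<tau> x = e C}"
      using stage_coset_eq[OF good1, of C] C unfolding R_def e_def by blast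
    show "e C \<in> ev \<tau> ` tower_set ss" using E.e_in_B[OF C] unfolding B .
  qed
  have order: "is_order (ev \<tau> ` tower_set ss)" using good1 by simp
  have \<xi>c: "\<xi> j l \<nu> \<in> carrier R" if "1 \<le> j" "j \<le> l" "l \<le> s" "\<nu> \<le> s" for j l \<nu> using \<xi> that by blast
  have \<xi>_rel: "t j * t l = (\<Sum>\<nu>\<le>s. e (\<xi> j l \<nu>) * t \<nu>)" if jl: "1 \<le> j" "j \<le> l" "l \<le> s" for j l
  proof -
    have eq: "u j \<otimes>\<^bsub>R\<^esub> u l = (\<Oplus>\<^bsub>R\<^esub>\<nu>\<in>{..s}. u 0 \<otimes>\<^bsub>R\<^esub> \<xi> j l \<nu> \<otimes>\<^bsub>R\<^esub> u \<nu>)"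
      using \<xi> jl by blast
    have "e (u j \<otimes>\<^bsub>R\<^esub> u l) = (\<Sum>\<nu>\<in>{..s}. e (u 0 \<otimes>\<^bsub>R\<^esub> \<xi> j l \<nu> \<otimes>\<^bsub>R\<^esub> u \<nu>))"
      unfolding eq by (rule E.e_finsum) (use \<xi>c[OF jl] uc in auto)
    then have "uv j * uv l = (\<Sum>\<nu>\<le>s. uv 0 * e (\<xi> j l \<nu>) * uv \<nu>)"
      using \<xi>c[OF jl] uc jl by (simp add: E.e_mult uv_def)
    also have "\<dots> = (\<Sum>\<nu>\<le>s. (e (\<xi> j l \<nu>) * t \<nu>) * (uv 0 * uv 0))"
    proof (rule sum.cong)
      fix \<nu>
      have "(e (\<xi> j l \<nu>) * t \<nu>) * (uv 0 * uv 0) = uv 0 * e (\<xi> j l \<nu>) * (t \<nu> * uv 0)"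
        by (simp only: mult_ac)
      then show "uv 0 * e (\<xi> j l \<nu>) * uv \<nu> = (e (\<xi> j l \<nu>) * t \<nu>) * (uv 0 * uv 0)" unfolding t by (rule sym)
    qed simp
    finally have "uv j * uv l = (\<Sum>\<nu>\<le>s. e (\<xi> j l \<nu>) * t \<nu>) * (uv 0 * uv 0)"
      unfolding sum_distrib_right .
    moreover have "(t j * uv 0) * (t l * uv 0) = (t j * t l) * (uv 0 * uv 0)" by (simp only: mult_ac)
    ultimately have "(t j * t l) * (uv 0 * uv 0) = (\<Sum>\<nu>\<le>s. e (\<xi> j l \<nu>) * t \<nu>) * (uv 0 * uv 0)"
      unfolding t by simp
    then show ?thesis using a by simp
  qed
  have \<eta>c: "\<eta> q \<nu> \<in> carrier R" if "q < h" "\<nu> \<le> s" for q \<nu>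
    using syz that unfolding syzygy_generators_def is_syzygy_def by blast
  have \<eta>_rel: "(\<Sum>\<nu>\<le>s. e (\<eta> q \<nu>) * uv \<nu>) = 0" if q: "q < h" for q
  proof -
    have "(\<Oplus>\<^bsub>R\<^esub>\<nu>\<in>{..s}. \<eta> q \<nu> \<otimes>\<^bsub>R\<^esub> u \<nu>) = \<zero>\<^bsub>R\<^esub>"
      using syz q unfolding syzygy_generators_def is_syzygy_def by blast
    then have "e (\<Oplus>\<^bsub>R\<^esub>\<nu>\<in>{..s}. \<eta> q \<nu> \<otimes>\<^bsub>R\<^esub> u \<nu>) = 0" by (simp add: E.e_zero)
    moreover have "e (\<Oplus>\<^bsub>R\<^esub>\<nu>\<in>{..s}. \<eta> q \<nu> \<otimes>\<^bsub>R\<^esub> u \<nu>) = (\<Sum>\<nu>\<le>s. e (\<eta> q \<nu>) * e (u \<nu>))"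
      by (rule E.e_lincomb[OF \<eta>c[OF q] uc])
    ultimately show ?thesis by (simp add: uv_def)
  qed
  have gen: "\<exists>c. (\<forall>q<h. c q \<in> ev \<tau> ` tower_set ss) \<and> (\<forall>\<nu>\<le>s. v \<nu> = (\<Sum>q<h. c q * e (\<eta> q \<nu>)))"
    if v: "\<And>\<nu>. \<nu> \<le> s \<Longrightarrow> v \<nu> \<in> ev \<tau> ` tower_set ss" "(\<Sum>\<nu>\<le>s. v \<nu> * uv \<nu>) = 0" for v
  proof -
    have "\<forall>\<nu>. \<exists>C. \<nu> \<le> s \<longrightarrow> C \<in> carrier R \<and> v \<nu> = e C" using v(1) unfolding B[symmetric] E.B_def by blast
    from choice[OF this] obtain V where V: "\<And>\<nu>. \<nu> \<le> s \<Longrightarrow> V \<nu> \<in> carrier R \<and> v \<nu> = e (V \<nu>)" by blast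
    have Vc: "V \<nu> \<in> carrier R" if "\<nu> \<le> s" for \<nu> using V[OF that] by blast
    have "e (\<Oplus>\<^bsub>R\<^esub>\<nu>\<in>{..s}. V \<nu> \<otimes>\<^bsub>R\<^esub> u \<nu>) = (\<Sum>\<nu>\<le>s. e (V \<nu>) * e (u \<nu>))"
      by (rule E.e_lincomb[OF Vc uc])
    also have "\<dots> = (\<Sum>\<nu>\<le>s. v \<nu> * uv \<nu>)" using V by (intro sum.cong) (auto simp: uv_def)
    finally have "e (\<Oplus>\<^bsub>R\<^esub>\<nu>\<in>{..s}. V \<nu> \<otimes>\<^bsub>R\<^esub> u \<nu>) = 0" using v(2) by simp
    then have "(\<Oplus>\<^bsub>R\<^esub>\<nu>\<in>{..s}. V \<nu> \<otimes>\<^bsub>R\<^esub> u \<nu>) = \<zero>\<^bsub>R\<^esub>"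
      using E.e_eq_0_iff[OF E.lincomb_closed[OF Vc uc]] by simp
    then have "is_syzygy R s u V" unfolding is_syzygy_def using Vc by blast
    then obtain c where c: "\<forall>q<h. c q \<in> carrier R"
      "\<forall>\<nu>\<le>s. V \<nu> = (\<Oplus>\<^bsub>R\<^esub>q\<in>{..<h}. c q \<otimes>\<^bsub>R\<^esub> \<eta> q \<nu>)" using syz unfolding syzygy_generators_def by blast
    have "v \<nu> = (\<Sum>q<h. e (c q) * e (\<eta> q \<nu>))" if \<nu>: "\<nu> \<le> s" for \<nu>
    proof -
      have "v \<nu> = e (\<Oplus>\<^bsub>R\<^esub>q\<in>{..<h}. c q \<otimes>\<^bsub>R\<^esub> \<eta> q \<nu>)" using V[OF \<nu>] c(2) \<nu> by simp
      also have "\<dots> = (\<Sum>q<h. e (c q) * e (\<eta> q \<nu>))"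
        using c(1) \<eta>c \<nu> by (subst E.e_finsum) (auto simp: E.e_mult)
      finally show ?thesis .
    qed
    moreover have "e (c q) \<in> ev \<tau> ` tower_set ss" if "q < h" for q using c(1) that E.e_in_B unfolding B by blast
    ultimately show ?thesis by (intro exI[of _ "\<lambda>q. e (c q)"]) blast
  qed
  have I: "I = {p \<in> tower_set ss. ev \<tau> p = 0}" using good1 by simp
  have kernel: "next_ideal ss I s \<xi> h \<eta> = {p \<in> tower_set (ss @ [s]). ev \<tau>' p = 0}"
    and image: "ev \<tau>' ` tower_set (ss @ [s]) = {\<Sum>\<nu>\<le>s. r \<nu> * t \<nu> | r. \<forall>\<nu>. r \<nu> \<in> ev \<tau> ` tower_set ss}"
    by (rule next_ideal_eq_kernel[where uv = uv and t = t and xv = "\<lambda>j l \<nu>. e (\<xi> j l \<nu>)" and hv = "\<lambda>q \<nu>. e (\<eta> q \<nu>)",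
          OF I order a t old new coset[OF \<xi>c] \<xi>_rel coset[OF \<eta>c] \<eta>_rel gen]; assumption)+
  have col: "colon E.B (e ` J) (uv 0) = {\<Sum>\<nu>\<le>s. r \<nu> * uv \<nu> | r. \<forall>\<nu>. r \<nu> \<in> E.B}"
    using E.genideal_image[of s u] uc unfolding u(2)[symmetric] E.colon_image[OF J(2,6)] uv_def by blast
  have "(\<lambda>b. b / uv 0) ` colon E.B (e ` J) (uv 0) = {\<Sum>\<nu>\<le>s. r \<nu> * t \<nu> | r. \<forall>\<nu>. r \<nu> \<in> E.B}"
  proof (intro equalityI subsetI)
    fix v assume "v \<in> (\<lambda>b. b / uv 0) ` colon E.B (e ` J) (uv 0)"
    then obtain r where r: "\<forall>\<nu>. r \<nu> \<in> E.B" "v = (\<Sum>\<nu>\<le>s. r \<nu> * uv \<nu>) / uv 0" unfolding col by blast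
    have "v = (\<Sum>\<nu>\<le>s. r \<nu> * t \<nu>)" unfolding r(2) by (simp add: t_def sum_divide_distrib)
    with r(1) show "v \<in> {\<Sum>\<nu>\<le>s. r \<nu> * t \<nu> | r. \<forall>\<nu>. r \<nu> \<in> E.B}" by blast
  next
    fix v assume "v \<in> {\<Sum>\<nu>\<le>s. r \<nu> * t \<nu> | r. \<forall>\<nu>. r \<nu> \<in> E.B}"
    then obtain r where r: "\<forall>\<nu>. r \<nu> \<in> E.B" "v = (\<Sum>\<nu>\<le>s. r \<nu> * t \<nu>)" by blast
    have "v = (\<Sum>\<nu>\<le>s. r \<nu> * uv \<nu>) / uv 0" unfolding r(2) by (simp add: t_def sum_divide_distrib)
    moreover have "(\<Sum>\<nu>\<le>s. r \<nu> * uv \<nu>) \<in> colon E.B (e ` J) (uv 0)" unfolding col using r(1) by blast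
    ultimately show "v \<in> (\<lambda>b. b / uv 0) ` colon E.B (e ` J) (uv 0)" by (rule image_eqI)
  qed
  then have im: "ev \<tau>' ` tower_set (ss @ [s]) = (\<lambda>b. b / uv 0) ` colon E.B (e ` J) (uv 0)"
    unfolding image B by (rule sym)
  have oc: "is_order ((\<lambda>b. b / uv 0) ` colon E.B (e ` J) (uv 0))"
    "E.B \<subseteq> (\<lambda>b. b / uv 0) ` colon E.B (e ` J) (uv 0)"
    unfolding uv_def by (rule order_colon_quotient[OF E.order J(3,4,5)])+
  have "ev \<tau>' ` tower_set (ss @ [s]) \<subseteq> span (cand_vals (ss @ [s]) \<tau>')"
  proof
    fix v assume "v \<in> ev \<tau>' ` tower_set (ss @ [s])"
    then obtain r where r: "\<forall>\<nu>. r \<nu> \<in> ev \<tau> ` tower_set ss" "v = (\<Sum>\<nu>\<le>s. r \<nu> * t \<nu>)" unfolding image by blast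
    have "r \<nu> * t \<nu> \<in> span (cand_vals (ss @ [s]) \<tau>')" if \<nu>: "\<nu> \<le> s" for \<nu>
    proof -
      \<comment> \<open>The elements whose product with t \<nu> lies in the new span form a
        k[x]-submodule. It contains the old candidate values, hence their span, hence the old
        order.\<close>
      define W where "W = {x. x * t \<nu> \<in> span (cand_vals (ss @ [s]) \<tau>')}"
      have ev_t: "ev \<tau>' (t_var ?i \<nu>) = t \<nu>"
        using new[of \<nu>] \<nu> a by (auto simp: ev_var t_def)
      have "cand_vals ss \<tau> \<subseteq> W"
      proof
        fix x assume "x \<in> cand_vals ss \<tau>"
        with old \<nu> have "x * ev \<tau>' (t_var ?i \<nu>) \<in> cand_vals (ss @ [s]) \<tau>'" by (rule cand_vals_snoc)
        then show "x \<in> W" unfolding W_def ev_t by (intro CollectI span_base)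
      qed
      moreover have "subspace W"
        by (rule subspaceI)
          (auto simp: W_def distrib_right mult.assoc intro: span_zero span_add span_scale)
      ultimately have "span (cand_vals ss \<tau>) \<subseteq> W" by (rule span_minimal)
      moreover have "r \<nu> \<in> span (cand_vals ss \<tau>)" using r(1) good1 by auto
      ultimately show ?thesis unfolding W_def by blast
    qed
    then show "v \<in> span (cand_vals (ss @ [s]) \<tau>')" unfolding r(2) by (intro span_sum) simp
  qed
  moreover have "is_order (ev \<tau>' ` tower_set (ss @ [s]))" unfolding im by (rule oc(1))
  ultimately show "good_state st'"
    unfolding st' ss' I' good_state.simps using kernel by blast
  have "state_order st' \<noteq> state_order st"
  proof
    assume "state_order st' = state_order st"
    then have eq: "(\<lambda>b. b / uv 0) ` colon E.B (e ` J) (uv 0) = E.B" unfolding st st' ss' by (simp add: im B)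
    \<comment> \<open>Multiplying back by a recovers aJ : J from its quotient by a, so equality of
      the two orders would make it the principal ideal of a.\<close>
    have "colon E.B (e ` J) (uv 0) = (\<lambda>r. r * uv 0) ` ((\<lambda>b. b / uv 0) ` colon E.B (e ` J) (uv 0))"
      unfolding image_image using a by simp
    then have "colon E.B (e ` J) (uv 0) = (\<lambda>r. r * uv 0) ` E.B" unfolding eq .
    then have "e ` test_colon R J (u 0) = e ` (PIdl\<^bsub>R\<^esub> (u 0))"
      unfolding E.colon_image[OF J(2,6)] E.principal_image[OF J(6)] uv_def .
    moreover have "test_colon R J (u 0) \<subseteq> carrier R" unfolding test_colon_def by blast
    moreover have "PIdl\<^bsub>R\<^esub> (u 0) \<subseteq> carrier R" unfolding cgenideal_def using J(6) by auto
    ultimately have "test_colon R J (u 0) = PIdl\<^bsub>R\<^esub> (u 0)" using inj_on_image_eq_iff[OF E.inj] by blast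
    with ns show False by blast
  qed
  moreover have "state_order st \<subseteq> state_order st'"
    unfolding st st' ss' state_order.simps im using oc(2) by (simp add: B)
  ultimately show "state_order st \<subset> state_order st'" by blast
qed

section \<open>Finitely generated syzygies and the existence of a normalization step\<close>

lemma row_lincomb:
  fixes g :: "nat \<Rightarrow> nat \<Rightarrow> 'l"
  assumes "pid_module (\<lambda>p (v::nat \<Rightarrow> 'l) i. \<kappa> p * v i)"
  shows "pid_module.lincomb (\<lambda>p (v::nat \<Rightarrow> 'l) i. \<kappa> p * v i) n c g = (\<lambda>i. \<Sum>q<n. \<kappa> (c q) * g q i)"
proof
  fix i
  show "pid_module.lincomb (\<lambda>p (v::nat \<Rightarrow> 'l) i. \<kappa> p * v i) n c g i = (\<Sum>q<n. \<kappa> (c q) * g q i)"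
    unfolding pid_module.lincomb_def[OF assms] by (induction n) simp_all
qed

text \<open>The syzygies form a k[x]-submodule of R^(s+1), which is finitely generated over k[x]
  because R is. Generators over k[x] are a fortiori generators over R.\<close>

lemma syzygies_fin_gen:
  fixes uv :: "nat \<Rightarrow> 'l" and s :: nat
  assumes R: "is_order R"
  obtains h :: nat and g where "\<And>q \<nu>. q < h \<Longrightarrow> \<nu> \<le> s \<Longrightarrow> g q \<nu> \<in> R"
    "\<And>q. q < h \<Longrightarrow> (\<Sum>\<nu>\<le>s. g q \<nu> * uv \<nu>) = 0"
    "\<And>v. (\<And>\<nu>. \<nu> \<le> s \<Longrightarrow> v \<nu> \<in> R) \<Longrightarrow> (\<Sum>\<nu>\<le>s. v \<nu> * uv \<nu>) = 0 \<Longrightarrow>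
       \<exists>c. \<forall>\<nu>\<le>s. v \<nu> = (\<Sum>q<h. \<kappa> (c q) * g q \<nu>)"
proof -
  interpret W: pid_module "\<lambda>p (v::nat \<Rightarrow> 'l) i. \<kappa> p * v i"
    by unfold_locales (auto simp: fun_eq_iff algebra_simps \<kappa>_add \<kappa>_mult \<kappa>_1)
  obtain b where b: "R = fam_span N b" using order_basis[OF R] by metis
  define K where "K = {v. (\<forall>\<nu>>s. v \<nu> = 0) \<and> (\<forall>\<nu>\<le>s. v \<nu> \<in> R) \<and> (\<Sum>\<nu>\<le>s. v \<nu> * uv \<nu>) = 0}"
  define G where "G = (\<lambda>(\<nu>, j) i. if i = \<nu> then b j else 0) ` ({..s} \<times> {..<N})"
  have "K \<subseteq> W.span G"
  proof
    fix v assume v: "v \<in> K"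
    have "\<forall>\<nu>. \<exists>c. \<nu> \<le> s \<longrightarrow> v \<nu> = (\<Sum>j<N. \<kappa> (c j) * b j)"
      using v unfolding K_def b fam_span_def lincomb_def by blast
    from choice[OF this] obtain c where c: "\<And>\<nu>. \<nu> \<le> s \<Longrightarrow> v \<nu> = (\<Sum>j<N. \<kappa> (c \<nu> j) * b j)" by blast
    have app: "sum f T i = (\<Sum>k\<in>T. f k i)" for f :: "nat \<Rightarrow> nat \<Rightarrow> 'l" and T :: "nat set" and i
      by (induction T rule: infinite_finite_induct) simp_all
    have "v = (\<Sum>\<nu>\<le>s. \<Sum>j<N. (\<lambda>i. \<kappa> (c \<nu> j) * (if i = \<nu> then b j else 0)))"
    proof
      fix i
      have "(\<Sum>\<nu>\<le>s. \<Sum>j<N. \<kappa> (c \<nu> j) * (if i = \<nu> then b j else 0)) = (\<Sum>\<nu>\<le>s. if \<nu> = i then v \<nu> else 0)"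
        by (rule sum.cong) (auto simp: c)
      also have "\<dots> = v i" using v by (auto simp: K_def)
      finally show "v i = (\<Sum>\<nu>\<le>s. \<Sum>j<N. (\<lambda>i. \<kappa> (c \<nu> j) * (if i = \<nu> then b j else 0))) i"
        by (simp add: app)
    qed
    moreover have "(\<lambda>i. \<kappa> (c \<nu> j) * (if i = \<nu> then b j else 0)) \<in> W.span G" if "\<nu> \<le> s" "j < N" for \<nu> j
    proof (rule W.span_scale[of "\<lambda>i. if i = \<nu> then b j else 0"], rule W.span_base)
      show "(\<lambda>i. if i = \<nu> then b j else 0) \<in> G"
        unfolding G_def by (rule image_eqI[of _ _ "(\<nu>, j)"]) (use that in auto)
    qed
    ultimately show "v \<in> W.span G" by (simp only:) (intro W.span_sum, simp)
  qed
  moreover have "finite G" unfolding G_def by simp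
  then obtain n g0 where "W.span G \<subseteq> W.fam_span n g0" by (rule W.span_finite_fam)
  ultimately have KG: "K \<subseteq> W.fam_span n g0" by blast
  have "W.subspace K"
  proof (rule W.subspaceI)
    show "0 \<in> K" unfolding K_def using orderD(6)[OF R] by simp
    show "v + w \<in> K" if "v \<in> K" "w \<in> K" for v w
      using that orderD(3)[OF R] unfolding K_def by (auto simp: distrib_right sum.distrib)
    show "(\<lambda>i. \<kappa> p * v i) \<in> K" if "v \<in> K" for p v
      using that orderD(4)[OF R orderD(8)[OF R]] unfolding K_def
      by (auto simp: mult.assoc simp flip: sum_distrib_left)
  qed
  from W.submodule_fin_gen[OF this KG] obtain h g where hg: "K = W.fam_span h g" by metis
  have gK: "g q \<in> K" if "q < h" for q unfolding hg using that by (rule W.fam_span_base)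
  show ?thesis
  proof (rule that[of h g])
    show "g q \<nu> \<in> R" if "q < h" "\<nu> \<le> s" for q \<nu> using gK[OF that(1)] that(2) unfolding K_def by blast
    show "(\<Sum>\<nu>\<le>s. g q \<nu> * uv \<nu>) = 0" if "q < h" for q using gK[OF that] unfolding K_def by blast
    fix v assume v: "\<And>\<nu>. \<nu> \<le> s \<Longrightarrow> v \<nu> \<in> R" "(\<Sum>\<nu>\<le>s. v \<nu> * uv \<nu>) = 0"
    define v' where "v' = (\<lambda>\<nu>. if \<nu> \<le> s then v \<nu> else 0)"
    have "v' \<in> K" unfolding K_def v'_def using v by simp
    then obtain c where c: "v' = W.lincomb h c g" unfolding hg W.fam_span_def by blast
    have "v \<nu> = (\<Sum>q<h. \<kappa> (c q) * g q \<nu>)" if \<nu>: "\<nu> \<le> s" for \<nu>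
    proof -
      have "v' \<nu> = (\<Sum>q<h. \<kappa> (c q) * g q \<nu>)" unfolding c row_lincomb[OF W.pid_module_axioms] ..
      then show ?thesis using \<nu> by (simp add: v'_def)
    qed
    then show "\<exists>c. \<forall>\<nu>\<le>s. v \<nu> = (\<Sum>q<h. \<kappa> (c q) * g q \<nu>)" by blast
  qed
qed

text \<open>Since the chosen test pair does not satisfy the stopping condition, only finite data are
  missing: generators of aJ : J, their products and their syzygies. All are obtained from
  k[x]-bases.\<close>

lemma step_exists:
  assumes good: "good_state st" and nstop: "\<not> normalization_stop F \<iota> st"
  shows "\<exists>st'. normalization_step F \<iota> st st'"
proof -
  obtain ss I \<tau> where st: "st = (ss, I, \<tau>)" by (cases st)
  define R where "R = stage_ring (ss, I, \<tau>)"
  define e where "e = stage_emb F \<iota> (ss, I, \<tau>)"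
  have good1: "good_state (ss, I, \<tau>)" using good st by simp
  interpret E: embedded_order \<kappa> "poly.coeff F" N y R e
    unfolding R_def e_def by (rule stage_embedded_order[OF good1])
  obtain J a where tp: "test_pair R e J a" by (rule E.test_pair_exists)
  have ns: "test_colon R J a \<noteq> PIdl\<^bsub>R\<^esub> a"
    using nstop tp unfolding normalization_stop_def st R_def e_def by blast
  note J = E.test_pairD[OF tp]
  note oc = order_colon_quotient[OF E.order J(3,4,5)]
  define OE where "OE = (\<lambda>b. b / e a) ` colon E.B (e ` J) (e a)"
  have OE: "is_order OE" "E.B \<subseteq> OE" unfolding OE_def by (rule oc)+
  have col: "v \<in> colon E.B (e ` J) (e a) \<longleftrightarrow> v / e a \<in> OE" for v
    unfolding OE_def using J(5) by (auto simp: image_iff)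
  obtain g where g: "is_basis g" "OE = fam_span N g" using order_basis[OF OE(1)] .
  have gOE: "g j \<in> OE" if "j < N" for j unfolding g(2) using that by (rule fam_span_base)
  have "\<exists>x. j < N \<longrightarrow> x \<in> carrier R \<and> e x = e a * g j" for j
  proof (cases "j < N")
    case True
    then have "e a * g j \<in> colon E.B (e ` J) (e a)" unfolding col using gOE J(5) by simp
    then have "e a * g j \<in> E.B" unfolding colon_def by blast
    then show ?thesis unfolding E.B_def by auto
  qed simp
  then have "\<forall>j. \<exists>x. j < N \<longrightarrow> x \<in> carrier R \<and> e x = e a * g j" by blast
  from choice[OF this] obtain x where x: "\<And>j. j < N \<Longrightarrow> x j \<in> carrier R \<and> e (x j) = e a * g j" by blast
  \<comment> \<open>u_0 = a is followed by a times a k[x]-basis g of (1/a)(aJ : J); hence s =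
    N.\<close>
  define u where "u = (\<lambda>\<nu>. case \<nu> of 0 \<Rightarrow> a | Suc j \<Rightarrow> x j)"
  have u0: "u 0 = a" by (simp add: u_def)
  have uc: "u \<nu> \<in> carrier R" if "\<nu> \<le> N" for \<nu>
    using that J(6) x by (cases \<nu>) (auto simp: u_def)
  have uOE: "e (u \<nu>) / e a \<in> OE" if "\<nu> \<le> N" for \<nu>
    using that x gOE J(5) orderD(7)[OF OE(1)] by (cases \<nu>) (auto simp: u_def)
  have col_span: "colon E.B (e ` J) (e a) = {\<Sum>\<nu>\<le>N. r \<nu> * e (u \<nu>) | r. \<forall>\<nu>. r \<nu> \<in> E.B}"
  proof (intro equalityI subsetI)
    fix v assume "v \<in> colon E.B (e ` J) (e a)"
    then obtain c where c: "v / e a = (\<Sum>j<N. \<kappa> (c j) * g j)"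
      unfolding col g(2) fam_span_def lincomb_def by blast
    \<comment> \<open>The generator u_0 = a gets coefficient 0: the multiples of the basis g reach
      all of aJ : J by themselves.\<close>
    define r where "r = (\<lambda>\<nu>. case \<nu> of 0 \<Rightarrow> 0 | Suc j \<Rightarrow> \<kappa> (c j))"
    have "v = e a * (\<Sum>j<N. \<kappa> (c j) * g j)" unfolding c[symmetric] using J(5) by simp
    also have "\<dots> = (\<Sum>j<N. \<kappa> (c j) * e (x j))" using x by (simp add: sum_distrib_left mult_ac)
    also have "\<dots> = (\<Sum>\<nu>\<le>N. r \<nu> * e (u \<nu>))"
      unfolding lessThan_Suc_atMost[symmetric] sum.lessThan_Suc_shift by (simp add: r_def u_def)
    finally have "v = (\<Sum>\<nu>\<le>N. r \<nu> * e (u \<nu>))" .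
    moreover have "\<forall>\<nu>. r \<nu> \<in> E.B"
      using orderD(6,8)[OF E.order] by (auto simp: r_def split: nat.split)
    ultimately show "v \<in> {\<Sum>\<nu>\<le>N. r \<nu> * e (u \<nu>) | r. \<forall>\<nu>. r \<nu> \<in> E.B}" by blast
  next
    fix v assume "v \<in> {\<Sum>\<nu>\<le>N. r \<nu> * e (u \<nu>) | r. \<forall>\<nu>. r \<nu> \<in> E.B}"
    then obtain r where r: "\<forall>\<nu>. r \<nu> \<in> E.B" "v = (\<Sum>\<nu>\<le>N. r \<nu> * e (u \<nu>))" by blast
    have "v / e a = (\<Sum>\<nu>\<le>N. r \<nu> * (e (u \<nu>) / e a))" unfolding r(2) by (simp add: sum_divide_distrib)
    moreover have "(\<Sum>\<nu>\<le>N. r \<nu> * (e (u \<nu>) / e a)) \<in> OE"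
      by (intro order_sum[OF OE(1)] orderD(4)[OF OE(1)] uOE) (use r(1) OE(2) in auto)
    ultimately show "v \<in> colon E.B (e ` J) (e a)" unfolding col by simp
  qed
  have tc: "test_colon R J a = Idl\<^bsub>R\<^esub> (u ` {..N})"
  proof -
    have carr: "u ` {..N} \<subseteq> carrier R" using uc by auto
    have "e ` test_colon R J a = e ` (Idl\<^bsub>R\<^esub> (u ` {..N}))"
      unfolding E.colon_image[OF J(2,6)] col_span using E.genideal_image[of N u] uc by simp
    moreover have "test_colon R J a \<subseteq> carrier R" unfolding test_colon_def by blast
    moreover have "Idl\<^bsub>R\<^esub> (u ` {..N}) \<subseteq> carrier R"
      using ideal.Icarr[OF E.R.genideal_ideal[OF carr]] by blast
    ultimately show ?thesis using inj_on_image_eq_iff[OF E.inj] by blast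
  qed
  have "\<exists>\<xi>. j \<le> N \<longrightarrow> l \<le> N \<longrightarrow> (\<forall>\<nu>\<le>N. \<xi> \<nu> \<in> carrier R) \<and>
     u j \<otimes>\<^bsub>R\<^esub> u l = (\<Oplus>\<^bsub>R\<^esub>\<nu>\<in>{..N}. a \<otimes>\<^bsub>R\<^esub> \<xi> \<nu> \<otimes>\<^bsub>R\<^esub> u \<nu>)" for j l
  proof (cases "j \<le> N \<and> l \<le> N")
    case True
    \<comment> \<open>(1/a)(aJ : J) is a ring, so u_j u_l / a lies in aJ : J again; its expansion in
      the generators supplies \<open>\<xi>\<close>.\<close>
    have "e (u j) / e a * (e (u l) / e a) \<in> OE" using True by (intro orderD(4)[OF OE(1)] uOE) auto
    then have "e (u j) * e (u l) / e a \<in> colon E.B (e ` J) (e a)" unfolding col by simp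
    then obtain r where r: "\<forall>\<nu>. r \<nu> \<in> E.B" "e (u j) * e (u l) / e a = (\<Sum>\<nu>\<le>N. r \<nu> * e (u \<nu>))"
      unfolding col_span by blast
    have "\<forall>\<nu>. \<exists>z. z \<in> carrier R \<and> r \<nu> = e z" using r(1) unfolding E.B_def by blast
    from choice[OF this] obtain \<xi> where \<xi>: "\<And>\<nu>. \<xi> \<nu> \<in> carrier R \<and> r \<nu> = e (\<xi> \<nu>)" by blast
    have "e (u j) * e (u l) = e a * (\<Sum>\<nu>\<le>N. r \<nu> * e (u \<nu>))" unfolding r(2)[symmetric] using J(5) by simp
    also have "\<dots> = (\<Sum>\<nu>\<le>N. e a * e (\<xi> \<nu>) * e (u \<nu>))" using \<xi> by (simp add: sum_distrib_left mult.assoc)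
    also have "\<dots> = (\<Sum>\<nu>\<in>{..N}. e (a \<otimes>\<^bsub>R\<^esub> \<xi> \<nu> \<otimes>\<^bsub>R\<^esub> u \<nu>))"
      using \<xi> uc J(6) by (intro sum.cong) (auto simp: E.e_mult)
    also have "\<dots> = e (\<Oplus>\<^bsub>R\<^esub>\<nu>\<in>{..N}. a \<otimes>\<^bsub>R\<^esub> \<xi> \<nu> \<otimes>\<^bsub>R\<^esub> u \<nu>)"
      using \<xi> uc J(6) by (intro E.e_finsum[symmetric]) auto
    finally have "e (u j \<otimes>\<^bsub>R\<^esub> u l) = e (\<Oplus>\<^bsub>R\<^esub>\<nu>\<in>{..N}. a \<otimes>\<^bsub>R\<^esub> \<xi> \<nu> \<otimes>\<^bsub>R\<^esub> u \<nu>)"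
      using uc True by (simp add: E.e_mult)
    moreover have "(\<Oplus>\<^bsub>R\<^esub>\<nu>\<in>{..N}. a \<otimes>\<^bsub>R\<^esub> \<xi> \<nu> \<otimes>\<^bsub>R\<^esub> u \<nu>) \<in> carrier R"
      using \<xi> uc J(6) by (intro E.R.finsum_closed) auto
    moreover have "u j \<otimes>\<^bsub>R\<^esub> u l \<in> carrier R" using uc True by simp
    ultimately have "u j \<otimes>\<^bsub>R\<^esub> u l = (\<Oplus>\<^bsub>R\<^esub>\<nu>\<in>{..N}. a \<otimes>\<^bsub>R\<^esub> \<xi> \<nu> \<otimes>\<^bsub>R\<^esub> u \<nu>)" using E.e_eq_iff by blast
    with \<xi> show ?thesis by blast
  qed blast
  then have ex: "\<forall>j. \<forall>l. \<exists>\<xi>. j \<le> N \<longrightarrow> l \<le> N \<longrightarrow> (\<forall>\<nu>\<le>N. \<xi> \<nu> \<in> carrier R) \<and>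
     u j \<otimes>\<^bsub>R\<^esub> u l = (\<Oplus>\<^bsub>R\<^esub>\<nu>\<in>{..N}. a \<otimes>\<^bsub>R\<^esub> \<xi> \<nu> \<otimes>\<^bsub>R\<^esub> u \<nu>)" by (intro allI)
  have "\<forall>j. \<exists>\<xi>. \<forall>l. j \<le> N \<longrightarrow> l \<le> N \<longrightarrow> (\<forall>\<nu>\<le>N. \<xi> l \<nu> \<in> carrier R) \<and>
     u j \<otimes>\<^bsub>R\<^esub> u l = (\<Oplus>\<^bsub>R\<^esub>\<nu>\<in>{..N}. a \<otimes>\<^bsub>R\<^esub> \<xi> l \<nu> \<otimes>\<^bsub>R\<^esub> u \<nu>)"
    by (intro allI choice) (rule ex[rule_format])
  from choice[OF this] obtain \<xi> where \<xi>: "\<And>j l. j \<le> N \<Longrightarrow> l \<le> N \<Longrightarrow> (\<forall>\<nu>\<le>N. \<xi> j l \<nu> \<in> carrier R) \<and>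
     u j \<otimes>\<^bsub>R\<^esub> u l = (\<Oplus>\<^bsub>R\<^esub>\<nu>\<in>{..N}. a \<otimes>\<^bsub>R\<^esub> \<xi> j l \<nu> \<otimes>\<^bsub>R\<^esub> u \<nu>)" by blast
  obtain h :: nat and w where w: "\<And>q \<nu>. q < h \<Longrightarrow> \<nu> \<le> N \<Longrightarrow> w q \<nu> \<in> E.B"
    "\<And>q. q < h \<Longrightarrow> (\<Sum>\<nu>\<le>N. w q \<nu> * e (u \<nu>)) = 0"
    "\<And>v. (\<And>\<nu>. \<nu> \<le> N \<Longrightarrow> v \<nu> \<in> E.B) \<Longrightarrow> (\<Sum>\<nu>\<le>N. v \<nu> * e (u \<nu>)) = 0 \<Longrightarrow>
       \<exists>c. \<forall>\<nu>\<le>N. v \<nu> = (\<Sum>q<h. \<kappa> (c q) * w q \<nu>)"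
  proof (rule syzygies_fin_gen[OF E.order, where s = N and uv = "\<lambda>\<nu>. e (u \<nu>)"])
    fix h :: nat and g
    assume g: "\<And>q \<nu>. q < h \<Longrightarrow> \<nu> \<le> N \<Longrightarrow> g q \<nu> \<in> E.B" "\<And>q. q < h \<Longrightarrow> (\<Sum>\<nu>\<le>N. g q \<nu> * e (u \<nu>)) = 0"
      "\<And>v. (\<And>\<nu>. \<nu> \<le> N \<Longrightarrow> v \<nu> \<in> E.B) \<Longrightarrow> (\<Sum>\<nu>\<le>N. v \<nu> * e (u \<nu>)) = 0 \<Longrightarrow>
         \<exists>c. \<forall>\<nu>\<le>N. v \<nu> = (\<Sum>q<h. \<kappa> (c q) * g q \<nu>)"
    show thesis by (rule that[of h g]) (fact g)+
  qed
  have "\<forall>q. \<exists>\<eta>. \<forall>\<nu>. q < h \<longrightarrow> \<nu> \<le> N \<longrightarrow> \<eta> \<nu> \<in> carrier R \<and> w q \<nu> = e (\<eta> \<nu>)"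
  proof (intro allI choice)
    fix q \<nu>
    show "\<exists>z. q < h \<longrightarrow> \<nu> \<le> N \<longrightarrow> z \<in> carrier R \<and> w q \<nu> = e z"
    proof (cases "q < h \<and> \<nu> \<le> N")
      case True
      then have "w q \<nu> \<in> E.B" using w(1) by blast
      then show ?thesis unfolding E.B_def by blast
    qed blast
  qed
  from choice[OF this] obtain \<eta> where \<eta>: "\<And>q \<nu>. q < h \<Longrightarrow> \<nu> \<le> N \<Longrightarrow> \<eta> q \<nu> \<in> carrier R \<and> w q \<nu> = e (\<eta> q \<nu>)" by blast
  have syz: "syzygy_generators R N u h \<eta>"
    unfolding syzygy_generators_def
  proof (intro conjI allI impI)
    fix q assume q: "q < h"
    have \<eta>c: "\<eta> q \<nu> \<in> carrier R" if "\<nu> \<le> N" for \<nu> using \<eta>[OF q that] by blast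
    have "e (\<Oplus>\<^bsub>R\<^esub>\<nu>\<in>{..N}. \<eta> q \<nu> \<otimes>\<^bsub>R\<^esub> u \<nu>) = (\<Sum>\<nu>\<le>N. e (\<eta> q \<nu>) * e (u \<nu>))"
      by (rule E.e_lincomb[OF \<eta>c uc])
    also have "\<dots> = (\<Sum>\<nu>\<le>N. w q \<nu> * e (u \<nu>))" using \<eta>[OF q] by (intro sum.cong) auto
    also have "\<dots> = 0" by (rule w(2)[OF q])
    finally have "(\<Oplus>\<^bsub>R\<^esub>\<nu>\<in>{..N}. \<eta> q \<nu> \<otimes>\<^bsub>R\<^esub> u \<nu>) = \<zero>\<^bsub>R\<^esub>"
      using E.e_eq_0_iff[OF E.lincomb_closed[OF \<eta>c uc]] by simp
    then show "is_syzygy R N u (\<eta> q)" unfolding is_syzygy_def using \<eta>c by blast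
  next
    fix v assume v: "is_syzygy R N u v"
    then have vc: "v \<nu> \<in> carrier R" if "\<nu> \<le> N" for \<nu> using that unfolding is_syzygy_def by blast
    have "e (\<Oplus>\<^bsub>R\<^esub>\<nu>\<in>{..N}. v \<nu> \<otimes>\<^bsub>R\<^esub> u \<nu>) = 0"
      using v unfolding is_syzygy_def by (simp add: E.e_zero)
    moreover have "e (\<Oplus>\<^bsub>R\<^esub>\<nu>\<in>{..N}. v \<nu> \<otimes>\<^bsub>R\<^esub> u \<nu>) = (\<Sum>\<nu>\<le>N. e (v \<nu>) * e (u \<nu>))"
      by (rule E.e_lincomb[OF vc uc])
    ultimately have "(\<Sum>\<nu>\<le>N. e (v \<nu>) * e (u \<nu>)) = 0" by simp
    then obtain c where c: "\<forall>\<nu>\<le>N. e (v \<nu>) = (\<Sum>q<h. \<kappa> (c q) * w q \<nu>)"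
      using w(3)[of "\<lambda>\<nu>. e (v \<nu>)"] E.e_in_B vc by blast
    have "\<forall>q. \<exists>z. z \<in> carrier R \<and> \<kappa> (c q) = e z" using orderD(8)[OF E.order] unfolding E.B_def by blast
    from choice[OF this] obtain z where z: "\<And>q. z q \<in> carrier R \<and> \<kappa> (c q) = e (z q)" by blast
    have "v \<nu> = (\<Oplus>\<^bsub>R\<^esub>q\<in>{..<h}. z q \<otimes>\<^bsub>R\<^esub> \<eta> q \<nu>)" if \<nu>: "\<nu> \<le> N" for \<nu>
    proof -
      have "e (v \<nu>) = (\<Sum>q\<in>{..<h}. e (z q \<otimes>\<^bsub>R\<^esub> \<eta> q \<nu>))"
        using c \<nu> z \<eta>[OF _ \<nu>] by (auto simp: E.e_mult intro!: sum.cong)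
      also have "\<dots> = e (\<Oplus>\<^bsub>R\<^esub>q\<in>{..<h}. z q \<otimes>\<^bsub>R\<^esub> \<eta> q \<nu>)"
        using z \<eta>[OF _ \<nu>] by (intro E.e_finsum[symmetric]) auto
      finally have "e (v \<nu>) = e (\<Oplus>\<^bsub>R\<^esub>q\<in>{..<h}. z q \<otimes>\<^bsub>R\<^esub> \<eta> q \<nu>)" .
      moreover have "(\<Oplus>\<^bsub>R\<^esub>q\<in>{..<h}. z q \<otimes>\<^bsub>R\<^esub> \<eta> q \<nu>) \<in> carrier R"
        using z \<eta>[OF _ \<nu>] by (intro E.R.finsum_closed) auto
      ultimately show ?thesis using E.e_eq_iff vc[OF \<nu>] by blast
    qed
    then show "\<exists>c. (\<forall>q<h. c q \<in> carrier R) \<and> (\<forall>\<nu>\<le>N. v \<nu> = (\<Oplus>\<^bsub>R\<^esub>q\<in>{..<h}. c q \<otimes>\<^bsub>R\<^esub> \<eta> q \<nu>))"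
      using z by (intro exI[of _ z]) blast
  qed
  define \<tau>' where "\<tau>' = (\<lambda>(i', j). if i' = Suc (length ss) \<and> 1 \<le> j \<and> j \<le> N then e (u j) / e (u 0) else \<tau> (i', j))"
  have "normalization_step F \<iota> (ss, I, \<tau>) (ss @ [N], next_ideal ss I N \<xi> h \<eta>, \<tau>')"
    unfolding normalization_step.simps Let_def R_def[symmetric] e_def[symmetric]
  proof (rule exI[of _ J], rule exI[of _ N], rule exI[of _ u], rule exI[of _ \<xi>], rule exI[of _ h], rule exI[of _ \<eta>], intro conjI)
    show "test_pair R e J (u 0)" "test_colon R J (u 0) \<noteq> PIdl\<^bsub>R\<^esub> (u 0)" "test_colon R J (u 0) = Idl\<^bsub>R\<^esub> (u ` {..N})"
      unfolding u0 by (rule tp ns tc)+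
    show "\<forall>j\<le>N. u j \<in> carrier R" using uc by blast
    show "\<forall>j l. 1 \<le> j \<and> j \<le> l \<and> l \<le> N \<longrightarrow> (\<forall>\<nu>\<le>N. \<xi> j l \<nu> \<in> carrier R) \<and>
       u j \<otimes>\<^bsub>R\<^esub> u l = (\<Oplus>\<^bsub>R\<^esub>\<nu>\<in>{..N}. u 0 \<otimes>\<^bsub>R\<^esub> \<xi> j l \<nu> \<otimes>\<^bsub>R\<^esub> u \<nu>)"
      unfolding u0 using \<xi> order_trans by blast
  qed (rule syz refl \<tau>'_def)+
  then show ?thesis unfolding st by (rule exI)
qed

section \<open>Termination and outcome of the normalization\<close>

theorem no_infinite_normalization:
  "\<nexists>st. st 0 = initial_state F \<and> (\<forall>i. normalization_step F \<iota> (st i) (st (Suc i)))"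
proof (rule notI, elim exE conjE)
  fix st :: "nat \<Rightarrow> ('a, 'l) state"
  assume st: "st 0 = initial_state F" "\<forall>i. normalization_step F \<iota> (st i) (st (Suc i))"
  have good: "good_state (st i)" for i
  proof (induction i)
    case 0
    then show ?case using initial_good st(1) by simp
  next
    case (Suc i)
    then show ?case using step_good(1) st(2) by blast
  qed
  have order: "is_order (state_order (st i))" for i using good[of i] by (cases "st i") simp
  show False
    by (rule no_infinite_order_chain[of "\<lambda>i. state_order (st i)"]) (use order step_good(2)[OF good] st(2) in blast)+
qed

lemma reachable_good: "(normalization_step F \<iota>)\<^sup>*\<^sup>* (initial_state F) st \<Longrightarrow> good_state st"
  by (induction rule: rtranclp_induct) (auto intro: initial_good step_good(1))

text \<open>A reachable state where the procedure cannot stop has a successor; if all reachable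
  states were of this kind, choosing successors would give an infinite run.\<close>

lemma normalization_result_exists: "\<exists>st. normalization_result F \<iota> st"
proof (rule ccontr)
  assume no: "\<nexists>st. normalization_result F \<iota> st"
  let ?reach = "\<lambda>st. (normalization_step F \<iota>)\<^sup>*\<^sup>* (initial_state F) st"
  have next_step: "\<exists>st'. ?reach st' \<and> normalization_step F \<iota> st st'" if st: "?reach st" for st
  proof -
    have "\<not> normalization_stop F \<iota> st" using no st unfolding normalization_result_def by blast
    then obtain st' where "normalization_step F \<iota> st st'" using step_exists[OF reachable_good[OF st]] by blast
    then show ?thesis using st rtranclp.rtrancl_into_rtrancl[of "normalization_step F \<iota>"] by blast
  qed
  have "\<exists>f. f 0 = initial_state F \<and> (\<forall>i. ?reach (f i)) \<and> (\<forall>i. normalization_step F \<iota> (f i) (f (Suc i)))"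
  proof -
    define f where "f = rec_nat (initial_state F) (\<lambda>_ st. SOME st'. ?reach st' \<and> normalization_step F \<iota> st st')"
    have f0: "f 0 = initial_state F" and fS: "f (Suc i) = (SOME st'. ?reach st' \<and> normalization_step F \<iota> (f i) st')" for i
      by (simp_all add: f_def)
    have r: "?reach (f i)" for i
    proof (induction i)
      case 0
      then show ?case by (simp add: f0)
    next
      case (Suc i)
      from someI_ex[OF next_step[OF Suc]] show ?case unfolding fS by blast
    qed
    have "normalization_step F \<iota> (f i) (f (Suc i))" for i
      using someI_ex[OF next_step[OF r[of i]]] unfolding fS by blast
    with f0 r show ?thesis by blast
  qed
  with no_infinite_normalization show False by blast
qed

lemma normalization_result_order:
  assumes "normalization_result F \<iota> st"
  shows "good_state st" "state_order st = Abar"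
proof -
  show good: "good_state st" using assms reachable_good unfolding normalization_result_def by blast
  obtain ss I \<tau> where st: "st = (ss, I, \<tau>)" by (cases st)
  define R where "R = stage_ring (ss, I, \<tau>)"
  define e where "e = stage_emb F \<iota> (ss, I, \<tau>)"
  have good1: "good_state (ss, I, \<tau>)" using good st by simp
  interpret E: embedded_order \<kappa> "poly.coeff F" N y R e
    unfolding R_def e_def by (rule stage_embedded_order[OF good1])
  obtain J a where "test_pair R e J a" "test_colon R J a = PIdl\<^bsub>R\<^esub> a"
    using assms unfolding normalization_result_def normalization_stop_def st R_def e_def by blast
  then have "E.B = Abar" by (rule E.stop_normal)
  moreover have "E.B = ev \<tau> ` tower_set ss" unfolding E.B_def unfolding R_def e_def by (rule stage_embedded_ring(2)[OF good1])
  ultimately show "state_order st = Abar" by (simp add: st)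
qed

end


section \<open>Correctness of the procedure\<close>

context curve_setup
begin

lemma kx_field_eq: "kx_field F \<iota> = Kx"
  unfolding kx_field_def Kx_def \<kappa>_def \<rho>_def by blast

text \<open>The definite description is legitimate because the entries of the matrix are forced:
  they are the coordinates of z * y^j in the powers of y.\<close>

lemma field_trace_eq:
  assumes z: "z \<in> Q" shows "field_trace F \<iota> z = lam (Fy * z)"
proof -
  have yQ: "y ^ j \<in> Q" for j using y_pow_in_A A_subset_Q by auto
  let ?P = "\<lambda>t. \<exists>M \<in> carrier_mat N N. elements_mat M \<subseteq> Kx \<and>
       (\<forall>j<N. z * y ^ j = (\<Sum>i<N. M $$ (i, j) * y ^ i)) \<and> t = (\<Sum>i<N. M $$ (i, i))"
  have "(THE t. ?P t) = lam (Fy * z)"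
  proof (rule the_equality)
    define M where "M = mat N N (\<lambda>(i, j). coord (\<lambda>i. y ^ i) (z * y ^ j) i)"
    have M: "M \<in> carrier_mat N N" by (simp add: M_def)
    have "elements_mat M \<subseteq> Kx"
    proof
      fix v assume "v \<in> elements_mat M"
      then obtain i j where ij: "i < N" "j < N" "v = M $$ (i, j)" using M by (auto simp: elements_mat_def)
      then show "v \<in> Kx" using coord_in_Kx[OF is_basis_powers Q_mult[OF z yQ] ij(1)] by (simp add: M_def)
    qed
    moreover have "\<forall>j<N. z * y ^ j = (\<Sum>i<N. M $$ (i, j) * y ^ i)"
      using coord_expansion[OF is_basis_powers Q_mult[OF z yQ]] by (simp add: M_def)
    moreover have "lam (Fy * z) = (\<Sum>i<N. M $$ (i, i))"
      unfolding lam_Fy[OF z] mult_trace_def by (simp add: M_def)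
    ultimately show "?P (lam (Fy * z))" using M by blast
  next
    fix t assume "?P t"
    then obtain M where M: "M \<in> carrier_mat N N" "elements_mat M \<subseteq> Kx"
      "\<And>j. j < N \<Longrightarrow> z * y ^ j = (\<Sum>i<N. M $$ (i, j) * y ^ i)" "t = (\<Sum>i<N. M $$ (i, i))" by blast
    have "coord (\<lambda>i. y ^ i) (z * y ^ j) i = M $$ (i, j)" if ij: "i < N" "j < N" for i j
    proof (rule coord_eqI[OF is_basis_powers M(3)[OF ij(2)] _ ij(1)])
      fix k assume "k < N"
      then have "M $$ (k, j) \<in> elements_mat M" using M(1) ij(2) by (intro elements_matI[of M N N k j]) auto
      then show "M $$ (k, j) \<in> Kx" using M(2) by blast
    qed
    then show "t = lam (Fy * z)" unfolding lam_Fy[OF z] mult_trace_def M(4) by simp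
  qed
  then show ?thesis
    unfolding field_trace_def Let_def tdeg kx_field_eq y_def[unfolded \<rho>_def, symmetric] .
qed

text \<open>The inverse of the Gram matrix of the trace form has as its rows the coordinates in w of
  the trace dual basis. Uniqueness of the inverse makes the dual elements independent of the
  run.\<close>

lemma gram_inverse_unique:
  assumes w: "is_basis w"
  defines "T \<equiv> mat N N (\<lambda>(i, j). field_trace F \<iota> (w i * w j))"
  obtains G d where "mutually_inverse N T G" "\<And>i. i < N \<Longrightarrow> d i = (G *\<^sub>v vec N w) $ i"
    "\<And>i. i < N \<Longrightarrow> d i \<in> Q" "\<And>i j. i < N \<Longrightarrow> j < N \<Longrightarrow> lam (Fy * d i * w j) = (if i = j then 1 else 0)"
    "\<And>G'. mutually_inverse N T G' \<Longrightarrow> G' = G"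
proof -
  have wQ: "w i \<in> Q" if "i < N" for i using w that by (simp add: is_basis_def)
  obtain d where dQ: "\<And>i. i < N \<Longrightarrow> d i \<in> Q"
    and dual: "\<And>i j. i < N \<Longrightarrow> j < N \<Longrightarrow> lam (Fy * d i * w j) = (if i = j then 1 else 0)"
  proof (rule dual_basis_exists[OF w])
    fix d assume d: "\<And>i. i < N \<Longrightarrow> d i \<in> Q"
      "\<And>i j. i < N \<Longrightarrow> j < N \<Longrightarrow> lam (Fy * d i * w j) = (if i = j then 1 else 0)"
    show thesis by (rule that[of d]) (fact d)+
  qed
  define G where "G = mat N N (\<lambda>(i, j). coord w (d i) j)"
  have Gc: "G \<in> carrier_mat N N" and Tc: "T \<in> carrier_mat N N" by (simp_all add: G_def T_def)
  have T_entry: "T $$ (i, j) = lam (Fy * (w i * w j))" if "i < N" "j < N" for i j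
    using that wQ by (simp add: T_def field_trace_eq Q_mult)
  have GT: "G * T = 1\<^sub>m N"
  proof (rule eq_matI)
    fix i j assume "i < dim_row (1\<^sub>m N)" "j < dim_col (1\<^sub>m N)"
    then have ij: "i < N" "j < N" by simp_all
    have FwQ: "Fy * w j \<in> Q" by (rule Q_mult[OF Fy_in_Q wQ[OF ij(2)]])
    have "(G * T) $$ (i, j) = (\<Sum>l<N. coord w (d i) l * lam (Fy * w j * w l))"
      unfolding mat_mult_entry[OF Gc Tc ij]
      using ij T_entry by (intro sum.cong) (auto simp: G_def mult_ac)
    also have "\<dots> = lam (Fy * w j * d i)"
      by (rule lam_span[OF wQ FwQ _ coord_in_Kx[OF w dQ[OF ij(1)]], symmetric])
        (simp_all add: coord_expansion[OF w dQ[OF ij(1)]])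
    also have "\<dots> = (if i = j then 1 else 0)" using dual[OF ij] by (simp add: mult_ac)
    finally show "(G * T) $$ (i, j) = 1\<^sub>m N $$ (i, j)" using ij by simp
  qed (use Gc Tc in simp_all)
  have TG: "T * G = 1\<^sub>m N" by (rule mat_mult_left_right_inverse[OF Gc Tc GT])
  show ?thesis
  proof (rule that[of G d])
    show "mutually_inverse N T G"
      unfolding mutually_inverse_def inverts_mat_def using Gc Tc GT TG by simp
    show "d i = (G *\<^sub>v vec N w) $ i" if i: "i < N" for i
    proof -
      have "(G *\<^sub>v vec N w) $ i = (\<Sum>j<N. coord w (d i) j * w j)"
        using i Gc by (simp add: scalar_prod_def atLeast0LessThan G_def)
      then show ?thesis using coord_expansion[OF w dQ[OF i]] by simp
    qed
    show "d i \<in> Q" if "i < N" for i using dQ[OF that] .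
    show "lam (Fy * d i * w j) = (if i = j then 1 else 0)" if "i < N" "j < N" for i j using dual[OF that] .
    fix G' assume "mutually_inverse N T G'"
    then have G': "G' \<in> carrier_mat N N" "T * G' = 1\<^sub>m N"
      unfolding mutually_inverse_def inverts_mat_def using Tc by auto
    have "G' = (G * T) * G'" unfolding GT using G'(1) by simp
    also have "\<dots> = G" unfolding assoc_mult_mat[OF Gc Tc G'(1)] G'(2) using Gc by simp
    finally show "G' = G" .
  qed
qed

lemma trace_dual_iff:
  assumes w: "is_basis w"
  obtains d where "trace_dual F \<iota> w d"
    "\<And>i. i < N \<Longrightarrow> d i \<in> Q" "\<And>i j. i < N \<Longrightarrow> j < N \<Longrightarrow> lam (Fy * d i * w j) = (if i = j then 1 else 0)"
    "\<And>w' i. trace_dual F \<iota> w w' \<Longrightarrow> i < N \<Longrightarrow> w' i = d i"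
proof -
  obtain G d where G: "mutually_inverse N (mat N N (\<lambda>(i, j). field_trace F \<iota> (w i * w j))) G"
    "\<And>i. i < N \<Longrightarrow> d i = (G *\<^sub>v vec N w) $ i"
    "\<And>i. i < N \<Longrightarrow> d i \<in> Q" "\<And>i j. i < N \<Longrightarrow> j < N \<Longrightarrow> lam (Fy * d i * w j) = (if i = j then 1 else 0)"
    "\<And>G'. mutually_inverse N (mat N N (\<lambda>(i, j). field_trace F \<iota> (w i * w j))) G' \<Longrightarrow> G' = G"
  proof (rule gram_inverse_unique[OF w])
    fix G d assume G: "mutually_inverse N (mat N N (\<lambda>(i, j). field_trace F \<iota> (w i * w j))) G"
      "\<And>i. i < N \<Longrightarrow> d i = (G *\<^sub>v vec N w) $ i"
      "\<And>i. i < N \<Longrightarrow> d i \<in> Q" "\<And>i j. i < N \<Longrightarrow> j < N \<Longrightarrow> lam (Fy * d i * w j) = (if i = j then 1 else 0)"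
      "\<And>G'. mutually_inverse N (mat N N (\<lambda>(i, j). field_trace F \<iota> (w i * w j))) G' \<Longrightarrow> G' = G"
    show thesis by (rule that[of G d]) (fact G)+
  qed
  show ?thesis
  proof (rule that[of d])
    show "trace_dual F \<iota> w d" unfolding trace_dual_def Let_def tdeg using G(1,2) by blast
    show "d i \<in> Q" if "i < N" for i using G(3)[OF that] .
    show "lam (Fy * d i * w j) = (if i = j then 1 else 0)" if "i < N" "j < N" for i j using G(4)[OF that] .
    fix w' i assume "trace_dual F \<iota> w w'" "i < N"
    then obtain G' where G': "mutually_inverse N (mat N N (\<lambda>(i, j). field_trace F \<iota> (w i * w j))) G'"
      "w' i = (G' *\<^sub>v vec N w) $ i" unfolding trace_dual_def Let_def tdeg by blast
    show "w' i = d i" unfolding G'(2) G(5)[OF G'(1)] using G(2)[OF \<open>i < N\<close>] by simp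
  qed
qed

section \<open>The conductor of the coordinate ring\<close>

lemma integral_closure_eq: "integral_closure (coord_ring F) \<iota> = Abar"
proof -
  have "embedded_order \<kappa> (poly.coeff F) N y (coord_ring F) \<iota>"
    using separable_curve_axioms coord.embedded_ring_axioms order_A
    by (simp add: embedded_order_def embedded_order_axioms_def coord.B_def image_coord)
  then interpret E: embedded_order \<kappa> "poly.coeff F" N y "coord_ring F" \<iota> .
  show ?thesis unfolding integral_closure_def E.frac_field_eq image_coord Abar_def ..
qed

lemma conductor_eq:
  "conductor (coord_ring F) \<iota> = {x \<in> carrier (coord_ring F). \<iota> x \<in> {z \<in> A. \<forall>v\<in>Abar. z * v \<in> A}}"
proof -
  have "\<iota> x \<in> A" if "x \<in> carrier (coord_ring F)" for x
    using that unfolding image_coord[symmetric] by (rule imageI)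
  then show ?thesis unfolding conductor_def integral_closure_eq image_coord by auto
qed

lemma conductor_image:
  "\<iota> ` conductor (coord_ring F) \<iota> = {z \<in> A. \<forall>v\<in>Abar. z * v \<in> A}"
proof (intro equalityI subsetI)
  fix v assume "v \<in> {z \<in> A. \<forall>v\<in>Abar. z * v \<in> A}"
  moreover from this obtain x where "v = \<iota> x" "x \<in> carrier (coord_ring F)"
    unfolding image_coord[symmetric] by auto
  ultimately show "v \<in> \<iota> ` conductor (coord_ring F) \<iota>" unfolding conductor_eq by auto
qed (auto simp: conductor_eq)

lemma conductor_ideal: "ideal (conductor (coord_ring F) \<iota>) (coord_ring F)"
  unfolding conductor_eq
proof (rule coord.ideal_preimage)
  let ?C = "{z \<in> A. \<forall>v\<in>Abar. z * v \<in> A}"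
  show "?C \<subseteq> coord.B" unfolding coord.B_def image_coord by auto
  show "0 \<in> ?C" using subspace_0[OF subspace_A] by simp
  show "a + b \<in> ?C" if "a \<in> ?C" "b \<in> ?C" for a b
    using that by (auto simp: distrib_right intro: subspace_add[OF subspace_A])
  show "b * a \<in> ?C" if "a \<in> ?C" "b \<in> coord.B" for a b
    using that unfolding coord.B_def image_coord by (auto simp: mult.assoc intro: A_mult)
qed

text \<open>The generators span the conductor over k[x] already. As the conductor is an ideal,
  passing to the generated ideal adds nothing.\<close>

lemma genideal_conductor_gens:
  assumes w: "is_basis w" "Abar = fam_span N w" and d: "trace_dual F \<iota> w d"
  shows "Idl\<^bsub>coord_ring F\<^esub> (conductor_gens F \<iota> d) = conductor (coord_ring F) \<iota>"
proof -
  obtain d' where d': "\<And>i. i < N \<Longrightarrow> d' i \<in> Q"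
    "\<And>i j. i < N \<Longrightarrow> j < N \<Longrightarrow> lam (Fy * d' i * w j) = (if i = j then 1 else 0)"
    "\<And>w' i. trace_dual F \<iota> w w' \<Longrightarrow> i < N \<Longrightarrow> w' i = d' i"
  proof (rule trace_dual_iff[OF w(1)])
    fix d' assume d': "\<And>i. i < N \<Longrightarrow> d' i \<in> Q"
      "\<And>i j. i < N \<Longrightarrow> j < N \<Longrightarrow> lam (Fy * d' i * w j) = (if i = j then 1 else 0)"
      "\<And>w' i. trace_dual F \<iota> w w' \<Longrightarrow> i < N \<Longrightarrow> w' i = d' i"
    show thesis by (rule that[of d']) (fact d')+
  qed
  have dd: "d i = d' i" if "i < N" for i by (rule d'(3)[OF d that])
  have C: "\<iota> ` conductor (coord_ring F) \<iota> = fam_span N (\<lambda>i. Fy * d' i)"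
    unfolding conductor_image by (rule conductor_eq_span[OF w(1) d'(1,2) w(2)])
  have C_car: "conductor (coord_ring F) \<iota> \<subseteq> carrier (coord_ring F)" unfolding conductor_def by blast
  have gens: "conductor_gens F \<iota> d = {f \<in> carrier (coord_ring F). \<exists>i<N. \<iota> f = Fy * d' i}"
    unfolding conductor_gens_def tdeg Fy_eq \<rho>_def using dd by auto
  have gens_car: "conductor_gens F \<iota> d \<subseteq> carrier (coord_ring F)" unfolding gens by blast
  show ?thesis
  proof
    have "conductor_gens F \<iota> d \<subseteq> conductor (coord_ring F) \<iota>"
    proof
      fix f assume "f \<in> conductor_gens F \<iota> d"
      then obtain i where f: "f \<in> carrier (coord_ring F)" "i < N" "\<iota> f = Fy * d' i" unfolding gens by blast
      have "\<iota> f \<in> \<iota> ` conductor (coord_ring F) \<iota>"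
        unfolding C f(3) using f(2) by (rule fam_span_base)
      then show "f \<in> conductor (coord_ring F) \<iota>" using coord.mem_image_iff[OF C_car f(1)] by simp
    qed
    then show "Idl\<^bsub>coord_ring F\<^esub> (conductor_gens F \<iota> d) \<subseteq> conductor (coord_ring F) \<iota>"
      by (rule coord.R.genideal_minimal[OF conductor_ideal])
  next
    have ideal: "ideal (Idl\<^bsub>coord_ring F\<^esub> (conductor_gens F \<iota> d)) (coord_ring F)"
      by (rule coord.R.genideal_ideal[OF gens_car])
    note I = coord.ideal_image[OF ideal]
    have gI: "Fy * d' i \<in> \<iota> ` (Idl\<^bsub>coord_ring F\<^esub> (conductor_gens F \<iota> d))" if i: "i < N" for i
    proof -
      have "Fy * d' i \<in> \<iota> ` conductor (coord_ring F) \<iota>" unfolding C using i by (rule fam_span_base)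
      then obtain f where f: "f \<in> carrier (coord_ring F)" "Fy * d' i = \<iota> f" using C_car by blast
      have "f \<in> conductor_gens F \<iota> d" unfolding gens using f i by auto
      then show ?thesis unfolding f(2) using coord.R.genideal_self[OF gens_car] by blast
    qed
    show "conductor (coord_ring F) \<iota> \<subseteq> Idl\<^bsub>coord_ring F\<^esub> (conductor_gens F \<iota> d)"
    proof
      fix f assume f: "f \<in> conductor (coord_ring F) \<iota>"
      then have "\<iota> f \<in> fam_span N (\<lambda>i. Fy * d' i)" unfolding C[symmetric] by (rule imageI)
      then obtain c where c: "\<iota> f = (\<Sum>i<N. \<kappa> (c i) * (Fy * d' i))" unfolding fam_span_def lincomb_def by blast
      have sumI: "sum h T \<in> \<iota> ` (Idl\<^bsub>coord_ring F\<^esub> (conductor_gens F \<iota> d))"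
        if "\<And>i. i \<in> T \<Longrightarrow> h i \<in> \<iota> ` (Idl\<^bsub>coord_ring F\<^esub> (conductor_gens F \<iota> d))" for h and T :: "nat set"
        using that by (induction T rule: infinite_finite_induct) (auto simp: I(2) intro: I(3))
      have "\<kappa> p \<in> coord.B" for p unfolding coord.B_def image_coord by (rule \<kappa>_in_A)
      then have "\<iota> f \<in> \<iota> ` (Idl\<^bsub>coord_ring F\<^esub> (conductor_gens F \<iota> d))"
        unfolding c by (intro sumI I(4) gI) auto
      then show "f \<in> Idl\<^bsub>coord_ring F\<^esub> (conductor_gens F \<iota> d)"
        using coord.mem_image_iff[of "Idl\<^bsub>coord_ring F\<^esub> (conductor_gens F \<iota> d)" f] ideal.Icarr[OF ideal] f C_car by blast
    qed
  qed
qed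

section \<open>The candidate set and the basis of the integral closure computed from it\<close>

context
  fixes st :: "('a, 'l) state" and ss I \<tau> and Bs :: "'a tpoly set list"
  assumes st: "st = (ss, I, \<tau>)" and good: "good_state st" and normal: "state_order st = Abar"
    and Bs: "set Bs = candidate_set F st"
begin

lemma good': "good_state (ss, I, \<tau>)"
  using good st by simp

interpretation E: embedded_order \<kappa> "poly.coeff F" N y "stage_ring st" "stage_emb F \<iota> st"
  unfolding st by (rule stage_embedded_order[OF good'])

lemma candidate_image: "stage_emb F \<iota> st ` candidate_set F st = cand_vals ss \<tau>"
  and candidate_carrier: "candidate_set F st \<subseteq> carrier (stage_ring st)"
proof -
  let ?p = "\<lambda>c j. (\<Prod>i\<in>{1..length ss}. t_var i (c i)) * t_const ([:0, 1:] ^ j) :: 'a tpoly"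
  have cs: "candidate_set F st = {stage_class st (?p c j) | c j. (\<forall>i\<in>{1..length ss}. c i \<le> ss ! (i - 1)) \<and> j < N}"
    unfolding st candidate_set.simps tdeg ..
  have p_in: "?p c j \<in> tower_set ss" if c: "\<forall>i\<in>{1..length ss}. c i \<le> ss ! (i - 1)" for c j
  proof (rule tower_set_mult[OF _ tower_set_const])
    have prod_in: "prod h K \<in> tower_set ss" if "\<And>i. i \<in> K \<Longrightarrow> h i \<in> tower_set ss" for h :: "nat \<Rightarrow> 'a tpoly" and K
      using that by (induction K rule: infinite_finite_induct) (auto simp: tower_set_1 intro: tower_set_mult)
    show "(\<Prod>i\<in>{1..length ss}. t_var i (c i) :: 'a tpoly) \<in> tower_set ss"
    proof (rule prod_in)
      fix i assume i: "i \<in> {1..length ss}"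
      show "(t_var i (c i) :: 'a tpoly) \<in> tower_set ss"
      proof (rule tower_set_var)
        show "c i = 0 \<or> (i, c i) \<in> tower_vars ss" using c i by (auto simp: tower_vars_def)
      qed
    qed
  qed
  have ev_p: "ev \<tau> (?p c j) = (\<Prod>i\<in>{1..length ss}. ev \<tau> (t_var i (c i))) * y ^ j" for c j
    by (simp add: ev_mult ev_prod ev_const \<rho>_pow y_def)
  have emb_p: "stage_emb F \<iota> st (stage_class st (?p c j)) = (\<Prod>i\<in>{1..length ss}. ev \<tau> (t_var i (c i))) * y ^ j"
    if "\<forall>i\<in>{1..length ss}. c i \<le> ss ! (i - 1)" for c j
    unfolding st stage_emb_coset[OF good' p_in[OF that]] by (rule ev_p)
  show "candidate_set F st \<subseteq> carrier (stage_ring st)"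
    unfolding cs unfolding st stage_carrier using p_in by blast
  show "stage_emb F \<iota> st ` candidate_set F st = cand_vals ss \<tau>"
  proof (intro equalityI subsetI)
    fix v assume "v \<in> stage_emb F \<iota> st ` candidate_set F st"
    then obtain c j where c: "\<forall>i\<in>{1..length ss}. c i \<le> ss ! (i - 1)" "j < N"
      "v = stage_emb F \<iota> st (stage_class st (?p c j))" unfolding cs by blast
    show "v \<in> cand_vals ss \<tau>" unfolding c(3) emb_p[OF c(1)] cand_vals_def using c(1,2) by blast
  next
    fix v assume "v \<in> cand_vals ss \<tau>"
    then obtain c j where c: "\<forall>i\<in>{1..length ss}. c i \<le> ss ! (i - 1)" "j < N"
      "v = (\<Prod>i\<in>{1..length ss}. ev \<tau> (t_var i (c i))) * y ^ j" unfolding cand_vals_def by blast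
    have "stage_class st (?p c j) \<in> candidate_set F st" unfolding cs using c(1,2) by blast
    then show "v \<in> stage_emb F \<iota> st ` candidate_set F st" unfolding c(3) emb_p[OF c(1), symmetric] by (rule imageI)
  qed
qed

definition bvals :: "nat \<Rightarrow> 'l" where "bvals i = stage_emb F \<iota> st (Bs ! i)"

lemma Bs_carrier: "i < length Bs \<Longrightarrow> Bs ! i \<in> carrier (stage_ring st)"
  using candidate_carrier Bs nth_mem by blast

lemma E_B: "E.B = Abar"
  unfolding E.B_def unfolding normal[symmetric] st state_order.simps by (rule stage_embedded_ring(2)[OF good'])

text \<open>The span clause of the invariant at the final stage, where the order is Abar;
  \<open>bvals\<close> enumerates the candidate values along the list \<open>Bs\<close>.\<close>

lemma Abar_eq_span: "Abar = fam_span (length Bs) bvals"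
proof
  show "fam_span (length Bs) bvals \<subseteq> Abar"
    by (rule fam_span_subset[OF order_subspace[OF order_Abar]])
      (use E.e_in_B[OF Bs_carrier] in \<open>simp add: E_B bvals_def\<close>)
  have "cand_vals ss \<tau> \<subseteq> fam_span (length Bs) bvals"
  proof
    fix v assume "v \<in> cand_vals ss \<tau>"
    then obtain C where "C \<in> set Bs" "v = stage_emb F \<iota> st C" unfolding candidate_image[symmetric] Bs by blast
    then obtain i where "i < length Bs" "v = bvals i" unfolding bvals_def by (metis in_set_conv_nth)
    then show "v \<in> fam_span (length Bs) bvals" using fam_span_base[of i "length Bs" bvals] by simp
  qed
  then have "span (cand_vals ss \<tau>) \<subseteq> fam_span (length Bs) bvals"
    by (rule span_minimal) (rule subspace_fam_span)
  moreover have "Abar \<subseteq> span (cand_vals ss \<tau>)" using good' normal[symmetric] st by simp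
  ultimately show "Abar \<subseteq> fam_span (length Bs) bvals" by blast
qed

lemma const_emb: "stage_class st (t_const [:p:]) \<in> carrier (stage_ring st)"
    "stage_emb F \<iota> st (stage_class st (t_const [:p:])) = \<kappa> p"
proof -
  show "stage_class st (t_const [:p:]) \<in> carrier (stage_ring st)"
    unfolding st stage_carrier by (rule imageI[OF tower_set_const])
  show "stage_emb F \<iota> st (stage_class st (t_const [:p:])) = \<kappa> p"
    unfolding st stage_emb_coset[OF good' tower_set_const] ev_const \<kappa>_def ..
qed

lemma kx_combination_emb:
  "kx_combination st Bs v \<in> carrier (stage_ring st)"
  "stage_emb F \<iota> st (kx_combination st Bs v) = lincomb (length Bs) (\<lambda>i. v $ i) bvals"
proof -
  show "kx_combination st Bs v \<in> carrier (stage_ring st)"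
    unfolding kx_combination_def using const_emb(1) Bs_carrier by (intro E.R.finsum_closed) auto
  have "stage_emb F \<iota> st (kx_combination st Bs v) = (\<Sum>i\<in>{..<length Bs}.
      stage_emb F \<iota> st (stage_class st (t_const [:v $ i:]) \<otimes>\<^bsub>stage_ring st\<^esub> Bs ! i))"
    unfolding kx_combination_def using const_emb(1) Bs_carrier by (intro E.e_finsum) auto
  also have "\<dots> = lincomb (length Bs) (\<lambda>i. v $ i) bvals"
    unfolding lincomb_def using const_emb Bs_carrier by (intro sum.cong) (auto simp: E.e_mult bvals_def)
  finally show "stage_emb F \<iota> st (kx_combination st Bs v) = lincomb (length Bs) (\<lambda>i. v $ i) bvals" .
qed

lemma kx_relations_eq: "kx_relations st Bs = relations (length Bs) bvals"
proof -
  have "kx_combination st Bs v = \<zero>\<^bsub>stage_ring st\<^esub> \<longleftrightarrow> lincomb (length Bs) (\<lambda>i. v $ i) bvals = 0" for v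
    using E.e_eq_0_iff[OF kx_combination_emb(1), of v] kx_combination_emb(2)[of v] by simp
  then show ?thesis unfolding kx_relations_def relations_def by simp
qed

lemmas stage_basis = Abar_eq_span kx_combination_emb kx_relations_eq

end

lemma finite_candidate_set: "finite (candidate_set F (ss, I, \<tau>))"
proof -
  let ?p = "\<lambda>c j. (\<Prod>i\<in>{1..length ss}. t_var i (c i)) * t_const ([:0, 1:] ^ j) :: 'a tpoly"
  let ?D = "PiE {1..length ss} (\<lambda>i. {..ss ! (i - 1)}) \<times> {..<N}"
  have "candidate_set F (ss, I, \<tau>) \<subseteq> (\<lambda>(c, j). stage_class (ss, I, \<tau>) (?p c j)) ` ?D"
  proof
    fix C assume "C \<in> candidate_set F (ss, I, \<tau>)"
    then obtain c j where c: "\<forall>i\<in>{1..length ss}. c i \<le> ss ! (i - 1)" "j < N" "C = stage_class (ss, I, \<tau>) (?p c j)"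
      unfolding candidate_set.simps tdeg by blast
    \<comment> \<open>Only the values of c at the existing levels matter for the class; restricting
      c makes the set of choices finite.\<close>
    let ?c = "restrict c {1..length ss}"
    have "(\<Prod>i\<in>{1..length ss}. t_var i (c i)) = (\<Prod>i\<in>{1..length ss}. t_var i (?c i) :: 'a tpoly)"
      by (rule prod.cong) auto
    then have "C = stage_class (ss, I, \<tau>) (?p ?c j)" unfolding c(3) by (simp only:)
    moreover have "(?c, j) \<in> ?D" using c by auto
    ultimately show "C \<in> (\<lambda>(c, j). stage_class (ss, I, \<tau>) (?p c j)) ` ?D" by (intro image_eqI[of _ _ "(?c, j)"]) auto
  qed
  moreover have "finite ?D" by (intro finite_cartesian_product finite_PiE) auto
  ultimately show ?thesis by (rule finite_surj[rotated])
qed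

lemma kx_basis_result_basis:
  assumes res: "normalization_result F \<iota> st" and kx: "kx_basis_result F st w"
  shows "is_basis (\<lambda>i. stage_emb F \<iota> st (w i))" "Abar = fam_span N (\<lambda>i. stage_emb F \<iota> st (w i))"
proof -
  obtain ss I \<tau> where st: "st = (ss, I, \<tau>)" by (cases st)
  note good = normalization_result_order[OF res]
  from kx obtain Bs m U P P' H H' where *: "set Bs = candidate_set F st \<and>
     U \<in> carrier_mat m (length Bs) \<and>
     kx_relations st Bs = (\<lambda>c. transpose_mat U *\<^sub>v c) ` carrier_vec m \<and>
     mutually_inverse m P P' \<and> mutually_inverse (length Bs) H H' \<and>
     smith_normal_form (P * U * H) \<and>
     (\<forall>i<N. w i = kx_combination st Bs (row H' (length Bs - N + i)))"
    unfolding kx_basis_result_def tdeg by (elim exE)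
  note Bs = conjunct1[OF *] and U = conjunct1[OF conjunct2[OF *]] conjunct1[OF conjunct2[OF conjunct2[OF *]]]
    and ** = conjunct2[OF conjunct2[OF conjunct2[OF *]]]
  have P: "mutually_inverse m P P'" and H: "mutually_inverse (length Bs) H H'"
    and snf: "smith_normal_form (P * U * H)"
    and w: "\<And>i. i < N \<Longrightarrow> w i = kx_combination st Bs (row H' (length Bs - N + i))"
    using ** by simp_all
  note sb = stage_basis[OF st good Bs]
  define b where "b = bvals st Bs"
  define v where "v = (\<lambda>i. lincomb (length Bs) (\<lambda>j. row H' (length Bs - N + i) $ j) b)"
  have wv: "stage_emb F \<iota> st (w i) = v i" if "i < N" for i
    unfolding w[OF that] v_def b_def by (rule sb(3))
  have "is_basis v" "Abar = fam_span N v"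
    unfolding v_def by (rule basis_of_smith_normal_form[OF sb(1)[folded b_def] U(1) U(2)[unfolded sb(4), folded b_def] P H snf])+
  moreover have "lincomb N c v = lincomb N c (\<lambda>i. stage_emb F \<iota> st (w i))" for c
    by (rule lincomb_cong) (simp_all add: wv)
  ultimately show "is_basis (\<lambda>i. stage_emb F \<iota> st (w i))" "Abar = fam_span N (\<lambda>i. stage_emb F \<iota> st (w i))"
    using wv by (simp_all add: is_basis_def fam_indep_def fam_span_def)
qed

lemma kx_basis_result_exists:
  assumes res: "normalization_result F \<iota> st"
  shows "\<exists>w. kx_basis_result F st w"
proof -
  obtain ss I \<tau> where st: "st = (ss, I, \<tau>)" by (cases st)
  note good = normalization_result_order[OF res]
  obtain Bs where Bs: "set Bs = candidate_set F st"
    using finite_list[OF finite_candidate_set[of ss I \<tau>]] st by blast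
  note sb = stage_basis[OF st good Bs]
  from smith_normal_form_exists[OF sb(1)] obtain m U H H' where snf:
    "U \<in> carrier_mat m (length Bs)" "relations (length Bs) (bvals st Bs) = (\<lambda>c. transpose_mat U *\<^sub>v c) ` carrier_vec m"
    "mutually_inverse m (1\<^sub>m m :: 'a poly mat) (1\<^sub>m m)" "mutually_inverse (length Bs) H H'"
    "smith_normal_form (1\<^sub>m m * U * H)" by blast
  have "kx_basis_result F st (\<lambda>i. kx_combination st Bs (row H' (length Bs - total_degree F + i)))"
    unfolding kx_basis_result_def sb(4)[symmetric]
    by (rule exI[of _ Bs], rule exI[of _ m], rule exI[of _ U], rule exI[of _ "1\<^sub>m m"], rule exI[of _ "1\<^sub>m m"],
        rule exI[of _ H], rule exI[of _ H'], intro conjI allI impI Bs snf(1,3,4,5) snf(2)[folded sb(4)] refl)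
  then show ?thesis by blast
qed

lemma conductor_preimage_eq:
  assumes w: "is_basis w" "Abar = fam_span N w" and d: "trace_dual F \<iota> w d"
  shows "conductor_preimage F (conductor_gens F \<iota> d) = {p. res_class F p \<in> conductor (coord_ring F) \<iota>}"
  unfolding conductor_preimage_def genideal_conductor_gens[OF w d] ..

lemma conductor_preimage_closed:
  defines "I \<equiv> {p. res_class F p \<in> conductor (coord_ring F) \<iota>}"
  shows "0 \<in> I" "p \<in> I \<Longrightarrow> q \<in> I \<Longrightarrow> p + q \<in> I" "p \<in> I \<Longrightarrow> q * p \<in> I"
proof -
  interpret C: ideal "conductor (coord_ring F) \<iota>" "coord_ring F" by (rule conductor_ideal)
  have "res_class F 0 = \<zero>\<^bsub>coord_ring F\<^esub>"
    using coord.e_eq_0_iff[OF res_in_carrier[of 0]] \<rho>_0 unfolding \<rho>_def by blast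
  then show "0 \<in> I" unfolding I_def using C.zero_closed by simp
  show "p + q \<in> I" if "p \<in> I" "q \<in> I"
    using that ring_hom_add[OF res_class_hom, of p q F] C.a_closed by (simp add: I_def)
  show "q * p \<in> I" if "p \<in> I"
    using that ring_hom_mult[OF res_class_hom, of q p F] C.I_l_closed[OF _ res_in_carrier] by (simp add: I_def)
qed

text \<open>Whatever choices the run makes before Step B, the ideal entering the truncation is the
  full preimage of the conductor.\<close>

lemma procedure_output_truncation:
  assumes "procedure_output F \<iota> out"
  shows "truncation_output N {p. res_class F p \<in> conductor (coord_ring F) \<iota>} out"
proof -
  obtain st w w' where res: "normalization_result F \<iota> st" and kx: "kx_basis_result F st w"
    and tr: "trace_dual F \<iota> (\<lambda>i. stage_emb F \<iota> st (w i)) w'"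
    and out: "truncation_output N (conductor_preimage F (conductor_gens F \<iota> w')) out"
    using assms unfolding procedure_output_def tdeg by blast
  show ?thesis
    using out unfolding conductor_preimage_eq[OF kx_basis_result_basis[OF res kx] tr] .
qed

lemma procedure_output_exists: "\<exists>out. procedure_output F \<iota> out"
proof -
  obtain st where res: "normalization_result F \<iota> st" using normalization_result_exists by blast
  obtain w where kx: "kx_basis_result F st w" using kx_basis_result_exists[OF res] by blast
  obtain d where tr: "trace_dual F \<iota> (\<lambda>i. stage_emb F \<iota> st (w i)) d"
    using trace_dual_iff[OF kx_basis_result_basis(1)[OF res kx]] by metis
  obtain out where "truncation_output N (conductor_preimage F (conductor_gens F \<iota> d)) out"
    using truncation_output_exists by blast
  with res kx tr show ?thesis unfolding procedure_output_def tdeg by blast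
qed

section \<open>Spans and independence over the constant field in the coordinate ring\<close>

lemma Span_res_class:
  "ring.Span (coord_ring F) (coord_consts F) (map (res_class F) ps) =
     {res_class F (\<Sum>i<length ps. Polynomial.smult [:c i:] (ps ! i)) | c. True}"
proof (induction ps)
  case Nil
  have "res_class F 0 = \<zero>\<^bsub>coord_ring F\<^esub>"
    using coord.e_eq_0_iff[OF res_in_carrier[of 0]] \<rho>_0 unfolding \<rho>_def by blast
  then show ?case by simp
next
  case (Cons p ps)
  let ?s = "\<lambda>c ps. \<Sum>i<length ps. Polynomial.smult [:c i:] (ps ! i)"
  have comb: "res_class F [:[:a:]:] \<otimes>\<^bsub>coord_ring F\<^esub> res_class F p \<oplus>\<^bsub>coord_ring F\<^esub> res_class F q
      = res_class F (Polynomial.smult [:a:] p + q)" for a q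
    using ring_hom_add[OF res_class_hom, of "Polynomial.smult [:a:] p" q F]
      ring_hom_mult[OF res_class_hom, of "[:[:a:]:]" p F] by simp
  have sum_Cons: "?s c (p # ps) = Polynomial.smult [:c 0:] p + ?s (\<lambda>i. c (Suc i)) ps" for c
    by (simp add: sum.lessThan_Suc_shift del: sum.lessThan_Suc)
  have mem: "x \<in> coord.R.Span (coord_consts F) (map (res_class F) (p # ps)) \<longleftrightarrow>
      (\<exists>a c. x = res_class F (Polynomial.smult [:a:] p + ?s c ps))" for x
  proof -
    have "x \<in> coord.R.Span (coord_consts F) (map (res_class F) (p # ps)) \<longleftrightarrow>
        (\<exists>k\<in>coord_consts F. \<exists>v\<in>coord.R.Span (coord_consts F) (map (res_class F) ps).
          x = k \<otimes>\<^bsub>coord_ring F\<^esub> res_class F p \<oplus>\<^bsub>coord_ring F\<^esub> v)"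
      by (simp add: coord.R.line_extension_mem_iff)
    also have "\<dots> \<longleftrightarrow> (\<exists>a c. x = res_class F [:[:a:]:] \<otimes>\<^bsub>coord_ring F\<^esub> res_class F p
          \<oplus>\<^bsub>coord_ring F\<^esub> res_class F (?s c ps))"
      unfolding Cons.IH unfolding coord_consts_def by auto
    finally show ?thesis unfolding comb .
  qed
  have reindex: "(\<exists>a c. x = res_class F (Polynomial.smult [:a:] p + ?s c ps)) \<longleftrightarrow>
      (\<exists>c. x = res_class F (?s c (p # ps)))" for x
  proof
    assume "\<exists>a c. x = res_class F (Polynomial.smult [:a:] p + ?s c ps)"
    then obtain a c where x: "x = res_class F (Polynomial.smult [:a:] p + ?s c ps)" by blast
    \<comment> \<open>\<open>case_nat\<close> puts the coefficient of the head in front and shifts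
      those of the tail by one.\<close>
    have "x = res_class F (?s (case_nat a c) (p # ps))" unfolding sum_Cons x by simp
    then show "\<exists>c. x = res_class F (?s c (p # ps))" by (rule exI[of _ "case_nat a c"])
  next
    assume "\<exists>c. x = res_class F (?s c (p # ps))"
    then obtain c where "x = res_class F (?s c (p # ps))" by blast
    then show "\<exists>a c. x = res_class F (Polynomial.smult [:a:] p + ?s c ps)" 
      unfolding sum_Cons by (intro exI[of _ "c 0"] exI[of _ "\<lambda>i. c (Suc i)"])
  qed
  show ?case
  proof (rule Set.set_eqI)
    show "x \<in> coord.R.Span (coord_consts F) (map (res_class F) (p # ps)) \<longleftrightarrow>
        x \<in> {res_class F (?s c (p # ps)) | c. True}" for x
      unfolding mem reindex by simp
  qed
qed

text \<open>The top monomial of the leading coefficient in Y has total degree at least the Y-degree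
  of p, so this degree is below N and a nonzero p cannot be a multiple of F.\<close>

lemma deg_le_dvd_zero:
  assumes "deg_le p (int N - 3)" "F dvd p" shows "p = 0"
proof (rule ccontr)
  assume p: "p \<noteq> 0"
  let ?n = "Polynomial.degree p" and ?m = "Polynomial.degree (lead_coeff p)"
  have "coeff2 p (?m, ?n) \<noteq> 0" using p by (simp add: coeff2_def)
  then have "int (?m + ?n) \<le> int N - 3" using assms(1) unfolding deg_le_iff supp2_def by fastforce
  then have "?n < N" by linarith
  with dvd_degree[OF assms(2)] p show False by blast
qed

text \<open>A relation between the residue classes is a combination of the polynomials divisible by
  F. It still obeys the degree bound, so it is 0 in S already.\<close>

lemma independent_res_class:
  assumes "\<And>p. p \<in> set ps \<Longrightarrow> deg_le p (int N - 3)"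
    and "\<And>c i. (\<Sum>i<length ps. Polynomial.smult [:c i:] (ps ! i)) = 0 \<Longrightarrow> i < length ps \<Longrightarrow> c i = 0"
  shows "ring.independent (coord_ring F) (coord_consts F) (map (res_class F) ps)"
  using assms
proof (induction ps)
  case Nil
  then show ?case by (simp add: coord.R.li_Nil)
next
  case (Cons p ps)
  let ?s = "\<lambda>c ps. \<Sum>i<length ps. Polynomial.smult [:c i:] (ps ! i)"
  have sum_Cons: "?s c (p # ps) = Polynomial.smult [:c 0:] p + ?s (\<lambda>i. c (Suc i)) ps" for c
    by (simp add: sum.lessThan_Suc_shift del: sum.lessThan_Suc)
  have "coord.R.independent (coord_consts F) (map (res_class F) ps)"
  proof (rule Cons.IH)
    show "deg_le q (int N - 3)" if "q \<in> set ps" for q using Cons.prems(1) that by simp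
    fix c :: "nat \<Rightarrow> 'a" and i assume "?s c ps = 0" "i < length ps"
    then show "c i = 0" using Cons.prems(2)[of "case_nat 0 c" "Suc i"] unfolding sum_Cons by simp
  qed
  moreover have "res_class F p \<notin> coord.R.Span (coord_consts F) (map (res_class F) ps)"
  proof
    assume "res_class F p \<in> coord.R.Span (coord_consts F) (map (res_class F) ps)"
    then obtain c where c: "res_class F p = res_class F (?s c ps)" unfolding Span_res_class by blast
    \<comment> \<open>If the class of the head lies in the span of the tail, the corresponding
      relation has coefficient -1 at the head, which cannot vanish.\<close>
    let ?c = "case_nat (- 1) c"
    have eq: "?s ?c (p # ps) = ?s c ps - p" unfolding sum_Cons by (simp flip: one_pCons)
    have "\<rho> (?s c ps - p) = 0" using c unfolding \<rho>_diff \<rho>_eq_iff[symmetric] by simp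
    then have dvd: "F dvd ?s ?c (p # ps)" unfolding eq \<rho>_eq_0_iff .
    have sum_deg: "deg_le (sum h J) (int N - 3)" if "\<And>i. i \<in> J \<Longrightarrow> deg_le (h i) (int N - 3)"
      for h :: "nat \<Rightarrow> 'a poly poly" and J
      using that by (induction J rule: infinite_finite_induct) (auto intro: deg_le_0 deg_le_add)
    have "deg_le (?s ?c (p # ps)) (int N - 3)"
    proof (rule sum_deg)
      fix i assume "i \<in> {..<length (p # ps)}"
      then have "(p # ps) ! i \<in> set (p # ps)" by (intro nth_mem) simp
      then show "deg_le (Polynomial.smult [:?c i:] ((p # ps) ! i)) (int N - 3)"
        by (intro deg_le_smult Cons.prems(1))
    qed
    from Cons.prems(2)[OF deg_le_dvd_zero[OF this dvd], of 0] show False by simp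
  qed
  ultimately show ?case using coord.R.li_Cons[OF res_in_carrier] by simp
qed

text \<open>The truncation asks only for some representative of bounded degree. Any such
  representative of a class in the conductor lies in the preimage ideal, so the classes of its
  truncation are exactly the truncated conductor.\<close>

lemma procedure_output_basis:
  assumes "procedure_output F \<iota> out"
  shows "ring.independent (coord_ring F) (coord_consts F) (map (res_class F) out)"
    and "ring.Span (coord_ring F) (coord_consts F) (map (res_class F) out) = conductor_trunc F \<iota> (int N - 3)"
proof -
  let ?I = "{p. res_class F p \<in> conductor (coord_ring F) \<iota>}"
  let ?s = "\<lambda>c. \<Sum>i<length out. Polynomial.smult [:c i:] (out ! i)"
  note trunc = truncation_output_basis[OF procedure_output_truncation[OF assms] conductor_preimage_closed]
  have out_span: "{?s c | c. True} = {p \<in> ?I. deg_le p (int N - 3)}" by (rule trunc(2))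
  have out_deg: "deg_le p (int N - 3)" if p: "p \<in> set out" for p
  proof -
    obtain j where j: "j < length out" "p = out ! j" using p by (auto simp: in_set_conv_nth)
    have unit: "Polynomial.smult [:if i = j then 1 else 0:] (out ! i) = (if i = j then p else 0)" for i
      by (cases "i = j") (simp_all add: j(2) flip: one_pCons)
    have "?s (\<lambda>i. if i = j then 1 else 0) = (\<Sum>i<length out. if i = j then p else 0)"
      by (rule sum.cong[OF refl unit])
    also have "\<dots> = p" using j(1) by simp
    finally have "p = ?s (\<lambda>i. if i = j then 1 else 0)" by (rule sym)
    then have "\<exists>c. p = ?s c" by (rule exI[of _ "\<lambda>i. if i = j then 1 else 0"])
    then have "p \<in> {?s c | c. True}" by (simp only: mem_Collect_eq simp_thms)
    then have "p \<in> {p \<in> ?I. deg_le p (int N - 3)}" by (rule subsetD[OF equalityD1[OF out_span]])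
    then show ?thesis by simp
  qed
  show "coord.R.independent (coord_consts F) (map (res_class F) out)"
  proof (rule independent_res_class)
    show "deg_le p (int N - 3)" if "p \<in> set out" for p by (rule out_deg[OF that])
    fix c :: "nat \<Rightarrow> 'a" and i assume "?s c = 0" "i < length out"
    then show "c i = 0" by (intro trunc(1))
  qed
  have "coord.R.Span (coord_consts F) (map (res_class F) out) = res_class F ` {?s c | c. True}"
    unfolding Span_res_class by (simp only: setcompr_eq_image image_image)
  also have "\<dots> = conductor_trunc F \<iota> (int N - 3)"
    unfolding out_span conductor_trunc_def by auto
  finally show "coord.R.Span (coord_consts F) (map (res_class F) out) = conductor_trunc F \<iota> (int N - 3)" .
qed

end

theorem mainTheorem2:
  fixes F :: "'a::field poly poly" and N :: nat
    and \<iota> :: "'a poly poly set \<Rightarrow> 'l::field"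
  assumes "perfect_field TYPE('a)"
    and "Factorial_Ring.irreducible F"
    and "total_degree F = N" and "Polynomial.degree F = N" and "lead_coeff F = 1"
    and "field_embedding (coord_ring F) \<iota>"
    and "separable_in_Y F \<iota>"
  shows "(\<nexists>st. st 0 = initial_state F \<and> (\<forall>i. normalization_step F \<iota> (st i) (st (Suc i)))) \<and>
    (\<exists>out. procedure_output F \<iota> out) \<and>
    (\<forall>out. procedure_output F \<iota> out \<longrightarrow>
       ring.independent (coord_ring F) (coord_consts F) (map (res_class F) out) \<and>
       ring.Span (coord_ring F) (coord_consts F) (map (res_class F) out)
         = conductor_trunc F \<iota> (int N - 3))"
proof -
  interpret curve_setup F N \<iota> by unfold_locales (rule assms)+
  show ?thesis
    by (intro conjI allI impI no_infinite_normalization procedure_output_exists procedure_output_basis)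
qed

end
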